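(* Let $K$ be a field complete with respect to a nontrivial non-archimedean absolute value, let $\mathcal{A}$ be an affinoid algebra over $K$, and let $X=\operatorname{Max}(\mathcal{A})$. Let $\mathcal{C}_L$ be the collection of all coverings of $X$ that are refined by some finite covering of $X$ by open Laurent domains. Then $(X,\mathcal{C}_L)$ is a Hausdorff uniform space which is totally bounded, and its completion $\hat{X}$ is compact. In particular, $X$ (with its canonical topology) embeds as a dense subspace of the compact Hausdorff topological space $\hat{X}$.
   Context: An affinoid algebra over $K$ is a quotient ring of the ring $T_n$ of restricted power series over $K$ in $n$ variables (coefficients tending to zero) for some $n\ge 1$. $\operatorname{Max}(\mathcal{A})$ is the set of maximal ideals of $\mathcal{A}$. For $x\in X$ corresponding to the maximal ideal $\mathfrak{m}$ and $f\in\mathcal{A}$, $f(x)$ is the image of $f$ in $\mathcal{A}/\mathfrak{m}$, a finite extension of $K$, and $|f(x)|$ is its absolute value under the unique extension of the absolute value of $K$. Put $\sqrt{|K^*|}=\{\alpha>0 : \alpha^n=|z| \text{ for some } z\in K \text{ and some integer } n\ge 1\}$. An open Laurent domain in $X$ is a set of the form $\{x\in X : |f_i(x)|<\alpha_i\ (1\le i\le s),\ |g_j(x)|>\beta_j\ (1\le j\le t)\}$ with $f_i,g_j\in\mathcal{A}$ and $\alpha_i,\beta_j\in\sqrt{|K^*|}$. The canonical topology on $X$ is the topology having the open Laurent domains as a base. A covering of a set $X$ is a collection of subsets of $X$ with union $X$. A covering $C$ refines a covering $D$ (written $C<D$) if every element of $C$ is contained in some element of $D$; $C$ star-refines $D$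 if for every $U\in C$ the union of all elements of $C$ meeting $U$ is contained in some element of $D$. A uniform structure on $X$ is a collection $\mathcal{C}$ of coverings (the uniform coverings) such that (C1) if $C\in\mathcal{C}$ and $C<D$ then $D\in\mathcal{C}$; (C2) for all $D_1,D_2\in\mathcal{C}$ there is $C\in\mathcal{C}$ star-refining both $D_1$ and $D_2$. It is Hausdorff if for all distinct $x,y\in X$ there is $C\in\mathcal{C}$ no element of which contains both $x$ and $y$. In the associated uniform topology, $U\subseteq X$ is open iff for each $x\in U$ there is $C\in\mathcal{C}$ such that the union of all elements of $C$ containing $x$ lies in $U$. A uniform space is totally bounded if each uniform covering has a finite subcover. A filter is Cauchy if it contains some element of each uniform covering; a uniform space is complete if every Cauchy filter converges. The completion of a Hausdorff uniform space $(X,\mathcal{C})$ is the complete Hausdorff uniform space, unique up to uniform isomorphism, containing $X$ as a dense subspace with $\mathcal{C}$ as induced uniform structure; compactness refers to its uniform topology. *)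

theory Defs
  imports "HOL-Analysis.Analysis" "HOL-Algebra.QuotRing" "HOL-Library.Multiset"
begin

section \<open>Valued fields\<close>

text \<open>An absolute value is a real-valued function on the type underlying a ring record; only its
  restriction to the carrier is meaningful.\<close>

definition absolute_value :: "('a, 'm) ring_scheme \<Rightarrow> ('a \<Rightarrow> real) \<Rightarrow> bool" where
  "absolute_value R v \<longleftrightarrow>
     (\<forall>x\<in>carrier R. 0 \<le> v x) \<and>
     (\<forall>x\<in>carrier R. v x = 0 \<longleftrightarrow> x = \<zero>\<^bsub>R\<^esub>) \<and>
     (\<forall>x\<in>carrier R. \<forall>y\<in>carrier R. v (x \<otimes>\<^bsub>R\<^esub> y) = v x * v y) \<and>
     (\<forall>x\<in>carrier R. \<forall>y\<in>carrier R. v (x \<oplus>\<^bsub>R\<^esub> y) \<le> v x + v y)"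

definition nonarchimedean :: "('a, 'm) ring_scheme \<Rightarrow> ('a \<Rightarrow> real) \<Rightarrow> bool" where
  "nonarchimedean R v \<longleftrightarrow>
     (\<forall>x\<in>carrier R. \<forall>y\<in>carrier R. v (x \<oplus>\<^bsub>R\<^esub> y) \<le> max (v x) (v y))"

definition nontrivial_value :: "('a, 'm) ring_scheme \<Rightarrow> ('a \<Rightarrow> real) \<Rightarrow> bool" where
  "nontrivial_value R v \<longleftrightarrow> (\<exists>x\<in>carrier R. x \<noteq> \<zero>\<^bsub>R\<^esub> \<and> v x \<noteq> 1)"

definition complete_value :: "('a, 'm) ring_scheme \<Rightarrow> ('a \<Rightarrow> real) \<Rightarrow> bool" where
  "complete_value R v \<longleftrightarrow>
     (\<forall>s :: nat \<Rightarrow> 'a. (\<forall>i. s i \<in> carrier R) \<and>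
        (\<forall>\<epsilon>>0. \<exists>N. \<forall>i\<ge>N. \<forall>j\<ge>N. v (s i \<ominus>\<^bsub>R\<^esub> s j) < \<epsilon>) \<longrightarrow>
        (\<exists>l\<in>carrier R. (\<lambda>i. v (s i \<ominus>\<^bsub>R\<^esub> l)) \<longlonglongrightarrow> 0))"

definition sqrt_value_group :: "('a, 'm) ring_scheme \<Rightarrow> ('a \<Rightarrow> real) \<Rightarrow> real set" where
  "sqrt_value_group K v = {\<alpha>. \<alpha> > 0 \<and> (\<exists>z\<in>carrier K. \<exists>n::nat. n \<ge> 1 \<and> \<alpha> ^ n = v z)}"


section \<open>Affinoid algebras\<close>

text \<open>As in HOL-Algebra's indexed polynomials, a monomial in the variables
  \<open>X\<^sub>0, \<dots>, X\<^sub>n\<^sub>-\<^sub>1\<close> is a multiset of indices below \<open>n\<close>, the multiplicity of \<open>i\<close> being the exponent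
  of \<open>X\<^sub>i\<close>.  A power series is its coefficient function, with value zero at all
  other multisets.\<close>

type_synonym 'k series = "nat multiset \<Rightarrow> 'k"

definition restricted_series ::
  "('k, 'm) ring_scheme \<Rightarrow> ('k \<Rightarrow> real) \<Rightarrow> nat \<Rightarrow> 'k series set" where
  "restricted_series K v n =
     {a. (\<forall>\<nu>. a \<nu> \<in> carrier K) \<and>
         (\<forall>\<nu>. \<not> set_mset \<nu> \<subseteq> {..<n} \<longrightarrow> a \<nu> = \<zero>\<^bsub>K\<^esub>) \<and>
         (\<forall>\<epsilon>>0. finite {\<nu>. \<epsilon> \<le> v (a \<nu>)})}"

definition const_series :: "('k, 'm) ring_scheme \<Rightarrow> 'k \<Rightarrow> 'k series" where
  "const_series K c = (\<lambda>\<nu>. if \<nu> = {#} then c else \<zero>\<^bsub>K\<^esub>)"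

definition tate_algebra ::
  "('k, 'm) ring_scheme \<Rightarrow> ('k \<Rightarrow> real) \<Rightarrow> nat \<Rightarrow> 'k series ring" where
  "tate_algebra K v n =
     \<lparr>carrier = restricted_series K v n,
      mult = (\<lambda>a b \<nu>. \<Oplus>\<^bsub>K\<^esub>\<mu>\<in>{\<mu>. \<mu> \<subseteq># \<nu>}. a \<mu> \<otimes>\<^bsub>K\<^esub> b (\<nu> - \<mu>)),
      one = const_series K \<one>\<^bsub>K\<^esub>,
      zero = const_series K \<zero>\<^bsub>K\<^esub>,
      add = (\<lambda>a b \<nu>. a \<nu> \<oplus>\<^bsub>K\<^esub> b \<nu>)\<rparr>"

text \<open>An affinoid algebra comes with its structure map \<open>\<kappa>\<close> from \<open>K\<close>, needed below to say that an
  absolute value on a residue field extends that of \<open>K\<close>.\<close>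

definition affinoid_algebra ::
  "('k, 'm) ring_scheme \<Rightarrow> ('k \<Rightarrow> real) \<Rightarrow> 'k series set ring \<Rightarrow> ('k \<Rightarrow> 'k series set) \<Rightarrow> bool" where
  "affinoid_algebra K v A \<kappa> \<longleftrightarrow>
     (\<exists>n\<ge>1. \<exists>I. ideal I (tate_algebra K v n) \<and>
        A = tate_algebra K v n Quot I \<and>
        \<kappa> = (\<lambda>c. I +>\<^bsub>tate_algebra K v n\<^esub> const_series K c))"

definition Max_spec :: "('a, 'm) ring_scheme \<Rightarrow> 'a set set" where
  "Max_spec A = {x. maximalideal x A}"

text \<open>The absolute value of the residue field at \<open>x\<close> extending the one of \<open>K\<close>.  Extensionality
  makes the description definite outside the carrier as well.\<close>

definition residue_abs ::
  "('k, 'm) ring_scheme \<Rightarrow> ('k \<Rightarrow> real) \<Rightarrow> ('a, 'n) ring_scheme \<Rightarrow> ('k \<Rightarrow> 'a) \<Rightarrow> 'a set \<Rightarrow> 'a set \<Rightarrow> real"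
  where
  "residue_abs K v A \<kappa> x =
     (THE w. w \<in> extensional (carrier (A Quot x)) \<and> absolute_value (A Quot x) w \<and>
             (\<forall>c\<in>carrier K. w (x +>\<^bsub>A\<^esub> \<kappa> c) = v c))"

definition abs_at ::
  "('k, 'm) ring_scheme \<Rightarrow> ('k \<Rightarrow> real) \<Rightarrow> ('a, 'n) ring_scheme \<Rightarrow> ('k \<Rightarrow> 'a) \<Rightarrow> 'a \<Rightarrow> 'a set \<Rightarrow> real"
  where
  "abs_at K v A \<kappa> f x = residue_abs K v A \<kappa> x (x +>\<^bsub>A\<^esub> f)"

text \<open>The families \<open>(f\<^sub>i, \<alpha>\<^sub>i)\<close> and \<open>(g\<^sub>j, \<beta>\<^sub>j)\<close> are given as finite, possibly empty, sets of pairs.\<close>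

definition open_laurent_domains ::
  "('k, 'm) ring_scheme \<Rightarrow> ('k \<Rightarrow> real) \<Rightarrow> ('a, 'n) ring_scheme \<Rightarrow> ('k \<Rightarrow> 'a) \<Rightarrow> 'a set set set" where
  "open_laurent_domains K v A \<kappa> =
     {{x \<in> Max_spec A. (\<forall>(f, \<alpha>)\<in>F. abs_at K v A \<kappa> f x < \<alpha>) \<and>
                       (\<forall>(g, \<beta>)\<in>G. abs_at K v A \<kappa> g x > \<beta>)} | F G.
        finite F \<and> F \<subseteq> carrier A \<times> sqrt_value_group K v \<and>
        finite G \<and> G \<subseteq> carrier A \<times> sqrt_value_group K v}"

definition canonical_topology ::
  "('k, 'm) ring_scheme \<Rightarrow> ('k \<Rightarrow> real) \<Rightarrow> ('a, 'n) ring_scheme \<Rightarrow> ('k \<Rightarrow> 'a) \<Rightarrow> 'a set topology" where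
  "canonical_topology K v A \<kappa> =
     topology (arbitrary union_of (\<lambda>U. U \<in> open_laurent_domains K v A \<kappa>))"


section \<open>Uniform structures given by coverings\<close>

definition covering :: "'x set \<Rightarrow> 'x set set \<Rightarrow> bool" where
  "covering X C \<longleftrightarrow> \<Union>C = X"

definition refines :: "'x set set \<Rightarrow> 'x set set \<Rightarrow> bool" where
  "refines C D \<longleftrightarrow> (\<forall>U\<in>C. \<exists>V\<in>D. U \<subseteq> V)"

definition star_refines :: "'x set set \<Rightarrow> 'x set set \<Rightarrow> bool" where
  "star_refines C D \<longleftrightarrow> (\<forall>U\<in>C. \<exists>V\<in>D. \<Union>{W\<in>C. W \<inter> U \<noteq> {}} \<subseteq> V)"

definition uniform_structure :: "'x set \<Rightarrow> 'x set set set \<Rightarrow> bool" where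
  "uniform_structure X \<C> \<longleftrightarrow>
     (\<forall>C\<in>\<C>. covering X C) \<and>
     (\<forall>C\<in>\<C>. \<forall>D. covering X D \<and> refines C D \<longrightarrow> D \<in> \<C>) \<and>
     (\<forall>D1\<in>\<C>. \<forall>D2\<in>\<C>. \<exists>C\<in>\<C>. star_refines C D1 \<and> star_refines C D2)"

definition uniform_Hausdorff :: "'x set \<Rightarrow> 'x set set set \<Rightarrow> bool" where
  "uniform_Hausdorff X \<C> \<longleftrightarrow>
     (\<forall>x\<in>X. \<forall>y\<in>X. x \<noteq> y \<longrightarrow> (\<exists>C\<in>\<C>. \<forall>U\<in>C. \<not> (x \<in> U \<and> y \<in> U)))"

definition uniform_topology :: "'x set \<Rightarrow> 'x set set set \<Rightarrow> 'x topology" where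
  "uniform_topology X \<C> =
     topology (\<lambda>U. U \<subseteq> X \<and> (\<forall>x\<in>U. \<exists>C\<in>\<C>. \<Union>{W\<in>C. x \<in> W} \<subseteq> U))"

definition uniform_totally_bounded :: "'x set \<Rightarrow> 'x set set set \<Rightarrow> bool" where
  "uniform_totally_bounded X \<C> \<longleftrightarrow> (\<forall>C\<in>\<C>. \<exists>D\<subseteq>C. finite D \<and> covering X D)"

text \<open>A filter on the set \<open>X\<close> is a proper HOL filter below \<^term>\<open>principal X\<close>.\<close>

definition uniform_Cauchy :: "'x set set set \<Rightarrow> 'x filter \<Rightarrow> bool" where
  "uniform_Cauchy \<C> F \<longleftrightarrow> (\<forall>C\<in>\<C>. \<exists>U\<in>C. eventually (\<lambda>x. x \<in> U) F)"

definition uniform_complete :: "'x set \<Rightarrow> 'x set set set \<Rightarrow> bool" where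
  "uniform_complete X \<C> \<longleftrightarrow>
     (\<forall>F. F \<noteq> bot \<and> F \<le> principal X \<and> uniform_Cauchy \<C> F \<longrightarrow>
        (\<exists>l. limitin (uniform_topology X \<C>) (\<lambda>x. x) l F))"

text \<open>The uniform structure induced on \<open>X\<close> by a map \<open>\<iota>\<close> into a uniform space with uniform
  coverings \<open>\<D>\<close>.\<close>

definition induced_uniformity ::
  "'x set \<Rightarrow> ('x \<Rightarrow> 'y) \<Rightarrow> 'y set set set \<Rightarrow> 'x set set set" where
  "induced_uniformity X \<iota> \<D> =
     {C. covering X C \<and> (\<exists>D\<in>\<D>. refines ((\<lambda>U. {x\<in>X. \<iota> x \<in> U}) ` D) C)}"

text \<open>\<open>(Y, \<D>)\<close> is a completion of \<open>(X, \<C>)\<close>, with \<open>X\<close> identified with its image under \<open>\<iota>\<close>.\<close>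

definition is_completion ::
  "'x set \<Rightarrow> 'x set set set \<Rightarrow> 'y set \<Rightarrow> 'y set set set \<Rightarrow> ('x \<Rightarrow> 'y) \<Rightarrow> bool" where
  "is_completion X \<C> Y \<D> \<iota> \<longleftrightarrow>
     uniform_structure Y \<D> \<and> uniform_Hausdorff Y \<D> \<and> uniform_complete Y \<D> \<and>
     inj_on \<iota> X \<and> \<iota> ` X \<subseteq> Y \<and>
     uniform_topology Y \<D> closure_of (\<iota> ` X) = Y \<and>
     induced_uniformity X \<iota> \<D> = \<C>"

definition laurent_uniformity ::
  "('k, 'm) ring_scheme \<Rightarrow> ('k \<Rightarrow> real) \<Rightarrow> ('a, 'n) ring_scheme \<Rightarrow> ('k \<Rightarrow> 'a) \<Rightarrow> 'a set set set set" where
  "laurent_uniformity K v A \<kappa> =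
     {D. covering (Max_spec A) D \<and>
         (\<exists>C. finite C \<and> C \<subseteq> open_laurent_domains K v A \<kappa> \<and> covering (Max_spec A) C \<and> refines C D)}"

text \<open>The predicates passed to \<^const>\<open>topology\<close> above satisfy \<^const>\<open>istopology\<close>.\<close>

lemma openin_canonical_topology:
  "openin (canonical_topology K v A \<kappa>) =
     arbitrary union_of (\<lambda>U. U \<in> open_laurent_domains K v A \<kappa>)"
proof -
  have "S \<inter> T \<in> open_laurent_domains K v A \<kappa>"
    if S: "S \<in> open_laurent_domains K v A \<kappa>" and T: "T \<in> open_laurent_domains K v A \<kappa>" for S T
  proof -
    obtain F G where FG: "finite F" "F \<subseteq> carrier A \<times> sqrt_value_group K v"
      "finite G" "G \<subseteq> carrier A \<times> sqrt_value_group K v"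
      and S: "S = {x \<in> Max_spec A. (\<forall>(f, \<alpha>)\<in>F. abs_at K v A \<kappa> f x < \<alpha>) \<and>
                       (\<forall>(g, \<beta>)\<in>G. abs_at K v A \<kappa> g x > \<beta>)}"
      using S unfolding open_laurent_domains_def by blast
    obtain F' G' where FG': "finite F'" "F' \<subseteq> carrier A \<times> sqrt_value_group K v"
      "finite G'" "G' \<subseteq> carrier A \<times> sqrt_value_group K v"
      and T: "T = {x \<in> Max_spec A. (\<forall>(f, \<alpha>)\<in>F'. abs_at K v A \<kappa> f x < \<alpha>) \<and>
                       (\<forall>(g, \<beta>)\<in>G'. abs_at K v A \<kappa> g x > \<beta>)}"
      using T unfolding open_laurent_domains_def by blast
    have "S \<inter> T = {x \<in> Max_spec A. (\<forall>(f, \<alpha>)\<in>F \<union> F'. abs_at K v A \<kappa> f x < \<alpha>) \<and>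
                       (\<forall>(g, \<beta>)\<in>G \<union> G'. abs_at K v A \<kappa> g x > \<beta>)}"
      unfolding S T by blast
    moreover have "finite (F \<union> F')" "F \<union> F' \<subseteq> carrier A \<times> sqrt_value_group K v"
      "finite (G \<union> G')" "G \<union> G' \<subseteq> carrier A \<times> sqrt_value_group K v"
      using FG FG' by auto
    ultimately show ?thesis
      unfolding open_laurent_domains_def by blast
  qed
  then have "istopology (arbitrary union_of (\<lambda>U. U \<in> open_laurent_domains K v A \<kappa>))"
    by (rule istopology_base)
  then show ?thesis
    by (simp add: canonical_topology_def topology_inverse')
qed

lemma openin_uniform_topology:
  assumes "uniform_structure X \<C>"
  shows "openin (uniform_topology X \<C>) U \<longleftrightarrow>
     U \<subseteq> X \<and> (\<forall>x\<in>U. \<exists>C\<in>\<C>. \<Union>{W\<in>C. x \<in> W} \<subseteq> U)"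
proof -
  let ?P = "\<lambda>U. U \<subseteq> X \<and> (\<forall>x\<in>U. \<exists>C\<in>\<C>. \<Union>{W\<in>C. x \<in> W} \<subseteq> U)"
  have "?P (S \<inter> T)" if S: "?P S" and T: "?P T" for S T
  proof (intro conjI ballI)
    show "S \<inter> T \<subseteq> X" using S by blast
    fix x assume x: "x \<in> S \<inter> T"
    obtain D1 D2 where D: "D1 \<in> \<C>" "D2 \<in> \<C>" "\<Union>{W\<in>D1. x \<in> W} \<subseteq> S" "\<Union>{W\<in>D2. x \<in> W} \<subseteq> T"
      using S T x by blast
    obtain C where C: "C \<in> \<C>" "star_refines C D1" "star_refines C D2"
      using assms D unfolding uniform_structure_def by blast
    have star: "\<Union>{W\<in>C. x \<in> W} \<subseteq> \<Union>{W\<in>D. x \<in> W}" if CD: "star_refines C D" for D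
    proof
      fix y assume "y \<in> \<Union>{W\<in>C. x \<in> W}"
      then obtain W where W: "W \<in> C" "x \<in> W" "y \<in> W" by blast
      then obtain V where "V \<in> D" "\<Union>{W'\<in>C. W' \<inter> W \<noteq> {}} \<subseteq> V"
        using CD unfolding star_refines_def by blast
      then show "y \<in> \<Union>{W\<in>D. x \<in> W}" using W by blast
    qed
    show "\<exists>C\<in>\<C>. \<Union>{W\<in>C. x \<in> W} \<subseteq> S \<inter> T"
      using C(1) subset_trans[OF star[OF C(2)] D(3)] subset_trans[OF star[OF C(3)] D(4)] by blast
  qed
  moreover have "?P (\<Union>\<K>)" if \<K>: "\<forall>S\<in>\<K>. ?P S" for \<K>
  proof (intro conjI ballI)
    show "\<Union>\<K> \<subseteq> X" using \<K> by blast
    fix x assume "x \<in> \<Union>\<K>"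
    then obtain S where "S \<in> \<K>" "x \<in> S" by blast
    moreover obtain C where "C \<in> \<C>" "\<Union>{W\<in>C. x \<in> W} \<subseteq> S" using \<K> calculation by blast
    ultimately show "\<exists>C\<in>\<C>. \<Union>{W\<in>C. x \<in> W} \<subseteq> \<Union>\<K>" by blast
  qed
  ultimately have "istopology ?P" unfolding istopology_def by blast
  then show ?thesis by (simp add: uniform_topology_def topology_inverse')
qed

end

theory Submission
  imports Defs "HOL-Algebra.Subrings"
begin

text \<open>The Nullstellensatz identifies the points of \<open>Max A\<close> with the multiplicative seminorms on the
  Tate algebra that extend \<open>v\<close>, have maximal kernel and vanish on the ideal \<open>I\<close>; they are bounded by the
  Gauss norm. The domain \<open>|b| \<le> |a|\<close> is the spectrum of the algebra obtained by adjoining a variable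
  \<open>X\<close> subject to \<open>aX + b = 0\<close>. If it is empty, then \<open>1 \<equiv> (aX + b)h\<close> modulo \<open>I\<close>, so the coefficients of
  \<open>h\<close> satisfy \<open>|h\<^sub>j| |b|\<^bsup>j+1\<^esup> = |a|\<^bsup>j\<^esup>\<close>; they tend to zero, whence \<open>|a| \<le> \<rho>|b|\<close> with
  a uniform \<open>\<rho> < 1\<close>. Applied to domains cut out by several such inequalities, this shows that every
  finite covering by open Laurent domains has a positive margin; it is therefore star-refined by
  the covering by small cells in the values of the finitely many functions involved. The
  completion consists of the minimal Cauchy filters.\<close>

section \<open>Completions of uniform spaces\<close>

text \<open>The canonical topology need not be compact, so a pointwise inequality |a| < |b| gives no
  gap by itself; this is why the gap is extracted from an algebraic certificate of emptiness.
  Passing from a domain to its algebra raises the number of variables, and points must be moved down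
  and up along this step. Both moves rest on the finiteness of residue fields over K: it makes the
  absolute value of a residue field exist and be unique, and it makes the restriction of a point to
  fewer variables have a maximal kernel. Finiteness is proved by induction on the number of
  variables without a division theorem for series: if the image of a ring of series in a field is
  itself a field, the inverse of the last variable can be approximated by a polynomial, and this
  supplies the distinguished element. The absolute value is the spectral norm of the quotient norm;
  it is multiplicative because all norms on a finite-dimensional space over a complete field are
  equivalent. Seminorms are preferred to ideals because they pass from \<open>RS (Suc n)\<close> to
  \<open>RS n\<close> by mere restriction.\<close>

lemma ultrafilter_below:
  assumes "F \<noteq> bot"
  shows "\<exists>G. G \<noteq> bot \<and> G \<le> F \<and> (\<forall>P. eventually P G \<or> eventually (\<lambda>x. \<not> P x) G)"
proof -
  let ?A = "{G. G \<noteq> bot \<and> G \<le> F}"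
  let ?R = "\<lambda>a b::'a filter. b \<le> a"
  have "\<exists>m\<in>?A. \<forall>a\<in>?A. ?R m a \<longrightarrow> a = m"
  proof (rule predicate_Zorn)
    show "partial_order_on ?A (relation_of ?R ?A)"
      by (auto simp: partial_order_on_def preorder_on_def refl_on_def trans_def antisym_def relation_of_def)
    fix C assume C: "C \<in> Chains (relation_of ?R ?A)"
    have CA: "\<And>c. c \<in> C \<Longrightarrow> c \<in> ?A" and tot: "\<And>a b. a \<in> C \<Longrightarrow> b \<in> C \<Longrightarrow> a \<le> b \<or> b \<le> a"
      using C unfolding Chains_def relation_of_def by blast+
    show "\<exists>u\<in>?A. \<forall>a\<in>C. ?R a u"
    proof (cases "C = {}")
      case True then show ?thesis using assms by auto
    next
      case False
      have ev: "eventually P (Inf C) \<longleftrightarrow> (\<exists>b\<in>C. eventually P b)" for P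
        by (rule eventually_Inf_base[OF False]) (meson tot inf_greatest order_refl)
      have "Inf C \<noteq> bot"
      proof
        assume "Inf C = bot"
        then have "eventually (\<lambda>_. False) (Inf C)" by simp
        then obtain b where "b \<in> C" "eventually (\<lambda>_. False) b" using ev by blast
        then have "b = bot" by (simp add: eventually_False)
        then show False using CA[OF \<open>b \<in> C\<close>] by blast
      qed
      moreover have "Inf C \<le> F" using False CA
        by (metis (no_types, lifting) Inf_lower equals0I mem_Collect_eq order_trans)
      ultimately show ?thesis by (auto intro: Inf_lower)
    qed
  qed
  then obtain G where G: "G \<noteq> bot" "G \<le> F"
    and mx: "\<And>H. H \<noteq> bot \<Longrightarrow> H \<le> F \<Longrightarrow> H \<le> G \<Longrightarrow> H = G" by blast
  have "eventually P G \<or> eventually (\<lambda>x. \<not> P x) G" for P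
  proof (rule disjCI)
    assume n: "\<not> eventually (\<lambda>x. \<not> P x) G"
    let ?H = "inf G (principal {x. P x})"
    have "?H \<noteq> bot"
      using n by (simp add: trivial_limit_def eventually_inf_principal)
    moreover have "?H \<le> F" using G(2) by (rule le_infI1)
    ultimately have "?H = G" using mx by simp
    then have "eventually P ?H \<longleftrightarrow> eventually P G" by simp
    then show "eventually P G" by (simp add: eventually_inf_principal)
  qed
  with G show ?thesis by blast
qed

lemma ultrafilter_Union:
  assumes u: "\<And>P. eventually P G \<or> eventually (\<lambda>x. \<not> P x) G"
    and "finite D" "eventually (\<lambda>x. x \<in> \<Union>D) G" "G \<noteq> bot"
  shows "\<exists>U\<in>D. eventually (\<lambda>x. x \<in> U) G"
proof (rule ccontr)
  assume "\<not> ?thesis"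
  then have "\<forall>U\<in>D. eventually (\<lambda>x. x \<notin> U) G" using u by blast
  then have "eventually (\<lambda>x. \<forall>U\<in>D. x \<notin> U) G" using assms(2) by (simp add: eventually_ball_finite)
  with assms(3) have "eventually (\<lambda>x. False) G" by eventually_elim auto
  then show False using assms(4) by (simp add: eventually_False)
qed

section \<open>Uniform spaces given by coverings: topology, separation, compactness\<close>

lemma star_refines_mono: "star_refines C D \<Longrightarrow> refines D E \<Longrightarrow> star_refines C E"
  unfolding star_refines_def refines_def by (meson order_trans)

lemma refines_trans: "refines C D \<Longrightarrow> refines D E \<Longrightarrow> refines C E"
  unfolding refines_def by (meson order_trans)

text \<open>The empty collection satisfies the axioms of \<open>uniform_structure\<close> vacuously,
  and only the empty set would be open in its topology; \<open>ne\<close> excludes it, so that X is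
  the underlying set of the topology.\<close>

locale cover_uniform =
  fixes X :: "'x set" and \<C> :: "'x set set set"
  assumes us: "uniform_structure X \<C>" and ne: "\<C> \<noteq> {}"
begin

definition star :: "'x \<Rightarrow> 'x set set \<Rightarrow> 'x set"
  where "star x C = \<Union>{W\<in>C. x \<in> W}"

lemma Union_covering: "C \<in> \<C> \<Longrightarrow> \<Union>C = X"
  and coverings_mono: "C \<in> \<C> \<Longrightarrow> \<Union>D = X \<Longrightarrow> refines C D \<Longrightarrow> D \<in> \<C>"
  and star_ref2_ex: "D1 \<in> \<C> \<Longrightarrow> D2 \<in> \<C> \<Longrightarrow> \<exists>C\<in>\<C>. star_refines C D1 \<and> star_refines C D2"
proof -
  note us' = us[unfolded uniform_structure_def covering_def]
  show "C \<in> \<C> \<Longrightarrow> \<Union>C = X" using us'[THEN conjunct1] by (rule bspec)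
  show "C \<in> \<C> \<Longrightarrow> \<Union>D = X \<Longrightarrow> refines C D \<Longrightarrow> D \<in> \<C>"
    using us'[THEN conjunct2, THEN conjunct1, THEN bspec, of C, THEN spec, of D] by iprover
  show "D1 \<in> \<C> \<Longrightarrow> D2 \<in> \<C> \<Longrightarrow> \<exists>C\<in>\<C>. star_refines C D1 \<and> star_refines C D2"
    using us'[THEN conjunct2, THEN conjunct2, THEN bspec, THEN bspec] .
qed

lemma covering_sub: "C \<in> \<C> \<Longrightarrow> U \<in> C \<Longrightarrow> U \<subseteq> X"
  using Union_upper Union_covering by fastforce

lemma covering_ex: "C \<in> \<C> \<Longrightarrow> x \<in> X \<Longrightarrow> \<exists>U\<in>C. x \<in> U"
  using Union_covering[of C] by auto

lemma star_ref2:
  assumes "D1 \<in> \<C>" "D2 \<in> \<C>"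
  obtains C where "C \<in> \<C>" "star_refines C D1" "star_refines C D2"
  using star_ref2_ex[OF assms] that by blast

lemma openin_iff: "openin (uniform_topology X \<C>) U \<longleftrightarrow> U \<subseteq> X \<and> (\<forall>x\<in>U. \<exists>C\<in>\<C>. star x C \<subseteq> U)"
  unfolding openin_uniform_topology[OF us] star_def by simp

lemma topspace_uniform: "topspace (uniform_topology X \<C>) = X"
proof -
  obtain C where "C \<in> \<C>" using ne by blast
  then have "openin (uniform_topology X \<C>) X"
    unfolding openin_iff star_def using covering_sub by blast
  then show ?thesis using openin_iff[of "topspace (uniform_topology X \<C>)"]
    by (metis openin_subset openin_topspace subset_antisym)
qed

lemma star_refinesD:
  assumes "star_refines C D" "U \<in> C" obtains V where "V \<in> D" "\<And>W. W \<in> C \<Longrightarrow> W \<inter> U \<noteq> {} \<Longrightarrow> W \<subseteq> V"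
proof -
  obtain V where "V \<in> D" "\<Union>{W\<in>C. W \<inter> U \<noteq> {}} \<subseteq> V"
    using assms unfolding star_refines_def by (elim ballE[of _ _ U]) auto
  then show ?thesis using that[of V] by (simp add: Sup_le_iff)
qed

lemma star_mem: "C \<in> \<C> \<Longrightarrow> x \<in> X \<Longrightarrow> x \<in> star x C"
  using covering_ex[of C x] unfolding star_def by blast

text \<open>A star need not be open. Its interior is taken to consist of the points z whose own star
  for some uniform covering D stays inside it; if E star-refines D, every point of
  \<open>star z E\<close> has its E-star inside \<open>star z D\<close>, so this set is
  open.\<close>

lemma star_contains_open:
  assumes "C \<in> \<C>" "x \<in> X"
  obtains O1 where "openin (uniform_topology X \<C>) O1" "x \<in> O1" "O1 \<subseteq> star x C"
proof -
  let ?O1 = "{z\<in>X. \<exists>D\<in>\<C>. star z D \<subseteq> star x C}"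
  have "\<exists>E\<in>\<C>. star z E \<subseteq> ?O1" if "z \<in> ?O1" for z
  proof -
    obtain D where D: "D \<in> \<C>" "star z D \<subseteq> star x C" using \<open>z \<in> ?O1\<close> by blast
    obtain E where E: "E \<in> \<C>" "star_refines E D" using star_ref2[OF D(1) D(1)] by blast
    have "star w E \<subseteq> star z D" if "w \<in> star z E" for w
    proof -
      obtain W where W: "W \<in> E" "z \<in> W" "w \<in> W" using \<open>w \<in> star z E\<close> unfolding star_def by blast
      obtain V where V: "V \<in> D" "\<And>W'. W' \<in> E \<Longrightarrow> W' \<inter> W \<noteq> {} \<Longrightarrow> W' \<subseteq> V"
        by (rule star_refinesD[OF E(2) W(1)]) blast
      have "z \<in> V" using V(2)[OF W(1)] W by blast
      moreover have "star w E \<subseteq> V" using V(2) W unfolding star_def by blast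
      ultimately show ?thesis using V(1) unfolding star_def by blast
    qed
    moreover have "star z E \<subseteq> X" using covering_sub[OF E(1)] unfolding star_def by blast
    ultimately have "star z E \<subseteq> ?O1" using D(2) E(1) by blast
    then show ?thesis using E(1) by blast
  qed
  then have "openin (uniform_topology X \<C>) ?O1" unfolding openin_iff by blast
  moreover have "x \<in> ?O1" using assms by blast
  moreover have "?O1 \<subseteq> star x C" using star_mem by blast
  ultimately show ?thesis by (rule that)
qed

text \<open>If the stars of x and y for a star-refinement D of C met, the two members of D involved
  would lie in a single member of C, which would then contain both points.\<close>

lemma Hausdorff_uniform:
  assumes "uniform_Hausdorff X \<C>"
  shows "Hausdorff_space (uniform_topology X \<C>)"
  unfolding Hausdorff_space_def
proof (intro allI impI, unfold topspace_uniform)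
  fix x y assume xy: "x \<in> X \<and> y \<in> X \<and> x \<noteq> y"
  then obtain C where C: "C \<in> \<C>" "\<forall>U\<in>C. \<not> (x \<in> U \<and> y \<in> U)"
    using assms unfolding uniform_Hausdorff_def by blast
  obtain D where D: "D \<in> \<C>" "star_refines D C" using star_ref2[OF C(1) C(1)] by blast
  have "star x D \<inter> star y D = {}"
  proof (rule ccontr)
    assume "star x D \<inter> star y D \<noteq> {}"
    then obtain w W W' where W: "W \<in> D" "W' \<in> D" "w \<in> W" "w \<in> W'" "x \<in> W" "y \<in> W'"
      unfolding star_def by blast
    obtain V where V: "V \<in> C" "\<And>W'. W' \<in> D \<Longrightarrow> W' \<inter> W \<noteq> {} \<Longrightarrow> W' \<subseteq> V"
      by (rule star_refinesD[OF D(2) W(1)]) blast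
    then show False using C(2) V(2)[OF W(1)] V(2)[OF W(2)] W by blast
  qed
  moreover obtain P where "openin (uniform_topology X \<C>) P" "x \<in> P" "P \<subseteq> star x D"
    using star_contains_open[OF D(1)] xy by blast
  moreover obtain Q where "openin (uniform_topology X \<C>) Q" "y \<in> Q" "Q \<subseteq> star y D"
    using star_contains_open[OF D(1)] xy by blast
  ultimately show "\<exists>U V. openin (uniform_topology X \<C>) U \<and> openin (uniform_topology X \<C>) V \<and>
      x \<in> U \<and> y \<in> V \<and> disjnt U V" unfolding disjnt_def by blast
qed

text \<open>Were there no finite subcover, the complements of finite unions would generate a proper
  filter. An ultrafilter finer than it is Cauchy by total boundedness, so it converges to some l; it
  then contains a member of the cover around l as well as the complement of that member.\<close>

lemma compact_uniform:
  assumes "uniform_complete X \<C>" "uniform_totally_bounded X \<C>"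
  shows "compact_space (uniform_topology X \<C>)"
  unfolding compact_space_alt topspace_uniform
proof (intro allI impI, elim conjE, rule ccontr)
  fix \<U> assume op: "\<forall>U\<in>\<U>. openin (uniform_topology X \<C>) U" and cX: "X \<subseteq> \<Union>\<U>"
    and nf: "\<not> (\<exists>\<F>. finite \<F> \<and> \<F> \<subseteq> \<U> \<and> X \<subseteq> \<Union>\<F>)"
  let ?B = "(\<lambda>\<F>. principal (X - \<Union>\<F>)) ` {\<F>. finite \<F> \<and> \<F> \<subseteq> \<U>}"
  have ev: "eventually P (Inf ?B) \<longleftrightarrow> (\<exists>b\<in>?B. eventually P b)" for P
  proof (rule eventually_Inf_base)
    show "?B \<noteq> {}" by blast
    fix F G assume "F \<in> ?B" "G \<in> ?B"
    then obtain f g where "finite f" "f \<subseteq> \<U>" "finite g" "g \<subseteq> \<U>" "F = principal (X - \<Union>f)"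
      "G = principal (X - \<Union>g)" by blast
    then show "\<exists>x\<in>?B. x \<le> inf F G"
      by (intro bexI[of _ "principal (X - \<Union>(f \<union> g))"] imageI) auto
  qed
  have "Inf ?B \<noteq> bot"
  proof
    assume "Inf ?B = bot"
    then have "eventually (\<lambda>_. False) (Inf ?B)" by simp
    then obtain b where b: "b \<in> ?B" "eventually (\<lambda>_. False) b" unfolding ev by (rule bexE)
    obtain \<F> where F: "finite \<F> \<and> \<F> \<subseteq> \<U>" "b = principal (X - \<Union>\<F>)" using b(1) by blast
    have "X - \<Union>\<F> = {}" using b(2) unfolding F(2) eventually_principal by blast
    then have "X \<subseteq> \<Union>\<F>" by blast
    with F(1) show False using nf by blast
  qed
  then have "\<exists>G. G \<noteq> bot \<and> G \<le> Inf ?B \<and> (\<forall>P. eventually P G \<or> eventually (\<lambda>x. \<not> P x) G)"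
    by (rule ultrafilter_below)
  then obtain G where G': "G \<noteq> bot \<and> G \<le> Inf ?B \<and> (\<forall>P. eventually P G \<or> eventually (\<lambda>x. \<not> P x) G)"
    by (rule exE)
  note G = G'[THEN conjunct1] G'[THEN conjunct2, THEN conjunct1]
    and u = G'[THEN conjunct2, THEN conjunct2, THEN spec]
  have FB: "eventually (\<lambda>x. x \<in> X - \<Union>\<F>) G" if "finite \<F>" "\<F> \<subseteq> \<U>" for \<F>
  proof -
    have "eventually (\<lambda>x. x \<in> X - \<Union>\<F>) (Inf ?B)"
      unfolding ev using that by (auto simp: eventually_principal)
    then show ?thesis using G(2) by (rule filter_leD[rotated])
  qed
  have GX: "G \<le> principal X"
    using FB[of "{}"] by (simp add: le_principal)
  have "uniform_Cauchy \<C> G"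
    unfolding uniform_Cauchy_def
  proof
    fix C assume C: "C \<in> \<C>"
    obtain D where D: "D \<subseteq> C" "finite D" "\<Union>D = X"
      using assms(2) C unfolding uniform_totally_bounded_def covering_def by blast
    have "\<exists>U\<in>D. eventually (\<lambda>x. x \<in> U) G"
      using ultrafilter_Union[OF u D(2) _ G(1)] D(3) GX by (simp add: le_principal)
    then show "\<exists>U\<in>C. eventually (\<lambda>x. x \<in> U) G" using D(1) by blast
  qed
  then obtain l where l: "limitin (uniform_topology X \<C>) (\<lambda>x. x) l G"
    using assms(1) G(1) GX unfolding uniform_complete_def by blast
  then have "l \<in> X" using topspace_uniform by (simp add: limitin_def)
  then obtain O1 where O1: "O1 \<in> \<U>" "l \<in> O1" using cX by blast
  have "eventually (\<lambda>x. x \<in> O1) G" using l op O1 by (simp add: limitin_def)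
  moreover have "eventually (\<lambda>x. x \<in> X - \<Union>{O1}) G" using FB[of "{O1}"] O1 by blast
  ultimately have "eventually (\<lambda>x. False) G" by eventually_elim auto
  then show False using G(1) by (simp add: eventually_False)
qed

section \<open>Minimal Cauchy filters\<close>

definition starf :: "'x filter \<Rightarrow> 'x set set \<Rightarrow> 'x set"
  where "starf F C = \<Union>{W\<in>C. eventually (\<lambda>x. x \<in> W) F}"

text \<open>For a Cauchy filter F this is the minimal Cauchy filter inside F. A filter with fewer
  sets is larger in the order of \<open>filter\<close>, whence
  \<open>F \<le> roundf F\<close>.\<close>

definition roundf :: "'x filter \<Rightarrow> 'x filter"
  where "roundf F = Inf ((\<lambda>C. principal (starf F C)) ` \<C>)"

lemma starf_refine: "star_refines C D \<Longrightarrow> starf F C \<subseteq> starf F D"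
proof
  fix x assume sr: "star_refines C D" and "x \<in> starf F C"
  then obtain W where W: "W \<in> C" "x \<in> W" "eventually (\<lambda>x. x \<in> W) F" unfolding starf_def by blast
  obtain V where V: "V \<in> D" "\<And>W'. W' \<in> C \<Longrightarrow> W' \<inter> W \<noteq> {} \<Longrightarrow> W' \<subseteq> V"
    by (rule star_refinesD[OF sr W(1)]) blast
  have "W \<subseteq> V" using V(2) W by blast
  moreover have "eventually (\<lambda>x. x \<in> V) F"
    using W(3) by (rule eventually_mono) (use \<open>W \<subseteq> V\<close> in blast)
  ultimately show "x \<in> starf F D" using V(1) W(2) unfolding starf_def by blast
qed

lemma eventually_roundf: "eventually P (roundf F) \<longleftrightarrow> (\<exists>C\<in>\<C>. \<forall>x\<in>starf F C. P x)"
proof -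
  have "eventually P (roundf F) \<longleftrightarrow> (\<exists>b\<in>(\<lambda>C. principal (starf F C)) ` \<C>. eventually P b)"
    unfolding roundf_def
  proof (rule eventually_Inf_base)
    show "(\<lambda>C. principal (starf F C)) ` \<C> \<noteq> {}" using ne by blast
    fix A B assume "A \<in> (\<lambda>C. principal (starf F C)) ` \<C>" "B \<in> (\<lambda>C. principal (starf F C)) ` \<C>"
    then obtain C D where CD: "C \<in> \<C>" "D \<in> \<C>" "A = principal (starf F C)" "B = principal (starf F D)"
      by blast
    obtain E where E: "E \<in> \<C>" "star_refines E C" "star_refines E D" using star_ref2[OF CD(1,2)] by blast
    show "\<exists>x\<in>(\<lambda>C. principal (starf F C)) ` \<C>. x \<le> inf A B"
      using E CD(3,4) starf_refine by (intro bexI[of _ "principal (starf F E)"]) auto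
  qed
  then show ?thesis by (simp add: eventually_principal)
qed

text \<open>Each Cauchy filter contains exactly one of these, so the completion can be formed
  without a quotient by equivalence of Cauchy filters. Minimality refers to inclusion of the sets of
  a filter, which is maximality in the order of \<open>filter\<close>.\<close>

definition minimal_Cauchy :: "'x filter set" where
  "minimal_Cauchy = {F. F \<noteq> bot \<and> F \<le> principal X \<and> uniform_Cauchy \<C> F \<and>
     (\<forall>G. G \<noteq> bot \<and> G \<le> principal X \<and> uniform_Cauchy \<C> G \<and> F \<le> G \<longrightarrow> G = F)}"

text \<open>Two sets that belong to F meet; if C star-refines D, all members of C in F therefore lie
  in one member of D, which makes \<open>roundf F\<close> Cauchy. A Cauchy filter G coarser than it
  has a member of each C, and this member also belongs to F; so G contains every star of F and
  equals \<open>roundf F\<close>.\<close>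

lemma roundf_minimal:
  assumes F: "F \<noteq> bot" "F \<le> principal X" "uniform_Cauchy \<C> F"
  shows "roundf F \<in> minimal_Cauchy" "F \<le> roundf F"
proof -
  show le: "F \<le> roundf F"
  proof (rule filter_leI)
    fix P assume "eventually P (roundf F)"
    then obtain C where C: "C \<in> \<C>" "\<forall>x\<in>starf F C. P x" unfolding eventually_roundf by blast
    obtain U where U: "U \<in> C" "eventually (\<lambda>x. x \<in> U) F"
      using F(3) C(1) unfolding uniform_Cauchy_def by blast
    have "U \<subseteq> starf F C" using U unfolding starf_def by blast
    with C(2) show "eventually P F" by (intro eventually_mono[OF U(2)]) blast
  qed
  have nb: "roundf F \<noteq> bot" using le F(1) by (metis bot.extremum_uniqueI)
  have pX: "roundf F \<le> principal X"
    unfolding le_principal eventually_roundf starf_def using ne covering_sub by blast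
  have ca: "uniform_Cauchy \<C> (roundf F)"
    unfolding uniform_Cauchy_def
  proof
    fix D assume D: "D \<in> \<C>"
    obtain C where C: "C \<in> \<C>" "star_refines C D" using star_ref2[OF D D] by blast
    obtain U where U: "U \<in> C" "eventually (\<lambda>x. x \<in> U) F"
      using F(3) C(1) unfolding uniform_Cauchy_def by blast
    obtain V where V: "V \<in> D" "\<And>W'. W' \<in> C \<Longrightarrow> W' \<inter> U \<noteq> {} \<Longrightarrow> W' \<subseteq> V"
      by (rule star_refinesD[OF C(2) U(1)]) blast
    have "W \<inter> U \<noteq> {}" if "eventually (\<lambda>x. x \<in> W) F" for W
    proof
      assume "W \<inter> U = {}"
      then have "eventually (\<lambda>x. False) F" using eventually_conj[OF that U(2)] 
        by (auto elim: eventually_mono)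
      then show False using F(1) by (simp add: eventually_False)
    qed
    then have "starf F C \<subseteq> V" using V(2) unfolding starf_def by blast
    then show "\<exists>U\<in>D. eventually (\<lambda>x. x \<in> U) (roundf F)"
      using V(1) C(1) unfolding eventually_roundf by blast
  qed
  have "G = roundf F" if G: "G \<noteq> bot" "G \<le> principal X" "uniform_Cauchy \<C> G" "roundf F \<le> G" for G
  proof (rule antisym)
    show "G \<le> roundf F"
    proof (rule filter_leI)
      fix P assume "eventually P (roundf F)"
      then obtain C where C: "C \<in> \<C>" "\<forall>x\<in>starf F C. P x" unfolding eventually_roundf by blast
      obtain U where U: "U \<in> C" "eventually (\<lambda>x. x \<in> U) G"
        using G(3) C(1) unfolding uniform_Cauchy_def by blast
      have "eventually (\<lambda>x. x \<in> U) F" using U(2) G(4) le by (meson filter_leD)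
      then have "U \<subseteq> starf F C" using U unfolding starf_def by blast
      with C(2) show "eventually P G" by (intro eventually_mono[OF U(2)]) blast
    qed
  qed (fact G(4))
  then show "roundf F \<in> minimal_Cauchy" unfolding minimal_Cauchy_def using nb pX ca by blast
qed

section \<open>The completion by minimal Cauchy filters\<close>

definition lifted :: "'x set \<Rightarrow> 'x filter set" where
  "lifted U = {F \<in> minimal_Cauchy. eventually (\<lambda>x. x \<in> U) F}"

definition lifted_uniformity :: "'x filter set set set" where
  "lifted_uniformity = {D. covering minimal_Cauchy D \<and> (\<exists>C\<in>\<C>. refines (lifted ` C) D)}"

lemma lifted_mono: "U \<subseteq> V \<Longrightarrow> lifted U \<subseteq> lifted V"
  unfolding lifted_def by (auto elim: eventually_mono)

lemma lifted_meet: "lifted U \<inter> lifted V \<noteq> {} \<Longrightarrow> U \<inter> V \<noteq> {}"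
proof
  assume "lifted U \<inter> lifted V \<noteq> {}" and e: "U \<inter> V = {}"
  then obtain F where "F \<noteq> bot" "eventually (\<lambda>x. x \<in> U) F" "eventually (\<lambda>x. x \<in> V) F"
    unfolding lifted_def minimal_Cauchy_def by blast
  then have "\<exists>x. x \<in> U \<and> x \<in> V" by (intro eventually_happens'[of F] eventually_conj)
  then show False using e by blast
qed

lemma lifted_cover: "C \<in> \<C> \<Longrightarrow> covering minimal_Cauchy (lifted ` C)"
  unfolding covering_def lifted_def minimal_Cauchy_def uniform_Cauchy_def by blast

lemma lifted_mem: "C \<in> \<C> \<Longrightarrow> lifted ` C \<in> lifted_uniformity"
  using lifted_cover unfolding lifted_uniformity_def refines_def by blast

lemma lifted_star:
  assumes *: "star_refines C D"
  shows "star_refines (lifted ` C) (lifted ` D)"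
  unfolding star_refines_def
proof (intro ballI, elim imageE)
  fix HU U assume U: "HU = lifted U" "U \<in> C"
  obtain V where V: "V \<in> D" "\<And>W. W \<in> C \<Longrightarrow> W \<inter> U \<noteq> {} \<Longrightarrow> W \<subseteq> V"
    by (rule star_refinesD[OF * U(2)]) blast
  have "lifted W \<subseteq> lifted V" if "W \<in> C" "lifted W \<inter> HU \<noteq> {}" for W
    using V(2)[OF that(1)] lifted_mono lifted_meet that(2) unfolding U(1) by metis
  then have "\<Union>{W \<in> lifted ` C. W \<inter> HU \<noteq> {}} \<subseteq> lifted V" by blast
  then show "\<exists>V\<in>lifted ` D. \<Union>{W \<in> lifted ` C. W \<inter> HU \<noteq> {}} \<subseteq> V" using V(1) by blast
qed

lemma lifted_uniform: "uniform_structure minimal_Cauchy lifted_uniformity"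
  unfolding uniform_structure_def
proof (intro conjI ballI allI impI)
  show "covering minimal_Cauchy C" if "C \<in> lifted_uniformity" for C
    using that unfolding lifted_uniformity_def by blast
next
  fix C D assume "C \<in> lifted_uniformity" "covering minimal_Cauchy D \<and> refines C D"
  then show "D \<in> lifted_uniformity"
    unfolding lifted_uniformity_def using refines_trans by blast
next
  fix D1 D2 assume "D1 \<in> lifted_uniformity" "D2 \<in> lifted_uniformity"
  then obtain C1 C2 where C: "C1 \<in> \<C>" "C2 \<in> \<C>" "refines (lifted ` C1) D1" "refines (lifted ` C2) D2"
    unfolding lifted_uniformity_def by blast
  obtain E where E: "E \<in> \<C>" "star_refines E C1" "star_refines E C2"
    using star_ref2[OF C(1,2)] by blast
  show "\<exists>C\<in>lifted_uniformity. star_refines C D1 \<and> star_refines C D2"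
    using lifted_mem[OF E(1)] lifted_star[OF E(2)] lifted_star[OF E(3)] C(3,4) star_refines_mono by blast
qed

text \<open>If every covering has a member common to F and G, then the supremum of F and G, whose
  sets are those common to both, is still Cauchy; minimality makes it equal to each of them.\<close>

lemma lifted_Hausdorff: "uniform_Hausdorff minimal_Cauchy lifted_uniformity"
  unfolding uniform_Hausdorff_def
proof (intro ballI impI)
  fix F G assume FG: "F \<in> minimal_Cauchy" "G \<in> minimal_Cauchy" "F \<noteq> G"
  show "\<exists>C\<in>lifted_uniformity. \<forall>U\<in>C. \<not> (F \<in> U \<and> G \<in> U)"
  proof (rule ccontr)
    assume n: "\<not> ?thesis"
    have "\<exists>U\<in>C. eventually (\<lambda>x. x \<in> U) F \<and> eventually (\<lambda>x. x \<in> U) G" if "C \<in> \<C>" for C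
    proof -
      have "lifted ` C \<in> lifted_uniformity" using \<open>C \<in> \<C>\<close> by (rule lifted_mem)
      then obtain U where "U \<in> lifted ` C" "F \<in> U" "G \<in> U" using n by meson
      then show ?thesis unfolding lifted_def by blast
    qed
    then have "uniform_Cauchy \<C> (sup F G)"
      unfolding uniform_Cauchy_def eventually_sup by blast
    moreover have "sup F G \<noteq> bot" "sup F G \<le> principal X"
      using FG unfolding minimal_Cauchy_def by auto
    ultimately have "sup F G = F" "sup F G = G"
      using FG unfolding minimal_Cauchy_def by auto
    then show False using FG(3) by simp
  qed
qed

text \<open>A Cauchy filter of filters is condensed into one filter G on X: a property holds along G
  when it holds along most of the given filters. G is Cauchy on X, and the minimal Cauchy filter
  \<open>roundf G\<close> is the limit.\<close>

lemma lifted_complete: "uniform_complete minimal_Cauchy lifted_uniformity"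
  unfolding uniform_complete_def
proof (intro allI impI, elim conjE)
  fix \<F> assume F: "\<F> \<noteq> bot" "\<F> \<le> principal minimal_Cauchy" "uniform_Cauchy lifted_uniformity \<F>"
  interpret H: cover_uniform minimal_Cauchy lifted_uniformity
    using lifted_uniform lifted_mem ne by unfold_locales auto
  define G where "G = Abs_filter (\<lambda>P. eventually (\<lambda>F. eventually P F) \<F>)"
  have ev: "eventually P G \<longleftrightarrow> eventually (\<lambda>F. eventually P F) \<F>" for P
    unfolding G_def
  proof (rule eventually_Abs_filter, rule is_filter.intro)
    show "eventually (\<lambda>F. eventually (\<lambda>x. True) F) \<F>"
      by (simp only: eventually_True)
    show "eventually (eventually (\<lambda>x. P x \<and> Q x)) \<F>"
      if "eventually (eventually P) \<F>" "eventually (eventually Q) \<F>" for P Q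
      using that by eventually_elim (rule eventually_conj)
    show "eventually (eventually Q) \<F>"
      if "\<forall>x. P x \<longrightarrow> Q x" "eventually (eventually P) \<F>" for P Q
      using that(2) by eventually_elim (use that(1) in \<open>auto elim: eventually_mono\<close>)
  qed
  have inY: "eventually (\<lambda>F. F \<in> minimal_Cauchy) \<F>" using F(2) by (simp add: le_principal)
  have "G \<noteq> bot"
  proof
    assume "G = bot"
    then have "eventually (\<lambda>x. False) G" by simp
    with inY have "eventually (\<lambda>F. F \<in> minimal_Cauchy \<and> eventually (\<lambda>x. False) F) \<F>"
      unfolding ev by (rule eventually_conj)
    then have "\<exists>F. F \<in> minimal_Cauchy \<and> eventually (\<lambda>x. False) F"
      using F(1) by (rule eventually_happens'[rotated])
    then show False by (auto simp: eventually_False minimal_Cauchy_def)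
  qed
  moreover have "G \<le> principal X"
    unfolding le_principal ev using inY
    by (rule eventually_mono) (simp add: minimal_Cauchy_def le_principal)
  moreover have "uniform_Cauchy \<C> G"
    unfolding uniform_Cauchy_def
  proof
    fix C assume "C \<in> \<C>"
    then obtain U where "U \<in> C" "eventually (\<lambda>F. F \<in> lifted U) \<F>"
      using F(3) lifted_mem unfolding uniform_Cauchy_def by blast
    then show "\<exists>U\<in>C. eventually (\<lambda>x. x \<in> U) G"
      unfolding ev by (auto simp: lifted_def elim!: eventually_mono)
  qed
  ultimately have m: "roundf G \<in> minimal_Cauchy" "G \<le> roundf G" by (rule roundf_minimal)+
  have "limitin (uniform_topology minimal_Cauchy lifted_uniformity) (\<lambda>x. x) (roundf G) \<F>"
    unfolding limitin_def H.topspace_uniform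
  proof (intro conjI allI impI, fact m(1), elim conjE)
    fix O1 assume O1: "openin (uniform_topology minimal_Cauchy lifted_uniformity) O1" "roundf G \<in> O1"
    then obtain D where D: "D \<in> lifted_uniformity" "H.star (roundf G) D \<subseteq> O1"
      unfolding H.openin_iff by blast
    obtain C where C: "C \<in> \<C>" "refines (lifted ` C) D" using D(1) unfolding lifted_uniformity_def by blast
    obtain U where U: "U \<in> C" "eventually (\<lambda>x. x \<in> U) (roundf G)"
      using m(1) C(1) unfolding minimal_Cauchy_def uniform_Cauchy_def by blast
    obtain V where V: "V \<in> D" "lifted U \<subseteq> V" using C(2) U(1) unfolding refines_def by blast
    have "roundf G \<in> lifted U" using U(2) m(1) unfolding lifted_def by blast
    then have "lifted U \<subseteq> O1" using V D(2) unfolding H.star_def by blast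
    moreover have "eventually (\<lambda>F. F \<in> lifted U) \<F>"
    proof -
      have "eventually (\<lambda>F. eventually (\<lambda>x. x \<in> U) F) \<F>"
        using filter_leD[OF m(2) U(2)] unfolding ev .
      with inY show ?thesis by eventually_elim (simp add: lifted_def)
    qed
    ultimately show "eventually (\<lambda>x. x \<in> O1) \<F>" by (auto elim: eventually_mono)
  qed
  then show "\<exists>l. limitin (uniform_topology minimal_Cauchy lifted_uniformity) (\<lambda>x. x) l \<F>" ..
qed

text \<open>The neighbourhood filter of x, as the minimal Cauchy filter inside the principal filter
  at x.\<close>

definition nbhd :: "'x \<Rightarrow> 'x filter" where "nbhd x = roundf (principal {x})"

lemma eventually_nbhd: "eventually P (nbhd x) \<longleftrightarrow> (\<exists>C\<in>\<C>. \<forall>y\<in>star x C. P y)"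
  unfolding nbhd_def eventually_roundf starf_def star_def by (simp add: eventually_principal)

lemma nbhd_mem: "x \<in> X \<Longrightarrow> nbhd x \<in> minimal_Cauchy"
  unfolding nbhd_def
proof (rule roundf_minimal(1))
  assume x: "x \<in> X"
  show "principal {x} \<noteq> bot" by (simp add: principal_eq_bot_iff)
  show "principal {x} \<le> principal X" using x by simp
  show "uniform_Cauchy \<C> (principal {x})"
    unfolding uniform_Cauchy_def eventually_principal using covering_ex x by blast
qed

lemma nbhd_self: "x \<in> X \<Longrightarrow> eventually (\<lambda>y. y \<in> U) (nbhd x) \<Longrightarrow> x \<in> U"
  unfolding eventually_nbhd using star_mem by blast

lemma completion_exists:
  assumes "uniform_Hausdorff X \<C>"
  shows "is_completion X \<C> minimal_Cauchy lifted_uniformity nbhd"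
  unfolding is_completion_def
proof (intro conjI lifted_uniform lifted_Hausdorff lifted_complete)
  interpret H: cover_uniform minimal_Cauchy lifted_uniformity
    using lifted_uniform lifted_mem ne by unfold_locales auto
  show "inj_on nbhd X"
  proof (rule inj_onI, rule ccontr)
    fix x y assume xy: "x \<in> X" "y \<in> X" "nbhd x = nbhd y" "x \<noteq> y"
    then obtain C where C: "C \<in> \<C>" "\<forall>U\<in>C. \<not> (x \<in> U \<and> y \<in> U)"
      using assms unfolding uniform_Hausdorff_def by blast
    have "uniform_Cauchy \<C> (nbhd x)" using nbhd_mem[OF xy(1)] unfolding minimal_Cauchy_def by blast
    then obtain U where "U \<in> C" "eventually (\<lambda>z. z \<in> U) (nbhd x)"
      using C(1) unfolding uniform_Cauchy_def by blast
    then show False using C(2) nbhd_self xy by metis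
  qed
  show im: "nbhd ` X \<subseteq> minimal_Cauchy" using nbhd_mem by blast
  show "uniform_topology minimal_Cauchy lifted_uniformity closure_of (nbhd ` X) = minimal_Cauchy"
  proof (rule antisym)
    show "uniform_topology minimal_Cauchy lifted_uniformity closure_of nbhd ` X \<subseteq> minimal_Cauchy"
      using closure_of_subset_topspace H.topspace_uniform by metis
    show "minimal_Cauchy \<subseteq> uniform_topology minimal_Cauchy lifted_uniformity closure_of nbhd ` X"
    proof
      fix F assume F: "F \<in> minimal_Cauchy"
      show "F \<in> uniform_topology minimal_Cauchy lifted_uniformity closure_of nbhd ` X"
        unfolding in_closure_of H.topspace_uniform
      proof (intro conjI allI impI, fact F, elim conjE)
        fix O1 assume O1: "F \<in> O1" "openin (uniform_topology minimal_Cauchy lifted_uniformity) O1"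
        then obtain D where D: "D \<in> lifted_uniformity" "H.star F D \<subseteq> O1"
          unfolding H.openin_iff by blast
        obtain C where C: "C \<in> \<C>" "refines (lifted ` C) D" using D(1) unfolding lifted_uniformity_def by blast
        obtain C' where C': "C' \<in> \<C>" "star_refines C' C" using star_ref2[OF C(1) C(1)] by blast
        obtain U where U: "U \<in> C'" "eventually (\<lambda>x. x \<in> U) F"
          using F C'(1) unfolding minimal_Cauchy_def uniform_Cauchy_def by blast
        obtain x where x: "x \<in> U"
          using U(2) F unfolding minimal_Cauchy_def
          by (auto dest: eventually_happens')
        have xX: "x \<in> X" using covering_sub[OF C'(1) U(1)] x by blast
        obtain V where V: "V \<in> C" "\<And>W'. W' \<in> C' \<Longrightarrow> W' \<inter> U \<noteq> {} \<Longrightarrow> W' \<subseteq> V"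
          by (rule star_refinesD[OF C'(2) U(1)]) blast
        have "nbhd x \<in> lifted V"
          unfolding lifted_def mem_Collect_eq eventually_nbhd star_def
          using nbhd_mem[OF xX] V(2) C'(1) x by blast
        moreover have "F \<in> lifted V"
        proof -
          have "U \<subseteq> V" using V(2)[OF U(1)] x by blast
          then show ?thesis using U(2) F unfolding lifted_def by (auto elim: eventually_mono)
        qed
        moreover obtain V' where "V' \<in> D" "lifted V \<subseteq> V'" using C(2) V(1) unfolding refines_def by blast
        ultimately have "nbhd x \<in> H.star F D" unfolding H.star_def by blast
        then show "\<exists>y. y \<in> nbhd ` X \<and> y \<in> O1" using D(2) xX by blast
      qed
    qed
  qed
  show "induced_uniformity X nbhd lifted_uniformity = \<C>"
  proof (rule antisym; rule subsetI)
    fix C assume "C \<in> induced_uniformity X nbhd lifted_uniformity"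
    then obtain D where C: "covering X C" and D: "D \<in> lifted_uniformity"
      and r: "refines ((\<lambda>U. {x\<in>X. nbhd x \<in> U}) ` D) C"
      unfolding induced_uniformity_def by blast
    obtain C0 where C0: "C0 \<in> \<C>" "refines (lifted ` C0) D" using D unfolding lifted_uniformity_def by blast
    \<comment> \<open>For \<open>nbhd x\<close> to lie in \<open>lifted V\<close>, the set V must be
      a neighbourhood of x and not merely contain it. Passing to a star-refinement provides this for
      all x in a member of \<open>C1\<close> at once.\<close>
    obtain C1 where C1: "C1 \<in> \<C>" "star_refines C1 C0" using star_ref2[OF C0(1) C0(1)] by blast
    have "refines C1 C"
      unfolding refines_def
    proof
      fix W assume W: "W \<in> C1"
      obtain V where V: "V \<in> C0" "\<And>W'. W' \<in> C1 \<Longrightarrow> W' \<inter> W \<noteq> {} \<Longrightarrow> W' \<subseteq> V"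
        by (rule star_refinesD[OF C1(2) W]) blast
      have "nbhd x \<in> lifted V" if "x \<in> W" for x
        using covering_sub[OF C1(1) W] nbhd_mem[of x] that V(2) C1(1)
        unfolding lifted_def mem_Collect_eq eventually_nbhd star_def by blast
      moreover obtain V' where "V' \<in> D" "lifted V \<subseteq> V'" using C0(2) V(1) unfolding refines_def by blast
      moreover obtain Z where "Z \<in> C" "{x\<in>X. nbhd x \<in> V'} \<subseteq> Z"
        using r \<open>V' \<in> D\<close> unfolding refines_def by blast
      ultimately show "\<exists>V\<in>C. W \<subseteq> V" using covering_sub[OF C1(1) W] by blast
    qed
    then show "C \<in> \<C>" using coverings_mono[OF C1(1)] C unfolding covering_def by blast
  next
    fix C assume C: "C \<in> \<C>"
    have "refines ((\<lambda>U. {x\<in>X. nbhd x \<in> U}) ` lifted ` C) C"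
      unfolding refines_def using nbhd_self unfolding lifted_def by blast
    then show "C \<in> induced_uniformity X nbhd lifted_uniformity"
      unfolding induced_uniformity_def using Union_covering[OF C] lifted_mem[OF C]
      by (auto simp: covering_def)
  qed
qed

end

section \<open>The topology of an arbitrary completion\<close>

locale completed = cover_uniform X \<C> for X :: "'x set" and \<C> +
  fixes Y :: "'y set" and \<D> :: "'y set set set" and \<iota> :: "'x \<Rightarrow> 'y"
  assumes cmp: "is_completion X \<C> Y \<D> \<iota>"
begin

lemma traceD: "D \<in> \<D> \<Longrightarrow> (\<lambda>U. {x\<in>X. \<iota> x \<in> U}) ` D \<in> \<C>"
proof -
  assume D: "D \<in> \<D>"
  have "uniform_structure Y \<D>" "\<iota> ` X \<subseteq> Y" using cmp
    unfolding is_completion_def by simp_all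
  then have "\<iota> ` X \<subseteq> \<Union>D" using D
    by (simp add: uniform_structure_def covering_def)
  then have "covering X ((\<lambda>U. {x\<in>X. \<iota> x \<in> U}) ` D)" unfolding covering_def by blast
  then have "(\<lambda>U. {x\<in>X. \<iota> x \<in> U}) ` D \<in> induced_uniformity X \<iota> \<D>"
    unfolding induced_uniformity_def refines_def using D by blast
  then show ?thesis using cmp unfolding is_completion_def by simp
qed

lemma D_ne: "\<D> \<noteq> {}"
  using cmp ne unfolding is_completion_def induced_uniformity_def by blast

sublocale Y: cover_uniform Y \<D>
proof
  show "uniform_structure Y \<D>" using cmp unfolding is_completion_def by (rule conjunct1)
qed (rule D_ne)

lemma dense: "y \<in> Y \<Longrightarrow> D \<in> \<D> \<Longrightarrow> \<exists>x\<in>X. \<iota> x \<in> Y.star y D"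
proof -
  assume y: "y \<in> Y" and D: "D \<in> \<D>"
  obtain P where P: "openin (uniform_topology Y \<D>) P" "y \<in> P" "P \<subseteq> Y.star y D"
    using Y.star_contains_open[OF D y] by blast
  have "y \<in> uniform_topology Y \<D> closure_of (\<iota> ` X)"
    using cmp y unfolding is_completion_def by simp
  then show ?thesis using P unfolding in_closure_of by blast
qed

text \<open>Finitely many members of a star-refinement E of D have traces covering X. Each is
  enlarged to a member of D that contains everything in E meeting it. By density any y lies in a
  member of E that also contains a point of X, and so meets one of the finitely many sets.\<close>

lemma completion_totally_bounded:
  assumes "uniform_totally_bounded X \<C>"
  shows "uniform_totally_bounded Y \<D>"
  unfolding uniform_totally_bounded_def
proof
  fix D assume D: "D \<in> \<D>"
  obtain E where E: "E \<in> \<D>" "star_refines E D" using Y.star_ref2[OF D D] by blast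
  obtain T where T: "T \<subseteq> (\<lambda>U. {x\<in>X. \<iota> x \<in> U}) ` E" "finite T" "\<Union>T = X"
    using bspec[OF assms[unfolded uniform_totally_bounded_def] traceD[OF E(1)]]
    by (elim exE conjE) (simp add: covering_def)
  obtain E' where E': "E' \<subseteq> E" "finite E'" "T = (\<lambda>U. {x\<in>X. \<iota> x \<in> U}) ` E'"
    using finite_subset_image[OF T(2,1)] by blast
  have "\<forall>U\<in>E'. \<exists>V\<in>D. \<forall>W\<in>E. W \<inter> U \<noteq> {} \<longrightarrow> W \<subseteq> V"
  proof
    fix U assume "U \<in> E'"
    then have "U \<in> E" using E'(1) by blast
    then show "\<exists>V\<in>D. \<forall>W\<in>E. W \<inter> U \<noteq> {} \<longrightarrow> W \<subseteq> V"
      by (rule Y.star_refinesD[OF E(2)]) blast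
  qed
  then obtain f where f: "\<And>U. U \<in> E' \<Longrightarrow> f U \<in> D"
    "\<And>U W. U \<in> E' \<Longrightarrow> W \<in> E \<Longrightarrow> W \<inter> U \<noteq> {} \<Longrightarrow> W \<subseteq> f U" by metis
  have "y \<in> \<Union>(f ` E')" if "y \<in> Y" for y
  proof -
    obtain x where x: "x \<in> X" "\<iota> x \<in> Y.star y E" using dense[OF \<open>y \<in> Y\<close> E(1)] by blast
    then obtain U where U: "U \<in> E'" "\<iota> x \<in> U" using T(3) E'(3) by blast
    obtain W where "W \<in> E" "y \<in> W" "\<iota> x \<in> W" using x(2) unfolding Y.star_def by blast
    then have "y \<in> f U" using f(2)[OF U(1)] U(2) by blast
    then show ?thesis using U(1) by blast
  qed
  moreover have "f ` E' \<subseteq> D" using f(1) by blast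
  moreover have "\<Union>(f ` E') \<subseteq> Y" using f(1) Y.covering_sub[OF D] by blast
  ultimately show "\<exists>D'\<subseteq>D. finite D' \<and> covering Y D'"
    unfolding covering_def using E'(2) by (intro exI[of _ "f ` E'"]) auto
qed

text \<open>The witness is the largest open V with trace inside U. The induced uniformity supplies,
  around each x in U, a star in Y with trace inside U, and this star contains an open neighbourhood
  of the image of x.\<close>

lemma openin_trace:
  "openin (uniform_topology X \<C>) U \<longleftrightarrow> (\<exists>V. openin (uniform_topology Y \<D>) V \<and> U = {x\<in>X. \<iota> x \<in> V})"
proof
  assume U: "openin (uniform_topology X \<C>) U"
  define V where "V = \<Union>{V. openin (uniform_topology Y \<D>) V \<and> {x\<in>X. \<iota> x \<in> V} \<subseteq> U}"
  have "openin (uniform_topology Y \<D>) V" unfolding V_def by (rule openin_Union) simp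
  moreover have "U = {x\<in>X. \<iota> x \<in> V}"
  proof
    show "{x\<in>X. \<iota> x \<in> V} \<subseteq> U" unfolding V_def by blast
    show "U \<subseteq> {x\<in>X. \<iota> x \<in> V}"
    proof
      fix x assume x: "x \<in> U"
      obtain C where C: "C \<in> \<C>" "star x C \<subseteq> U" "x \<in> X" using U x unfolding openin_iff by blast
      have "C \<in> induced_uniformity X \<iota> \<D>" using cmp C(1) unfolding is_completion_def by simp
      then obtain D where D: "D \<in> \<D>" "refines ((\<lambda>U. {x\<in>X. \<iota> x \<in> U}) ` D) C"
        unfolding induced_uniformity_def by blast
      have iY: "\<iota> x \<in> Y" using cmp C(3) unfolding is_completion_def by blast
      obtain P where P: "openin (uniform_topology Y \<D>) P" "\<iota> x \<in> P" "P \<subseteq> Y.star (\<iota> x) D"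
        using Y.star_contains_open[OF D(1) iY] by blast
      have "z \<in> U" if z: "z \<in> X" "\<iota> z \<in> P" for z
      proof -
        obtain W where W: "W \<in> D" "\<iota> x \<in> W" "\<iota> z \<in> W" using P(3) z unfolding Y.star_def by blast
        obtain Q where "Q \<in> C" "{x\<in>X. \<iota> x \<in> W} \<subseteq> Q" using D(2) W(1) unfolding refines_def by blast
        then show ?thesis using W z C(2,3) unfolding star_def by blast
      qed
      then have "P \<subseteq> V" unfolding V_def using P(1) by blast
      then show "x \<in> {x\<in>X. \<iota> x \<in> V}" using P(2) C(3) by blast
    qed
  qed
  ultimately show "\<exists>V. openin (uniform_topology Y \<D>) V \<and> U = {x\<in>X. \<iota> x \<in> V}" by blast
next
  assume "\<exists>V. openin (uniform_topology Y \<D>) V \<and> U = {x\<in>X. \<iota> x \<in> V}"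
  then obtain V where V: "openin (uniform_topology Y \<D>) V" "U = {x\<in>X. \<iota> x \<in> V}" by blast
  show "openin (uniform_topology X \<C>) U"
    unfolding openin_iff
  proof (intro conjI ballI)
    show "U \<subseteq> X" using V(2) by blast
    fix x assume x: "x \<in> U"
    then obtain D where D: "D \<in> \<D>" "Y.star (\<iota> x) D \<subseteq> V" using V unfolding Y.openin_iff by blast
    have "star x ((\<lambda>U. {x\<in>X. \<iota> x \<in> U}) ` D) \<subseteq> U"
      unfolding V(2) star_def using D(2) unfolding Y.star_def by blast
    then show "\<exists>C\<in>\<C>. star x C \<subseteq> U" using traceD[OF D(1)] by blast
  qed
qed

lemma completion_embedding: "embedding_map (uniform_topology X \<C>) (uniform_topology Y \<D>) \<iota>"
proof -
  have inj: "inj_on \<iota> X" and im: "\<iota> ` X \<subseteq> Y" using cmp unfolding is_completion_def by blast+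
  have tops: "topspace (subtopology (uniform_topology Y \<D>) (\<iota> ` X)) = \<iota> ` X"
    using im Y.topspace_uniform by auto
  have "quotient_map (uniform_topology X \<C>) (subtopology (uniform_topology Y \<D>) (\<iota> ` X)) \<iota>"
    unfolding quotient_map_def topspace_uniform tops
  proof (intro conjI allI impI refl)
    fix U assume U: "U \<subseteq> \<iota> ` X"
    have "U = V \<inter> \<iota> ` X \<longleftrightarrow> {x \<in> X. \<iota> x \<in> U} = {x\<in>X. \<iota> x \<in> V}" for V using U by blast
    then show "openin (uniform_topology X \<C>) {x \<in> X. \<iota> x \<in> U} =
         openin (subtopology (uniform_topology Y \<D>) (\<iota> ` X)) U"
      unfolding openin_trace openin_subtopology by blast
  qed
  then show ?thesis
    unfolding embedding_map_def topspace_uniform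
    using inj by (simp add: homeomorphic_map_def topspace_uniform)
qed

lemma completion_properties:
  assumes "uniform_totally_bounded X \<C>"
  shows "topspace (uniform_topology Y \<D>) = Y"
    "compact_space (uniform_topology Y \<D>)"
    "Hausdorff_space (uniform_topology Y \<D>)"
    "embedding_map (uniform_topology X \<C>) (uniform_topology Y \<D>) \<iota>"
    "uniform_topology Y \<D> closure_of (\<iota> ` X) = Y"
proof -
  have "uniform_complete Y \<D>" "uniform_Hausdorff Y \<D>"
    and cl: "uniform_topology Y \<D> closure_of (\<iota> ` X) = Y"
    using cmp unfolding is_completion_def by simp_all
  then show "compact_space (uniform_topology Y \<D>)" "Hausdorff_space (uniform_topology Y \<D>)"
    using Y.compact_uniform completion_totally_bounded[OF assms] Y.Hausdorff_uniform by simp_all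
  show "uniform_topology Y \<D> closure_of (\<iota> ` X) = Y" by (rule cl)
qed (rule Y.topspace_uniform completion_embedding)+

end

section \<open>Coverings by open Laurent domains\<close>

lemma finite_positive_lower_bound:
  fixes e :: "'a \<Rightarrow> real"
  assumes "finite A" "\<And>c. c \<in> A \<Longrightarrow> 0 < e c"
  shows "\<exists>\<epsilon>>0. \<forall>c\<in>A. \<epsilon> \<le> e c"
proof (cases "A = {}")
  case True then show ?thesis by (intro exI[of _ 1]) simp
next
  case False
  then show ?thesis using assms by (intro exI[of _ "Min (e ` A)"]) (simp add: Min_gr_iff)
qed

text \<open>Kept free of assumptions so that the assumption \<open>relax\<close> of
  \<open>laurent_space\<close> can be phrased in terms of \<open>conds\<close>, \<open>sat\<close>
  and \<open>ncdom\<close>.\<close>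

locale laurent_data =
  fixes X :: "'x set" and Fs :: "'f set" and val :: "'f \<Rightarrow> 'x \<Rightarrow> real" and S :: "real set"
begin

text \<open>A triple \<open>(\<sigma>, f, \<alpha>)\<close> stands for the condition \<open>|f| < \<alpha>\<close> if \<open>\<sigma> = 1\<close> and for
  \<open>|f| > \<alpha>\<close> if \<open>\<sigma> = -1\<close>.\<close>

fun sat :: "real \<times> 'f \<times> real \<Rightarrow> 'x \<Rightarrow> bool" where
  "sat (\<sigma>, f, \<alpha>) x \<longleftrightarrow> \<sigma> * val f x < \<sigma> * \<alpha>"

definition conds :: "(real \<times> 'f \<times> real) set" where "conds = {1, -1} \<times> Fs \<times> S"

definition cdom :: "(real \<times> 'f \<times> real) set \<Rightarrow> 'x set" where
  "cdom Cs = {x \<in> X. \<forall>c\<in>Cs. sat c x}"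

definition ncdom :: "(real \<times> 'f \<times> real) set \<Rightarrow> 'x set" where
  "ncdom Cs = {x \<in> X. \<forall>c\<in>Cs. \<not> sat c x}"

definition LD :: "'x set set" where
  "LD = {{x \<in> X. (\<forall>(f, \<alpha>)\<in>F. val f x < \<alpha>) \<and> (\<forall>(g, \<beta>)\<in>G. val g x > \<beta>)} | F G.
        finite F \<and> F \<subseteq> Fs \<times> S \<and> finite G \<and> G \<subseteq> Fs \<times> S}"

definition LU :: "'x set set set" where
  "LU = {D. covering X D \<and> (\<exists>C. finite C \<and> C \<subseteq> LD \<and> covering X C \<and> refines C D)}"

lemma sat1: "sat (1, c) x \<longleftrightarrow> val (fst c) x < snd c" by (cases c) simp

lemma satm: "sat (-1, c) x \<longleftrightarrow> snd c < val (fst c) x" by (cases c) simp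

lemma LD_iff: "U \<in> LD \<longleftrightarrow> (\<exists>Cs. finite Cs \<and> Cs \<subseteq> conds \<and> U = cdom Cs)"
proof
  assume "U \<in> LD"
  then obtain F G where FG: "finite F" "F \<subseteq> Fs \<times> S" "finite G" "G \<subseteq> Fs \<times> S"
    "U = {x \<in> X. (\<forall>(f, \<alpha>)\<in>F. val f x < \<alpha>) \<and> (\<forall>(g, \<beta>)\<in>G. val g x > \<beta>)}" unfolding LD_def by blast
  have "U = cdom (Pair 1 ` F \<union> Pair (-1) ` G)"
  proof -
    have "(\<forall>c\<in>Pair 1 ` F \<union> Pair (-1) ` G. sat c x) \<longleftrightarrow>
        (\<forall>(f, \<alpha>)\<in>F. val f x < \<alpha>) \<and> (\<forall>(g, \<beta>)\<in>G. val g x > \<beta>)" for x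
      unfolding ball_Un ball_simps by (simp add: split_beta sat1 satm)
    then show ?thesis unfolding FG(5) cdom_def by simp
  qed
  moreover have "Pair 1 ` F \<union> Pair (-1) ` G \<subseteq> conds" using FG unfolding conds_def by auto
  ultimately show "\<exists>Cs. finite Cs \<and> Cs \<subseteq> conds \<and> U = cdom Cs"
    using FG(1,3) by (intro exI[of _ "Pair 1 ` F \<union> Pair (-1) ` G"]) simp
next
  assume "\<exists>Cs. finite Cs \<and> Cs \<subseteq> conds \<and> U = cdom Cs"
  then obtain Cs where Cs: "finite Cs" "Cs \<subseteq> conds" "U = cdom Cs" by blast
  let ?F = "snd ` {c \<in> Cs. fst c = 1}" and ?G = "snd ` {c \<in> Cs. fst c = -1}"
  have "x \<in> U \<longleftrightarrow> x \<in> {x \<in> X. (\<forall>(f, \<alpha>)\<in>?F. val f x < \<alpha>) \<and> (\<forall>(g, \<beta>)\<in>?G. val g x > \<beta>)}" for x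
  proof -
    have "(\<forall>c\<in>Cs. sat c x) \<longleftrightarrow> (\<forall>(f, \<alpha>)\<in>?F. val f x < \<alpha>) \<and> (\<forall>(g, \<beta>)\<in>?G. val g x > \<beta>)"
    proof
      assume s: "\<forall>c\<in>Cs. sat c x"
      show "(\<forall>(f, \<alpha>)\<in>?F. val f x < \<alpha>) \<and> (\<forall>(g, \<beta>)\<in>?G. val g x > \<beta>)" using s by fastforce
    next
      assume s: "(\<forall>(f, \<alpha>)\<in>?F. val f x < \<alpha>) \<and> (\<forall>(g, \<beta>)\<in>?G. val g x > \<beta>)"
      show "\<forall>c\<in>Cs. sat c x"
      proof
        fix c assume c: "c \<in> Cs"
        obtain \<sigma> f \<alpha> where e: "c = (\<sigma>, f, \<alpha>)" by (metis prod_cases3)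
        have "\<sigma> = 1 \<or> \<sigma> = -1" using c Cs(2) unfolding e conds_def by auto
        then show "sat c x" using s c unfolding e by force
      qed
    qed
    then show ?thesis unfolding Cs(3) cdom_def by simp
  qed
  then have "U = {x \<in> X. (\<forall>(f, \<alpha>)\<in>?F. val f x < \<alpha>) \<and> (\<forall>(g, \<beta>)\<in>?G. val g x > \<beta>)}" by blast
  moreover have "finite ?F" "finite ?G" "?F \<subseteq> Fs \<times> S" "?G \<subseteq> Fs \<times> S" using Cs(1,2) unfolding conds_def by auto
  ultimately show "U \<in> LD" unfolding LD_def by blast
qed

lemma cdom_Un: "cdom (A \<union> B) = cdom A \<inter> cdom B" unfolding cdom_def by blast

lemma cdom_empty: "cdom {} = X" unfolding cdom_def by simp

lemma cdom_sub: "cdom Cs \<subseteq> X" unfolding cdom_def by blast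

lemma X_LD: "X \<in> LD" unfolding LD_iff by (intro exI[of _ "{}"]) (simp add: cdom_empty)

lemma LD_Int: "U \<in> LD \<Longrightarrow> W \<in> LD \<Longrightarrow> U \<inter> W \<in> LD"
  unfolding LD_iff by (metis cdom_Un finite_UnI Un_subset_iff)

end

text \<open>What the geometry of X has to supply. The essential point is \<open>relax\<close>: an
  empty set defined by finitely many closed conditions remains empty when one bound is moved by a
  positive amount. From this and elementary facts about the values, the uniform structure is
  obtained combinatorially.\<close>

locale laurent_space = laurent_data +
  assumes nonneg: "f \<in> Fs \<Longrightarrow> x \<in> X \<Longrightarrow> 0 \<le> val f x"
    and bounded: "f \<in> Fs \<Longrightarrow> \<exists>M. \<forall>x\<in>X. val f x \<le> M"
    and S_pos: "s \<in> S \<Longrightarrow> 0 < s"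
    and S_dense: "0 \<le> a \<Longrightarrow> a < b \<Longrightarrow> \<exists>s\<in>S. a < s \<and> s < b"
    and separating: "x \<in> X \<Longrightarrow> y \<in> X \<Longrightarrow> x \<noteq> y \<Longrightarrow> \<exists>f\<in>Fs. val f x < val f y"
    and relax: "finite Cs \<Longrightarrow> Cs \<subseteq> conds \<Longrightarrow> (\<sigma>, f, \<alpha>) \<in> conds \<Longrightarrow>
      {x \<in> ncdom Cs. \<not> sat (\<sigma>, f, \<alpha>) x} = {} \<Longrightarrow>
      \<exists>\<alpha>'\<in>S. \<sigma> * \<alpha>' < \<sigma> * \<alpha> \<and> {x \<in> ncdom Cs. \<not> sat (\<sigma>, f, \<alpha>') x} = {}"
begin

lemma relaxed_ex:
  assumes "(\<sigma>, f, \<alpha>) \<in> conds" shows "\<exists>\<alpha>'\<in>S. \<sigma> * \<alpha>' < \<sigma> * \<alpha>"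
proof -
  have a: "\<alpha> > 0" and s: "\<sigma> = 1 \<or> \<sigma> = -1" using assms S_pos unfolding conds_def by auto
  obtain b where "b \<in> S" "b < \<alpha>" using S_dense[of 0 \<alpha>] a by auto
  moreover obtain c where "c \<in> S" "c > \<alpha>" using S_dense[of \<alpha> "\<alpha> + 1"] a by auto
  ultimately show ?thesis using s by force
qed

text \<open>A closed condition set covered by open ones stays covered when one bound is relaxed a little:
  split according to which condition of the first open set fails, and use \<open>relax\<close> at the end.\<close>

lemma relax_covering:
  "finite P \<Longrightarrow> (\<And>Cs. Cs \<in> P \<Longrightarrow> finite Cs \<and> Cs \<subseteq> conds) \<Longrightarrow> finite C \<Longrightarrow> C \<subseteq> conds \<Longrightarrow>
    (\<sigma>, f, \<alpha>) \<in> conds \<Longrightarrow> {x \<in> ncdom C. \<not> sat (\<sigma>, f, \<alpha>) x} \<subseteq> \<Union>(cdom ` P) \<Longrightarrow>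
    \<exists>\<alpha>'\<in>S. \<sigma> * \<alpha>' < \<sigma> * \<alpha> \<and> {x \<in> ncdom C. \<not> sat (\<sigma>, f, \<alpha>') x} \<subseteq> \<Union>(cdom ` P)"
proof (induction P arbitrary: C rule: finite_induct)
  case empty
  then have "{x \<in> ncdom C. \<not> sat (\<sigma>, f, \<alpha>) x} = {}" by auto
  then show ?case using relax[OF empty.prems(2-4)] by auto
next
  case (insert Cs P)
  have Cs: "finite Cs" "Cs \<subseteq> conds" using insert.prems(1) by auto
  have "\<exists>\<alpha>'\<in>S. \<sigma> * \<alpha>' < \<sigma> * \<alpha> \<and> {x \<in> ncdom (insert c C). \<not> sat (\<sigma>, f, \<alpha>') x} \<subseteq> \<Union>(cdom ` P)"
    if c: "c \<in> Cs" for c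
  proof (rule insert.IH)
    show "{x \<in> ncdom (insert c C). \<not> sat (\<sigma>, f, \<alpha>) x} \<subseteq> \<Union>(cdom ` P)"
    proof
      fix x assume x: "x \<in> {x \<in> ncdom (insert c C). \<not> sat (\<sigma>, f, \<alpha>) x}"
      then have "x \<in> {x \<in> ncdom C. \<not> sat (\<sigma>, f, \<alpha>) x}" "x \<notin> cdom Cs"
        using c unfolding ncdom_def cdom_def by auto
      then show "x \<in> \<Union>(cdom ` P)" using insert.prems(5) by blast
    qed
  qed (use insert.prems c Cs in auto)
  then have "\<forall>c\<in>Cs. \<exists>\<alpha>'. \<alpha>' \<in> S \<and> \<sigma> * \<alpha>' < \<sigma> * \<alpha> \<and>
      {x \<in> ncdom (insert c C). \<not> sat (\<sigma>, f, \<alpha>') x} \<subseteq> \<Union>(cdom ` P)" by blast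
  from bchoice[OF this] obtain A where "\<forall>c\<in>Cs. A c \<in> S \<and> \<sigma> * A c < \<sigma> * \<alpha> \<and>
      {x \<in> ncdom (insert c C). \<not> sat (\<sigma>, f, A c) x} \<subseteq> \<Union>(cdom ` P)" ..
  then have A: "\<And>c. c \<in> Cs \<Longrightarrow> A c \<in> S" "\<And>c. c \<in> Cs \<Longrightarrow> \<sigma> * A c < \<sigma> * \<alpha>"
    "\<And>c. c \<in> Cs \<Longrightarrow> {x \<in> ncdom (insert c C). \<not> sat (\<sigma>, f, A c) x} \<subseteq> \<Union>(cdom ` P)" by (simp_all del: sat.simps)
  \<comment> \<open>The bound nearest to \<alpha> among the \<open>A c\<close> serves all c at once.
    If \<open>Cs\<close> is empty, \<open>cdom Cs\<close> is all of X and any relaxed bound will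
    do.\<close>
  have "\<exists>\<alpha>'\<in>S. \<sigma> * \<alpha>' < \<sigma> * \<alpha> \<and> (\<forall>c\<in>Cs. \<sigma> * A c \<le> \<sigma> * \<alpha>')"
  proof (cases "Cs = {}")
    case True then show ?thesis using relaxed_ex[OF insert.prems(4)] by auto
  next
    case False
    let ?M = "Max ((\<lambda>c. \<sigma> * A c) ` Cs)"
    have "?M \<in> (\<lambda>c. \<sigma> * A c) ` Cs" using False Cs(1) by (intro Max_in) auto
    then obtain c where c: "?M = \<sigma> * A c" "c \<in> Cs" by (rule imageE)
    have "\<sigma> * A d \<le> \<sigma> * A c" if "d \<in> Cs" for d unfolding c(1)[symmetric] using that Cs(1) by (intro Max_ge) auto
    then show ?thesis using A(1,2)[OF c(2)] by blast
  qed
  then obtain \<alpha>' where a: "\<alpha>' \<in> S" "\<sigma> * \<alpha>' < \<sigma> * \<alpha>" "\<And>c. c \<in> Cs \<Longrightarrow> \<sigma> * A c \<le> \<sigma> * \<alpha>'" by blast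
  have "{x \<in> ncdom C. \<not> sat (\<sigma>, f, \<alpha>') x} \<subseteq> \<Union>(cdom ` insert Cs P)"
  proof
    fix x assume x: "x \<in> {x \<in> ncdom C. \<not> sat (\<sigma>, f, \<alpha>') x}"
    show "x \<in> \<Union>(cdom ` insert Cs P)"
    proof (cases "x \<in> cdom Cs")
      case True then show ?thesis by simp
    next
      case False
      then obtain c where c: "c \<in> Cs" "\<not> sat c x" using x unfolding cdom_def ncdom_def by blast
      have "\<not> sat (\<sigma>, f, A c) x" using x a(3)[OF c(1)] by simp
      then have "x \<in> {x \<in> ncdom (insert c C). \<not> sat (\<sigma>, f, A c) x}" using x c(2) unfolding ncdom_def by simp
      then show ?thesis using A(3)[OF c(1)] by blast
    qed
  qed
  then show ?case using a(1,2) by blast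
qed

definition inside :: "real \<Rightarrow> (real \<times> 'b \<times> real) set \<Rightarrow> 'a \<Rightarrow> bool" where
  "inside \<epsilon> Cs x \<longleftrightarrow> (\<forall>(\<sigma>, f, \<alpha>)\<in>Cs. \<sigma> * val f x < \<sigma> * \<alpha> - \<epsilon>)"

lemma inside_mono: "inside \<epsilon> Cs x \<Longrightarrow> \<delta> \<le> \<epsilon> \<Longrightarrow> inside \<delta> Cs x"
  unfolding inside_def by fastforce

text \<open>Where a condition c of the first open set fails, the others cover, and by
  \<open>relax_covering\<close> they still cover where a slightly tightened form of c fails. There
  the induction hypothesis gives a margin, the failure of the tightened condition being added to C.
  Elsewhere all tightened conditions hold, so the original ones hold with the amounts of tightening
  as margin.\<close>

lemma covering_margin:
  "finite P \<Longrightarrow> (\<And>Cs. Cs \<in> P \<Longrightarrow> finite Cs \<and> Cs \<subseteq> conds) \<Longrightarrow> finite C \<Longrightarrow> C \<subseteq> conds \<Longrightarrow>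
    ncdom C \<subseteq> \<Union>(cdom ` P) \<Longrightarrow> \<exists>\<epsilon>>0. \<forall>x\<in>ncdom C. \<exists>Cs\<in>P. inside \<epsilon> Cs x"
proof (induction P arbitrary: C rule: finite_induct)
  case empty then show ?case by (intro exI[of _ 1]) auto
next
  case (insert Cs P)
  have Cs: "finite Cs" "Cs \<subseteq> conds" using insert.prems(1) by auto
  have ex: "\<exists>\<epsilon>>0. \<exists>\<alpha>'. \<epsilon> \<le> fst c * snd (snd c) - fst c * \<alpha>' \<and>
      (\<forall>x\<in>ncdom C. \<not> sat (fst c, fst (snd c), \<alpha>') x \<longrightarrow> (\<exists>Cs\<in>P. inside \<epsilon> Cs x))" if c: "c \<in> Cs" for c
  proof -
    obtain \<sigma> f \<alpha> where e: "c = (\<sigma>, f, \<alpha>)" by (metis prod_cases3)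
    have cc: "(\<sigma>, f, \<alpha>) \<in> conds" using c Cs(2) e by blast
    have "{x \<in> ncdom C. \<not> sat (\<sigma>, f, \<alpha>) x} \<subseteq> \<Union>(cdom ` P)"
    proof
      fix x assume x: "x \<in> {x \<in> ncdom C. \<not> sat (\<sigma>, f, \<alpha>) x}"
      then have "x \<notin> cdom Cs" using c e unfolding cdom_def by blast
      then show "x \<in> \<Union>(cdom ` P)" using x insert.prems(4) by blast
    qed
    then obtain \<alpha>' where a: "\<alpha>' \<in> S" "\<sigma> * \<alpha>' < \<sigma> * \<alpha>"
      "{x \<in> ncdom C. \<not> sat (\<sigma>, f, \<alpha>') x} \<subseteq> \<Union>(cdom ` P)"
      using relax_covering[OF insert.hyps(1) _ insert.prems(2,3) cc] insert.prems(1) by auto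
    have n: "ncdom (insert (\<sigma>, f, \<alpha>') C) = {x \<in> ncdom C. \<not> sat (\<sigma>, f, \<alpha>') x}" unfolding ncdom_def by auto
    have "insert (\<sigma>, f, \<alpha>') C \<subseteq> conds" using cc a(1) insert.prems(3) unfolding conds_def by auto
    then obtain \<epsilon> where ep: "\<epsilon> > 0" "\<And>x. x \<in> ncdom C \<Longrightarrow> \<not> sat (\<sigma>, f, \<alpha>') x \<Longrightarrow> \<exists>Cs\<in>P. inside \<epsilon> Cs x"
      using insert.IH[of "insert (\<sigma>, f, \<alpha>') C"] insert.prems(1,2) a(3) unfolding n by auto
    show ?thesis
    proof (intro exI conjI)
      show "0 < min \<epsilon> (\<sigma> * \<alpha> - \<sigma> * \<alpha>')" using ep(1) a(2) by simp
      show "min \<epsilon> (\<sigma> * \<alpha> - \<sigma> * \<alpha>') \<le> fst c * snd (snd c) - fst c * \<alpha>'" unfolding e by simp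
      show "\<forall>x\<in>ncdom C. \<not> sat (fst c, fst (snd c), \<alpha>') x \<longrightarrow> (\<exists>Cs\<in>P. inside (min \<epsilon> (\<sigma> * \<alpha> - \<sigma> * \<alpha>')) Cs x)"
        unfolding e using ep(2) inside_mono min.cobounded1 by (metis fst_conv snd_conv)
    qed
  qed
  then obtain e where e: "\<And>c. c \<in> Cs \<Longrightarrow> 0 < e c"
    "\<And>c. c \<in> Cs \<Longrightarrow> \<exists>\<alpha>'. e c \<le> fst c * snd (snd c) - fst c * \<alpha>' \<and>
      (\<forall>x\<in>ncdom C. \<not> sat (fst c, fst (snd c), \<alpha>') x \<longrightarrow> (\<exists>Cs\<in>P. inside (e c) Cs x))" by metis
  obtain A where A: "\<And>c. c \<in> Cs \<Longrightarrow> e c \<le> fst c * snd (snd c) - fst c * A c"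
    "\<And>c x. c \<in> Cs \<Longrightarrow> x \<in> ncdom C \<Longrightarrow> \<not> sat (fst c, fst (snd c), A c) x \<Longrightarrow> \<exists>Cs\<in>P. inside (e c) Cs x"
    using e(2) by metis
  obtain \<epsilon> where ep: "\<epsilon> > 0" "\<And>c. c \<in> Cs \<Longrightarrow> \<epsilon> \<le> e c"
    using finite_positive_lower_bound[OF Cs(1), of e] e(1) by blast
  have "\<exists>Cs\<in>insert Cs P. inside \<epsilon> Cs x" if x: "x \<in> ncdom C" for x
  proof (cases "\<forall>c\<in>Cs. sat (fst c, fst (snd c), A c) x")
    case True
    have "inside \<epsilon> Cs x" unfolding inside_def
    proof (intro ballI, clarify)
      fix \<sigma> f \<alpha> assume c: "(\<sigma>, f, \<alpha>) \<in> Cs"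
      show "\<sigma> * val f x < \<sigma> * \<alpha> - \<epsilon>" using bspec[OF True c] A(1)[OF c] ep(2)[OF c] by simp
    qed
    then show ?thesis by blast
  next
    case False
    then obtain c where "c \<in> Cs" "\<not> sat (fst c, fst (snd c), A c) x" by blast
    then show ?thesis using A(2)[OF _ x] ep(2) inside_mono by blast
  qed
  then show ?case using ep(1) by blast
qed

section \<open>Small cells, star-refinement and the Laurent uniform structure\<close>

definition small_grid :: "real \<Rightarrow> 'b set \<Rightarrow> (real \<times> 'b \<times> real) set set \<Rightarrow> bool" where
  "small_grid \<delta> A I \<longleftrightarrow> finite I \<and> (\<forall>Cs\<in>I. finite Cs \<and> Cs \<subseteq> conds) \<and> X \<subseteq> \<Union>(cdom ` I) \<and>
    (\<forall>f\<in>A. \<forall>Cs\<in>I. \<forall>x\<in>cdom Cs. \<forall>y\<in>cdom Cs. \<bar>val f x - val f y\<bar> < \<delta>)"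

lemma small_gridD:
  assumes "small_grid \<delta> A I"
  shows "finite I" "Cs \<in> I \<Longrightarrow> finite Cs \<and> Cs \<subseteq> conds" "X \<subseteq> \<Union>(cdom ` I)"
    "f \<in> A \<Longrightarrow> Cs \<in> I \<Longrightarrow> x \<in> cdom Cs \<Longrightarrow> y \<in> cdom Cs \<Longrightarrow> \<bar>val f x - val f y\<bar> < \<delta>"
  using assms unfolding small_grid_def by simp_all

text \<open>The values of f lie in the compact interval \<open>{0..M}\<close>. Short intervals
  around its points admit a finite subcover, and their preimages are the cells.\<close>

lemma grid_one:
  assumes f: "f \<in> Fs" and d: "\<delta> > 0"
  shows "\<exists>I. small_grid \<delta> {f} I"
proof -
  obtain M where M: "\<And>x. x \<in> X \<Longrightarrow> val f x \<le> M" using bounded[OF f] by blast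
  have "\<exists>a b Cs. a < t \<and> t < b \<and> b - a < \<delta> \<and> finite Cs \<and> Cs \<subseteq> conds \<and>
      (\<forall>x\<in>X. (\<forall>c\<in>Cs. sat c x) \<longleftrightarrow> a < val f x \<and> val f x < b)" if t: "t \<in> {0..M}" for t
  proof -
    obtain b where b: "b \<in> S" "t < b" "b < t + \<delta> / 2" using S_dense[of t "t + \<delta> / 2"] t d by auto
    show ?thesis
    proof (cases "t = 0")
      \<comment> \<open>S contains only positive numbers, so near 0 only the upper bound is imposed.
        The lower endpoint -\<delta>/4 is nominal: it holds automatically for a nonnegative
        value.\<close>
      case True
      have "(\<forall>c\<in>{(1, f, b)}. sat c x) \<longleftrightarrow> - (\<delta> / 4) < val f x \<and> val f x < b" if "x \<in> X" for x
        using nonneg[OF f that] d by auto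
      moreover have "{(1, f, b)} \<subseteq> conds" using f b unfolding conds_def by simp
      ultimately show ?thesis using True b d
        by (intro exI[of _ "- (\<delta> / 4)"] exI[of _ b] exI[of _ "{(1, f, b)}"]) auto
    next
      case False
      then obtain a where a: "a \<in> S" "max 0 (t - \<delta> / 2) < a" "a < t"
        using S_dense[of "max 0 (t - \<delta> / 2)" t] t d by auto
      have "(\<forall>c\<in>{(1, f, b), (-1, f, a)}. sat c x) \<longleftrightarrow> a < val f x \<and> val f x < b" for x by auto
      moreover have "{(1, f, b), (-1, f, a)} \<subseteq> conds" using f a b unfolding conds_def by simp
      moreover have "b - a < \<delta>" using a b by simp
      ultimately show ?thesis using a b
        by (intro exI[of _ a] exI[of _ b] exI[of _ "{(1, f, b), (-1, f, a)}"]) simp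
    qed
  qed
  then have "\<exists>a b Cs. \<forall>t\<in>{0..M}. a t < t \<and> t < b t \<and> b t - a t < \<delta> \<and> finite (Cs t) \<and> Cs t \<subseteq> conds \<and>
      (\<forall>x\<in>X. (\<forall>c\<in>Cs t. sat c x) \<longleftrightarrow> a t < val f x \<and> val f x < b t)" by metis
  then obtain a b Cs where "\<forall>t\<in>{0..M}. a t < t \<and> t < b t \<and> b t - a t < \<delta> \<and> finite (Cs t) \<and> Cs t \<subseteq> conds \<and>
      (\<forall>x\<in>X. (\<forall>c\<in>Cs t. sat c x) \<longleftrightarrow> a t < val f x \<and> val f x < b t)" by (elim exE)
  note ab = bspec[OF this]
  have "compact {0..M}" by simp
  moreover have "{0..M} \<subseteq> (\<Union>t\<in>{0..M}. {a t<..<b t})" using ab by fastforce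
  ultimately obtain T where T: "T \<subseteq> {0..M}" "finite T" "{0..M} \<subseteq> (\<Union>t\<in>T. {a t<..<b t})"
    by (elim compactE_image) auto
  have cd: "x \<in> cdom (Cs t) \<longleftrightarrow> x \<in> X \<and> a t < val f x \<and> val f x < b t" if "t \<in> T" for t x
  proof -
    have "t \<in> {0..M}" using that T(1) by blast
    then have "\<forall>x\<in>X. (\<forall>c\<in>Cs t. sat c x) \<longleftrightarrow> a t < val f x \<and> val f x < b t" using ab by blast
    then show ?thesis unfolding cdom_def by blast
  qed
  show ?thesis
    unfolding small_grid_def
  proof (intro exI[of _ "Cs ` T"] conjI ballI)
    show "finite (Cs ` T)" using T(2) by simp
    show "X \<subseteq> \<Union>(cdom ` Cs ` T)"
    proof
      fix x assume x: "x \<in> X"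
      then have "val f x \<in> {0..M}" using nonneg[OF f x] M[OF x] by simp
      then obtain t where "t \<in> T" "val f x \<in> {a t<..<b t}" using T(3) by blast
      then show "x \<in> \<Union>(cdom ` Cs ` T)" using cd x by auto
    qed
    fix C assume "C \<in> Cs ` T"
    then obtain t where t: "t \<in> T" "C = Cs t" by blast
    have "t \<in> {0..M}" using t(1) T(1) by blast
    then show "finite C" "C \<subseteq> conds" using ab unfolding t(2) by blast+
    fix g x y assume "g \<in> {f}" and g: "x \<in> cdom C" "y \<in> cdom C"
    then have gf: "g = f" by simp
    from g have "a t < val f x" "val f x < b t" "a t < val f y" "val f y < b t" unfolding t(2) cd[OF t(1)] by simp_all
    moreover have "b t - a t < \<delta>" using ab[of t] t(1) T(1) by blast
    ultimately show "\<bar>val g x - val g y\<bar> < \<delta>" unfolding gf by linarith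
  qed
qed

lemma grid:
  assumes d: "\<delta> > 0"
  shows "finite A \<Longrightarrow> A \<subseteq> Fs \<Longrightarrow> \<exists>I. small_grid \<delta> A I"
proof (induction A rule: finite_induct)
  case empty
  show ?case unfolding small_grid_def by (intro exI[of _ "{{}}"]) (simp add: cdom_empty)
next
  case (insert f A)
  then obtain I where "small_grid \<delta> A I" by auto
  note I = small_gridD[OF this]
  obtain J where "small_grid \<delta> {f} J" using grid_one[of f \<delta>] d insert.prems by auto
  note J = small_gridD[OF this]
  show ?case
    unfolding small_grid_def
  proof (intro exI[of _ "(\<lambda>(a, b). a \<union> b) ` (I \<times> J)"] conjI ballI)
    show "finite ((\<lambda>(a, b). a \<union> b) ` (I \<times> J))" using I(1) J(1) by simp
    show "X \<subseteq> \<Union>(cdom ` (\<lambda>(a, b). a \<union> b) ` (I \<times> J))"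
    proof
      fix x assume "x \<in> X"
      then obtain a b where "a \<in> I" "b \<in> J" "x \<in> cdom a" "x \<in> cdom b" using I(3) J(3) by blast
      then show "x \<in> \<Union>(cdom ` (\<lambda>(a, b). a \<union> b) ` (I \<times> J))"
        by (intro UN_I[of "a \<union> b"]) (auto simp: cdom_Un)
    qed
    fix C assume "C \<in> (\<lambda>(a, b). a \<union> b) ` (I \<times> J)"
    then obtain a b where ab: "a \<in> I" "b \<in> J" "C = a \<union> b" by auto
    then show "finite C" "C \<subseteq> conds" using I(2) J(2) by auto
    fix h x y assume h: "h \<in> insert f A" and "x \<in> cdom C" "y \<in> cdom C"
    then have "x \<in> cdom a" "y \<in> cdom a" "x \<in> cdom b" "y \<in> cdom b" unfolding ab(3) cdom_Un by auto
    then show "\<bar>val h x - val h y\<bar> < \<delta>" using h I(4)[OF _ ab(1)] J(4)[OF _ ab(2)] by (cases "h = f") simp_all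
  qed
qed

text \<open>Every x satisfies the conditions of some member V of C with margin \<epsilon>, while the
  functions occurring in C vary by less than \<epsilon>/2 on each cell. Going from x within its cell
  to a point z shared with another cell, and on to y in that cell, changes each value by less than
  \<epsilon>, so y still lies in V.\<close>

lemma laurent_star_refinement:
  assumes C: "finite C" "C \<subseteq> LD" "covering X C"
  shows "\<exists>E. finite E \<and> E \<subseteq> LD \<and> covering X E \<and> star_refines E C"
proof -
  have "\<forall>U\<in>C. \<exists>Cs. finite Cs \<and> Cs \<subseteq> conds \<and> U = cdom Cs" using C(2) LD_iff by blast
  then obtain r where r: "\<And>U. U \<in> C \<Longrightarrow> finite (r U)" "\<And>U. U \<in> C \<Longrightarrow> r U \<subseteq> conds" "\<And>U. U \<in> C \<Longrightarrow> U = cdom (r U)" by metis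
  let ?P = "r ` C"
  have "ncdom {} \<subseteq> \<Union>(cdom ` ?P)"
  proof
    fix x assume "x \<in> ncdom {}"
    then have "x \<in> \<Union>C" using C(3) unfolding ncdom_def covering_def by simp
    then show "x \<in> \<Union>(cdom ` ?P)" using r(3) by blast
  qed
  then have "\<exists>\<epsilon>>0. \<forall>x\<in>ncdom {}. \<exists>Cs\<in>?P. inside \<epsilon> Cs x"
    by (rule covering_margin[rotated 4]) (use C(1) r(1,2) in auto)
  then obtain \<epsilon> where ep: "\<epsilon> > 0" "\<And>x. x \<in> X \<Longrightarrow> \<exists>Cs\<in>?P. inside \<epsilon> Cs x"
    unfolding ncdom_def by auto
  define A where "A = (\<Union>U\<in>C. (\<lambda>c. fst (snd c)) ` r U)"
  have A: "finite A" "A \<subseteq> Fs" unfolding A_def using C(1) r(1,2) unfolding conds_def by fastforce+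
  obtain I where "small_grid (\<epsilon> / 2) A I" using grid[of "\<epsilon> / 2" A] ep(1) A by auto
  note I = small_gridD[OF this]
  \<comment> \<open>Empty cells are dropped: star-refinement would ask for a member of C above them,
    and C may be empty when X is.\<close>
  define E where "E = {U \<in> cdom ` I. U \<noteq> {}}"
  have "finite E" unfolding E_def using I(1) by simp
  moreover have "E \<subseteq> LD" unfolding E_def using I(2) LD_iff by blast
  moreover have "covering X E" unfolding covering_def E_def using I(3) cdom_sub by blast
  moreover have "star_refines E C"
    unfolding star_refines_def
  proof
    fix U assume U: "U \<in> E"
    then obtain x Cs where x: "x \<in> U" "Cs \<in> I" "U = cdom Cs" unfolding E_def by blast
    have xX: "x \<in> X" using x cdom_sub by blast
    obtain V where V: "V \<in> C" "inside \<epsilon> (r V) x" using ep(2)[OF xX] by blast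
    have "W \<subseteq> V" if W: "W \<in> E" "W \<inter> U \<noteq> {}" for W
    proof
      fix y assume y: "y \<in> W"
      obtain z Ds where z: "z \<in> W" "z \<in> U" "Ds \<in> I" "W = cdom Ds" using W unfolding E_def by blast
      have yX: "y \<in> X" using y z(4) cdom_sub by blast
      have "sat c y" if c: "c \<in> r V" for c
      proof -
        obtain \<sigma> f \<alpha> where e: "c = (\<sigma>, f, \<alpha>)" by (metis prod_cases3)
        have s: "\<sigma> = 1 \<or> \<sigma> = -1" using c r(2)[OF V(1)] unfolding e conds_def by auto
        have fA: "f \<in> A" unfolding A_def using c V(1) e by force
        have "\<bar>val f x - val f z\<bar> < \<epsilon> / 2" using I(4)[OF fA x(2)] x(1,3) z(2) by blast
        moreover have "\<bar>val f z - val f y\<bar> < \<epsilon> / 2" using I(4)[OF fA z(3)] z(1,4) y by blast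
        moreover have "\<sigma> * val f x < \<sigma> * \<alpha> - \<epsilon>" using V(2) c unfolding e inside_def by blast
        ultimately show ?thesis unfolding e sat.simps using s ep(1) by (elim disjE; hypsubst; linarith)
      qed
      then show "y \<in> V" using r(3)[OF V(1)] yX unfolding cdom_def by blast
    qed
    then show "\<exists>V\<in>C. \<Union>{W \<in> E. W \<inter> U \<noteq> {}} \<subseteq> V" using V(1) by blast
  qed
  ultimately show ?thesis by blast
qed

lemma LU_I: "finite C \<Longrightarrow> C \<subseteq> LD \<Longrightarrow> covering X C \<Longrightarrow> C \<in> LU"
  unfolding LU_def refines_def by blast

lemma laurent_uniform: "uniform_structure X LU"
  unfolding uniform_structure_def
proof (intro conjI ballI allI impI)
  show "covering X C" if "C \<in> LU" for C using that unfolding LU_def by simp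
next
  fix C D assume "C \<in> LU" "covering X D \<and> refines C D"
  then show "D \<in> LU" unfolding LU_def using refines_trans by blast
next
  fix D1 D2 assume "D1 \<in> LU" "D2 \<in> LU"
  then obtain C1 C2 where C1: "finite C1" "C1 \<subseteq> LD" "covering X C1" "refines C1 D1"
    and C2: "finite C2" "C2 \<subseteq> LD" "covering X C2" "refines C2 D2" unfolding LU_def by blast
  let ?C = "(\<lambda>(U, W). U \<inter> W) ` (C1 \<times> C2)"
  have "covering X ?C"
  proof -
    have "\<Union>?C = \<Union>C1 \<inter> \<Union>C2" by auto
    then show ?thesis using C1(3) C2(3) unfolding covering_def by simp
  qed
  moreover have "finite ?C" using C1(1) C2(1) by simp
  moreover have "?C \<subseteq> LD" using C1(2) C2(2) LD_Int by auto
  ultimately obtain E where E: "finite E" "E \<subseteq> LD" "covering X E" "star_refines E ?C"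
    using laurent_star_refinement[of ?C] by blast
  have "refines ?C C1" "refines ?C C2" unfolding refines_def by auto
  then have "star_refines E D1" "star_refines E D2"
    using star_refines_mono[OF E(4)] refines_trans C1(4) C2(4) by blast+
  then show "\<exists>C\<in>LU. star_refines C D1 \<and> star_refines C D2" using LU_I[OF E(1-3)] by blast
qed

lemma LU_ne: "LU \<noteq> {}"
  using LU_I[of "{X}"] X_LD unfolding covering_def by auto

text \<open>These coverings do the local work: no member contains both a point with value at most a
  and a point with value at least b.\<close>

lemma two_covering:
  assumes "f \<in> Fs" "a \<in> S" "b \<in> S" "a < b"
  shows "{cdom {(1, f, b)}, cdom {(-1, f, a)}} \<in> LU"
proof (rule LU_I)
  show "{cdom {(1, f, b)}, cdom {(-1, f, a)}} \<subseteq> LD"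
    using assms unfolding LD_iff subset_iff conds_def by (auto intro: exI[of _ "{(1, f, b)}"] exI[of _ "{(-1, f, a)}"])
  show "covering X {cdom {(1, f, b)}, cdom {(-1, f, a)}}"
    unfolding covering_def cdom_def using assms(4) by auto
qed simp

lemma laurent_Hausdorff: "uniform_Hausdorff X LU"
  unfolding uniform_Hausdorff_def
proof (intro ballI impI)
  fix x y assume xy: "x \<in> X" "y \<in> X" "x \<noteq> y"
  then obtain f where f: "f \<in> Fs" "val f x < val f y" using separating by blast
  obtain b where b: "b \<in> S" "val f x < b" "b < val f y" using S_dense[OF nonneg[OF f(1) xy(1)] f(2)] by blast
  obtain a where a: "a \<in> S" "val f x < a" "a < b" using S_dense[OF nonneg[OF f(1) xy(1)] b(2)] by blast
  show "\<exists>C\<in>LU. \<forall>U\<in>C. \<not> (x \<in> U \<and> y \<in> U)"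
    using two_covering[OF f(1) a(1) b(1) a(3)] a b
    by (intro bexI[of _ "{cdom {(1, f, b)}, cdom {(-1, f, a)}}"]) (auto simp: cdom_def)
qed

lemma laurent_totally_bounded: "uniform_totally_bounded X LU"
  unfolding uniform_totally_bounded_def
proof
  fix D assume D: "D \<in> LU"
  then obtain C where C: "finite C" "covering X C" "refines C D" unfolding LU_def by blast
  obtain g where g: "\<And>U. U \<in> C \<Longrightarrow> g U \<in> D" "\<And>U. U \<in> C \<Longrightarrow> U \<subseteq> g U"
    using C(3) unfolding refines_def by metis
  have "\<Union>D = X" using D unfolding LU_def covering_def by simp
  then have "\<Union>(g ` C) = X" using g C(2) unfolding covering_def by blast
  then show "\<exists>E\<subseteq>D. finite E \<and> covering X E"
    using g(1) C(1) unfolding covering_def by (intro exI[of _ "g ` C"]) auto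
qed

sublocale U: cover_uniform X LU
  by unfold_locales (rule laurent_uniform LU_ne)+

text \<open>A point with |f| < \<alpha> has |f| < a for some a < \<alpha> in S. Of the two
  overlapping sets |f| < \<alpha> and |f| > a only the first contains it, so the star of the point
  is the given domain. Lower bounds are treated symmetrically.\<close>

lemma cond_neighbourhood:
  assumes c: "c \<in> conds" and x: "x \<in> X" "sat c x"
  shows "\<exists>C\<in>LU. U.star x C \<subseteq> cdom {c}"
proof -
  obtain \<sigma> f \<alpha> where e: "c = (\<sigma>, f, \<alpha>)" by (metis prod_cases3)
  have s: "\<sigma> = 1 \<or> \<sigma> = -1" and f: "f \<in> Fs" and \<alpha>: "\<alpha> \<in> S" using c unfolding e conds_def by auto
  show ?thesis
  proof (cases "\<sigma> = 1")
    case True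
    then have "val f x < \<alpha>" using x(2) e by simp
    then obtain a where a: "a \<in> S" "val f x < a" "a < \<alpha>" using S_dense[OF nonneg[OF f x(1)]] by blast
    have "U.star x {cdom {(1, f, \<alpha>)}, cdom {(-1, f, a)}} \<subseteq> cdom {c}"
      unfolding U.star_def e True using a(2) by (auto simp: cdom_def)
    then show ?thesis using two_covering[OF f a(1) \<alpha> a(3)] by blast
  next
    case False
    then have m: "\<sigma> = -1" using s by simp
    then have "\<alpha> < val f x" using x(2) e by simp
    then obtain b where b: "b \<in> S" "\<alpha> < b" "b < val f x" using S_dense[of \<alpha>] S_pos[OF \<alpha>] by (meson less_imp_le)
    have "U.star x {cdom {(1, f, b)}, cdom {(-1, f, \<alpha>)}} \<subseteq> cdom {c}"
      unfolding U.star_def e m using b(3) by (auto simp: cdom_def)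
    then show ?thesis using two_covering[OF f \<alpha> b(1,2)] by blast
  qed
qed

lemma cdom_neighbourhood:
  "finite Cs \<Longrightarrow> Cs \<subseteq> conds \<Longrightarrow> x \<in> cdom Cs \<Longrightarrow> \<exists>C\<in>LU. U.star x C \<subseteq> cdom Cs"
proof (induction Cs rule: finite_induct)
  case empty
  obtain C where "C \<in> LU" using LU_ne by blast
  moreover have "U.star x C \<subseteq> cdom {}"
    unfolding cdom_empty U.star_def using U.covering_sub[OF calculation] by blast
  ultimately show ?case by blast
next
  case (insert c Cs)
  have i: "cdom (insert c Cs) = cdom {c} \<inter> cdom Cs" using cdom_Un[of "{c}" Cs] by simp
  have x: "x \<in> X" "sat c x" "x \<in> cdom Cs" using insert.prems unfolding cdom_def by auto
  obtain C where C: "C \<in> LU" "U.star x C \<subseteq> cdom Cs" using insert x by auto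
  obtain D where D: "D \<in> LU" "U.star x D \<subseteq> cdom {c}" using cond_neighbourhood[of c x] insert.prems x by auto
  obtain E where E: "E \<in> LU" "star_refines E C" "star_refines E D" using U.star_ref2[OF C(1) D(1)] .
  have st: "U.star x E \<subseteq> U.star x C'" if "star_refines E C'" for C'
  proof
    fix z assume "z \<in> U.star x E"
    then obtain W where W: "W \<in> E" "x \<in> W" "z \<in> W" unfolding U.star_def by blast
    obtain V where V: "V \<in> C'" "\<And>W'. W' \<in> E \<Longrightarrow> W' \<inter> W \<noteq> {} \<Longrightarrow> W' \<subseteq> V"
      by (rule U.star_refinesD[OF \<open>star_refines E C'\<close> W(1)]) blast
    then show "z \<in> U.star x C'" using V(2)[OF W(1)] W unfolding U.star_def by blast
  qed
  show ?case unfolding i using E(1) st[OF E(2)] st[OF E(3)] C(2) D(2) by blast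
qed

lemma openin_laurent:
  "openin (uniform_topology X LU) W \<longleftrightarrow> (arbitrary union_of (\<lambda>U. U \<in> LD)) W"
proof
  assume W: "openin (uniform_topology X LU) W"
  have "\<exists>U\<in>LD. x \<in> U \<and> U \<subseteq> W" if x: "x \<in> W" for x
  proof -
    obtain D where D: "D \<in> LU" "U.star x D \<subseteq> W" "x \<in> X" using W x unfolding U.openin_iff by blast
    obtain C where C: "C \<subseteq> LD" "covering X C" "refines C D" using D(1) unfolding LU_def by blast
    have "x \<in> \<Union>C" using C(2) D(3) unfolding covering_def by simp
    then obtain U where U: "U \<in> C" "x \<in> U" by blast
    then obtain V where "V \<in> D" "U \<subseteq> V" using C(3) unfolding refines_def by blast
    then have "U \<subseteq> W" using U D(2) unfolding U.star_def by blast
    then show ?thesis using U C(1) by blast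
  qed
  then have "W = \<Union>{U \<in> LD. U \<subseteq> W}" by blast
  then show "(arbitrary union_of (\<lambda>U. U \<in> LD)) W" unfolding union_of_def arbitrary_def
    by (intro exI[of _ "{U \<in> LD. U \<subseteq> W}"]) auto
next
  assume "(arbitrary union_of (\<lambda>U. U \<in> LD)) W"
  then obtain \<U> where U: "\<U> \<subseteq> LD" "\<Union>\<U> = W" unfolding union_of_def arbitrary_def by auto
  have "openin (uniform_topology X LU) V" if V: "V \<in> \<U>" for V
  proof -
    have "V \<in> LD" using V U(1) by blast
    then obtain Cs where Cs: "finite Cs" "Cs \<subseteq> conds" "V = cdom Cs" unfolding LD_iff by (elim exE conjE)
    show ?thesis unfolding U.openin_iff Cs(3) using cdom_neighbourhood[OF Cs(1,2)] cdom_sub by simp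
  qed
  then show "openin (uniform_topology X LU) W" unfolding U(2)[symmetric] by (rule openin_Union)
qed

end

section \<open>Extensions of complete absolute values\<close>

text \<open>Spanning families are lists and the coefficients form an arbitrary set, because the same
  notion is used over the subfield \<open>k\<close>, over rings of polynomials and over rings of
  convergent series.\<close>

fun lspan :: "('a, 'b) ring_scheme \<Rightarrow> 'a set \<Rightarrow> 'a list \<Rightarrow> 'a set" where
  "lspan R A [] = {\<zero>\<^bsub>R\<^esub>}"
| "lspan R A (u # us) = {a \<otimes>\<^bsub>R\<^esub> u \<oplus>\<^bsub>R\<^esub> w | a w. a \<in> A \<and> w \<in> lspan R A us}"

lemma lspan_ConsI:
  "x = a \<otimes>\<^bsub>R\<^esub> u \<oplus>\<^bsub>R\<^esub> w \<Longrightarrow> a \<in> A \<Longrightarrow> w \<in> lspan R A us \<Longrightarrow> x \<in> lspan R A (u # us)"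
  by auto

context cring begin

lemma lspan_carrier:
  assumes "A \<subseteq> carrier R" "set us \<subseteq> carrier R"
  shows "lspan R A us \<subseteq> carrier R"
  using assms by (induction us) auto

lemma lspan_zero:
  assumes "subring A R" "set us \<subseteq> carrier R"
  shows "\<zero> \<in> lspan R A us"
  using assms(2)
proof (induction us)
  case (Cons u us)
  have "\<zero> = \<zero> \<otimes> u \<oplus> \<zero>" using Cons.prems by simp
  moreover have "\<zero> \<in> A" using subringE(2)[OF assms(1)] .
  ultimately show ?case using Cons by (intro lspan_ConsI) auto
qed simp

lemma lspan_add:
  assumes A: "subring A R" and "set us \<subseteq> carrier R" "x \<in> lspan R A us" "y \<in> lspan R A us"
  shows "x \<oplus> y \<in> lspan R A us"
  using assms(2-)
proof (induction us arbitrary: x y)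
  case (Cons u us)
  obtain a w b z where e: "a \<in> A" "b \<in> A" "w \<in> lspan R A us" "z \<in> lspan R A us"
    "x = a \<otimes> u \<oplus> w" "y = b \<otimes> u \<oplus> z" using Cons.prems by auto
  have c: "a \<in> carrier R" "b \<in> carrier R" "w \<in> carrier R" "z \<in> carrier R" "u \<in> carrier R"
    using e subringE(1)[OF A] lspan_carrier[of A us] Cons.prems by auto
  have "x \<oplus> y = (a \<oplus> b) \<otimes> u \<oplus> (w \<oplus> z)" unfolding e using c by algebra
  then show ?case using Cons e(1-4) subringE(7)[OF A]
    by (intro lspan_ConsI[where a="a \<oplus> b" and w="w \<oplus> z"]) auto
qed simp

lemma lspan_smult:
  assumes A: "subring A R" and "set us \<subseteq> carrier R" "x \<in> lspan R A us" "c \<in> A"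
  shows "c \<otimes> x \<in> lspan R A us"
  using assms(2-)
proof (induction us arbitrary: x)
  case Nil
  then show ?case using subringE(1)[OF A] by auto
next
  case (Cons u us)
  obtain a w where e: "a \<in> A" "w \<in> lspan R A us" "x = a \<otimes> u \<oplus> w" using Cons.prems by auto
  have c: "a \<in> carrier R" "c \<in> carrier R" "w \<in> carrier R" "u \<in> carrier R"
    using e subringE(1)[OF A] lspan_carrier[of A us] Cons.prems by auto
  have "c \<otimes> x = (c \<otimes> a) \<otimes> u \<oplus> (c \<otimes> w)" unfolding e using c by algebra
  then show ?case using Cons e(1,2) subringE(6)[OF A]
    by (intro lspan_ConsI[where a="c \<otimes> a" and w="c \<otimes> w"]) auto
qed

lemma lspan_minus:
  assumes A: "subring A R" and us: "set us \<subseteq> carrier R" and x: "x \<in> lspan R A us"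
  shows "\<ominus> x \<in> lspan R A us"
proof -
  have "x \<in> carrier R" using lspan_carrier[OF subringE(1)[OF A] us] x by blast
  then have "\<ominus> x = (\<ominus> \<one>) \<otimes> x" by algebra
  moreover have "\<ominus> \<one> \<in> A" using subringE(3,5)[OF A] by blast
  ultimately show ?thesis using lspan_smult[OF A us x] by simp
qed

lemma lspan_member:
  assumes A: "subring A R" and "set us \<subseteq> carrier R" "u \<in> set us"
  shows "u \<in> lspan R A us"
  using assms(2-)
proof (induction us)
  case (Cons t us)
  have t: "t \<in> carrier R" using Cons by simp
  show ?case
  proof (cases "u = t")
    case True
    have "t = \<one> \<otimes> t \<oplus> \<zero>" using t by algebra
    then show ?thesis using True lspan_zero[OF A, of us] subringE(3)[OF A] Cons
      by (intro lspan_ConsI[where a=\<one> and w=\<zero>]) auto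
  next
    case False
    then have u: "u \<in> lspan R A us" using Cons by auto
    have "u \<in> carrier R" using Cons by auto
    then have "u = \<zero> \<otimes> t \<oplus> u" using t by algebra
    then show ?thesis using u subringE(2)[OF A] by (intro lspan_ConsI[where a=\<zero> and w=u]) auto
  qed
qed simp

lemma lspan_subset:
  assumes A: "subring A R" and "set vs \<subseteq> carrier R" "set us \<subseteq> lspan R A vs"
  shows "lspan R A us \<subseteq> lspan R A vs"
  using assms(3)
proof (induction us)
  case Nil
  then show ?case using lspan_zero[OF A, of vs] assms(2) by simp
next
  case (Cons u us)
  then show ?case using lspan_add[OF A assms(2)] lspan_smult[OF A assms(2)] by auto
qed

lemma lspan_mono: "A \<subseteq> B \<Longrightarrow> lspan R A us \<subseteq> lspan R B us"
  by (induction us) auto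

end

text \<open>A multiplicative constant disappears when n-th roots are taken. This turns an
  equivalence of norms into an inequality without constant as soon as powers are respected.\<close>

lemma power_bound_le:
  fixes a b C :: real
  assumes "0 \<le> a" "0 \<le> b" "\<And>n. a ^ n \<le> C * b ^ n"
  shows "a \<le> b"
proof (rule ccontr)
  assume "\<not> a \<le> b"
  then have ab: "b < a" by simp
  show False
  proof (cases "b = 0")
    case True
    then show False using assms(3)[of 1] ab by simp
  next
    case False
    then have "1 < a / b" using assms(2) ab by simp
    then obtain n where n: "C < (a / b) ^ n" using real_arch_pow by blast
    have "(a / b) ^ n \<le> C" using assms(2) assms(3)[of n] False
      by (simp add: power_divide pos_divide_le_eq)
    then show False using n by simp
  qed
qed

lemma le_mult_epsilon:
  fixes a b c :: real
  assumes "\<And>d. d > 0 \<Longrightarrow> a \<le> (b + d) * (c + d)"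
  shows "a \<le> b * c"
proof (rule tendsto_lowerbound)
  show "((\<lambda>d. (b + d) * (c + d)) \<longlongrightarrow> b * c) (at_right 0)"
    by (auto intro!: tendsto_eq_intros)
  show "eventually (\<lambda>d. a \<le> (b + d) * (c + d)) (at_right 0)"
    using assms by (auto simp: eventually_at_right_less intro: eventually_mono[OF eventually_at_right_less])
qed simp

section \<open>Norms on finite-dimensional spaces over a complete field\<close>

definition value_Cauchy :: "('a, 'b) ring_scheme \<Rightarrow> ('a \<Rightarrow> real) \<Rightarrow> (nat \<Rightarrow> 'a) \<Rightarrow> bool" where
  "value_Cauchy R q s \<longleftrightarrow> (\<forall>\<epsilon>>0. \<exists>N. \<forall>i\<ge>N. \<forall>j\<ge>N. q (s i \<ominus>\<^bsub>R\<^esub> s j) < \<epsilon>)"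

locale valued_subfield = field L for L (structure) +
  fixes k :: "'a set" and v :: "'a \<Rightarrow> real"
  assumes sub: "subfield k L"
    and v_nonneg: "a \<in> k \<Longrightarrow> 0 \<le> v a"
    and v_zero: "a \<in> k \<Longrightarrow> v a = 0 \<longleftrightarrow> a = \<zero>"
    and v_mult: "a \<in> k \<Longrightarrow> b \<in> k \<Longrightarrow> v (a \<otimes> b) = v a * v b"
    and v_complete: "\<And>s. (\<And>i. s i \<in> k) \<Longrightarrow> value_Cauchy L v s \<Longrightarrow>
        \<exists>l\<in>k. (\<lambda>i. v (s i \<ominus> l)) \<longlonglongrightarrow> 0"
begin

lemma ksr: "subring k L" using sub by (rule subfieldE(1))

lemma kc: "a \<in> k \<Longrightarrow> a \<in> carrier L" using subringE(1)[OF ksr] by blast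

lemma kinv: "a \<in> k \<Longrightarrow> a \<noteq> \<zero> \<Longrightarrow> inv a \<in> k \<and> inv a \<otimes> a = \<one>"
  using subfield_m_inv[OF sub, of a] by auto

lemma v_one: "v \<one> = 1"
proof -
  have "\<one> \<in> k" using subringE(3)[OF ksr] .
  then have "v \<one> = v \<one> * v \<one>" "v \<one> \<noteq> 0" using v_mult[of \<one> \<one>] v_zero[of \<one>] by auto
  then show ?thesis by simp
qed

lemma v_minus_one: "v (\<ominus> \<one>) = 1"
proof -
  have m: "\<ominus> \<one> \<in> k" using subringE(3,5)[OF ksr] by blast
  have "\<ominus> \<one> \<otimes> \<ominus> \<one> = \<one>" by algebra
  then have "v (\<ominus> \<one>) * v (\<ominus> \<one>) = 1" using v_mult[OF m m] v_one by simp
  then show ?thesis using v_nonneg[OF m] by (metis mult_cancel_left1 abs_mult_self_eq abs_of_nonneg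
        mult_left_mono nle_le power2_eq_square power2_eq_1_iff abs_1)
qed

definition knorm :: "('a \<Rightarrow> real) \<Rightarrow> bool" where
  "knorm q \<longleftrightarrow> (\<forall>x\<in>carrier L. 0 \<le> q x) \<and> (\<forall>x\<in>carrier L. q x = 0 \<longrightarrow> x = \<zero>) \<and>
     (\<forall>x\<in>carrier L. \<forall>y\<in>carrier L. q (x \<oplus> y) \<le> q x + q y) \<and>
     (\<forall>a\<in>k. \<forall>x\<in>carrier L. q (a \<otimes> x) = v a * q x)"

lemma knormD:
  assumes "knorm q"
  shows "x \<in> carrier L \<Longrightarrow> 0 \<le> q x" "x \<in> carrier L \<Longrightarrow> q x = 0 \<Longrightarrow> x = \<zero>"
    "x \<in> carrier L \<Longrightarrow> y \<in> carrier L \<Longrightarrow> q (x \<oplus> y) \<le> q x + q y"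
    "a \<in> k \<Longrightarrow> x \<in> carrier L \<Longrightarrow> q (a \<otimes> x) = v a * q x"
  using assms by (simp_all add: knorm_def)

lemma knorm_zero: "knorm q \<Longrightarrow> q \<zero> = 0"
  using knormD(4)[of q \<zero> \<zero>] subringE(2)[OF ksr] v_zero[of \<zero>] by simp

lemma knorm_minus:
  assumes "knorm q" "x \<in> carrier L" shows "q (\<ominus> x) = q x"
proof -
  have "\<ominus> x = \<ominus> \<one> \<otimes> x" using assms(2) by algebra
  moreover have "\<ominus> \<one> \<in> k" using subringE(3,5)[OF ksr] by blast
  ultimately show ?thesis using knormD(4)[OF assms(1)] assms(2) v_minus_one by simp
qed

lemma knorm_diff:
  assumes "knorm q" "x \<in> carrier L" "y \<in> carrier L" shows "q (x \<ominus> y) \<le> q x + q y"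
  using knormD(3)[OF assms(1,2), of "\<ominus> y"] knorm_minus[OF assms(1,3)] assms
  by (simp add: minus_eq)

definition lspan_complete :: "('a \<Rightarrow> real) \<Rightarrow> 'a list \<Rightarrow> bool" where
  "lspan_complete q us \<longleftrightarrow> (\<forall>s. (\<forall>i. s i \<in> lspan L k us) \<longrightarrow> value_Cauchy L q s \<longrightarrow>
     (\<exists>l\<in>lspan L k us. (\<lambda>i. q (s i \<ominus> l)) \<longlonglongrightarrow> 0))"

text \<open>Were there vectors w of the span with u + w arbitrarily small, they would form a Cauchy
  sequence with limit -u in the complete span, so that u would lie in it. Scaling by a gives the
  bound for all multiples of u.\<close>

lemma dist_positive:
  assumes q: "knorm q" and c: "lspan_complete q us" and us: "set us \<subseteq> carrier L"
    and u: "u \<in> carrier L" "u \<notin> lspan L k us"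
  shows "\<exists>\<delta>>0. \<forall>a\<in>k. \<forall>w\<in>lspan L k us. v a * \<delta> \<le> q (a \<otimes> u \<oplus> w)"
proof -
  note sc = lspan_carrier[OF subringE(1)[OF ksr] us]
  have "\<exists>\<delta>>0. \<forall>w\<in>lspan L k us. \<delta> \<le> q (u \<oplus> w)"
  proof (rule ccontr)
    assume n: "\<not> ?thesis"
    have "\<exists>w\<in>lspan L k us. q (u \<oplus> w) < inverse (real (Suc n))" for n
    proof -
      have "inverse (real (Suc n)) > 0" by simp
      with n show ?thesis by (meson not_le)
    qed
    then obtain w where w: "\<And>n. w n \<in> lspan L k us" "\<And>n. q (u \<oplus> w n) < inverse (real (Suc n))"
      by metis
    have wc: "w n \<in> carrier L" for n using w(1) sc by blast
    have "value_Cauchy L q w"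
      unfolding value_Cauchy_def
    proof (intro allI impI)
      fix e :: real assume "e > 0"
      then obtain N where N: "inverse (real (Suc N)) < e / 2"
        using reals_Archimedean[of "e/2"] by auto
      have "q (w i \<ominus> w j) < e" if "i \<ge> N" "j \<ge> N" for i j
      proof -
        have "w i \<ominus> w j = (u \<oplus> w i) \<ominus> (u \<oplus> w j)" using u wc by algebra
        then have tri: "q (w i \<ominus> w j) \<le> q (u \<oplus> w i) + q (u \<oplus> w j)"
          using knorm_diff[OF q] u wc by simp
        have "q (u \<oplus> w n) < e / 2" if "n \<ge> N" for n
        proof -
          have "inverse (real (Suc n)) \<le> inverse (real (Suc N))" using that by (simp add: le_imp_inverse_le)
          then show ?thesis using w(2)[of n] N by linarith
        qed
        from this[OF that(1)] this[OF that(2)] tri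
        show ?thesis by linarith
      qed
      then show "\<exists>N. \<forall>i\<ge>N. \<forall>j\<ge>N. q (w i \<ominus> w j) < e" by blast
    qed
    then obtain l where l: "l \<in> lspan L k us" "(\<lambda>i. q (w i \<ominus> l)) \<longlonglongrightarrow> 0"
      using c w(1) unfolding lspan_complete_def by blast
    have lc: "l \<in> carrier L" using l sc by blast
    have "q (u \<oplus> l) \<le> inverse (real (Suc n)) + q (w n \<ominus> l)" for n
    proof -
      have "u \<oplus> l = (u \<oplus> w n) \<ominus> (w n \<ominus> l)" using u wc lc by algebra
      then have "q (u \<oplus> l) \<le> q (u \<oplus> w n) + q (w n \<ominus> l)"
        using knorm_diff[OF q] u wc lc by simp
      then show ?thesis using w(2)[of n] by linarith
    qed
    moreover have "(\<lambda>n. inverse (real (Suc n)) + q (w n \<ominus> l)) \<longlonglongrightarrow> 0"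
      using tendsto_add[OF LIMSEQ_inverse_real_of_nat l(2)] by simp
    ultimately have "q (u \<oplus> l) \<le> 0" by (intro LIMSEQ_le_const) auto
    then have "u \<oplus> l = \<zero>" using knormD(1,2)[OF q, of "u \<oplus> l"] u lc by auto
    then have "u = \<ominus> l" using u lc by (simp add: sum_zero_eq_neg)
    then show False using u lspan_minus[OF ksr us l(1)] by simp
  qed
  then obtain \<delta> where d: "\<delta> > 0" "\<And>w. w \<in> lspan L k us \<Longrightarrow> \<delta> \<le> q (u \<oplus> w)" by blast
  have "v a * \<delta> \<le> q (a \<otimes> u \<oplus> w)" if aw: "a \<in> k" "w \<in> lspan L k us" for a w
  proof (cases "a = \<zero>")
    case True
    then show ?thesis using v_zero[of a] aw knormD(1)[OF q, of "a \<otimes> u \<oplus> w"] sc u kc by auto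
  next
    case False
    have i: "inv a \<in> k" "inv a \<otimes> a = \<one>" using kinv aw False by auto
    have cc: "a \<in> carrier L" "inv a \<in> carrier L" "w \<in> carrier L" using aw i kc sc by auto
    have "a \<otimes> (u \<oplus> inv a \<otimes> w) = a \<otimes> u \<oplus> (inv a \<otimes> a) \<otimes> w" using cc u by algebra
    then have "a \<otimes> (u \<oplus> inv a \<otimes> w) = a \<otimes> u \<oplus> w" using i cc by simp
    then have "q (a \<otimes> u \<oplus> w) = v a * q (u \<oplus> inv a \<otimes> w)"
      using knormD(4)[OF q aw(1), of "u \<oplus> inv a \<otimes> w"] cc u by simp
    then show ?thesis using d(2)[OF lspan_smult[OF ksr us aw(2) i(1)]] v_nonneg[OF aw(1)]
      by (simp add: mult_left_mono)
  qed
  with d(1) show ?thesis by blast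
qed

text \<open>Induction on the list. For a new vector u outside the span, \<open>dist_positive\<close>
  bounds the coefficient of u by the norm; so for a Cauchy sequence the coefficients and the
  remaining parts are both Cauchy, and both converge.\<close>

lemma lspan_complete:
  assumes q: "knorm q" and "set us \<subseteq> carrier L"
  shows "lspan_complete q us"
  using assms(2)
proof (induction us)
  case Nil
  then show ?case unfolding lspan_complete_def
  proof (intro allI impI)
    fix s :: "nat \<Rightarrow> 'a" assume "\<forall>i. s i \<in> lspan L k []"
    then have "s i \<ominus> \<zero> = \<zero>" for i by (simp add: minus_eq)
    moreover have "q \<zero> = 0" by (rule knorm_zero[OF q])
    ultimately show "\<exists>l\<in>lspan L k []. (\<lambda>i. q (s i \<ominus> l)) \<longlonglongrightarrow> 0" by simp
  qed
next
  case (Cons u us)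
  then have c: "lspan_complete q us" and us: "set us \<subseteq> carrier L" and u: "u \<in> carrier L" by auto
  note sc = lspan_carrier[OF subringE(1)[OF ksr] us]
  show ?case
  proof (cases "u \<in> lspan L k us")
    case True
    have "lspan L k (u # us) \<subseteq> lspan L k us"
      using True lspan_member[OF ksr us] by (intro lspan_subset[OF ksr us]) auto
    moreover have "lspan L k us \<subseteq> lspan L k (u # us)"
      using lspan_member[OF ksr, of "u # us"] u us
      by (intro lspan_subset[OF ksr]) (auto simp del: lspan.simps)
    ultimately have "lspan L k (u # us) = lspan L k us" by blast
    then show ?thesis using c unfolding lspan_complete_def by simp
  next
    case False
    obtain \<delta> where d: "\<delta> > 0" "\<And>a w. a \<in> k \<Longrightarrow> w \<in> lspan L k us \<Longrightarrow> v a * \<delta> \<le> q (a \<otimes> u \<oplus> w)"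
      using dist_positive[OF q c us u False] by blast
    show ?thesis unfolding lspan_complete_def
    proof (intro allI impI)
      fix s assume s: "\<forall>i. s i \<in> lspan L k (u # us)" and C: "value_Cauchy L q s"
      have "\<forall>i. \<exists>a w. s i = a \<otimes> u \<oplus> w \<and> a \<in> k \<and> w \<in> lspan L k us" using s by simp
      then obtain a w where aw: "\<And>i. s i = a i \<otimes> u \<oplus> w i" "\<And>i. a i \<in> k" "\<And>i. w i \<in> lspan L k us"
        by metis
      have cc: "a i \<in> carrier L" "w i \<in> carrier L" for i using aw kc sc by auto
      have da: "v (a i \<ominus> a j) * \<delta> \<le> q (s i \<ominus> s j)" for i j
      proof -
        have "s i \<ominus> s j = (a i \<ominus> a j) \<otimes> u \<oplus> (w i \<ominus> w j)" unfolding aw(1) using cc u by algebra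
        moreover have "a i \<ominus> a j \<in> k" using aw(2) subringE(5,7)[OF ksr] by (simp add: minus_eq)
        moreover have "w i \<ominus> w j \<in> lspan L k us"
          using aw(3) lspan_add[OF ksr us] lspan_minus[OF ksr us] by (simp add: minus_eq)
        ultimately show ?thesis using d(2) by simp
      qed
      have "value_Cauchy L v a"
        unfolding value_Cauchy_def
      proof (intro allI impI)
        fix e :: real assume e: "e > 0"
        then obtain N where N: "\<And>i j. i \<ge> N \<Longrightarrow> j \<ge> N \<Longrightarrow> q (s i \<ominus> s j) < e * \<delta>"
          using C d(1) unfolding value_Cauchy_def by (meson mult_pos_pos)
        have "v (a i \<ominus> a j) < e" if "i \<ge> N" "j \<ge> N" for i j
          using da[of i j] N[OF that] d(1) by (meson le_less_trans mult_less_cancel_right_pos)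
        then show "\<exists>N. \<forall>i\<ge>N. \<forall>j\<ge>N. v (a i \<ominus> a j) < e" by blast
      qed
      then obtain b where b: "b \<in> k" "(\<lambda>i. v (a i \<ominus> b)) \<longlonglongrightarrow> 0" using v_complete aw(2) by blast
      have bc: "b \<in> carrier L" using b kc by blast
      have ab: "a i \<ominus> a j \<in> k" "a i \<ominus> b \<in> k" for i j
        using aw(2) b subringE(5,7)[OF ksr] by (simp_all add: minus_eq)
      have "value_Cauchy L q w"
        unfolding value_Cauchy_def
      proof (intro allI impI)
        fix e :: real assume e: "e > 0"
        \<comment> \<open>The difference of two remaining parts exceeds that of the given sequence
          by a multiple of u of norm at most e' / \<delta> times q u; hence e' is e divided by 1 + q
          u / \<delta>.\<close>
        obtain e' where e': "e' > 0" "e' + e' / \<delta> * q u \<le> e"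
        proof
          let ?e = "e / (1 + q u / \<delta>)"
          have "0 \<le> q u / \<delta>" using knormD(1)[OF q u] d(1) by simp
          then show "?e > 0" using e by (simp add: add_pos_nonneg)
          have "x + x / \<delta> * y = x * (1 + y / \<delta>)" for x y :: real by (simp add: algebra_simps)
          then have "?e + ?e / \<delta> * q u = ?e * (1 + q u / \<delta>)" .
          also have "\<dots> = e" using \<open>0 \<le> q u / \<delta>\<close> by simp
          finally show "?e + ?e / \<delta> * q u \<le> e" by simp
        qed
        obtain N where N: "\<And>i j. i \<ge> N \<Longrightarrow> j \<ge> N \<Longrightarrow> q (s i \<ominus> s j) < e'"
          using C e'(1) unfolding value_Cauchy_def by meson
        have "q (w i \<ominus> w j) < e" if ij: "i \<ge> N" "j \<ge> N" for i j
        proof -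
          have "w i \<ominus> w j = (s i \<ominus> s j) \<ominus> (a i \<ominus> a j) \<otimes> u" unfolding aw(1) using cc u by algebra
          then have "q (w i \<ominus> w j) \<le> q (s i \<ominus> s j) + q ((a i \<ominus> a j) \<otimes> u)"
            using knorm_diff[OF q, of "s i \<ominus> s j" "(a i \<ominus> a j) \<otimes> u"] aw(1) cc u by simp
          also have "q ((a i \<ominus> a j) \<otimes> u) = v (a i \<ominus> a j) * q u" using knormD(4)[OF q ab(1) u] .
          also have "\<dots> \<le> e' / \<delta> * q u"
          proof (rule mult_right_mono)
            show "v (a i \<ominus> a j) \<le> e' / \<delta>" using da[of i j] N[OF ij] d(1)
              by (simp add: pos_le_divide_eq)
          qed (use knormD(1)[OF q u] in simp)
          finally show ?thesis using N[OF ij] e'(2) by linarith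
        qed
        then show "\<exists>N. \<forall>i\<ge>N. \<forall>j\<ge>N. q (w i \<ominus> w j) < e" by blast
      qed
      then obtain l where l: "l \<in> lspan L k us" "(\<lambda>i. q (w i \<ominus> l)) \<longlonglongrightarrow> 0"
        using c aw(3) unfolding lspan_complete_def by blast
      have lc: "l \<in> carrier L" using l sc by blast
      have up: "q (s i \<ominus> (b \<otimes> u \<oplus> l)) \<le> v (a i \<ominus> b) * q u + q (w i \<ominus> l)" for i
      proof -
        have "s i \<ominus> (b \<otimes> u \<oplus> l) = (a i \<ominus> b) \<otimes> u \<oplus> (w i \<ominus> l)" unfolding aw(1) using cc bc lc u by algebra
        then show ?thesis using knormD(3)[OF q, of "(a i \<ominus> b) \<otimes> u" "w i \<ominus> l"]
            knormD(4)[OF q ab(2) u] cc bc lc u by simp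
      qed
      have lim0: "(\<lambda>i. v (a i \<ominus> b) * q u + q (w i \<ominus> l)) \<longlonglongrightarrow> 0"
        using tendsto_add[OF tendsto_mult_right[OF b(2), of "q u"] l(2)] by simp
      have "(\<lambda>i. q (s i \<ominus> (b \<otimes> u \<oplus> l))) \<longlonglongrightarrow> 0"
      proof (rule tendsto_sandwich[OF _ _ tendsto_const lim0])
        show "\<forall>\<^sub>F i in sequentially. 0 \<le> q (s i \<ominus> (b \<otimes> u \<oplus> l))"
          using knormD(1)[OF q] aw(1) cc bc lc u by simp
        show "\<forall>\<^sub>F i in sequentially. q (s i \<ominus> (b \<otimes> u \<oplus> l)) \<le> v (a i \<ominus> b) * q u + q (w i \<ominus> l)"
          using up by simp
      qed
      moreover have "b \<otimes> u \<oplus> l \<in> lspan L k (u # us)" using b l by (intro lspan_ConsI) auto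
      ultimately show "\<exists>l\<in>lspan L k (u # us). (\<lambda>i. q (s i \<ominus> l)) \<longlonglongrightarrow> 0" by blast
    qed
  qed
qed

text \<open>The bound from \<open>dist_positive\<close> controls the coefficient of u by q, hence
  also the remaining part of the vector; \<open>C'\<close> collects the two contributions to
  p.\<close>

lemma norm_equivalence:
  assumes q: "knorm q" and p: "knorm p" and "set us \<subseteq> carrier L"
  shows "\<exists>C\<ge>0. \<forall>x\<in>lspan L k us. p x \<le> C * q x"
  using assms(3)
proof (induction us)
  case Nil
  have "p \<zero> = 0" by (rule knorm_zero[OF p])
  then show ?case using knormD(1)[OF q] by (intro exI[of _ 1]) simp
next
  case (Cons u us)
  then have us: "set us \<subseteq> carrier L" and u: "u \<in> carrier L" by auto
  note sc = lspan_carrier[OF subringE(1)[OF ksr] us]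
  obtain C where C: "C \<ge> 0" "\<And>x. x \<in> lspan L k us \<Longrightarrow> p x \<le> C * q x" using Cons by auto
  show ?case
  proof (cases "u \<in> lspan L k us")
    case True
    have "lspan L k (u # us) \<subseteq> lspan L k us"
      using True lspan_member[OF ksr us] by (intro lspan_subset[OF ksr us]) auto
    then show ?thesis using C by blast
  next
    case False
    obtain \<delta> where d: "\<delta> > 0" "\<And>a w. a \<in> k \<Longrightarrow> w \<in> lspan L k us \<Longrightarrow> v a * \<delta> \<le> q (a \<otimes> u \<oplus> w)"
      using dist_positive[OF q lspan_complete[OF q us] us u False] by blast
    define C' where "C' = p u / \<delta> + C * (1 + q u / \<delta>)"
    have "C' \<ge> 0" unfolding C'_def using C(1) d(1) knormD(1)[OF q u] knormD(1)[OF p u] by simp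
    moreover have "p x \<le> C' * q x" if x: "x \<in> lspan L k (u # us)" for x
    proof -
      obtain a w where aw: "x = a \<otimes> u \<oplus> w" "a \<in> k" "w \<in> lspan L k us" using x by auto
      have cc: "a \<in> carrier L" "w \<in> carrier L" using aw kc sc by auto
      have va: "v a \<le> q x / \<delta>" using d(2)[OF aw(2,3)] aw(1) d(1) by (simp add: pos_le_divide_eq)
      have "w = x \<ominus> a \<otimes> u" unfolding aw(1) using cc u by algebra
      then have "q w \<le> q x + v a * q u"
        using knorm_diff[OF q, of x "a \<otimes> u"] knormD(4)[OF q aw(2) u] aw(1) cc u by simp
      also have "\<dots> \<le> q x + q x / \<delta> * q u" using mult_right_mono[OF va knormD(1)[OF q u]] by simp
      finally have qw: "q w \<le> q x * (1 + q u / \<delta>)" by (simp add: algebra_simps)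
      have "p x \<le> v a * p u + p w" unfolding aw(1)
        using knormD(3)[OF p, of "a \<otimes> u" w] knormD(4)[OF p aw(2) u] cc u by simp
      also have "\<dots> \<le> q x / \<delta> * p u + C * (q x * (1 + q u / \<delta>))"
      proof (rule add_mono)
        show "v a * p u \<le> q x / \<delta> * p u" using va knormD(1)[OF p u] by (rule mult_right_mono)
        show "p w \<le> C * (q x * (1 + q u / \<delta>))"
          using C(2)[OF aw(3)] mult_left_mono[OF qw C(1)] by linarith
      qed
      also have "\<dots> = C' * q x" unfolding C'_def by (simp add: algebra_simps)
      finally show ?thesis .
    qed
    ultimately show ?thesis by blast
  qed
qed

text \<open>The two norms are comparable up to a constant; applying this to all powers of x and
  using multiplicativity removes the constant.\<close>

lemma mult_norm_unique:
  assumes us: "set us \<subseteq> carrier L" "lspan L k us = carrier L"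
    and w: "knorm w" "\<And>x y. x \<in> carrier L \<Longrightarrow> y \<in> carrier L \<Longrightarrow> w (x \<otimes> y) = w x * w y"
    and w': "knorm w'" "\<And>x y. x \<in> carrier L \<Longrightarrow> y \<in> carrier L \<Longrightarrow> w' (x \<otimes> y) = w' x * w' y"
    and x: "x \<in> carrier L"
  shows "w x \<le> w' x"
proof -
  obtain C where C: "\<And>y. y \<in> carrier L \<Longrightarrow> w y \<le> C * w' y"
    using norm_equivalence[OF w'(1) w(1) us(1)] us(2) by auto
  have pw: "u (x [^] n) = u x ^ n"
    if "knorm u" "\<And>x y. x \<in> carrier L \<Longrightarrow> y \<in> carrier L \<Longrightarrow> u (x \<otimes> y) = u x * u y" for u and n :: nat
  proof (induction n)
    case 0
    have "u \<one> * u \<one> = u \<one>" using that(2)[of \<one> \<one>] by simp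
    moreover have "u \<one> \<noteq> 0" using knormD(2)[OF that(1), of \<one>] by auto
    ultimately show ?case by simp
  next
    case (Suc n) then show ?case using that(2) x by (simp add: mult.commute)
  qed
  show ?thesis
  proof (rule power_bound_le)
    show "w x ^ n \<le> C * w' x ^ n" for n
      using C[of "x [^] n"] x pw[OF w] pw[OF w'] by simp
  qed (use knormD(1) w(1) w'(1) x in auto)
qed

end

section \<open>The spectral norm of a submultiplicative ultrametric norm\<close>

locale submult_norm = valued_subfield +
  fixes p :: "'a \<Rightarrow> real"
  assumes p_nonneg: "x \<in> carrier L \<Longrightarrow> 0 \<le> p x"
    and p_one: "p \<one> = 1"
    and p_add: "x \<in> carrier L \<Longrightarrow> y \<in> carrier L \<Longrightarrow> p (x \<oplus> y) \<le> max (p x) (p y)"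
    and p_mult: "x \<in> carrier L \<Longrightarrow> y \<in> carrier L \<Longrightarrow> p (x \<otimes> y) \<le> p x * p y"
    and p_smult: "a \<in> k \<Longrightarrow> x \<in> carrier L \<Longrightarrow> p (a \<otimes> x) = v a * p x"
begin

lemma p_ne: "x \<in> carrier L \<Longrightarrow> x \<noteq> \<zero> \<Longrightarrow> p x \<noteq> 0"
proof
  assume x: "x \<in> carrier L" "x \<noteq> \<zero>" and z: "p x = 0"
  then have "x \<otimes> inv x = \<one>" "inv x \<in> carrier L" by (simp_all add: field_Units)
  then show False using p_mult[OF x(1), of "inv x"] p_one z by simp
qed

lemma p_knorm: "knorm p"
  unfolding knorm_def
proof (intro conjI ballI impI)
  fix x y assume "x \<in> carrier L" "y \<in> carrier L"
  then show "p (x \<oplus> y) \<le> p x + p y" using p_add[of x y] p_nonneg[of x] p_nonneg[of y] by linarith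
qed (use p_nonneg p_ne p_smult in auto)

text \<open>The spectral radius formula with exponents from 1 on. As an infimum it makes sense
  before the roots are known to converge.\<close>

definition sp :: "'a \<Rightarrow> real" where "sp x = (INF n. root (Suc n) (p (x [^] Suc n)))"

lemma sp_bdd: "x \<in> carrier L \<Longrightarrow> bdd_below (range (\<lambda>n. root (Suc n) (p (x [^] Suc n))))"
  by (rule bdd_belowI[of _ 0]) (auto intro!: real_root_ge_zero p_nonneg simp del: nat_pow_Suc)

lemma sp_nonneg: "x \<in> carrier L \<Longrightarrow> 0 \<le> sp x"
  unfolding sp_def by (rule cINF_greatest) (auto intro!: real_root_ge_zero p_nonneg simp del: nat_pow_Suc)

lemma sp_power_le:
  assumes x: "x \<in> carrier L" shows "sp x ^ n \<le> p (x [^] n)"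
proof (cases n)
  case 0 then show ?thesis using p_one by simp
next
  case (Suc m)
  have "sp x \<le> root (Suc m) (p (x [^] Suc m))" unfolding sp_def by (rule cINF_lower[OF sp_bdd[OF x]]) simp
  then have "sp x ^ Suc m \<le> root (Suc m) (p (x [^] Suc m)) ^ Suc m" using sp_nonneg[OF x] by (rule power_mono)
  also have "\<dots> = p (x [^] Suc m)" using x by (intro real_root_pow_pos2) (auto intro!: p_nonneg simp del: nat_pow_Suc)
  finally show ?thesis using Suc by simp
qed

lemma sp_le: "x \<in> carrier L \<Longrightarrow> sp x \<le> p x"
  using sp_power_le[of x 1] by simp

lemma p_power_le: "x \<in> carrier L \<Longrightarrow> p (x [^] (n::nat)) \<le> p x ^ n"
proof (induction n)
  case (Suc n)
  have "p (x [^] Suc n) \<le> p (x [^] n) * p x" using Suc p_mult[of "x [^] n" x] by simp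
  also have "\<dots> \<le> p x ^ n * p x" using Suc p_nonneg by (intro mult_right_mono) auto
  finally show ?case by (simp add: mult.commute)
qed (simp add: p_one)

text \<open>One exponent M with \<open>p (x [^] M) \<le> s ^ M\<close> suffices: write n as a
  multiple of M plus a remainder r < M. The finitely many remainders are absorbed in C, which
  exceeds each of the ratios (p x / s)^r.\<close>

lemma p_power_bound:
  assumes x: "x \<in> carrier L" and d: "d > 0"
  shows "\<exists>C>0. \<forall>n::nat. p (x [^] n) \<le> C * (sp x + d) ^ n"
proof -
  define s where "s = sp x + d"
  have s: "s > 0" using sp_nonneg[OF x] d by (simp add: s_def)
  have "(INF n. root (Suc n) (p (x [^] Suc n))) < s" using d unfolding s_def sp_def by simp
  then obtain m where m: "root (Suc m) (p (x [^] Suc m)) < s"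
    using cINF_less_iff[OF _ sp_bdd[OF x]] by (auto simp del: nat_pow_Suc)
  define M where "M = Suc m"
  have pM: "p (x [^] M) \<le> s ^ M"
  proof -
    have "p (x [^] M) = root M (p (x [^] M)) ^ M" unfolding M_def using x
      by (intro real_root_pow_pos2[symmetric]) (auto intro!: p_nonneg simp del: nat_pow_Suc)
    also have "\<dots> \<le> s ^ M" using m x unfolding M_def[symmetric]
      by (intro power_mono) (auto intro!: real_root_ge_zero p_nonneg)
    finally show ?thesis .
  qed
  define C where "C = 1 + (\<Sum>r<M. (p x / s) ^ r)"
  have C1: "C > 0" unfolding C_def using s p_nonneg[OF x] by (intro add_pos_nonneg sum_nonneg) auto
  have Cr: "p x ^ r \<le> C * s ^ r" if "r < M" for r
  proof -
    have "(p x / s) ^ r \<le> (\<Sum>r<M. (p x / s) ^ r)"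
      using that s p_nonneg[OF x] by (intro member_le_sum) auto
    then have "(p x / s) ^ r \<le> C" unfolding C_def by simp
    then show ?thesis using s by (simp add: power_divide pos_divide_le_eq)
  qed
  have "p (x [^] n) \<le> C * s ^ n" for n :: nat
  proof -
    have n: "n = M * (n div M) + n mod M" by simp
    have "x [^] n = (x [^] M) [^] (n div M) \<otimes> x [^] (n mod M)"
      using x by (subst n) (simp only: nat_pow_mult[symmetric] nat_pow_pow)
    then have "p (x [^] n) \<le> p ((x [^] M) [^] (n div M)) * p (x [^] (n mod M))"
      using p_mult x by simp
    also have "\<dots> \<le> (s ^ M) ^ (n div M) * (C * s ^ (n mod M))"
    proof (rule mult_mono)
      have "p ((x [^] M) [^] (n div M)) \<le> p (x [^] M) ^ (n div M)" using p_power_le x by simp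
      also have "\<dots> \<le> (s ^ M) ^ (n div M)" using pM p_nonneg x by (intro power_mono) auto
      finally show "p ((x [^] M) [^] (n div M)) \<le> (s ^ M) ^ (n div M)" .
      show "p (x [^] (n mod M)) \<le> C * s ^ (n mod M)"
        using p_power_le[OF x] Cr[of "n mod M"] M_def order_trans by fastforce
    qed (use s x p_nonneg in auto)
    also have "\<dots> = C * s ^ (M * (n div M) + n mod M)" unfolding power_add power_mult by simp
    also have "M * (n div M) + n mod M = n" by simp
    finally show ?thesis .
  qed
  with C1 show ?thesis unfolding s_def by blast
qed

lemma sp_mult_le:
  assumes x: "x \<in> carrier L" and y: "y \<in> carrier L" shows "sp (x \<otimes> y) \<le> sp x * sp y"
proof (rule le_mult_epsilon)
  fix d :: real assume d: "d > 0"
  obtain C where C: "C > 0" "\<And>n::nat. p (x [^] n) \<le> C * (sp x + d) ^ n"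
    using p_power_bound[OF x d] by blast
  obtain D where D: "D > 0" "\<And>n::nat. p (y [^] n) \<le> D * (sp y + d) ^ n"
    using p_power_bound[OF y d] by blast
  show "sp (x \<otimes> y) \<le> (sp x + d) * (sp y + d)"
  proof (rule power_bound_le)
    fix n
    have "sp (x \<otimes> y) ^ n \<le> p (x [^] n \<otimes> y [^] n)"
      using sp_power_le[of "x \<otimes> y" n] x y by (simp add: nat_pow_distrib)
    also have "\<dots> \<le> p (x [^] n) * p (y [^] n)" using p_mult x y by simp
    also have "\<dots> \<le> (C * (sp x + d) ^ n) * (D * (sp y + d) ^ n)"
      using C D p_nonneg x y sp_nonneg d by (intro mult_mono) auto
    finally show "sp (x \<otimes> y) ^ n \<le> (C * D) * ((sp x + d) * (sp y + d)) ^ n"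
      by (simp add: power_mult_distrib mult_ac)
  qed (use sp_nonneg x y d in auto)
qed

text \<open>An ultrametric form of the binomial theorem. The extra factor h lets the induction
  expand one factor x + y at a time, so that binomial coefficients never appear.\<close>

lemma p_add_power:
  assumes x: "x \<in> carrier L" and y: "y \<in> carrier L"
  shows "h \<in> carrier L \<Longrightarrow> (\<And>i j. i + j = n \<Longrightarrow> p (x [^] i \<otimes> y [^] j \<otimes> h) \<le> M) \<Longrightarrow>
    p ((x \<oplus> y) [^] (n::nat) \<otimes> h) \<le> M"
proof (induction n arbitrary: h)
  case 0 then show ?case using 0(2)[of 0 0] by simp
next
  case (Suc n)
  have e: "(x \<oplus> y) [^] Suc n \<otimes> h = (x \<oplus> y) [^] n \<otimes> (x \<otimes> h) \<oplus> (x \<oplus> y) [^] n \<otimes> (y \<otimes> h)"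
    using x y Suc(2) by (simp add: m_assoc l_distr r_distr)
  have 1: "p ((x \<oplus> y) [^] n \<otimes> (x \<otimes> h)) \<le> M"
  proof (rule Suc.IH)
    fix i j assume "i + j = n"
    moreover have "x [^] i \<otimes> y [^] j \<otimes> (x \<otimes> h) = x [^] Suc i \<otimes> y [^] j \<otimes> h"
      using x y Suc(2) by (simp add: m_ac)
    ultimately show "p (x [^] i \<otimes> y [^] j \<otimes> (x \<otimes> h)) \<le> M" using Suc(3)[of "Suc i" j] by simp
  qed (use x Suc(2) in simp)
  have 2: "p ((x \<oplus> y) [^] n \<otimes> (y \<otimes> h)) \<le> M"
  proof (rule Suc.IH)
    fix i j assume "i + j = n"
    moreover have "x [^] i \<otimes> y [^] j \<otimes> (y \<otimes> h) = x [^] i \<otimes> y [^] Suc j \<otimes> h"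
      using x y Suc(2) by (simp add: m_ac)
    ultimately show "p (x [^] i \<otimes> y [^] j \<otimes> (y \<otimes> h)) \<le> M" using Suc(3)[of i "Suc j"] by simp
  qed (use y Suc(2) in simp)
  show ?case unfolding e
    using p_add[of "(x \<oplus> y) [^] n \<otimes> (x \<otimes> h)" "(x \<oplus> y) [^] n \<otimes> (y \<otimes> h)"] 1 2 x y Suc(2) by simp
qed

lemma sp_add:
  assumes x: "x \<in> carrier L" and y: "y \<in> carrier L" shows "sp (x \<oplus> y) \<le> max (sp x) (sp y)"
proof (rule field_le_epsilon)
  fix d :: real assume d: "d > 0"
  define m where "m = max (sp x) (sp y) + d"
  have m: "m > 0" "sp x + d \<le> m" "sp y + d \<le> m" unfolding m_def using sp_nonneg[OF x] d by auto
  obtain C where C: "C > 0" "\<And>n::nat. p (x [^] n) \<le> C * (sp x + d) ^ n"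
    using p_power_bound[OF x d] by blast
  obtain D where D: "D > 0" "\<And>n::nat. p (y [^] n) \<le> D * (sp y + d) ^ n"
    using p_power_bound[OF y d] by blast
  have "sp (x \<oplus> y) \<le> m"
  proof (rule power_bound_le)
    fix n
    have "p ((x \<oplus> y) [^] n \<otimes> \<one>) \<le> (C * D) * m ^ n"
    proof (rule p_add_power[OF x y])
      fix i j :: nat assume ij: "i + j = n"
      have "p (x [^] i \<otimes> y [^] j \<otimes> \<one>) \<le> p (x [^] i) * p (y [^] j)" using p_mult x y by simp
      also have "\<dots> \<le> (C * m ^ i) * (D * m ^ j)"
      proof (rule mult_mono)
        show "p (x [^] i) \<le> C * m ^ i"
          by (rule order_trans[OF C(2)]) (use C(1) m sp_nonneg[OF x] d in \<open>auto intro!: power_mono\<close>)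
        show "p (y [^] j) \<le> D * m ^ j"
          by (rule order_trans[OF D(2)]) (use D(1) m sp_nonneg[OF y] d in \<open>auto intro!: power_mono\<close>)
      qed (use C m p_nonneg x y in auto)
      finally show "p (x [^] i \<otimes> y [^] j \<otimes> \<one>) \<le> (C * D) * m ^ n"
        using ij by (simp add: power_add[symmetric] mult_ac)
    qed simp
    then show "sp (x \<oplus> y) ^ n \<le> (C * D) * m ^ n"
      using sp_power_le[of "x \<oplus> y" n] x y by simp
  qed (use sp_nonneg x y m in auto)
  then show "sp (x \<oplus> y) \<le> max (sp x) (sp y) + d" unfolding m_def .
qed

lemma p_k: "a \<in> k \<Longrightarrow> p a = v a"
  using p_smult[of a \<one>] p_one kc by simp

lemma sp_smult:
  assumes a: "a \<in> k" and x: "x \<in> carrier L" shows "sp (a \<otimes> x) = v a * sp x"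
proof -
  have le: "sp (b \<otimes> y) \<le> v b * sp y" if "b \<in> k" "y \<in> carrier L" for b y
    using sp_mult_le[of b y] sp_le[of b] p_k[of b] kc[of b] that sp_nonneg[of y]
    by (metis mult_right_mono order_trans)
  show ?thesis
  proof (cases "a = \<zero>")
    case True
    then show ?thesis using le[OF a x] sp_nonneg[of \<zero>] v_zero[OF a] x by simp
  next
    case False
    have i: "inv a \<in> k" "inv a \<otimes> a = \<one>" using kinv[OF a False] by auto
    have "inv a \<otimes> (a \<otimes> x) = x" using i a x kc by (simp add: m_assoc[symmetric])
    then have "sp x \<le> v (inv a) * sp (a \<otimes> x)" using le[OF i(1), of "a \<otimes> x"] a x kc by simp
    then have "v a * sp x \<le> v a * (v (inv a) * sp (a \<otimes> x))" using v_nonneg[OF a] by (rule mult_left_mono)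
    also have "\<dots> = sp (a \<otimes> x)" using v_mult[OF i(1) a] i(2) v_one by (simp add: mult_ac)
    finally show ?thesis using le[OF a x] by simp
  qed
qed

lemma sp_one: "sp \<one> = 1"
proof -
  have "sp \<one> * sp \<one> \<ge> sp \<one>" using sp_mult_le[of \<one> \<one>] by simp
  moreover have "sp \<one> = v \<one> * sp \<one>" using sp_smult[of \<one> \<one>] subringE(3)[OF ksr] by simp
  moreover have "sp \<one> \<ge> 1" unfolding sp_def by (rule cINF_greatest) (auto simp: p_one)
  moreover have "sp \<one> \<le> 1" using sp_le[of \<one>] p_one by simp
  ultimately show ?thesis by simp
qed

lemma sp_submult: "submult_norm L k v sp"
  by unfold_locales (use sp_nonneg sp_one sp_add sp_mult_le sp_smult in auto)

lemma sp_pow: 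
  assumes x: "x \<in> carrier L" shows "sp (x [^] (n::nat)) = sp x ^ n"
proof (rule antisym)
  interpret S: submult_norm L k v sp by (rule sp_submult)
  show "sp (x [^] n) \<le> sp x ^ n" by (rule S.p_power_le[OF x])
  show "sp x ^ n \<le> sp (x [^] n)"
    unfolding sp_def[of "x [^] n"]
  proof (rule cINF_greatest)
    fix m
    have "(sp x ^ n) ^ Suc m \<le> p ((x [^] n) [^] Suc m)"
      using sp_power_le[OF x, of "n * Suc m"] unfolding nat_pow_pow[OF x] power_mult .
    then have "root (Suc m) ((sp x ^ n) ^ Suc m) \<le> root (Suc m) (p ((x [^] n) [^] Suc m))"
      by (rule real_root_le_mono[OF zero_less_Suc])
    then show "sp x ^ n \<le> root (Suc m) (p ((x [^] n) [^] Suc m))"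
      using real_root_power_cancel[of "Suc m" "sp x ^ n"] sp_nonneg[OF x] by (simp del: nat_pow_Suc power_Suc)
  qed simp
qed

lemma sp_pos: "x \<in> carrier L \<Longrightarrow> x \<noteq> \<zero> \<Longrightarrow> 0 < sp x"
  using submult_norm.p_ne[OF sp_submult] sp_nonneg by (metis less_eq_real_def)

text \<open>The quotients \<open>t g n\<close> of sp (g f^n) by (sp f)^n decrease with n, and their
  limit q is again a submultiplicative norm, at most \<open>sp\<close>. Finite dimension gives sp
  \<le> C q; as \<open>sp\<close> respects powers, the constant can be removed, so that sp g \<le> q
  g \<le> sp (g f) / sp f.\<close>

lemma sp_mult:
  assumes us: "set us \<subseteq> carrier L" "lspan L k us = carrier L"
    and g: "g \<in> carrier L" and f: "f \<in> carrier L"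
  shows "sp (g \<otimes> f) = sp g * sp f"
proof (cases "f = \<zero>")
  case True
  then show ?thesis using g submult_norm.p_knorm[OF sp_submult] knorm_zero by simp
next
  case False
  note sf = sp_pos[OF f False]
  define t where "t = (\<lambda>g n. sp (g \<otimes> f [^] n) / sp f ^ (n::nat))"
  define q where "q = (\<lambda>g. INF n. t g n)"
  have q_eq: "q g = (INF n. t g n)" for g by (simp add: q_def)
  have t_nonneg: "0 \<le> t g n" if "g \<in> carrier L" for g n
    unfolding t_def using that f sp_nonneg sf by simp
  have bdd: "bdd_below (range (t g))" if "g \<in> carrier L" for g
    using t_nonneg[OF that] by (intro bdd_belowI[of _ 0]) auto
  have t_dec: "t g (Suc n) \<le> t g n" if "g \<in> carrier L" for g n
  proof -
    have "sp (g \<otimes> f [^] Suc n) \<le> sp (g \<otimes> f [^] n) * sp f"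
      using sp_mult_le[of "g \<otimes> f [^] n" f] that f by (simp add: m_assoc)
    then show ?thesis unfolding t_def using sf by (simp add: field_simps)
  qed
  have t_anti: "t g m \<le> t g n" if "g \<in> carrier L" "n \<le> m" for g n m
    using lift_Suc_antimono_le[of "t g", OF t_dec[OF that(1)] that(2)] .
  have q_le: "q g \<le> t g n" if "g \<in> carrier L" for g n
    unfolding q_def by (rule cINF_lower[OF bdd[OF that]]) simp
  have q_nonneg: "0 \<le> q g" if "g \<in> carrier L" for g
    unfolding q_def using t_nonneg[OF that] by (intro cINF_greatest) auto
  have q_app: "\<exists>n. t g n < q g + d" if "g \<in> carrier L" "d > 0" for g d
  proof -
    have "(INF n. t g n) < q g + d" using that(2) unfolding q_def by simp
    then show ?thesis using cINF_less_iff[OF _ bdd[OF that(1)]] by auto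
  qed
  have t_one: "t \<one> n = 1" for n unfolding t_def using sp_pow[OF f] f sf by simp
  have q_one: "q \<one> = 1" unfolding q_def by (simp add: t_one)
  have q_sp: "q g \<le> sp g" if "g \<in> carrier L" for g
    using q_le[OF that, of 0] that unfolding t_def by simp
  have q_mult: "q (g \<otimes> h) \<le> q g * q h" if gh: "g \<in> carrier L" "h \<in> carrier L" for g h
  proof (rule le_mult_epsilon)
    fix d :: real assume d: "d > 0"
    obtain n where n: "t g n < q g + d" using q_app[OF gh(1) d] by blast
    obtain m where m: "t h m < q h + d" using q_app[OF gh(2) d] by blast
    have "(g \<otimes> h) \<otimes> f [^] (n + m) = (g \<otimes> f [^] n) \<otimes> (h \<otimes> f [^] m)"
      using gh f by (simp add: nat_pow_mult[symmetric] m_ac)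
    then have "sp ((g \<otimes> h) \<otimes> f [^] (n + m)) \<le> sp (g \<otimes> f [^] n) * sp (h \<otimes> f [^] m)"
      using sp_mult_le gh f by simp
    then have "t (g \<otimes> h) (n + m) \<le> t g n * t h m"
      unfolding t_def using sf by (simp add: power_add divide_right_mono)
    also have "\<dots> \<le> (q g + d) * (q h + d)"
      using n m t_nonneg gh q_nonneg d by (intro mult_mono) (auto intro: less_imp_le add_nonneg_nonneg)
    finally show "q (g \<otimes> h) \<le> (q g + d) * (q h + d)"
      using q_le[of "g \<otimes> h" "n + m"] gh by simp
  qed
  have max_div: "a / c \<le> max (x / c) (y / c)" if "c > 0" "a \<le> max x y" for a c x y :: real
    using that by (auto simp: le_max_iff_disj divide_right_mono)
  have q_add: "q (g \<oplus> h) \<le> q g + q h" if gh: "g \<in> carrier L" "h \<in> carrier L" for g h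
  proof (rule field_le_epsilon)
    fix e :: real assume e: "e > 0"
    obtain n where n: "t g n < q g + e" using q_app[OF gh(1) e] by blast
    obtain m where m: "t h m < q h + e" using q_app[OF gh(2) e] by blast
    define N where "N = max n m"
    have "(g \<oplus> h) \<otimes> f [^] N = g \<otimes> f [^] N \<oplus> h \<otimes> f [^] N" using gh f by (simp add: l_distr)
    then have "sp ((g \<oplus> h) \<otimes> f [^] N) \<le> max (sp (g \<otimes> f [^] N)) (sp (h \<otimes> f [^] N))"
      using sp_add gh f by simp
    then have "t (g \<oplus> h) N \<le> max (t g N) (t h N)"
      unfolding t_def using max_div[of "sp f ^ N"] sf by simp
    moreover have "t g N < q g + e" "t h N < q h + e"
      using t_anti[of g n N] t_anti[of h m N] n m gh unfolding N_def by auto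
    ultimately show "q (g \<oplus> h) \<le> q g + q h + e"
      using q_le[of "g \<oplus> h" N] gh q_nonneg[of g] q_nonneg[of h] by simp
  qed
  have q_smult: "q (a \<otimes> g) = v a * q g" if a: "a \<in> k" and g: "g \<in> carrier L" for a g
  proof -
    have ts: "t (b \<otimes> g) n = v b * t g n" if "b \<in> k" "g \<in> carrier L" for b g n
      unfolding t_def using sp_smult[OF that(1), of "g \<otimes> f [^] n"] that f kc by (simp add: m_assoc)
    have le: "q (b \<otimes> g) \<le> v b * q g" if b: "b \<in> k" and g: "g \<in> carrier L" for b g
    proof (cases "v b = 0")
      case True
      then show ?thesis using ts[OF b g, of 0] q_le[of "b \<otimes> g" 0] b g kc by simp
    next
      case False
      then have vb: "v b > 0" using v_nonneg[OF b] by simp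
      have "q (b \<otimes> g) / v b \<le> q g"
      proof -
        have "q (b \<otimes> g) / v b \<le> t g n" for n
          using q_le[of "b \<otimes> g" n] ts[OF b g, of n] b g kc vb by (simp add: pos_divide_le_eq mult.commute)
        then show "q (b \<otimes> g) / v b \<le> q g" unfolding q_eq[of g] by (intro cINF_greatest) auto
      qed
      then show ?thesis using vb by (simp add: pos_divide_le_eq mult.commute)
    qed
    show ?thesis
    proof (cases "a = \<zero>")
      case True
      then show ?thesis using le[OF a g] q_nonneg[of "a \<otimes> g"] v_zero[OF a] g by simp
    next
      case False
      have i: "inv a \<in> k" "inv a \<otimes> a = \<one>" using kinv[OF a False] by auto
      have "inv a \<otimes> (a \<otimes> g) = g" using i a g kc by (simp add: m_assoc[symmetric])
      then have "q g \<le> v (inv a) * q (a \<otimes> g)" using le[OF i(1), of "a \<otimes> g"] a g kc by simp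
      then have "v a * q g \<le> v a * (v (inv a) * q (a \<otimes> g))" using v_nonneg[OF a] by (rule mult_left_mono)
      also have "\<dots> = q (a \<otimes> g)" using v_mult[OF i(1) a] i(2) v_one by (simp add: mult_ac)
      finally show ?thesis using le[OF a g] by simp
    qed
  qed
  have q_knorm: "knorm q"
    unfolding knorm_def
  proof (intro conjI ballI impI q_nonneg q_add q_smult)
    fix x assume x: "x \<in> carrier L" "q x = 0"
    show "x = \<zero>"
    proof (rule ccontr)
      assume "x \<noteq> \<zero>"
      then have "x \<otimes> inv x = \<one>" "inv x \<in> carrier L" using x by (simp_all add: field_Units)
      then show False using q_mult[OF x(1), of "inv x"] q_one x(2) by simp
    qed
  qed
  obtain C where C: "\<And>y. y \<in> carrier L \<Longrightarrow> sp y \<le> C * q y" "C \<ge> 0"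
    using norm_equivalence[OF q_knorm submult_norm.p_knorm[OF sp_submult] us(1)] us(2) by auto
  have qp: "q (g [^] n) \<le> q g ^ n" for n :: nat
  proof (induction n)
    case (Suc n)
    have "q (g [^] Suc n) \<le> q (g [^] n) * q g" using q_mult[of "g [^] n" g] g by simp
    also have "\<dots> \<le> q g ^ n * q g" using Suc q_nonneg[OF g] by (rule mult_right_mono)
    finally show ?case by (simp add: mult.commute)
  qed (simp add: q_one)
  have "sp g \<le> q g"
  proof (rule power_bound_le)
    show "sp g ^ n \<le> C * q g ^ n" for n
      using C(1)[of "g [^] n"] mult_left_mono[OF qp[of n] C(2)] sp_pow[OF g] g by simp
  qed (use sp_nonneg q_nonneg g in auto)
  also have "\<dots> \<le> sp (g \<otimes> f) / sp f" using q_le[OF g, of 1] f g unfolding t_def by simp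
  finally have "sp g * sp f \<le> sp (g \<otimes> f)" using sf by (simp add: pos_le_divide_eq)
  then show ?thesis using sp_mult_le[OF g f] by simp
qed

end

section \<open>Residue fields of Banach algebras\<close>

context field begin

text \<open>Elimination takes the place of a determinant. In the relation for the first generator m
  its own coefficient is moved to the left, so that t2 = t - e a carries m into e times the span of
  the others; multiplying the remaining relations by t2 removes m from them. All multipliers stay
  congruent to 1 modulo e.\<close>

lemma nakayama_annihilator:
  assumes A: "subring A R" and e: "e \<in> A"
  shows "set ms \<subseteq> carrier R \<Longrightarrow> \<exists>a\<in>A. t = \<one> \<oplus> e \<otimes> a \<Longrightarrow>
    (\<forall>m\<in>set ms. \<exists>x\<in>lspan R A ms. t \<otimes> m = e \<otimes> x) \<Longrightarrow>
    \<exists>t'. (\<exists>a\<in>A. t' = \<one> \<oplus> e \<otimes> a) \<and> (\<forall>m\<in>set ms. t' \<otimes> m = \<zero>)"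
proof (induction ms arbitrary: t)
  case Nil
  then show ?case by auto
next
  case (Cons m ms)
  have Ac: "x \<in> A \<Longrightarrow> x \<in> carrier R" for x using subringE(1)[OF A] by blast
  have ms: "set ms \<subseteq> carrier R" and m: "m \<in> carrier R" using Cons.prems(1) by auto
  note sc = lspan_carrier[OF subringE(1)[OF A] ms]
  have ec: "e \<in> carrier R" using e Ac by simp
  obtain b where b: "b \<in> A" "t = \<one> \<oplus> e \<otimes> b" using Cons.prems(2) by blast
  have tc: "t \<in> carrier R" using b ec Ac by simp
  obtain a x where ax: "a \<in> A" "x \<in> lspan R A ms" "t \<otimes> m = e \<otimes> (a \<otimes> m \<oplus> x)"
    using Cons.prems(3) by auto
  have c: "a \<in> carrier R" "x \<in> carrier R" "b \<in> carrier R" using ax b Ac sc by auto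
  define t2 where "t2 = t \<ominus> e \<otimes> a"
  have t2c: "t2 \<in> carrier R" unfolding t2_def using tc ec c by simp
  have t2m: "t2 \<otimes> m = e \<otimes> x"
  proof -
    have "t2 \<otimes> m = t \<otimes> m \<ominus> e \<otimes> (a \<otimes> m)" unfolding t2_def using tc ec c m by algebra
    then show ?thesis unfolding ax(3) using ec c m by algebra
  qed
  have t2A: "t2 \<in> A"
    unfolding t2_def b(2) using subringE(3,5,6,7)[OF A] e ax(1) b(1) by (simp add: minus_eq)
  have step: "\<exists>y\<in>lspan R A ms. (t \<otimes> t2) \<otimes> m' = e \<otimes> y" if m': "m' \<in> set ms" for m'
  proof -
    obtain a' x' where a': "a' \<in> A" "x' \<in> lspan R A ms" "t \<otimes> m' = e \<otimes> (a' \<otimes> m \<oplus> x')"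
      using Cons.prems(3) m' by auto
    have c': "a' \<in> carrier R" "x' \<in> carrier R" "m' \<in> carrier R" using a' Ac sc ms m' by auto
    have "(t \<otimes> t2) \<otimes> m' = t2 \<otimes> (t \<otimes> m')" using tc t2c c' by algebra
    also have "\<dots> = e \<otimes> (a' \<otimes> (t2 \<otimes> m) \<oplus> t2 \<otimes> x')" unfolding a'(3) using tc t2c c' m ec by algebra
    finally have eq: "(t \<otimes> t2) \<otimes> m' = e \<otimes> (a' \<otimes> (e \<otimes> x) \<oplus> t2 \<otimes> x')" unfolding t2m .
    have "a' \<otimes> (e \<otimes> x) \<oplus> t2 \<otimes> x' \<in> lspan R A ms"
      using lspan_add[OF A ms] lspan_smult[OF A ms] a'(1,2) e ax(2) t2A by simp
    with eq show ?thesis by blast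
  qed
  have "b \<oplus> (b \<ominus> a) \<oplus> e \<otimes> b \<otimes> (b \<ominus> a) \<in> A"
    using subringE(3,5,6,7)[OF A] e ax(1) b(1) by (simp add: minus_eq)
  moreover have "t \<otimes> t2 = \<one> \<oplus> e \<otimes> (b \<oplus> (b \<ominus> a) \<oplus> e \<otimes> b \<otimes> (b \<ominus> a))"
    unfolding t2_def b(2) using ec c by algebra
  ultimately have "\<exists>t3. (\<exists>a\<in>A. t3 = \<one> \<oplus> e \<otimes> a) \<and> (\<forall>m\<in>set ms. t3 \<otimes> m = \<zero>)"
    using step by (intro Cons.IH[OF ms, of "t \<otimes> t2"]) blast+
  then obtain t3 d where t3: "d \<in> A" "t3 = \<one> \<oplus> e \<otimes> d" "\<And>m'. m' \<in> set ms \<Longrightarrow> t3 \<otimes> m' = \<zero>" by blast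
  have dc: "d \<in> carrier R" "t3 \<in> carrier R" using t3 Ac ec by auto
  have kill: "t3 \<otimes> y = \<zero>" if "y \<in> lspan R A us" "set us \<subseteq> set ms" for y us
    using that
  proof (induction us arbitrary: y)
    case Nil then show ?case using dc by simp
  next
    case (Cons u us)
    obtain r w where r: "r \<in> A" "w \<in> lspan R A us" "y = r \<otimes> u \<oplus> w" using Cons.prems by auto
    have cc: "r \<in> carrier R" "u \<in> carrier R" "w \<in> carrier R"
      using r Ac Cons.prems(2) ms lspan_carrier[OF subringE(1)[OF A], of us] by auto
    have "t3 \<otimes> y = r \<otimes> (t3 \<otimes> u) \<oplus> t3 \<otimes> w" unfolding r(3) using cc dc by algebra
    then show ?case using t3(3)[of u] Cons.IH[OF r(2)] Cons.prems(2) cc by simp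
  qed
  \<comment> \<open>t3 kills the span of \<open>ms\<close>, and t2 carries m into e times this span,
    so the product kills m as well.\<close>
  show ?case
  proof (intro exI conjI ballI)
    show "\<exists>a\<in>A. t3 \<otimes> t2 = \<one> \<oplus> e \<otimes> a"
    proof
      show "d \<oplus> (b \<ominus> a) \<oplus> e \<otimes> d \<otimes> (b \<ominus> a) \<in> A"
        using subringE(3,5,6,7)[OF A] e ax(1) b(1) t3(1) by (simp add: minus_eq)
      show "t3 \<otimes> t2 = \<one> \<oplus> e \<otimes> (d \<oplus> (b \<ominus> a) \<oplus> e \<otimes> d \<otimes> (b \<ominus> a))"
        unfolding t2_def b(2) t3(2) using ec c dc by algebra
    qed
    fix m' assume m': "m' \<in> set (m # ms)"
    then have m'c: "m' \<in> carrier R" using ms m by auto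
    show "(t3 \<otimes> t2) \<otimes> m' = \<zero>"
    proof (cases "m' = m")
      case True
      have "(t3 \<otimes> t2) \<otimes> m = t3 \<otimes> (e \<otimes> x)" using dc t2c m by (simp add: m_assoc t2m)
      also have "\<dots> = e \<otimes> (t3 \<otimes> x)" using dc c ec by algebra
      finally show ?thesis using kill[OF ax(2)] ec True by simp
    next
      case False
      have "(t3 \<otimes> t2) \<otimes> m' = t2 \<otimes> (t3 \<otimes> m')" using dc t2c m'c by algebra
      then show ?thesis using t3(3)[of m'] False m' t2c by simp
    qed
  qed
qed

text \<open>The module spanned by \<open>ms\<close> is stable under multiplication by 1/e, so it
  equals e times itself, and some 1 + e a with a in A annihilates it. As it contains 1, this element
  is zero and 1/e = -a. The lemma serves to show that a ring over which a field is finitely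
  generated as a module is itself a field.\<close>

lemma nakayama_inverse:
  assumes A: "subring A R" and e: "e \<in> A" "e \<noteq> \<zero>" and ms: "set ms \<subseteq> carrier R"
    and one: "\<one> \<in> lspan R A ms" and M: "\<And>m. m \<in> set ms \<Longrightarrow> inv e \<otimes> m \<in> lspan R A ms"
  shows "inv e \<in> A"
proof -
  have Ac: "x \<in> A \<Longrightarrow> x \<in> carrier R" for x using subringE(1)[OF A] by blast
  have ec: "e \<in> carrier R" "inv e \<in> carrier R" "e \<otimes> inv e = \<one>"
    using e Ac by (auto simp: field_Units)
  have "\<exists>t'. (\<exists>a\<in>A. t' = \<one> \<oplus> e \<otimes> a) \<and> (\<forall>m\<in>set ms. t' \<otimes> m = \<zero>)"
  proof (rule nakayama_annihilator[OF A e(1) ms])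
    show "\<exists>a\<in>A. \<one> = \<one> \<oplus> e \<otimes> a" using subringE(2)[OF A] ec by (intro bexI[of _ \<zero>]) simp_all
    show "\<forall>m\<in>set ms. \<exists>x\<in>lspan R A ms. \<one> \<otimes> m = e \<otimes> x"
    proof
      fix m assume m: "m \<in> set ms"
      then have "\<one> \<otimes> m = e \<otimes> (inv e \<otimes> m)" using ms ec by (auto simp: m_assoc[symmetric])
      then show "\<exists>x\<in>lspan R A ms. \<one> \<otimes> m = e \<otimes> x" using M[OF m] by blast
    qed
  qed
  then obtain t a where t: "a \<in> A" "t = \<one> \<oplus> e \<otimes> a" "\<And>m. m \<in> set ms \<Longrightarrow> t \<otimes> m = \<zero>" by blast
  have tc: "t \<in> carrier R" "a \<in> carrier R" using t Ac ec by auto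
  have kill: "t \<otimes> y = \<zero>" if "y \<in> lspan R A us" "set us \<subseteq> set ms" for y us
    using that
  proof (induction us arbitrary: y)
    case Nil then show ?case using tc by simp
  next
    case (Cons u us)
    obtain r w where r: "r \<in> A" "w \<in> lspan R A us" "y = r \<otimes> u \<oplus> w" using Cons.prems by auto
    have cc: "r \<in> carrier R" "u \<in> carrier R" "w \<in> carrier R"
      using r Ac Cons.prems(2) ms lspan_carrier[OF subringE(1)[OF A], of us] by auto
    have "t \<otimes> y = r \<otimes> (t \<otimes> u) \<oplus> t \<otimes> w" unfolding r(3) using cc tc by algebra
    then show ?case using t(3)[of u] Cons.IH[OF r(2)] Cons.prems(2) cc by simp
  qed
  have "t = \<zero>" using kill[OF one] tc by simp
  then have "inv e \<otimes> (\<one> \<oplus> e \<otimes> a) = \<zero>" using t(2) ec by simp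
  then have "inv e \<oplus> (e \<otimes> inv e) \<otimes> a = \<zero>" using ec(1,2) tc(2) by algebra
  then have "inv e \<oplus> a = \<zero>" using ec tc by simp
  then have "inv e = \<ominus> a" using ec tc by (simp add: sum_zero_eq_neg)
  then show ?thesis using subringE(5)[OF A t(1)] by simp
qed

end

lemma (in cring) lspan_tower:
  assumes k: "subring k R" and ws: "set ws \<subseteq> carrier R" and bs: "set bs \<subseteq> carrier R"
    and A: "A \<subseteq> lspan R k bs"
  shows "lspan R A ws \<subseteq> lspan R k (concat (map (\<lambda>w. map (\<lambda>b. b \<otimes> w) bs) ws))"
  using ws
proof (induction ws)
  case Nil then show ?case by simp
next
  case (Cons w ws)
  let ?cs = "concat (map (\<lambda>w. map (\<lambda>b. b \<otimes> w) bs) ws)" and ?bw = "map (\<lambda>b. b \<otimes> w) bs"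
  have w: "w \<in> carrier R" using Cons by simp
  have cs: "set (?bw @ ?cs) \<subseteq> carrier R" using Cons.prems bs by auto
  have 1: "a \<otimes> w \<in> lspan R k (map (\<lambda>b. b \<otimes> w) bs)" if "a \<in> lspan R k bs" "set bs \<subseteq> carrier R" for a bs
    using that
  proof (induction bs arbitrary: a)
    case Nil then show ?case using w by simp
  next
    case (Cons b bs)
    obtain r x where r: "r \<in> k" "x \<in> lspan R k bs" "a = r \<otimes> b \<oplus> x" using Cons.prems by auto
    have cc: "r \<in> carrier R" "b \<in> carrier R" "x \<in> carrier R"
      using r Cons.prems(2) lspan_carrier[OF subringE(1)[OF k], of bs] subringE(1)[OF k] by auto
    have "a \<otimes> w = r \<otimes> (b \<otimes> w) \<oplus> x \<otimes> w" unfolding r(3) using cc w by algebra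
    moreover have "x \<otimes> w \<in> lspan R k (map (\<lambda>b. b \<otimes> w) bs)" using Cons r by simp
    ultimately show ?case unfolding list.map using r(1) by (intro lspan_ConsI)
  qed
  have sub1: "lspan R k ?bw \<subseteq> lspan R k (?bw @ ?cs)"
    using lspan_member[OF k cs] by (intro lspan_subset[OF k cs]) auto
  have sub2: "lspan R k ?cs \<subseteq> lspan R k (?bw @ ?cs)"
    using lspan_member[OF k cs] by (intro lspan_subset[OF k cs]) auto
  have IH: "lspan R A ws \<subseteq> lspan R k ?cs" using Cons by simp
  show ?case
  proof
    fix x assume "x \<in> lspan R A (w # ws)"
    then obtain a y where ay: "x = a \<otimes> w \<oplus> y" "a \<in> A" "y \<in> lspan R A ws" by auto
    have "a \<otimes> w \<in> lspan R k (?bw @ ?cs)" using 1[of a bs] ay(2) A bs sub1 by blast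
    moreover have "y \<in> lspan R k (?bw @ ?cs)" using ay(3) IH sub2 by blast
    ultimately show "x \<in> lspan R k (concat (map (\<lambda>w. map (\<lambda>b. b \<otimes> w) bs) (w # ws)))"
      using lspan_add[OF k cs] ay(1) by simp
  qed
qed

lemma (in ring_hom_cring) lspan_image:
  assumes "A \<subseteq> carrier R" "set us \<subseteq> carrier R"
  shows "h ` lspan R A us = lspan S (h ` A) (map h us)"
  using assms(2)
proof (induction us)
  case Nil then show ?case by simp
next
  case (Cons u us)
  have c: "lspan R A us \<subseteq> carrier R" using Cons.prems by (intro R.lspan_carrier[OF assms(1)]) simp
  have e: "h (a \<otimes> u \<oplus> w) = h a \<otimes>\<^bsub>S\<^esub> h u \<oplus>\<^bsub>S\<^esub> h w" if "a \<in> A" "w \<in> lspan R A us" for a w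
    using that assms(1) Cons.prems c by (auto simp: subset_iff)
  show ?case
  proof (rule antisym; rule subsetI)
    fix x assume "x \<in> h ` lspan R A (u # us)"
    then obtain a w where "a \<in> A" "w \<in> lspan R A us" "x = h (a \<otimes> u \<oplus> w)" by auto
    then show "x \<in> lspan S (h ` A) (map h (u # us))"
      using e Cons unfolding list.map by (intro lspan_ConsI[where a="h a" and w="h w"]) auto
  next
    fix x assume "x \<in> lspan S (h ` A) (map h (u # us))"
    then obtain a w' where aw: "a \<in> A" "w' \<in> lspan S (h ` A) (map h us)" "x = h a \<otimes>\<^bsub>S\<^esub> h u \<oplus>\<^bsub>S\<^esub> w'" by auto
    then obtain w where w: "w \<in> lspan R A us" "w' = h w" using Cons by auto
    have "x = h (a \<otimes> u \<oplus> w)" using e aw w by simp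
    then show "x \<in> h ` lspan R A (u # us)" using lspan_ConsI[OF refl aw(1) w(1)] by blast
  qed
qed

section \<open>Ultrametric Banach algebras over K\<close>

locale banach_algebra = B: cring B + K: field K + ring_hom_cring K B \<kappa>
  for B :: "('b, 'n) ring_scheme" (structure) and K :: "('k, 'm) ring_scheme" and \<kappa> +
  fixes v :: "'k \<Rightarrow> real" and nm :: "'b \<Rightarrow> real"
  assumes av: "absolute_value K v" and na: "nonarchimedean K v"
    and nt: "nontrivial_value K v" and cv: "complete_value K v"
    and nm_nonneg: "x \<in> carrier B \<Longrightarrow> 0 \<le> nm x"
    and nm_zero: "x \<in> carrier B \<Longrightarrow> nm x = 0 \<longleftrightarrow> x = \<zero>"
    and nm_add: "x \<in> carrier B \<Longrightarrow> y \<in> carrier B \<Longrightarrow> nm (x \<oplus> y) \<le> max (nm x) (nm y)"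
    and nm_mult: "x \<in> carrier B \<Longrightarrow> y \<in> carrier B \<Longrightarrow> nm (x \<otimes> y) \<le> nm x * nm y"
    and nm_smult: "c \<in> carrier K \<Longrightarrow> x \<in> carrier B \<Longrightarrow> nm (\<kappa> c \<otimes> x) = v c * nm x"
    and nm_one: "nm \<one> = 1"
    and nm_complete: "\<And>s. (\<And>i. s i \<in> carrier B) \<Longrightarrow> value_Cauchy B nm s \<Longrightarrow>
        \<exists>l\<in>carrier B. (\<lambda>i. nm (s i \<ominus> l)) \<longlonglongrightarrow> 0"
begin

abbreviation K_zero ("0\<^sub>K") where "0\<^sub>K \<equiv> \<zero>\<^bsub>K\<^esub>"

abbreviation K_one ("1\<^sub>K") where "1\<^sub>K \<equiv> \<one>\<^bsub>K\<^esub>"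

abbreviation K_times (infixl "\<cdot>" 70) where "a \<cdot> b \<equiv> a \<otimes>\<^bsub>K\<^esub> b"

abbreviation K_minus (infixl "\<ominus>\<^sub>K" 65) where "a \<ominus>\<^sub>K b \<equiv> a \<ominus>\<^bsub>K\<^esub> b"

lemma v_nonneg: "c \<in> carrier K \<Longrightarrow> 0 \<le> v c"
  and v_zero: "c \<in> carrier K \<Longrightarrow> v c = 0 \<longleftrightarrow> c = 0\<^sub>K"
  and v_mult: "c \<in> carrier K \<Longrightarrow> d \<in> carrier K \<Longrightarrow> v (c \<cdot> d) = v c * v d"
  and v_add: "c \<in> carrier K \<Longrightarrow> d \<in> carrier K \<Longrightarrow> v (c \<oplus>\<^bsub>K\<^esub> d) \<le> max (v c) (v d)"
  using av na unfolding absolute_value_def nonarchimedean_def by blast+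

lemma v_one: "v 1\<^sub>K = 1"
  using v_mult[of "1\<^sub>K" "1\<^sub>K"] v_zero[of "1\<^sub>K"] by simp

lemma v_pow: "c \<in> carrier K \<Longrightarrow> v (c [^]\<^bsub>K\<^esub> (n::nat)) = v c ^ n"
  by (induction n) (simp_all add: v_one v_mult mult.commute)

lemma K_inv: "c \<in> carrier K \<Longrightarrow> c \<noteq> 0\<^sub>K \<Longrightarrow> inv\<^bsub>K\<^esub> c \<in> carrier K \<and> c \<cdot> inv\<^bsub>K\<^esub> c = 1\<^sub>K \<and>
    inv\<^bsub>K\<^esub> c \<noteq> 0\<^sub>K"
  by (metis K.Units_inv_closed K.Units_r_inv K.field_Units K.r_null K.zero_not_one DiffI empty_iff insert_iff)

lemma v_inv: "c \<in> carrier K \<Longrightarrow> c \<noteq> 0\<^sub>K \<Longrightarrow> v (inv\<^bsub>K\<^esub> c) = 1 / v c"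
  using v_mult[of c "inv\<^bsub>K\<^esub> c"] K_inv[of c] v_one v_zero[of c] by (simp add: field_simps)

lemma v_pos: "c \<in> carrier K \<Longrightarrow> c \<noteq> 0\<^sub>K \<Longrightarrow> 0 < v c"
  using v_nonneg[of c] v_zero[of c] by simp

lemma small_scalar: obtains c where "c \<in> carrier K" "c \<noteq> 0\<^sub>K" "v c < 1"
proof -
  obtain z where z: "z \<in> carrier K" "z \<noteq> 0\<^sub>K" "v z \<noteq> 1"
    using nt unfolding nontrivial_value_def by blast
  show ?thesis
  proof (cases "v z < 1")
    case False
    then have "v (inv\<^bsub>K\<^esub> z) < 1" using z v_inv[of z] by (simp add: divide_less_eq)
    then show ?thesis using that K_inv[of z] z by blast
  qed (use that z in blast)
qed

lemma nm_kappa: "c \<in> carrier K \<Longrightarrow> nm (\<kappa> c) = v c"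
  using nm_smult[of c \<one>] nm_one by simp

lemma nm_minus: "x \<in> carrier B \<Longrightarrow> nm (\<ominus> x) = nm x"
proof -
  assume x: "x \<in> carrier B"
  have "v (\<ominus>\<^bsub>K\<^esub> 1\<^sub>K) * v (\<ominus>\<^bsub>K\<^esub> 1\<^sub>K) = 1"
    using v_mult[of "\<ominus>\<^bsub>K\<^esub> 1\<^sub>K" "\<ominus>\<^bsub>K\<^esub> 1\<^sub>K"] v_one by (simp add: K.l_minus K.r_minus)
  then have "v (\<ominus>\<^bsub>K\<^esub> 1\<^sub>K) = 1" using v_nonneg[of "\<ominus>\<^bsub>K\<^esub> 1\<^sub>K"]
    by (metis K.add.inv_closed K.one_closed abs_of_nonneg power2_eq_1_iff power2_eq_square abs_1 abs_minus_cancel)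
  moreover have "\<ominus> x = \<kappa> (\<ominus>\<^bsub>K\<^esub> 1\<^sub>K) \<otimes> x" using x by (simp add: B.l_minus)
  ultimately show ?thesis using nm_smult[of "\<ominus>\<^bsub>K\<^esub> 1\<^sub>K" x] x by simp
qed

lemma nm_diff: "x \<in> carrier B \<Longrightarrow> y \<in> carrier B \<Longrightarrow> nm (x \<ominus> y) \<le> max (nm x) (nm y)"
  using nm_add[of x "\<ominus> y"] nm_minus[of y] by (simp add: B.minus_eq)

lemma nm_pow: "x \<in> carrier B \<Longrightarrow> nm (x [^] (n::nat)) \<le> nm x ^ n"
proof (induction n)
  case (Suc n)
  have "nm (x [^] Suc n) \<le> nm (x [^] n) * nm x" using Suc nm_mult by simp
  also have "\<dots> \<le> nm x ^ n * nm x" using Suc nm_nonneg by (intro mult_right_mono) auto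
  finally show ?case by (simp add: mult.commute)
qed (simp add: nm_one)

text \<open>In an ultrametric norm a tail is bounded by its largest term, so the distance to the
  limit is at most r^n, without the constant of a geometric series.\<close>

lemma geometric_limit:
  assumes s: "\<And>n. s n \<in> carrier B" and r: "0 \<le> r" "r < 1"
    and d: "\<And>n. nm (s (Suc n) \<ominus> s n) \<le> r ^ n"
  shows "\<exists>l\<in>carrier B. \<forall>n. nm (l \<ominus> s n) \<le> r ^ n"
proof -
  have tail: "nm (s (n + j) \<ominus> s n) \<le> r ^ n" for n j
  proof (induction j)
    case 0
    have "s n \<ominus> s n = \<zero>" using s by (simp add: B.minus_eq B.r_neg)
    then show ?case using nm_zero[of \<zero>] r by simp
  next
    case (Suc j)
    have "s (n + Suc j) \<ominus> s n = (s (Suc (n + j)) \<ominus> s (n + j)) \<oplus> (s (n + j) \<ominus> s n)"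
      using s[of n] s[of "n + j"] s[of "Suc (n + j)"] unfolding add_Suc_right by algebra
    then have "nm (s (n + Suc j) \<ominus> s n) \<le> max (nm (s (Suc (n + j)) \<ominus> s (n + j))) (nm (s (n + j) \<ominus> s n))"
      using nm_add s by simp
    moreover have "r ^ (n + j) \<le> r ^ n" using r by (intro power_decreasing) auto
    ultimately show ?case using d[of "n + j"] Suc by linarith
  qed
  have rl: "(\<lambda>n. r ^ n) \<longlonglongrightarrow> 0" using r by (intro LIMSEQ_power_zero) simp
  have close: "nm (s i \<ominus> s j) \<le> r ^ n" if "i \<ge> n" "j \<ge> n" for i j n
  proof -
    have "s i \<ominus> s j = (s i \<ominus> s n) \<ominus> (s j \<ominus> s n)" using s[of i] s[of j] s[of n] by algebra
    then have "nm (s i \<ominus> s j) \<le> max (nm (s i \<ominus> s n)) (nm (s j \<ominus> s n))"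
      using nm_diff[of "s i \<ominus> s n" "s j \<ominus> s n"] s by simp
    moreover have "nm (s i \<ominus> s n) \<le> r ^ n" "nm (s j \<ominus> s n) \<le> r ^ n"
      using tail[of n "i - n"] tail[of n "j - n"] that by auto
    ultimately show ?thesis by simp
  qed
  have "value_Cauchy B nm s"
    unfolding value_Cauchy_def
  proof (intro allI impI)
    fix e :: real assume "e > 0"
    then obtain N where "r ^ N < e" using real_arch_pow_inv r(2) by blast
    then show "\<exists>N. \<forall>i\<ge>N. \<forall>j\<ge>N. nm (s i \<ominus> s j) < e"
      using close by (intro exI[of _ N]) (meson le_less_trans)
  qed
  then obtain l where l: "l \<in> carrier B" "(\<lambda>i. nm (s i \<ominus> l)) \<longlonglongrightarrow> 0" using nm_complete s by blast
  have "nm (l \<ominus> s n) \<le> r ^ n" for n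
  proof (rule field_le_epsilon)
    fix e :: real assume "e > 0"
    then have "\<forall>\<^sub>F i in sequentially. nm (s i \<ominus> l) < e" using l(2) by (rule order_tendstoD(2)[rotated])
    then obtain N where N: "\<And>i. i \<ge> N \<Longrightarrow> nm (s i \<ominus> l) < e" unfolding eventually_sequentially by blast
    let ?i = "max N n"
    have "l \<ominus> s n = (s ?i \<ominus> s n) \<ominus> (s ?i \<ominus> l)" using s[of ?i] s[of n] l(1) by algebra
    then have "nm (l \<ominus> s n) \<le> max (nm (s ?i \<ominus> s n)) (nm (s ?i \<ominus> l))"
      using nm_diff[of "s ?i \<ominus> s n" "s ?i \<ominus> l"] s l(1) by simp
    moreover have "nm (s ?i \<ominus> s n) \<le> r ^ n" using close[of n ?i n] by simp
    moreover have "0 \<le> r ^ n" using r by simp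
    ultimately show "nm (l \<ominus> s n) \<le> r ^ n + e" using N[of ?i] \<open>e > 0\<close> by simp
  qed
  with l(1) show ?thesis by blast
qed

lemma limit_zero:
  assumes "x \<in> carrier B" "r < 1" "\<And>n. nm x \<le> r ^ (n::nat)" "0 \<le> r"
  shows "x = \<zero>"
proof -
  have "(\<lambda>n. r ^ n) \<longlonglongrightarrow> 0" using assms by (intro LIMSEQ_power_zero) simp
  then have "nm x \<le> 0" using assms(3) by (intro LIMSEQ_le_const) auto
  then show ?thesis using nm_nonneg[OF assms(1)] nm_zero[OF assms(1)] by simp
qed

text \<open>The geometric series: \<open>s n\<close> is the sum of the first n powers of u, built by
  Horner's rule, and (1 - u) s n = 1 - u^n.\<close>

lemma one_minus_unit:
  assumes u: "u \<in> carrier B" "nm u < 1"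
  shows "\<exists>w\<in>carrier B. (\<one> \<ominus> u) \<otimes> w = \<one>"
proof -
  define s where "s = rec_nat \<zero> (\<lambda>n x. \<one> \<oplus> u \<otimes> x)"
  have s0: "s 0 = \<zero>" and sS: "\<And>n. s (Suc n) = \<one> \<oplus> u \<otimes> s n" unfolding s_def by simp_all
  have sc: "s n \<in> carrier B" for n by (induction n) (simp_all add: s0 sS u)
  have diff: "s (Suc n) \<ominus> s n = u [^] n" for n
  proof (induction n)
    case 0 then show ?case using u by (simp add: s0 sS B.minus_eq)
  next
    case (Suc n)
    have "s (Suc (Suc n)) \<ominus> s (Suc n) = u \<otimes> (s (Suc n) \<ominus> s n)"
      unfolding sS[of "Suc n"] using sS[of n] sc[of n] sc[of "Suc n"] u(1) by algebra
    then show ?case using Suc u by (simp add: B.m_comm)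
  qed
  have prod: "(\<one> \<ominus> u) \<otimes> s n = \<one> \<ominus> u [^] n" for n
  proof -
    have "(\<one> \<ominus> u) \<otimes> s n = \<one> \<ominus> (s (Suc n) \<ominus> s n)" unfolding sS using sc[of n] u(1) by algebra
    then show ?thesis by (simp add: diff)
  qed
  obtain l where l: "l \<in> carrier B" "\<And>n. nm (l \<ominus> s n) \<le> nm u ^ n"
    using geometric_limit[of s "nm u"] sc nm_nonneg[OF u(1)] u(2) diff nm_pow[OF u(1)] by auto
  have minus2: "\<one> \<ominus> (\<one> \<ominus> w) = w" if "w \<in> carrier B" for w using that by algebra
  have "(\<one> \<ominus> u) \<otimes> l \<ominus> \<one> = \<zero>"
  proof (rule limit_zero[OF _ u(2)])
    fix n
    have "(\<one> \<ominus> u) \<otimes> l \<ominus> \<one> = (\<one> \<ominus> u) \<otimes> (l \<ominus> s n) \<ominus> (\<one> \<ominus> (\<one> \<ominus> u) \<otimes> s n)"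
      using u(1) l(1) sc[of n] by algebra
    also have "\<one> \<ominus> (\<one> \<ominus> u) \<otimes> s n = u [^] n" unfolding prod using minus2[of "u [^] n"] u(1) by simp
    finally have "nm ((\<one> \<ominus> u) \<otimes> l \<ominus> \<one>) \<le> max (nm ((\<one> \<ominus> u) \<otimes> (l \<ominus> s n))) (nm (u [^] n))"
      using nm_diff u(1) l(1) sc by simp
    moreover have "nm ((\<one> \<ominus> u) \<otimes> (l \<ominus> s n)) \<le> nm u ^ n"
    proof -
      have "nm (\<one> \<ominus> u) \<le> 1" using nm_diff[of \<one> u] nm_one u by simp
      then have "nm (\<one> \<ominus> u) * nm (l \<ominus> s n) \<le> 1 * nm u ^ n"
        using l(2)[of n] nm_nonneg u(1) l(1) sc by (intro mult_mono) auto
      then show ?thesis using nm_mult[of "\<one> \<ominus> u" "l \<ominus> s n"] u(1) l(1) sc by fastforce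
    qed
    ultimately show "nm ((\<one> \<ominus> u) \<otimes> l \<ominus> \<one>) \<le> nm u ^ n" using nm_pow[OF u(1), of n] by simp
  qed (use nm_nonneg u l in simp_all)
  then have "(\<one> \<ominus> u) \<otimes> l = \<one>" using u(1) l(1) by simp
  then show ?thesis using l(1) by blast
qed

text \<open>The sum of c^k x_k over k < n. With |c| < 1 and x_k in the unit ball these partial sums
  converge at the rate |c|^n.\<close>

definition psum :: "'k \<Rightarrow> (nat \<Rightarrow> 'b) \<Rightarrow> nat \<Rightarrow> 'b" where
  "psum c x n = rec_nat \<zero> (\<lambda>k y. y \<oplus> \<kappa> (c [^]\<^bsub>K\<^esub> k) \<otimes> x k) n"

lemma psum_0: "psum c x 0 = \<zero>"
  and psum_Suc: "psum c x (Suc n) = psum c x n \<oplus> \<kappa> (c [^]\<^bsub>K\<^esub> n) \<otimes> x n"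
  by (simp_all add: psum_def)

lemma psum_carrier:
  assumes "\<And>k. x k \<in> carrier B" "c \<in> carrier K" shows "psum c x n \<in> carrier B"
  by (induction n) (simp_all add: psum_0 psum_Suc assms)

lemma series_limit:
  assumes x: "\<And>n. x n \<in> carrier B" "\<And>n. nm (x n) \<le> 1" and c: "c \<in> carrier K" "v c < 1"
  shows "\<exists>l\<in>carrier B. \<forall>n. nm (l \<ominus> psum c x n) \<le> v c ^ n"
proof (rule geometric_limit[OF _ v_nonneg[OF c(1)] c(2)])
  show s: "psum c x n \<in> carrier B" for n using x(1) c(1) by (rule psum_carrier)
  fix n
  have "psum c x (Suc n) \<ominus> psum c x n = \<kappa> (c [^]\<^bsub>K\<^esub> n) \<otimes> x n"
  proof -
    have "(a \<oplus> b) \<ominus> a = b" if "a \<in> carrier B" "b \<in> carrier B" for a b using that by algebra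
    then show ?thesis using s[of n] x c by (simp add: psum_Suc)
  qed
  then have "nm (psum c x (Suc n) \<ominus> psum c x n) = v c ^ n * nm (x n)"
    using nm_smult[of "c [^]\<^bsub>K\<^esub> n" "x n"] x c v_pow[OF c(1), of n] by simp
  also have "\<dots> \<le> v c ^ n * 1" using x(2) v_nonneg[OF c(1)] by (intro mult_left_mono) auto
  finally show "nm (psum c x (Suc n) \<ominus> psum c x n) \<le> v c ^ n" by simp
qed

lemma psum_shift:
  assumes x: "\<And>k. x k \<in> carrier B" and c: "c \<in> carrier K"
  shows "psum c x (Suc n) = x 0 \<oplus> \<kappa> c \<otimes> psum c (\<lambda>k. x (Suc k)) n"
proof (induction n)
  case 0 then show ?case using assms by (simp add: psum_0 psum_Suc)
next
  case (Suc n)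
  have pc: "psum c (\<lambda>k. x (Suc k)) n \<in> carrier B" using assms by (intro psum_carrier)
  have e: "\<kappa> (c [^]\<^bsub>K\<^esub> Suc n) = \<kappa> c \<otimes> \<kappa> (c [^]\<^bsub>K\<^esub> n)" using assms by (simp add: B.m_comm)
  have cc: "\<kappa> c \<in> carrier B" "\<kappa> (c [^]\<^bsub>K\<^esub> n) \<in> carrier B" using c by auto
  have "a \<oplus> k \<otimes> p \<oplus> (k \<otimes> q) \<otimes> w = a \<oplus> k \<otimes> (p \<oplus> q \<otimes> w)"
    if "a \<in> carrier B" "k \<in> carrier B" "p \<in> carrier B" "q \<in> carrier B" "w \<in> carrier B" for a k p q w
    using that by algebra
  from this[OF x[of 0] cc(1) pc cc(2) x[of "Suc n"]]
  show ?case unfolding psum_Suc[of c x "Suc n"] Suc e psum_Suc[of c "\<lambda>k. x (Suc k)" n] .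
qed

lemma psum_smult:
  assumes x: "\<And>k. x k \<in> carrier B" and c: "c \<in> carrier K" and d: "d \<in> carrier B"
  shows "psum c (\<lambda>k. d \<otimes> x k) n = d \<otimes> psum c x n"
proof (induction n)
  case (Suc n)
  have pc: "psum c x n \<in> carrier B" "\<kappa> (c [^]\<^bsub>K\<^esub> n) \<in> carrier B"
    using psum_carrier[OF x c] c by auto
  have "d \<otimes> p \<oplus> k \<otimes> (d \<otimes> w) = d \<otimes> (p \<oplus> k \<otimes> w)"
    if "p \<in> carrier B" "k \<in> carrier B" "w \<in> carrier B" for p k w
    using that d by algebra
  from this[OF pc x[of n]] show ?case unfolding psum_Suc Suc .
qed (simp add: psum_0 d)

lemma psum_add:
  assumes x: "\<And>k. x k \<in> carrier B" "\<And>k. w k \<in> carrier B" and c: "c \<in> carrier K"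
  shows "psum c (\<lambda>k. x k \<oplus> w k) n = psum c x n \<oplus> psum c w n"
proof (induction n)
  case (Suc n)
  have pc: "psum c x n \<in> carrier B" "psum c w n \<in> carrier B" "\<kappa> (c [^]\<^bsub>K\<^esub> n) \<in> carrier B"
    using psum_carrier[OF x(1) c] psum_carrier[OF x(2) c] c by auto
  have "p \<oplus> q \<oplus> k \<otimes> (a \<oplus> b) = p \<oplus> k \<otimes> a \<oplus> (q \<oplus> k \<otimes> b)"
    if "p \<in> carrier B" "q \<in> carrier B" "k \<in> carrier B" "a \<in> carrier B" "b \<in> carrier B" for p q k a b
    using that by algebra
  from this[OF pc x(1)[of n] x(2)[of n]] show ?case unfolding psum_Suc Suc .
qed (simp add: psum_0)

section \<open>Polynomials and convergent series over the valuation ring\<close>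

definition V :: "'k set" where "V = {c \<in> carrier K. v c \<le> 1}"

lemma V_carrier: "c \<in> V \<Longrightarrow> c \<in> carrier K" by (simp add: V_def)

lemma V_one: "1\<^sub>K \<in> V" and V_zero: "0\<^sub>K \<in> V"
  using v_zero[of "0\<^sub>K"] by (simp_all add: V_def v_one)

lemma V_mult: "c \<in> V \<Longrightarrow> d \<in> V \<Longrightarrow> c \<cdot> d \<in> V"
  by (auto simp: V_def v_mult v_nonneg intro: mult_le_one)

lemma V_add: "c \<in> V \<Longrightarrow> d \<in> V \<Longrightarrow> c \<oplus>\<^bsub>K\<^esub> d \<in> V"
  using v_add[of c d] by (auto simp: V_def)

lemma V_minus_one: "\<ominus>\<^bsub>K\<^esub> 1\<^sub>K \<in> V"
  using nm_kappa[of "\<ominus>\<^bsub>K\<^esub> 1\<^sub>K"] nm_minus[of \<one>] nm_one by (simp add: V_def)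

fun mnm :: "(nat \<Rightarrow> 'b) \<Rightarrow> nat \<Rightarrow> (nat \<Rightarrow> nat) \<Rightarrow> 'b" where
  "mnm y 0 e = \<one>"
| "mnm y (Suc m) e = mnm y m e \<otimes> y m [^] e m"

lemma mnm_carrier: "(\<And>i. i < m \<Longrightarrow> y i \<in> carrier B) \<Longrightarrow> mnm y m e \<in> carrier B"
  by (induction m) auto

lemma mnm_cong: "(\<And>i. i < m \<Longrightarrow> e i = e' i) \<Longrightarrow> mnm y m e = mnm y m e'"
  by (induction m) auto

lemma mnm_mult:
  "(\<And>i. i < m \<Longrightarrow> y i \<in> carrier B) \<Longrightarrow> mnm y m e \<otimes> mnm y m e' = mnm y m (\<lambda>i. e i + e' i)"
proof (induction m)
  case (Suc m)
  have "mnm y m e \<in> carrier B" "mnm y m e' \<in> carrier B" using Suc.prems by (simp_all add: mnm_carrier)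
  moreover have "y m \<in> carrier B" using Suc.prems by simp
  moreover have "(a \<otimes> p) \<otimes> (b \<otimes> q) = (a \<otimes> b) \<otimes> (p \<otimes> q)"
    if "a \<in> carrier B" "b \<in> carrier B" "p \<in> carrier B" "q \<in> carrier B" for a b p q
    using that by (simp add: B.m_ac)
  ultimately show ?case using Suc by (simp add: B.nat_pow_mult)
qed simp

lemma mnm_zero: "(\<And>i. i < m \<Longrightarrow> y i \<in> carrier B) \<Longrightarrow> mnm y m (\<lambda>_. 0) = \<one>"
  by (induction m) auto

lemma mnm_unit: "(\<And>i. i < m \<Longrightarrow> y i \<in> carrier B) \<Longrightarrow> j < m \<Longrightarrow> mnm y m (\<lambda>i. if i = j then 1 else 0) = y j"
proof (induction m)
  case (Suc m)
  have z: "mnm y m (\<lambda>i. if i = m then 1 else 0) = \<one>"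
    using mnm_cong[of m "\<lambda>i. if i = m then 1 else 0" "\<lambda>_. 0" y] mnm_zero[of m y] Suc.prems by simp
  show ?case
  proof (cases "j = m")
    case True then show ?thesis using z Suc.prems by simp
  next
    case False then show ?thesis using Suc by simp
  qed
qed simp

lemma nm_mnm: "(\<And>i. i < m \<Longrightarrow> y i \<in> carrier B \<and> nm (y i) \<le> 1) \<Longrightarrow> nm (mnm y m e) \<le> 1"
proof (induction m)
  case (Suc m)
  have c: "mnm y m e \<in> carrier B" "y m \<in> carrier B" "nm (y m) \<le> 1" using Suc.prems by (simp_all add: mnm_carrier)
  have "nm (y m [^] e m) \<le> 1" using nm_pow[OF c(2), of "e m"] power_le_one[OF nm_nonneg[OF c(2)] c(3), of "e m"] by linarith
  then have "nm (mnm y m e) * nm (y m [^] e m) \<le> 1" using Suc c nm_nonneg by (intro mult_le_one) auto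
  then show ?case using nm_mult[of "mnm y m e" "y m [^] e m"] c by simp
qed (simp add: nm_one)

definition expos :: "nat \<Rightarrow> (nat \<Rightarrow> nat) set" where "expos m = {e. \<forall>i\<ge>m. e i = 0}"

text \<open>The polynomials in \<open>y\<^sub>0, \<dots>, y\<^sub>m\<^sub>-\<^sub>1\<close> with coefficients in the valuation ring.\<close>

inductive_set Pol :: "(nat \<Rightarrow> 'b) \<Rightarrow> nat \<Rightarrow> 'b set" for y m where
  zero: "\<zero> \<in> Pol y m"
| step: "p \<in> Pol y m \<Longrightarrow> c \<in> V \<Longrightarrow> e \<in> expos m \<Longrightarrow> \<kappa> c \<otimes> mnm y m e \<oplus> p \<in> Pol y m"

end

locale variables = banach_algebra +
  fixes y :: "nat \<Rightarrow> 'a" and m :: nat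
  assumes y: "i < m \<Longrightarrow> y i \<in> carrier B" "i < m \<Longrightarrow> nm (y i) \<le> 1"
begin

lemma mc: "mnm y m e \<in> carrier B" using mnm_carrier[of m y] y by simp

lemma Pol_carrier: "p \<in> Pol y m \<Longrightarrow> p \<in> carrier B"
  by (induction rule: Pol.induct) (simp_all add: mc V_carrier)

lemma Pol_nm: "p \<in> Pol y m \<Longrightarrow> nm p \<le> 1"
proof (induction rule: Pol.induct)
  case (step p c e)
  have "nm (\<kappa> c \<otimes> mnm y m e) \<le> 1"
    using step nm_smult[of c "mnm y m e"] mc nm_mnm[of m y e] y nm_nonneg[OF mc]
    by (auto simp: V_def v_nonneg intro: mult_le_one)
  then show ?case using nm_add[of "\<kappa> c \<otimes> mnm y m e" p] step mc Pol_carrier V_carrier by fastforce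
qed (use nm_zero[of \<zero>] in simp)

lemma Pol_add: "p \<in> Pol y m \<Longrightarrow> q \<in> Pol y m \<Longrightarrow> p \<oplus> q \<in> Pol y m"
proof (induction rule: Pol.induct)
  case zero then show ?case using Pol_carrier by simp
next
  case (step p c e)
  have "\<kappa> c \<otimes> mnm y m e \<oplus> p \<oplus> q = \<kappa> c \<otimes> mnm y m e \<oplus> (p \<oplus> q)"
    using step mc V_carrier Pol_carrier by (simp add: B.a_assoc)
  then show ?case using Pol.step[OF step.IH[OF step.prems] step.hyps(2,3)] by simp
qed

lemma Pol_term: "p \<in> Pol y m \<Longrightarrow> c \<in> V \<Longrightarrow> e \<in> expos m \<Longrightarrow> \<kappa> c \<otimes> mnm y m e \<otimes> p \<in> Pol y m"
proof (induction rule: Pol.induct)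
  case zero then show ?case using Pol.zero mc V_carrier by simp
next
  case (step p d f)
  have eq: "\<kappa> c \<otimes> mnm y m e \<otimes> (\<kappa> d \<otimes> mnm y m f \<oplus> p) =
    \<kappa> (c \<cdot> d) \<otimes> mnm y m (\<lambda>i. e i + f i) \<oplus> \<kappa> c \<otimes> mnm y m e \<otimes> p"
    using mnm_mult[of m y e f, symmetric] y mc step V_carrier Pol_carrier[OF step.hyps(1)]
    by (simp add: B.r_distr B.m_ac)
  have "(\<lambda>i. e i + f i) \<in> expos m" using step unfolding expos_def by auto
  then show ?case unfolding eq
    using step V_mult Pol.step by blast
qed

lemma Pol_mult: "p \<in> Pol y m \<Longrightarrow> q \<in> Pol y m \<Longrightarrow> p \<otimes> q \<in> Pol y m"
proof (induction rule: Pol.induct)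
  case zero then show ?case using Pol_carrier Pol.zero by simp
next
  case (step p c e)
  have "(\<kappa> c \<otimes> mnm y m e \<oplus> p) \<otimes> q = \<kappa> c \<otimes> mnm y m e \<otimes> q \<oplus> p \<otimes> q"
    using step mc V_carrier Pol_carrier by (simp add: B.l_distr)
  then show ?case using Pol_add Pol_term step by simp
qed

lemma Pol_const: "c \<in> V \<Longrightarrow> \<kappa> c \<in> Pol y m"
proof -
  assume c: "c \<in> V"
  have "\<kappa> c \<otimes> mnm y m (\<lambda>_. 0) \<oplus> \<zero> = \<kappa> c" using mnm_zero[of m y] y c V_carrier by simp
  moreover have "\<kappa> c \<otimes> mnm y m (\<lambda>_. 0) \<oplus> \<zero> \<in> Pol y m"
    by (rule Pol.step[OF Pol.zero c]) (simp add: expos_def)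
  ultimately show ?thesis by simp
qed

lemma Pol_var: "j < m \<Longrightarrow> y j \<in> Pol y m"
proof -
  assume j: "j < m"
  let ?e = "\<lambda>i. if i = j then 1 else 0"
  have "\<kappa> 1\<^sub>K \<otimes> mnm y m ?e \<oplus> \<zero> = y j" using mnm_unit[of m y j] y j by simp
  moreover have "\<kappa> 1\<^sub>K \<otimes> mnm y m ?e \<oplus> \<zero> \<in> Pol y m"
    by (rule Pol.step[OF Pol.zero V_one]) (use j in \<open>simp add: expos_def\<close>)
  ultimately show ?thesis by simp
qed

lemma Pol_subring: "subring (Pol y m) B"
proof (rule B.subringI)
  show "\<ominus> h \<in> Pol y m" if "h \<in> Pol y m" for h
  proof -
    have "\<kappa> (\<ominus>\<^bsub>K\<^esub> 1\<^sub>K) \<otimes> h = \<ominus> h" using Pol_carrier[OF that] by (simp add: B.l_minus)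
    then show ?thesis using Pol_mult[OF Pol_const[OF V_minus_one] that] by simp
  qed
  show "\<one> \<in> Pol y m" using Pol_const[OF V_one] by simp
qed (use Pol_carrier Pol_mult Pol_add in auto)

text \<open>The image of the power series with coefficients in the valuation ring tending to zero,
  characterized coinductively: it is the largest set \<open>T\<close> in the unit ball such that
  \<open>T \<subseteq> Pol + cT\<close> for all \<open>c \<noteq> 0\<close>.\<close>

definition D :: "'a set" where
  "D = \<Union>{T. T \<subseteq> {x \<in> carrier B. nm x \<le> 1} \<and> (\<forall>c\<in>carrier K. c \<noteq> 0\<^sub>K \<longrightarrow>
     (\<forall>t\<in>T. \<exists>p\<in>Pol y m. \<exists>t'\<in>T. t = p \<oplus> \<kappa> c \<otimes> t'))}"

lemma D_coinduct:
  assumes "\<And>t. t \<in> T \<Longrightarrow> t \<in> carrier B \<and> nm t \<le> 1"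
    and "\<And>c t. c \<in> carrier K \<Longrightarrow> c \<noteq> 0\<^sub>K \<Longrightarrow> t \<in> T \<Longrightarrow> \<exists>p\<in>Pol y m. \<exists>t'\<in>T. t = p \<oplus> \<kappa> c \<otimes> t'"
  shows "T \<subseteq> D"
  unfolding D_def using assms by (intro Union_upper) auto

lemma D_carrier: "x \<in> D \<Longrightarrow> x \<in> carrier B" and D_nm: "x \<in> D \<Longrightarrow> nm x \<le> 1"
  unfolding D_def by auto

lemma D_split:
  assumes "x \<in> D" "c \<in> carrier K" "c \<noteq> 0\<^sub>K"
  obtains p t where "p \<in> Pol y m" "t \<in> D" "x = p \<oplus> \<kappa> c \<otimes> t"
proof -
  obtain T where T: "x \<in> T" and T': "T \<subseteq> {x \<in> carrier B. nm x \<le> 1} \<and> (\<forall>c\<in>carrier K. c \<noteq> 0\<^sub>K \<longrightarrow>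
     (\<forall>t\<in>T. \<exists>p\<in>Pol y m. \<exists>t'\<in>T. t = p \<oplus> \<kappa> c \<otimes> t'))"
    using assms(1) unfolding D_def by (elim UnionE CollectE)
  have TD: "T \<subseteq> D"
    unfolding D_def by (rule Union_upper, rule CollectI) (rule T')
  have "\<exists>p\<in>Pol y m. \<exists>t'\<in>T. x = p \<oplus> \<kappa> c \<otimes> t'"
    using T'[THEN conjunct2, rule_format, OF assms(2,3) T] .
  then show ?thesis using TD by (elim bexE) (rule that, auto)
qed

text \<open>A single scalar c0 with |c0| < 1 suffices when T is stable under V: r iterations leave a
  remainder with factor c0^r, and once |c0|^r < |c| the quotient c0^r / c lies in V and is absorbed
  into the remainder.\<close>

lemma D_coinduct1:
  assumes T: "\<And>t. t \<in> T \<Longrightarrow> t \<in> carrier B \<and> nm t \<le> 1"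
    and Vs: "\<And>c t. c \<in> V \<Longrightarrow> t \<in> T \<Longrightarrow> \<kappa> c \<otimes> t \<in> T"
    and c0: "c0 \<in> carrier K" "c0 \<noteq> 0\<^sub>K" "v c0 < 1"
    and st: "\<And>t. t \<in> T \<Longrightarrow> \<exists>p\<in>Pol y m. \<exists>t'\<in>T. t = p \<oplus> \<kappa> c0 \<otimes> t'"
  shows "T \<subseteq> D"
proof (rule D_coinduct)
  fix c t assume c: "c \<in> carrier K" "c \<noteq> 0\<^sub>K" and t: "t \<in> T"
  have c0V: "c0 \<in> V" using c0 by (simp add: V_def)
  have pow: "\<exists>p\<in>Pol y m. \<exists>t'\<in>T. t = p \<oplus> \<kappa> (c0 [^]\<^bsub>K\<^esub> r) \<otimes> t'" for r :: nat
  proof (induction r)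
    case 0
    show ?case using Pol.zero t T[OF t] by (intro bexI[of _ \<zero>] bexI[of _ t]) simp_all
  next
    case (Suc r)
    then obtain p t' where p: "p \<in> Pol y m" "t' \<in> T" "t = p \<oplus> \<kappa> (c0 [^]\<^bsub>K\<^esub> r) \<otimes> t'" by blast
    obtain p' t'' where p': "p' \<in> Pol y m" "t'' \<in> T" "t' = p' \<oplus> \<kappa> c0 \<otimes> t''" using st[OF p(2)] by blast
    have cV: "c0 [^]\<^bsub>K\<^esub> r \<in> V" using c0 v_nonneg[OF c0(1)] by (simp add: V_def v_pow power_le_one)
    have "t = (p \<oplus> \<kappa> (c0 [^]\<^bsub>K\<^esub> r) \<otimes> p') \<oplus> \<kappa> (c0 [^]\<^bsub>K\<^esub> Suc r) \<otimes> t''"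
      unfolding p(3) p'(3) using Pol_carrier[OF p(1)] Pol_carrier[OF p'(1)] T[OF p'(2)] c0
      by (simp add: B.r_distr B.m_assoc B.a_assoc)
    moreover have "p \<oplus> \<kappa> (c0 [^]\<^bsub>K\<^esub> r) \<otimes> p' \<in> Pol y m"
      using Pol_add[OF p(1) Pol_mult[OF Pol_const[OF cV] p'(1)]] .
    ultimately show ?case using p'(2) by blast
  qed
  obtain r where r: "v c0 ^ r < v c" using real_arch_pow_inv[OF v_pos[OF c] c0(3)] by blast
  obtain p t' where p: "p \<in> Pol y m" "t' \<in> T" "t = p \<oplus> \<kappa> (c0 [^]\<^bsub>K\<^esub> r) \<otimes> t'" using pow[of r] by blast
  define d where "d = inv\<^bsub>K\<^esub> c \<cdot> c0 [^]\<^bsub>K\<^esub> r"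
  have d: "d \<in> V" unfolding d_def V_def using K_inv[OF c] c0 r v_pos[OF c]
    by (simp add: v_mult v_inv[OF c] v_pow)
  have "c \<cdot> d = c0 [^]\<^bsub>K\<^esub> r" unfolding d_def using K_inv[OF c] c c0 by (simp add: K.m_assoc[symmetric])
  then have "\<kappa> c \<otimes> (\<kappa> d \<otimes> t') = \<kappa> (c0 [^]\<^bsub>K\<^esub> r) \<otimes> t'"
    using hom_mult[of c d] c V_carrier[OF d] T[OF p(2)] by (simp add: B.m_assoc)
  then show "\<exists>p\<in>Pol y m. \<exists>t'\<in>T. t = p \<oplus> \<kappa> c \<otimes> t'" using p Vs[OF d p(2)] by metis
qed (use T in auto)

lemma Pol_D: "Pol y m \<subseteq> D"
proof (rule D_coinduct)
  fix c t assume "c \<in> carrier K" "t \<in> Pol y m"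
  then show "\<exists>p\<in>Pol y m. \<exists>t'\<in>Pol y m. t = p \<oplus> \<kappa> c \<otimes> t'"
    using Pol.zero Pol_carrier by (intro bexI[of _ t] bexI[of _ \<zero>]) simp_all
qed (use Pol_carrier Pol_nm in auto)

lemma D_add: assumes "x \<in> D" "z \<in> D" shows "x \<oplus> z \<in> D"
proof -
  have "{x \<oplus> z | x z. x \<in> D \<and> z \<in> D} \<subseteq> D"
  proof (rule D_coinduct)
    fix t assume "t \<in> {x \<oplus> z | x z. x \<in> D \<and> z \<in> D}"
    then obtain x z where "x \<in> D" "z \<in> D" "t = x \<oplus> z" by blast
    then show "t \<in> carrier B \<and> nm t \<le> 1"
      using nm_add[of x z] D_carrier[of x] D_carrier[of z] D_nm[of x] D_nm[of z] by simp
  next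
    fix c t assume c: "c \<in> carrier K" "c \<noteq> 0\<^sub>K" and "t \<in> {x \<oplus> z | x z. x \<in> D \<and> z \<in> D}"
    then obtain x z where t: "x \<in> D" "z \<in> D" "t = x \<oplus> z" by blast
    obtain p x' where p: "p \<in> Pol y m" "x' \<in> D" "x = p \<oplus> \<kappa> c \<otimes> x'" using D_split[OF t(1) c] .
    obtain q z' where q: "q \<in> Pol y m" "z' \<in> D" "z = q \<oplus> \<kappa> c \<otimes> z'" using D_split[OF t(2) c] .
    have cc: "\<kappa> c \<in> carrier B" using c by simp
    have "t = (p \<oplus> q) \<oplus> \<kappa> c \<otimes> (x' \<oplus> z')" unfolding t(3) p(3) q(3)
      using Pol_carrier[OF p(1)] Pol_carrier[OF q(1)] D_carrier[OF p(2)] D_carrier[OF q(2)] cc by algebra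
    then show "\<exists>p\<in>Pol y m. \<exists>t'\<in>{x \<oplus> z | x z. x \<in> D \<and> z \<in> D}. t = p \<oplus> \<kappa> c \<otimes> t'"
      using Pol_add[OF p(1) q(1)] p(2) q(2) by blast
  qed
  then show ?thesis using assms by blast
qed

lemma D_Pol_mult: assumes "q \<in> Pol y m" "x \<in> D" shows "q \<otimes> x \<in> D"
proof -
  have "(\<lambda>x. q \<otimes> x) ` D \<subseteq> D"
  proof (rule D_coinduct)
    fix t assume "t \<in> (\<lambda>x. q \<otimes> x) ` D"
    then obtain x where x: "x \<in> D" "t = q \<otimes> x" by blast
    have "nm q * nm x \<le> 1" using Pol_nm[OF assms(1)] D_nm[OF x(1)] nm_nonneg[OF D_carrier[OF x(1)]]
      by (intro mult_le_one) auto
    then show "t \<in> carrier B \<and> nm t \<le> 1"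
      using nm_mult[of q x] D_carrier[OF x(1)] Pol_carrier[OF assms(1)] x(2) by simp
  next
    fix c t assume c: "c \<in> carrier K" "c \<noteq> 0\<^sub>K" and "t \<in> (\<lambda>x. q \<otimes> x) ` D"
    then obtain x where t: "x \<in> D" "t = q \<otimes> x" by blast
    obtain p x' where p: "p \<in> Pol y m" "x' \<in> D" "x = p \<oplus> \<kappa> c \<otimes> x'" using D_split[OF t(1) c] .
    have cc: "\<kappa> c \<in> carrier B" using c by simp
    have "t = q \<otimes> p \<oplus> \<kappa> c \<otimes> (q \<otimes> x')" unfolding t(2) p(3)
      using Pol_carrier[OF p(1)] Pol_carrier[OF assms(1)] D_carrier[OF p(2)] cc by algebra
    then show "\<exists>p\<in>Pol y m. \<exists>t'\<in>(\<lambda>x. q \<otimes> x) ` D. t = p \<oplus> \<kappa> c \<otimes> t'"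
      using Pol_mult[OF assms(1) p(1)] p(2) by blast
  qed
  then show ?thesis using assms by blast
qed

lemma D_smult: "c \<in> V \<Longrightarrow> x \<in> D \<Longrightarrow> \<kappa> c \<otimes> x \<in> D"
  by (rule D_Pol_mult[OF Pol_const])

text \<open>The set of products alone does not support the coinductive step, because expanding (p +
  c x')(q + c z') leaves the mixed terms p z' and q x'. The set of all x z + w absorbs them into
  w.\<close>

lemma D_mult: assumes "x \<in> D" "z \<in> D" shows "x \<otimes> z \<in> D"
proof -
  let ?T = "{x \<otimes> z \<oplus> w | x z w. x \<in> D \<and> z \<in> D \<and> w \<in> D}"
  obtain c where c: "c \<in> carrier K" "c \<noteq> 0\<^sub>K" "v c < 1" by (rule small_scalar)
  have cV: "c \<in> V" and cc: "\<kappa> c \<in> carrier B" using c by (simp_all add: V_def)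
  have "?T \<subseteq> D"
  proof (rule D_coinduct1[OF _ _ c])
    fix t assume "t \<in> ?T"
    then obtain x z w where t: "x \<in> D" "z \<in> D" "w \<in> D" "t = x \<otimes> z \<oplus> w" by blast
    note tc = t(1-3)[THEN D_carrier]
    have "nm x * nm z \<le> 1" using t(1,2)[THEN D_nm] nm_nonneg[OF tc(2)] by (intro mult_le_one) auto
    then have "nm (x \<otimes> z) \<le> 1" using nm_mult[OF tc(1,2)] by simp
    then show "t \<in> carrier B \<and> nm t \<le> 1" using nm_add[of "x \<otimes> z" w] tc D_nm[OF t(3)] t(4) by simp
  next
    fix d t assume d: "d \<in> V" and "t \<in> ?T"
    then obtain x z w where t: "x \<in> D" "z \<in> D" "w \<in> D" "t = x \<otimes> z \<oplus> w" by blast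
    have "\<kappa> d \<otimes> t = (\<kappa> d \<otimes> x) \<otimes> z \<oplus> \<kappa> d \<otimes> w" unfolding t(4)
      using t(1-3) D_carrier d V_carrier by (simp add: B.r_distr B.m_assoc)
    then show "\<kappa> d \<otimes> t \<in> ?T" using t(2) D_smult[OF d t(1)] D_smult[OF d t(3)] by blast
  next
    fix t assume "t \<in> ?T"
    then obtain x z w where t: "x \<in> D" "z \<in> D" "w \<in> D" "t = x \<otimes> z \<oplus> w" by blast
    obtain p x' where p: "p \<in> Pol y m" "x' \<in> D" "x = p \<oplus> \<kappa> c \<otimes> x'" using D_split[OF t(1) c(1,2)] .
    obtain q z' where q: "q \<in> Pol y m" "z' \<in> D" "z = q \<oplus> \<kappa> c \<otimes> z'" using D_split[OF t(2) c(1,2)] .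
    obtain r w' where r: "r \<in> Pol y m" "w' \<in> D" "w = r \<oplus> \<kappa> c \<otimes> w'" using D_split[OF t(3) c(1,2)] .
    have "t = (p \<otimes> q \<oplus> r) \<oplus> \<kappa> c \<otimes> ((\<kappa> c \<otimes> x') \<otimes> z' \<oplus> (p \<otimes> z' \<oplus> q \<otimes> x' \<oplus> w'))"
      unfolding t(4) p(3) q(3) r(3)
      using Pol_carrier[OF p(1)] Pol_carrier[OF q(1)] Pol_carrier[OF r(1)]
        D_carrier[OF p(2)] D_carrier[OF q(2)] D_carrier[OF r(2)] cc by algebra
    moreover have "p \<otimes> q \<oplus> r \<in> Pol y m" by (rule Pol_add[OF Pol_mult[OF p(1) q(1)] r(1)])
    moreover have "p \<otimes> z' \<oplus> q \<otimes> x' \<oplus> w' \<in> D"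
      by (rule D_add[OF D_add[OF D_Pol_mult[OF p(1) q(2)] D_Pol_mult[OF q(1) p(2)]] r(2)])
    moreover have "\<kappa> c \<otimes> x' \<in> D" using D_smult[OF cV p(2)] .
    ultimately show "\<exists>p\<in>Pol y m. \<exists>t'\<in>?T. t = p \<oplus> \<kappa> c \<otimes> t'" using q(2) by blast
  qed
  moreover have "x \<otimes> z \<oplus> \<zero> \<in> ?T" using assms Pol_D Pol.zero by blast
  ultimately show ?thesis using assms D_carrier by auto
qed

lemma D_subring: "subring D B"
proof (rule B.subringI)
  show "\<ominus> h \<in> D" if "h \<in> D" for h
  proof -
    have "\<kappa> (\<ominus>\<^bsub>K\<^esub> 1\<^sub>K) \<otimes> h = \<ominus> h" using D_carrier[OF that] by (simp add: B.l_minus)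
    then show ?thesis using D_smult[OF V_minus_one that] by simp
  qed
  show "\<one> \<in> D" using Pol_D Pol_const[OF V_one] by auto
qed (use D_carrier D_mult D_add in auto)

text \<open>The K-algebra generated by D inside B; D itself is a module over V only.\<close>

definition E :: "'a set" where
  "E = {x \<in> carrier B. \<exists>c\<in>carrier K. c \<noteq> 0\<^sub>K \<and> \<kappa> c \<otimes> x \<in> D}"

lemma D_E: "D \<subseteq> E"
proof
  fix x assume x: "x \<in> D"
  then have "\<kappa> 1\<^sub>K \<otimes> x \<in> D" using D_carrier by simp
  then show "x \<in> E" unfolding E_def using D_carrier[OF x] K.one_not_zero K.one_closed by blast
qed

lemma E_smult: assumes "a \<in> carrier K" "x \<in> E" shows "\<kappa> a \<otimes> x \<in> E"
proof -
  obtain c where c: "c \<in> carrier K" "c \<noteq> 0\<^sub>K" "\<kappa> c \<otimes> x \<in> D" and x: "x \<in> carrier B"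
    using assms(2) unfolding E_def by blast
  show ?thesis
  proof (cases "a \<in> V")
    case True
    have "\<kappa> c \<otimes> (\<kappa> a \<otimes> x) = \<kappa> a \<otimes> (\<kappa> c \<otimes> x)" using c(1) assms(1) x by (simp add: B.m_ac)
    then show ?thesis unfolding E_def using c x assms(1) D_smult[OF True c(3)] by auto
  next
    case False
    then have a0: "a \<noteq> 0\<^sub>K" using V_zero by auto
    let ?d = "c \<cdot> inv\<^bsub>K\<^esub> a"
    have i: "inv\<^bsub>K\<^esub> a \<in> carrier K" "a \<cdot> inv\<^bsub>K\<^esub> a = 1\<^sub>K" "inv\<^bsub>K\<^esub> a \<noteq> 0\<^sub>K"
      using K_inv[OF assms(1) a0] by auto
    have "\<kappa> ?d \<otimes> (\<kappa> a \<otimes> x) = \<kappa> c \<otimes> (\<kappa> (a \<cdot> inv\<^bsub>K\<^esub> a) \<otimes> x)"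
      using c(1) assms(1) x i(1) by (simp add: B.m_ac)
    then have "\<kappa> ?d \<otimes> (\<kappa> a \<otimes> x) \<in> D" using c x i by simp
    moreover have "?d \<noteq> 0\<^sub>K" "?d \<in> carrier K" using c i K.integral by auto
    ultimately show ?thesis unfolding E_def using x assms(1) by auto
  qed
qed

lemma E_subring: "subring E B"
proof (rule B.subringI)
  show "E \<subseteq> carrier B" unfolding E_def by blast
  show "\<one> \<in> E" using D_E subringE(3)[OF D_subring] by blast
  show "\<ominus> h \<in> E" if "h \<in> E" for h
  proof -
    have "\<kappa> (\<ominus>\<^bsub>K\<^esub> 1\<^sub>K) \<otimes> h = \<ominus> h" using that by (simp add: B.l_minus E_def)
    then show ?thesis using E_smult[OF _ that, of "\<ominus>\<^bsub>K\<^esub> 1\<^sub>K"] by simp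
  qed
  fix x z assume "x \<in> E" "z \<in> E"
  then obtain c d where c: "c \<in> carrier K" "c \<noteq> 0\<^sub>K" "\<kappa> c \<otimes> x \<in> D" "x \<in> carrier B"
    and d: "d \<in> carrier K" "d \<noteq> 0\<^sub>K" "\<kappa> d \<otimes> z \<in> D" "z \<in> carrier B"
    unfolding E_def by blast
  have cd: "c \<cdot> d \<in> carrier K" "c \<cdot> d \<noteq> 0\<^sub>K" using c d K.integral by auto
  have "\<kappa> (c \<cdot> d) \<otimes> (x \<otimes> z) = (\<kappa> c \<otimes> x) \<otimes> (\<kappa> d \<otimes> z)" using c d by (simp add: B.m_ac)
  then have "\<kappa> (c \<cdot> d) \<otimes> (x \<otimes> z) \<in> D" using D_mult c(3) d(3) by simp
  then show "x \<otimes> z \<in> E" unfolding E_def using cd c(4) d(4) by blast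
  \<comment> \<open>Clearing both denominators of a sum multiplies elements of D by c and by d,
    which may be large. A further small scalar h brings h c and h d into V.\<close>
  obtain g where g: "g \<in> carrier K" "g \<noteq> 0\<^sub>K" "v g < 1" by (rule small_scalar)
  obtain r where r: "v g ^ r < min (1 / v c) (1 / v d)"
    using real_arch_pow_inv[of "min (1 / v c) (1 / v d)" "v g"] v_pos[OF c(1,2)] v_pos[OF d(1,2)] g(3) by auto
  define h where "h = g [^]\<^bsub>K\<^esub> r"
  have h: "h \<in> carrier K" "h \<noteq> 0\<^sub>K" "v h < 1 / v c" "v h < 1 / v d"
    unfolding h_def using g r v_pos[OF g(1,2)] v_zero[of "g [^]\<^bsub>K\<^esub> r"] by (auto simp: v_pow)
  have V1: "h \<cdot> d \<in> V" "h \<cdot> c \<in> V"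
    unfolding V_def using h c d v_pos[OF c(1,2)] v_pos[OF d(1,2)]
    by (simp_all add: v_mult pos_less_divide_eq less_imp_le)
  have "\<kappa> (h \<cdot> (c \<cdot> d)) \<otimes> (x \<oplus> z) = \<kappa> (h \<cdot> d) \<otimes> (\<kappa> c \<otimes> x) \<oplus> \<kappa> (h \<cdot> c) \<otimes> (\<kappa> d \<otimes> z)"
    using h c d by (simp add: B.m_ac B.r_distr)
  then have "\<kappa> (h \<cdot> (c \<cdot> d)) \<otimes> (x \<oplus> z) \<in> D"
    using D_add[OF D_smult[OF V1(1) c(3)] D_smult[OF V1(2) d(3)]] by simp
  moreover have "h \<cdot> (c \<cdot> d) \<in> carrier K" "h \<cdot> (c \<cdot> d) \<noteq> 0\<^sub>K"
    using h cd K.integral by auto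
  ultimately show "x \<oplus> z \<in> E" unfolding E_def using c(4) d(4) by blast
qed

lemma E_const: "c \<in> carrier K \<Longrightarrow> \<kappa> c \<in> E"
  using E_smult[of c \<one>] subringE(3)[OF E_subring] by simp

end

text \<open>The list z^(s-1), ..., z, 1. Its span consists of the polynomials in z of degree below s
  with coefficients in the given set.\<close>

fun zpowers :: "('a, 'b) ring_scheme \<Rightarrow> 'a \<Rightarrow> nat \<Rightarrow> 'a list" where
  "zpowers R z 0 = []"
| "zpowers R z (Suc s) = (z [^]\<^bsub>R\<^esub> s) # zpowers R z s"

lemma (in cring) zpowers_carrier: "z \<in> carrier R \<Longrightarrow> set (zpowers R z s) \<subseteq> carrier R"
  by (induction s) auto

lemma zpowers_mem: "x \<in> set (zpowers R z s) \<longleftrightarrow> (\<exists>j<s. x = z [^]\<^bsub>R\<^esub> j)"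
  by (induction s) (auto simp: less_Suc_eq)

lemma (in cring) zpowers_Suc:
  assumes A: "subring A R" and z: "z \<in> carrier R" and l: "l \<in> lspan R A (zpowers R z s)"
  shows "z \<otimes> l \<in> lspan R A (zpowers R z (Suc s))"
  using l
proof (induction s arbitrary: l)
  case 0
  then show ?case using z subringE(2)[OF A] by (auto intro!: exI[of _ \<zero>])
next
  case (Suc s)
  obtain a w where aw: "a \<in> A" "w \<in> lspan R A (zpowers R z s)" "l = a \<otimes> z [^] s \<oplus> w" using Suc.prems by auto
  have c: "a \<in> carrier R" "w \<in> carrier R"
    using aw subringE(1)[OF A] lspan_carrier[OF subringE(1)[OF A] zpowers_carrier[OF z]] by auto
  have "z \<otimes> l = a \<otimes> z [^] Suc s \<oplus> z \<otimes> w" unfolding aw(3) using c z by (simp add: r_distr m_ac)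
  then show ?case using aw(1) Suc.IH[OF aw(2)] by (subst zpowers.simps(2), intro lspan_ConsI)
qed

lemma (in cring) zpowers_mono:
  assumes A: "subring A R" and z: "z \<in> carrier R" and "s \<le> t"
  shows "lspan R A (zpowers R z s) \<subseteq> lspan R A (zpowers R z t)"
proof (rule lspan_subset[OF A zpowers_carrier[OF z]], rule subsetI)
  fix x assume "x \<in> set (zpowers R z s)"
  then have "x \<in> set (zpowers R z t)" using assms(3) less_le_trans unfolding zpowers_mem by blast
  then show "x \<in> lspan R A (zpowers R z t)" by (rule lspan_member[OF A zpowers_carrier[OF z]])
qed

lemma (in cring) zpowers_shift:
  assumes A: "subring A R" and z: "z \<in> carrier R" and l: "l \<in> lspan R A (zpowers R z s)"
  shows "z [^] (e::nat) \<otimes> l \<in> lspan R A (zpowers R z (s + e))"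
proof (induction e)
  case 0
  have "l \<in> carrier R" using l lspan_carrier[OF subringE(1)[OF A] zpowers_carrier[OF z]] by blast
  then show ?case using l by simp
next
  case (Suc e)
  have "z [^] Suc e \<otimes> l = z \<otimes> (z [^] e \<otimes> l)"
    using z subsetD[OF lspan_carrier[OF subringE(1)[OF A] zpowers_carrier[OF z]] l] by (simp add: m_ac)
  then show ?case using zpowers_Suc[OF A z Suc] by simp
qed

lemma (in cring) zpowers_power:
  assumes A: "subring A R" and z: "z \<in> carrier R" and "j < s"
  shows "z [^] j \<in> lspan R A (zpowers R z s)"
  using assms(3) by (intro lspan_member[OF A zpowers_carrier[OF z]]) (auto simp: zpowers_mem)

lemma (in cring) lspan_subring:
  assumes S: "subring S R" and "A \<subseteq> S" "set us \<subseteq> S"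
  shows "lspan R A us \<subseteq> S"
  using assms(3)
proof (induction us)
  case Nil then show ?case using subringE(2)[OF S] by simp
next
  case (Cons u us)
  show ?case
  proof
    fix x assume "x \<in> lspan R A (u # us)"
    then obtain a w where aw: "a \<in> A" "w \<in> lspan R A us" "x = a \<otimes> u \<oplus> w" by auto
    then have "a \<in> S" "w \<in> S" "u \<in> S" using Cons assms(2) by auto
    then show "x \<in> S" unfolding aw(3) by (intro subringE(6,7)[OF S])
  qed
qed

lemma (in abelian_monoid) finsum_in:
  assumes "finite F" "\<And>x. x \<in> F \<Longrightarrow> f x \<in> T" "T \<subseteq> carrier G" "\<zero> \<in> T"
    and "\<And>a b. a \<in> T \<Longrightarrow> b \<in> T \<Longrightarrow> a \<oplus> b \<in> T"
  shows "finsum G f F \<in> T"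
  using assms(1,2)
proof (induction F)
  case empty then show ?case using assms(4) by simp
next
  case (insert x F)
  then have "finsum G f (insert x F) = f x \<oplus> finsum G f F"
    using assms(3) by (intro finsum_insert) auto
  then show ?case using insert assms(5) by simp
qed

lemma digits_unique:
  fixes a b :: "nat \<Rightarrow> nat"
  assumes "\<And>i. i < n \<Longrightarrow> a i < M" "\<And>i. i < n \<Longrightarrow> b i < M"
    and "(\<Sum>i<n. a i * M ^ i) = (\<Sum>i<n. b i * M ^ i)" and "i < n"
  shows "a i = b i"
  using assms
proof (induction n arbitrary: a b i)
  case (Suc n)
  have s: "(\<Sum>i<Suc n. c i * M ^ i) = c 0 + M * (\<Sum>i<n. c (Suc i) * M ^ i)" for c :: "nat \<Rightarrow> nat"
    by (simp add: sum.lessThan_Suc_shift sum_distrib_left mult_ac del: sum.lessThan_Suc)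
  have M: "a 0 < M" "b 0 < M" using Suc.prems by auto
  have eq: "a 0 + M * (\<Sum>i<n. a (Suc i) * M ^ i) = b 0 + M * (\<Sum>i<n. b (Suc i) * M ^ i)"
    using Suc.prems(3) unfolding s .
  have "(a 0 + M * (\<Sum>i<n. a (Suc i) * M ^ i)) mod M = (b 0 + M * (\<Sum>i<n. b (Suc i) * M ^ i)) mod M"
    unfolding eq ..
  then have a0: "a 0 = b 0" using M by simp
  then have eq': "(\<Sum>i<n. a (Suc i) * M ^ i) = (\<Sum>i<n. b (Suc i) * M ^ i)" using eq M by simp
  show ?case
  proof (cases i)
    case 0 then show ?thesis using a0 by simp
  next
    case (Suc j)
    then show ?thesis using Suc.IH[OF _ _ eq', of j] Suc.prems by simp
  qed
qed simp

context variables
begin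

text \<open>Coinduction on the set of all sums of such series: the tail after the first term,
  divided by c, is again the sum of a series of this kind, by \<open>psum_shift\<close>.\<close>

lemma series_D:
  assumes r: "\<And>k. r k \<in> Pol y m" and c: "c \<in> carrier K" "c \<noteq> 0\<^sub>K" "v c < 1"
    and R: "R \<in> carrier B" "\<And>n. nm (R \<ominus> psum c r n) \<le> v c ^ n"
  shows "R \<in> D"
proof -
  let ?T = "{R \<in> carrier B. \<exists>r. (\<forall>k. r k \<in> Pol y m) \<and> (\<forall>n. nm (R \<ominus> psum c r n) \<le> v c ^ n)}"
  have "?T \<subseteq> D"
  proof (rule D_coinduct1[OF _ _ c])
    fix t assume "t \<in> ?T"
    then obtain r where t: "t \<in> carrier B" "\<And>n. nm (t \<ominus> psum c r n) \<le> v c ^ n" by blast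
    then show "t \<in> carrier B \<and> nm t \<le> 1" using t(2)[of 0] by (simp add: B.minus_eq psum_0)
  next
    fix d t assume d: "d \<in> V" and "t \<in> ?T"
    then obtain r where t: "t \<in> carrier B" "\<And>k. r k \<in> Pol y m" "\<And>n. nm (t \<ominus> psum c r n) \<le> v c ^ n" by blast
    have rc: "r k \<in> carrier B" for k using t(2) Pol_carrier by blast
    have dc: "d \<in> carrier K" "\<kappa> d \<in> carrier B" using V_carrier[OF d] by auto
    have "nm (\<kappa> d \<otimes> t \<ominus> psum c (\<lambda>k. \<kappa> d \<otimes> r k) n) \<le> v c ^ n" for n
    proof -
      have pc: "psum c r n \<in> carrier B" using rc c(1) by (rule psum_carrier)
      have "\<kappa> d \<otimes> t \<ominus> psum c (\<lambda>k. \<kappa> d \<otimes> r k) n = \<kappa> d \<otimes> (t \<ominus> psum c r n)"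
        unfolding psum_smult[OF rc c(1) dc(2)] using pc t(1) dc(2) by (simp add: B.minus_eq B.r_distr B.r_minus)
      then have "nm (\<kappa> d \<otimes> t \<ominus> psum c (\<lambda>k. \<kappa> d \<otimes> r k) n) = v d * nm (t \<ominus> psum c r n)"
        using nm_smult dc t(1) pc by simp
      also have "\<dots> \<le> 1 * v c ^ n" using t d pc nm_nonneg by (intro mult_mono) (auto simp: V_def)
      finally show ?thesis by simp
    qed
    moreover have "\<kappa> d \<otimes> r k \<in> Pol y m" for k using Pol_mult[OF Pol_const[OF d] t(2)] .
    ultimately show "\<kappa> d \<otimes> t \<in> ?T" using t(1) dc(2) by (auto intro!: exI[of _ "\<lambda>k. \<kappa> d \<otimes> r k"])
  next
    fix t assume "t \<in> ?T"
    then obtain r where t: "t \<in> carrier B" "\<And>k. r k \<in> Pol y m" "\<And>n. nm (t \<ominus> psum c r n) \<le> v c ^ n" by blast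
    have rc: "r k \<in> carrier B" for k using t(2) Pol_carrier by blast
    have i: "inv\<^bsub>K\<^esub> c \<in> carrier K" "c \<cdot> inv\<^bsub>K\<^esub> c = 1\<^sub>K" using K_inv[OF c(1,2)] by auto
    have ii: "\<kappa> c \<otimes> \<kappa> (inv\<^bsub>K\<^esub> c) = \<one>" using hom_mult[of c "inv\<^bsub>K\<^esub> c"] i c by simp
    have cc: "\<kappa> c \<in> carrier B" "\<kappa> (inv\<^bsub>K\<^esub> c) \<in> carrier B" using c i by auto
    define t' where "t' = \<kappa> (inv\<^bsub>K\<^esub> c) \<otimes> (t \<ominus> r 0)"
    have t'c: "t' \<in> carrier B" unfolding t'_def using cc t rc by simp
    have "\<kappa> c \<otimes> t' = (\<kappa> c \<otimes> \<kappa> (inv\<^bsub>K\<^esub> c)) \<otimes> (t \<ominus> r 0)" unfolding t'_def using cc t(1) rc[of 0] by algebra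
    then have ct: "\<kappa> c \<otimes> t' = t \<ominus> r 0" using ii t(1) rc by simp
    have te: "t = r 0 \<oplus> \<kappa> c \<otimes> t'" unfolding ct using t(1) rc[of 0] by algebra
    have alg: "a \<otimes> (x \<ominus> q) = (b \<oplus> a \<otimes> x) \<ominus> (b \<oplus> a \<otimes> q)"
      if "a \<in> carrier B" "x \<in> carrier B" "q \<in> carrier B" "b \<in> carrier B" for a x q b
      using that by algebra
    have "nm (t' \<ominus> psum c (\<lambda>k. r (Suc k)) n) \<le> v c ^ n" for n
    proof -
      have pc: "psum c (\<lambda>k. r (Suc k)) n \<in> carrier B" using rc c(1) by (intro psum_carrier)
      have "\<kappa> c \<otimes> (t' \<ominus> psum c (\<lambda>k. r (Suc k)) n) = t \<ominus> psum c r (Suc n)"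
        unfolding psum_shift[OF rc c(1)] using alg[OF cc(1) t'c pc rc[of 0]] te by simp
      then have "v c * nm (t' \<ominus> psum c (\<lambda>k. r (Suc k)) n) = nm (t \<ominus> psum c r (Suc n))"
        using nm_smult[OF c(1), of "t' \<ominus> psum c (\<lambda>k. r (Suc k)) n"] pc t'c by simp
      also have "\<dots> \<le> v c * v c ^ n" using t(3)[of "Suc n"] by simp
      finally show ?thesis using v_pos[OF c(1,2)] by simp
    qed
    then have "t' \<in> ?T" using t'c t(2) by (auto intro!: exI[of _ "\<lambda>k. r (Suc k)"])
    then show "\<exists>p\<in>Pol y m. \<exists>t'\<in>?T. t = p \<oplus> \<kappa> c \<otimes> t'" using te t(2)[of 0] by blast
  qed
  then show ?thesis using assms by blast
qed

text \<open>The series is summed coefficient by coefficient: for each vector of the list the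
  coefficients in \<open>Pol\<close> form a series of their own, whose sum lies in D by
  \<open>series_D\<close>.\<close>

lemma series_lspan:
  assumes c: "c \<in> carrier K" "c \<noteq> 0\<^sub>K" "v c < 1"
  shows "set us \<subseteq> carrier B \<Longrightarrow> (\<And>u. u \<in> set us \<Longrightarrow> nm u \<le> 1) \<Longrightarrow>
    (\<And>k. x k \<in> lspan B (Pol y m) us) \<Longrightarrow>
    \<exists>l\<in>lspan B D us. \<forall>n. nm (l \<ominus> psum c x n) \<le> v c ^ n"
proof (induction us arbitrary: x)
  case Nil
  then have "psum c x n = \<zero>" for n by (induction n) (use c in \<open>simp_all add: psum_0 psum_Suc\<close>)
  then show ?case using nm_zero[of \<zero>] v_nonneg[OF c(1)] by (simp add: B.minus_eq)
next
  case (Cons u us)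
  have "\<forall>k. \<exists>r w. x k = r \<otimes> u \<oplus> w \<and> r \<in> Pol y m \<and> w \<in> lspan B (Pol y m) us" using Cons.prems(3) by simp
  then obtain r w where rw: "\<And>k. x k = r k \<otimes> u \<oplus> w k" "\<And>k. r k \<in> Pol y m"
    "\<And>k. w k \<in> lspan B (Pol y m) us" by metis
  have u: "u \<in> carrier B" "nm u \<le> 1" and us: "set us \<subseteq> carrier B" using Cons.prems by auto
  have rc: "r k \<in> carrier B" for k using rw(2) Pol_carrier by blast
  have wc: "w k \<in> carrier B" for k using rw(3) B.lspan_carrier[OF _ us] Pol_carrier by blast
  obtain l where l: "l \<in> lspan B D us" "\<And>n. nm (l \<ominus> psum c w n) \<le> v c ^ n"
    using Cons.IH[of w, OF us _ rw(3)] Cons.prems(2) by auto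
  have lc: "l \<in> carrier B" using l(1) B.lspan_carrier[OF _ us] D_carrier by blast
  obtain R where R: "R \<in> carrier B" "\<And>n. nm (R \<ominus> psum c r n) \<le> v c ^ n"
    using series_limit[of r c] rc Pol_nm[OF rw(2)] c by auto
  have RD: "R \<in> D" using series_D[OF rw(2) c R] .
  have "nm ((R \<otimes> u \<oplus> l) \<ominus> psum c x n) \<le> v c ^ n" for n
  proof -
    have pc: "psum c r n \<in> carrier B" "psum c w n \<in> carrier B" using rc wc c(1) by (auto intro: psum_carrier)
    have "x = (\<lambda>k. u \<otimes> r k \<oplus> w k)" using rw(1) rc u by (intro ext) (simp add: B.m_comm)
    then have "psum c x n = psum c (\<lambda>k. u \<otimes> r k \<oplus> w k) n" by simp
    also have "\<dots> = psum c (\<lambda>k. u \<otimes> r k) n \<oplus> psum c w n" using rc u wc c(1) by (intro psum_add) auto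
    also have "psum c (\<lambda>k. u \<otimes> r k) n = u \<otimes> psum c r n" using rc u c(1) by (intro psum_smult) auto
    finally have e: "psum c x n = u \<otimes> psum c r n \<oplus> psum c w n" .
    have "(R \<otimes> u \<oplus> l) \<ominus> psum c x n = u \<otimes> (R \<ominus> psum c r n) \<oplus> (l \<ominus> psum c w n)"
      unfolding e using R(1) u(1) lc pc by algebra
    then have "nm ((R \<otimes> u \<oplus> l) \<ominus> psum c x n) \<le> max (nm (u \<otimes> (R \<ominus> psum c r n))) (nm (l \<ominus> psum c w n))"
      using nm_add R(1) u(1) lc pc by simp
    moreover have "nm (u \<otimes> (R \<ominus> psum c r n)) \<le> 1 * v c ^ n"
    proof -
      have "nm u * nm (R \<ominus> psum c r n) \<le> 1 * v c ^ n"
        using u R pc nm_nonneg by (intro mult_mono) auto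
      then show ?thesis using nm_mult[of u "R \<ominus> psum c r n"] u(1) R(1) pc by simp
    qed
    ultimately show ?thesis using l(2)[of n] by simp
  qed
  moreover have "R \<otimes> u \<oplus> l \<in> lspan B D (u # us)" by (rule lspan_ConsI[OF refl RD l(1)])
  ultimately show ?case by blast
qed

lemma Pol_least:
  assumes S: "subring S B" and "\<And>c. c \<in> V \<Longrightarrow> \<kappa> c \<in> S" "\<And>i. i < m \<Longrightarrow> y i \<in> S"
  shows "Pol y m \<subseteq> S"
proof
  have pw: "x [^] (n::nat) \<in> S" if "x \<in> S" for x n
    by (induction n) (use subringE(3,6)[OF S] that in auto)
  have "j \<le> m \<Longrightarrow> mnm y j e \<in> S" for j e
    by (induction j) (use subringE(3,6)[OF S] assms(3) pw in auto)
  then have mS: "mnm y m e \<in> S" for e by simp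
  fix p assume "p \<in> Pol y m"
  then show "p \<in> S"
    by (induction rule: Pol.induct) (use subringE(2,6,7)[OF S] assms(2) mS in auto)
qed

end

section \<open>Maximal ideals of Banach algebras and finiteness over a subalgebra\<close>

locale banach_point = banach_algebra B K \<kappa> v nm + L: field L + phi: ring_hom_cring B L \<phi>
  for B :: "('b, 'n) ring_scheme" (structure) and K :: "('k, 'm) ring_scheme" and \<kappa> v nm
    and L :: "('l, 'o) ring_scheme" and \<phi> +
  assumes surj: "\<phi> ` carrier B = carrier L"
begin

text \<open>Maximal ideals are closed. If arbitrarily small t map to l \<noteq> 0 and b maps to the
  inverse of l, then b t has norm below 1 for suitable t, so 1 - b t is a unit of B; but its image
  is 0.\<close>

lemma kernel_closed:
  assumes l: "l \<in> carrier L" and t: "\<And>e. e > 0 \<Longrightarrow> \<exists>t\<in>carrier B. nm t < e \<and> \<phi> t = l"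
  shows "l = \<zero>\<^bsub>L\<^esub>"
proof (rule ccontr)
  assume "l \<noteq> \<zero>\<^bsub>L\<^esub>"
  then have i: "inv\<^bsub>L\<^esub> l \<in> carrier L" "inv\<^bsub>L\<^esub> l \<otimes>\<^bsub>L\<^esub> l = \<one>\<^bsub>L\<^esub>" using l by (simp_all add: L.field_Units)
  then obtain b where b: "b \<in> carrier B" "\<phi> b = inv\<^bsub>L\<^esub> l" using surj by (metis imageE)
  have p: "0 < 1 / (nm b + 1)" using nm_nonneg[OF b(1)] by simp
  obtain t where t: "t \<in> carrier B" "nm t < 1 / (nm b + 1)" "\<phi> t = l" using t[OF p] by blast
  have "nm (b \<otimes> t) \<le> nm b * nm t" by (rule nm_mult[OF b(1) t(1)])
  also have "\<dots> \<le> nm b * (1 / (nm b + 1))" using t(2) nm_nonneg[OF b(1)] by (intro mult_left_mono) auto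
  also have "\<dots> < 1" using nm_nonneg[OF b(1)] by simp
  finally obtain w where w: "w \<in> carrier B" "(\<one> \<ominus> b \<otimes> t) \<otimes> w = \<one>"
    using one_minus_unit[of "b \<otimes> t"] b(1) t(1) by auto
  have z: "\<phi> (\<one> \<ominus> b \<otimes> t) = \<zero>\<^bsub>L\<^esub>"
    using b t i L.one_closed by (simp add: B.minus_eq L.r_neg)
  have "\<phi> ((\<one> \<ominus> b \<otimes> t) \<otimes> w) = \<phi> (\<one> \<ominus> b \<otimes> t) \<otimes>\<^bsub>L\<^esub> \<phi> w"
    by (rule phi.hom_mult) (use b(1) t(1) w(1) in auto)
  also have "\<dots> = \<zero>\<^bsub>L\<^esub>" unfolding z using w(1) by simp
  finally show False using w(2) by simp
qed

definition k :: "'l set" where "k = \<phi> ` \<kappa> ` carrier K"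

lemma kE: "a \<in> k \<Longrightarrow> \<exists>c\<in>carrier K. a = \<phi> (\<kappa> c)" unfolding k_def by blast

lemma k_subfield: "subfield k L"
proof (rule L.subfieldI')
  have 1: "ring_hom_ring B L \<phi>" by (rule ring_hom_ringI2[OF B.ring_axioms L.ring_axioms phi.homh])
  have 2: "ring_hom_ring K B \<kappa>" by (rule ring_hom_ringI2[OF K.ring_axioms B.ring_axioms homh])
  show "subring k L"
    unfolding k_def
    by (rule ring_hom_ring.img_is_subring[OF 1 ring_hom_ring.img_is_subring[OF 2 K.carrier_is_subring]])
  fix a assume "a \<in> k - {\<zero>\<^bsub>L\<^esub>}"
  then obtain c where c: "c \<in> carrier K" "a = \<phi> (\<kappa> c)" "a \<noteq> \<zero>\<^bsub>L\<^esub>" using kE by blast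
  then have "c \<noteq> 0\<^sub>K" by auto
  then have i: "inv\<^bsub>K\<^esub> c \<in> carrier K" "c \<cdot> inv\<^bsub>K\<^esub> c = 1\<^sub>K" using K_inv[OF c(1)] by auto
  have "\<phi> (\<kappa> (c \<cdot> inv\<^bsub>K\<^esub> c)) = \<one>\<^bsub>L\<^esub>" unfolding i(2) by simp
  then have "a \<otimes>\<^bsub>L\<^esub> \<phi> (\<kappa> (inv\<^bsub>K\<^esub> c)) = \<one>\<^bsub>L\<^esub>" using c(1,2) i(1) by simp
  then have "inv\<^bsub>L\<^esub> a = \<phi> (\<kappa> (inv\<^bsub>K\<^esub> c))"
    using c i(1) by (metis L.comm_inv_char hom_closed phi.hom_closed)
  then show "inv\<^bsub>L\<^esub> a \<in> k" unfolding k_def using i(1) by simp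
qed

text \<open>Division by successive approximation. The relation \<open>rel\<close> reduces z^s, up to
  the kernel of \<phi>, to lower powers of z with an error in c D; hence every element of D is such
  a polynomial up to an error in c D. Iteration produces a series in powers of c whose terms have
  degree below s in z, and its sum has coefficients in the ring D of the variables y'. The error
  vanishes in the limit by \<open>kernel_closed\<close>.\<close>

lemma finite_over_subalgebra:
  assumes vY: "variables B K \<kappa> v nm y (Suc m)" and vY': "variables B K \<kappa> v nm y' m"
    and sub: "\<And>i. i < m \<Longrightarrow> y' i \<in> Pol y (Suc m)"
    and yz: "\<And>i. i < m \<Longrightarrow> \<exists>t. y i \<in> lspan B (Pol y' m) (zpowers B (y m) t)"
    and c: "c \<in> carrier K" "c \<noteq> 0\<^sub>K" "v c < 1"
    and rel: "l \<in> lspan B (Pol y' m) (zpowers B (y m) s)" "d \<in> variables.D B K \<kappa> v nm y (Suc m)"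
      "\<phi> (y m [^] s) = \<phi> (l \<oplus> \<kappa> c \<otimes> d)"
  shows "\<phi> ` variables.E B K \<kappa> v nm y (Suc m) =
    lspan L (\<phi> ` variables.E B K \<kappa> v nm y' m) (map \<phi> (zpowers B (y m) s))"
proof -
  interpret Y: variables B K \<kappa> v nm y "Suc m" by (rule vY)
  interpret Y': variables B K \<kappa> v nm y' m by (rule vY')
  define z where "z = y m"
  have z: "z \<in> carrier B" "nm z \<le> 1" "z \<in> Pol y (Suc m)" unfolding z_def using Y.y[of m] Y.Pol_var by auto
  have cc: "\<kappa> c \<in> carrier B" using c by simp
  let ?S = "Pol y' m" and ?low = "\<lambda>t. lspan B (Pol y' m) (zpowers B z t)"
  note S = Y'.Pol_subring
  note zc = B.zpowers_carrier[OF z(1)]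
  have SP: "?S \<subseteq> Pol y (Suc m)"
    using Y.Pol_const sub by (intro Y'.Pol_least Y.Pol_subring)
  have lowc: "x \<in> carrier B" if "x \<in> ?low t" for x t
    using B.lspan_carrier[OF _ zc] Y'.Pol_carrier that by blast
  \<comment> \<open>Elements that up to the kernel are polynomials of degree below s in z with an
    error in c D. Stability under z and under the coefficients brings 1, then all monomials in y,
    and finally all of D into Q.\<close>
  define Q where "Q = {x \<in> carrier B. \<exists>l\<in>?low s. \<exists>d\<in>Y.D. \<phi> x = \<phi> (l \<oplus> \<kappa> c \<otimes> d)}"
  have Q_I: "x \<in> Q" if "x \<in> carrier B" "l \<in> ?low s" "d \<in> Y.D" "\<phi> x = \<phi> (l \<oplus> \<kappa> c \<otimes> d)" for x l d
    unfolding Q_def using that by blast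
  have Q_E: "\<exists>l d. l \<in> ?low s \<and> d \<in> Y.D \<and> \<phi> x = \<phi> (l \<oplus> \<kappa> c \<otimes> d)" if "x \<in> Q" for x
    using that unfolding Q_def by blast
  have Qc: "x \<in> carrier B" if "x \<in> Q" for x using that unfolding Q_def by blast
  have Y0: "\<zero> \<in> Y.D" by (rule subringE(2)[OF Y.D_subring])
  have low_Q: "x \<in> Q" if "x \<in> ?low s" for x
    using Q_I[OF lowc[OF that] that Y0] lowc[OF that] cc by simp
  have Q_add: "a \<oplus> b \<in> Q" if ab: "a \<in> Q" "b \<in> Q" for a b
  proof -
    obtain l1 d1 where 1: "l1 \<in> ?low s" "d1 \<in> Y.D" "\<phi> a = \<phi> (l1 \<oplus> \<kappa> c \<otimes> d1)" using Q_E[OF ab(1)] by blast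
    obtain l2 d2 where 2: "l2 \<in> ?low s" "d2 \<in> Y.D" "\<phi> b = \<phi> (l2 \<oplus> \<kappa> c \<otimes> d2)" using Q_E[OF ab(2)] by blast
    note ccs = lowc[OF 1(1)] lowc[OF 2(1)] Y.D_carrier[OF 1(2)] Y.D_carrier[OF 2(2)] cc
    have "\<phi> (a \<oplus> b) = \<phi> ((l1 \<oplus> \<kappa> c \<otimes> d1) \<oplus> (l2 \<oplus> \<kappa> c \<otimes> d2))" using 1(3) 2(3) Qc[OF ab(1)] Qc[OF ab(2)] ccs by simp
    also have "(l1 \<oplus> \<kappa> c \<otimes> d1) \<oplus> (l2 \<oplus> \<kappa> c \<otimes> d2) = (l1 \<oplus> l2) \<oplus> \<kappa> c \<otimes> (d1 \<oplus> d2)" using ccs by algebra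
    finally show ?thesis
      using Q_I[OF _ B.lspan_add[OF S zc 1(1) 2(1)] Y.D_add[OF 1(2) 2(2)]] Qc[OF ab(1)] Qc[OF ab(2)] by simp
  qed
  have Q_S: "r \<otimes> x \<in> Q" if rx: "r \<in> ?S" "x \<in> Q" for r x
  proof -
    obtain l1 d1 where 1: "l1 \<in> ?low s" "d1 \<in> Y.D" "\<phi> x = \<phi> (l1 \<oplus> \<kappa> c \<otimes> d1)" using Q_E[OF rx(2)] by blast
    note ccs = lowc[OF 1(1)] Y.D_carrier[OF 1(2)] cc Y'.Pol_carrier[OF rx(1)]
    have "\<phi> (r \<otimes> x) = \<phi> (r \<otimes> (l1 \<oplus> \<kappa> c \<otimes> d1))" using 1(3) Qc[OF rx(2)] ccs by simp
    also have "r \<otimes> (l1 \<oplus> \<kappa> c \<otimes> d1) = r \<otimes> l1 \<oplus> \<kappa> c \<otimes> (r \<otimes> d1)" using ccs by algebra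
    finally show ?thesis
      using Q_I[OF _ B.lspan_smult[OF S zc 1(1) rx(1)] Y.D_Pol_mult[OF subsetD[OF SP rx(1)] 1(2)]] Qc[OF rx(2)] ccs by simp
  qed
  have zs_Q: "z [^] t \<in> Q" if "t \<le> s" for t
  proof (cases "t = s")
    case True
    show ?thesis unfolding True by (rule Q_I[OF _ rel(1)[folded z_def] rel(2) rel(3)[folded z_def]]) (use z in simp)
  next
    case False
    then show ?thesis using that by (intro low_Q B.zpowers_power[OF S z(1)]) simp
  qed
  have z_low: "z \<otimes> x \<in> Q" if "x \<in> ?low t" "t \<le> s" for x t
    using that
  proof (induction t arbitrary: x)
    case 0
    then show ?case using low_Q[OF B.lspan_zero[OF S zc]] z by simp
  next
    case (Suc t)
    obtain a w where aw: "a \<in> ?S" "w \<in> ?low t" "x = a \<otimes> z [^] t \<oplus> w" using Suc.prems(1) by auto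
    have "z \<otimes> x = a \<otimes> z [^] Suc t \<oplus> z \<otimes> w"
      unfolding aw(3) using Y'.Pol_carrier[OF aw(1)] z lowc[OF aw(2)] by (simp add: B.r_distr B.m_ac)
    then show ?case using Q_add[OF Q_S[OF aw(1) zs_Q[of "Suc t"]] Suc.IH[OF aw(2)]] Suc.prems(2) by simp
  qed
  have Q_D: "x \<oplus> \<kappa> c \<otimes> d \<in> Q" if x: "x \<in> Q" and d: "d \<in> Y.D" for x d
  proof -
    obtain l1 d1 where 1: "l1 \<in> ?low s" "d1 \<in> Y.D" "\<phi> x = \<phi> (l1 \<oplus> \<kappa> c \<otimes> d1)" using Q_E[OF x] by blast
    note ccs = lowc[OF 1(1)] Y.D_carrier[OF 1(2)] Y.D_carrier[OF d] cc
    have "\<phi> (x \<oplus> \<kappa> c \<otimes> d) = \<phi> ((l1 \<oplus> \<kappa> c \<otimes> d1) \<oplus> \<kappa> c \<otimes> d)" using 1(3) Qc[OF x] ccs by simp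
    also have "(l1 \<oplus> \<kappa> c \<otimes> d1) \<oplus> \<kappa> c \<otimes> d = l1 \<oplus> \<kappa> c \<otimes> (d1 \<oplus> d)" using ccs by algebra
    finally show ?thesis using Q_I[OF _ 1(1) Y.D_add[OF 1(2) d]] Qc[OF x] ccs by simp
  qed
  have Q_phi: "x \<in> Q" if "x' \<in> Q" "x \<in> carrier B" "\<phi> x = \<phi> x'" for x x'
    using that unfolding Q_def by auto
  have Q_z: "z \<otimes> x \<in> Q" if x: "x \<in> Q" for x
  proof -
    obtain l1 d1 where 1: "l1 \<in> ?low s" "d1 \<in> Y.D" "\<phi> x = \<phi> (l1 \<oplus> \<kappa> c \<otimes> d1)" using Q_E[OF x] by blast
    note ccs = lowc[OF 1(1)] Y.D_carrier[OF 1(2)] cc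
    have "\<phi> (z \<otimes> x) = \<phi> (z \<otimes> (l1 \<oplus> \<kappa> c \<otimes> d1))" using 1(3) Qc[OF x] ccs z by simp
    also have "z \<otimes> (l1 \<oplus> \<kappa> c \<otimes> d1) = z \<otimes> l1 \<oplus> \<kappa> c \<otimes> (z \<otimes> d1)" using ccs z(1) by algebra
    finally show ?thesis
      using Q_phi[OF Q_D[OF z_low[OF 1(1) order_refl] Y.D_Pol_mult[OF z(3) 1(2)]]] Qc[OF x] z(1) by simp
  qed
  have Q_low: "a \<otimes> x \<in> Q" if "a \<in> ?low t" "x \<in> Q" for a t x
    using that
  proof (induction t arbitrary: a)
    case 0
    then show ?case using low_Q[OF B.lspan_zero[OF S zc]] Qc by simp
  next
    case (Suc t)
    obtain r w where rw: "r \<in> ?S" "w \<in> ?low t" "a = r \<otimes> z [^] t \<oplus> w" using Suc.prems(1) by auto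
    have zx: "z [^] j \<otimes> x \<in> Q" for j :: nat
    proof (induction j)
      case 0 then show ?case using Suc.prems(2) Qc by simp
    next
      case (Suc j)
      have "z [^] Suc j \<otimes> x = z \<otimes> (z [^] j \<otimes> x)" using z Qc[OF \<open>x \<in> Q\<close>] by (simp add: B.m_ac)
      then show ?case using Q_z[OF Suc] by simp
    qed
    have "a \<otimes> x = r \<otimes> (z [^] t \<otimes> x) \<oplus> w \<otimes> x"
      unfolding rw(3) using Y'.Pol_carrier[OF rw(1)] z lowc[OF rw(2)] Qc[OF Suc.prems(2)] by (simp add: B.l_distr B.m_assoc)
    then show ?case using Q_add[OF Q_S[OF rw(1) zx] Suc.IH[OF rw(2) Suc.prems(2)]] by simp
  qed
  have one_Q: "\<one> \<in> Q" using zs_Q[of 0] by simp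
  have y_pow: "y i [^] (n::nat) \<otimes> x \<in> Q" if "i < Suc m" "x \<in> Q" for i n x
  proof (induction n)
    case 0 then show ?case using that Qc by simp
  next
    case (Suc n)
    have yi: "y i \<in> carrier B" using Y.y(1)[OF that(1)] .
    have e: "y i [^] Suc n \<otimes> x = y i \<otimes> (y i [^] n \<otimes> x)" using yi Qc[OF that(2)] by (simp add: B.m_ac)
    show ?case
    proof (cases "i = m")
      case True
      then show ?thesis unfolding e using Q_z[OF Suc] by (simp add: z_def)
    next
      case False
      then have "i < m" using \<open>i < Suc m\<close> by simp
      then obtain t where "y i \<in> ?low t" using yz[of i] unfolding z_def by blast
      then show ?thesis unfolding e using Q_low Suc by blast
    qed
  qed
  have mnm_Q: "j \<le> Suc m \<Longrightarrow> x \<in> Q \<Longrightarrow> mnm y j e \<otimes> x \<in> Q" for j x e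
  proof (induction j arbitrary: x)
    case 0 then show ?case using Qc by simp
  next
    case (Suc j)
    have c1: "mnm y j e \<in> carrier B" "y j \<in> carrier B"
      using Suc.prems(1) Y.y(1) by (auto intro: mnm_carrier)
    have "mnm y (Suc j) e \<otimes> x = mnm y j e \<otimes> (y j [^] e j \<otimes> x)"
      using c1 Qc[OF Suc.prems(2)] by (simp add: B.m_assoc)
    then show ?case using Suc.IH[OF _ y_pow[of j x "e j"]] Suc.prems by simp
  qed
  have Pol_Q: "p \<in> Q" if "p \<in> Pol y (Suc m)" for p
    using that
  proof (induction rule: Pol.induct)
    case zero then show ?case using low_Q[OF B.lspan_zero[OF S zc]] .
  next
    case (step p b e)
    have "mnm y (Suc m) e \<in> Q" using mnm_Q[OF order_refl one_Q, of e] Y.mc by simp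
    then show ?case using Q_add[OF Q_S[OF Y'.Pol_const[OF step.hyps(2)]] step.IH] by blast
  qed
  have D_Q: "x \<in> Q" if "x \<in> Y.D" for x
  proof -
    obtain p t where "p \<in> Pol y (Suc m)" "t \<in> Y.D" "x = p \<oplus> \<kappa> c \<otimes> t" using Y.D_split[OF \<open>x \<in> Y.D\<close> c(1,2)] .
    then show ?thesis using Q_D[OF Pol_Q] by simp
  qed
  have "\<forall>x\<in>Y.D. \<exists>l d. l \<in> ?low s \<and> d \<in> Y.D \<and> \<phi> x = \<phi> (l \<oplus> \<kappa> c \<otimes> d)" using Q_E D_Q by blast
  then obtain f g where fg: "\<And>x. x \<in> Y.D \<Longrightarrow> f x \<in> ?low s" "\<And>x. x \<in> Y.D \<Longrightarrow> g x \<in> Y.D"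
    "\<And>x. x \<in> Y.D \<Longrightarrow> \<phi> x = \<phi> (f x \<oplus> \<kappa> c \<otimes> g x)" by metis
  have D_low: "\<exists>l\<in>lspan B Y'.D (zpowers B z s). \<phi> h = \<phi> l" if h: "h \<in> Y.D" for h
  proof -
    \<comment> \<open>The successive errors for h: each is split into its polynomial part
      \<open>f\<close> and c times the next error \<open>g\<close>.\<close>
    define dd where "dd n = (g ^^ n) h" for n
    have dd: "dd n \<in> Y.D" for n unfolding dd_def by (induction n) (simp_all add: h fg(2))
    have ddc: "dd n \<in> carrier B" for n using Y.D_carrier[OF dd] .
    define x where "x n = f (dd n)" for n
    have xl: "x n \<in> ?low s" for n unfolding x_def using fg(1)[OF dd] .
    have xc: "x n \<in> carrier B" for n using lowc[OF xl] .
    have pc: "psum c x n \<in> carrier B" for n using xc c(1) by (rule psum_carrier)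
    have alg1: "p \<oplus> q \<otimes> (a \<oplus> b \<otimes> d) = (p \<oplus> q \<otimes> a) \<oplus> (q \<otimes> b) \<otimes> d"
      if "p \<in> carrier B" "q \<in> carrier B" "a \<in> carrier B" "b \<in> carrier B" "d \<in> carrier B" for p q a b d
      using that by algebra
    have alg2: "(p \<oplus> q) \<ominus> a = q \<ominus> (a \<ominus> p)"
      if "p \<in> carrier B" "q \<in> carrier B" "a \<in> carrier B" for p q a
      using that by algebra
    have ph: "\<phi> h = \<phi> (psum c x n \<oplus> \<kappa> (c [^]\<^bsub>K\<^esub> n) \<otimes> dd n)" for n
    proof (induction n)
      case 0 then show ?case using Y.D_carrier[OF h] by (simp add: dd_def psum_0)
    next
      case (Suc n)
      have cn: "\<kappa> (c [^]\<^bsub>K\<^esub> n) \<in> carrier B" using c by simp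
      have e: "\<kappa> (c [^]\<^bsub>K\<^esub> Suc n) = \<kappa> (c [^]\<^bsub>K\<^esub> n) \<otimes> \<kappa> c" using c by simp
      have "\<phi> (dd n) = \<phi> (x n \<oplus> \<kappa> c \<otimes> dd (Suc n))" using fg(3)[OF dd[of n]] by (simp add: x_def dd_def)
      then have "\<phi> h = \<phi> (psum c x n \<oplus> \<kappa> (c [^]\<^bsub>K\<^esub> n) \<otimes> (x n \<oplus> \<kappa> c \<otimes> dd (Suc n)))"
        using Suc pc[of n] cn ddc xc cc by simp
      also have "psum c x n \<oplus> \<kappa> (c [^]\<^bsub>K\<^esub> n) \<otimes> (x n \<oplus> \<kappa> c \<otimes> dd (Suc n)) =
          (psum c x n \<oplus> \<kappa> (c [^]\<^bsub>K\<^esub> n) \<otimes> x n) \<oplus> \<kappa> (c [^]\<^bsub>K\<^esub> Suc n) \<otimes> dd (Suc n)"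
        unfolding e using alg1[OF pc[of n] cn xc[of n] cc ddc[of "Suc n"]] .
      finally show ?case by (simp only: psum_Suc)
    qed
    have "nm u \<le> 1" if "u \<in> set (zpowers B z s)" for u
      using that nm_pow[OF z(1)] power_le_one[OF nm_nonneg[OF z(1)] z(2)] unfolding zpowers_mem by (metis order_trans)
    then obtain l where l: "l \<in> lspan B Y'.D (zpowers B z s)" "\<And>n. nm (l \<ominus> psum c x n) \<le> v c ^ n"
      using Y'.series_lspan[of c "zpowers B z s" x, OF c zc _ xl] by blast
    have lc: "l \<in> carrier B" using l(1) B.lspan_carrier[OF _ zc] Y'.D_carrier by blast
    have hc: "h \<in> carrier B" using Y.D_carrier[OF h] .
    have "\<phi> (h \<ominus> l) = \<zero>\<^bsub>L\<^esub>"
    proof (rule kernel_closed)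
      show "\<phi> (h \<ominus> l) \<in> carrier L" using hc lc by simp
      fix e :: real assume "e > 0"
      then obtain n where n: "v c ^ n < e" using real_arch_pow_inv c(3) by blast
      have cn: "\<kappa> (c [^]\<^bsub>K\<^esub> n) \<in> carrier B" "c [^]\<^bsub>K\<^esub> n \<in> carrier K" using c by simp_all
      \<comment> \<open>The n-th error term minus the tail of the series. It has norm at most |c|^n
        and the same image as h - l.\<close>
      let ?t = "\<kappa> (c [^]\<^bsub>K\<^esub> n) \<otimes> dd n \<ominus> (l \<ominus> psum c x n)"
      have "v (c [^]\<^bsub>K\<^esub> n) * nm (dd n) \<le> v c ^ n * 1"
        unfolding v_pow[OF c(1)] using Y.D_nm[OF dd[of n]] v_nonneg[OF c(1)] by (intro mult_left_mono) auto
      then have "nm (\<kappa> (c [^]\<^bsub>K\<^esub> n) \<otimes> dd n) \<le> v c ^ n" using nm_smult[OF cn(2) ddc[of n]] by simp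
      then have "nm ?t \<le> v c ^ n"
        using nm_diff[of "\<kappa> (c [^]\<^bsub>K\<^esub> n) \<otimes> dd n" "l \<ominus> psum c x n"] l(2)[of n] cn(1) ddc[of n] lc pc[of n] by simp
      moreover have "\<phi> (h \<ominus> l) = \<phi> ?t"
      proof -
        have "\<phi> (h \<ominus> l) = \<phi> h \<ominus>\<^bsub>L\<^esub> \<phi> l" using hc lc by (simp add: B.minus_eq L.minus_eq)
        also have "\<dots> = \<phi> (psum c x n \<oplus> \<kappa> (c [^]\<^bsub>K\<^esub> n) \<otimes> dd n) \<ominus>\<^bsub>L\<^esub> \<phi> l" unfolding ph[of n] ..
        also have "\<dots> = \<phi> ((psum c x n \<oplus> \<kappa> (c [^]\<^bsub>K\<^esub> n) \<otimes> dd n) \<ominus> l)"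
          using pc[of n] cn(1) ddc[of n] lc by (simp add: B.minus_eq L.minus_eq)
        also have "(psum c x n \<oplus> \<kappa> (c [^]\<^bsub>K\<^esub> n) \<otimes> dd n) \<ominus> l = ?t"
          using alg2[OF pc[of n] _ lc, of "\<kappa> (c [^]\<^bsub>K\<^esub> n) \<otimes> dd n"] cn(1) ddc[of n] by simp
        finally show ?thesis .
      qed
      ultimately show "\<exists>t\<in>carrier B. nm t < e \<and> \<phi> t = \<phi> (h \<ominus> l)"
        using n cn(1) ddc[of n] lc pc[of n] by (intro bexI[of _ ?t]) auto
    qed
    then have "\<phi> h \<ominus>\<^bsub>L\<^esub> \<phi> l = \<zero>\<^bsub>L\<^esub>" using hc lc by (simp add: B.minus_eq L.minus_eq)
    then have "\<phi> h = \<phi> l" using hc lc by simp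
    then show ?thesis using l(1) by blast
  qed
  have E'E: "Y'.E \<subseteq> Y.E"
  proof -
    have "Y'.D \<subseteq> Y.D"
    proof (rule Y.D_coinduct)
      fix b t assume "b \<in> carrier K" "b \<noteq> 0\<^sub>K" "t \<in> Y'.D"
      then obtain p t' where "p \<in> ?S" "t' \<in> Y'.D" "t = p \<oplus> \<kappa> b \<otimes> t'" using Y'.D_split by metis
      then show "\<exists>p\<in>Pol y (Suc m). \<exists>t'\<in>Y'.D. t = p \<oplus> \<kappa> b \<otimes> t'" using SP by blast
    qed (use Y'.D_carrier Y'.D_nm in auto)
    then show ?thesis unfolding Y'.E_def Y.E_def by blast
  qed
  have E'c: "Y'.E \<subseteq> carrier B" by (rule subringE(1)[OF Y'.E_subring])
  have "\<phi> ` Y.E = \<phi> ` lspan B Y'.E (zpowers B z s)"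
  proof (rule antisym)
    have zE: "z [^] j \<in> Y.E" for j :: nat
      using z(3) Y.Pol_D Y.D_E subringE(3,6)[OF Y.E_subring] by (induction j) auto
    have "lspan B Y'.E (zpowers B z s) \<subseteq> Y.E"
      by (rule B.lspan_subring[OF Y.E_subring E'E]) (auto simp: zpowers_mem zE)
    then show "\<phi> ` lspan B Y'.E (zpowers B z s) \<subseteq> \<phi> ` Y.E" by (rule image_mono)
    show "\<phi> ` Y.E \<subseteq> \<phi> ` lspan B Y'.E (zpowers B z s)"
    proof
      fix u assume "u \<in> \<phi> ` Y.E"
      then obtain x b where x: "x \<in> carrier B" "u = \<phi> x" "b \<in> carrier K" "b \<noteq> 0\<^sub>K" "\<kappa> b \<otimes> x \<in> Y.D"
        unfolding Y.E_def by blast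
      obtain l where l: "l \<in> lspan B Y'.D (zpowers B z s)" "\<phi> (\<kappa> b \<otimes> x) = \<phi> l" using D_low[OF x(5)] by blast
      have lE: "l \<in> lspan B Y'.E (zpowers B z s)" using l(1) B.lspan_mono[OF Y'.D_E] by blast
      have lc: "l \<in> carrier B" using lE B.lspan_carrier[OF E'c zc] by blast
      have i: "inv\<^bsub>K\<^esub> b \<in> carrier K" "b \<cdot> inv\<^bsub>K\<^esub> b = 1\<^sub>K" using K_inv[OF x(3,4)] by auto
      have ii: "\<kappa> b \<otimes> \<kappa> (inv\<^bsub>K\<^esub> b) = \<one>" using hom_mult[of b "inv\<^bsub>K\<^esub> b"] i x by simp
      have bc: "\<kappa> b \<in> carrier B" "\<kappa> (inv\<^bsub>K\<^esub> b) \<in> carrier B" using x i by auto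
      have "\<kappa> (inv\<^bsub>K\<^esub> b) \<otimes> (\<kappa> b \<otimes> x) = (\<kappa> b \<otimes> \<kappa> (inv\<^bsub>K\<^esub> b)) \<otimes> x" using bc x(1) by algebra
      then have xe: "x = \<kappa> (inv\<^bsub>K\<^esub> b) \<otimes> (\<kappa> b \<otimes> x)" using ii x(1) by simp
      have "u = \<phi> (\<kappa> (inv\<^bsub>K\<^esub> b)) \<otimes>\<^bsub>L\<^esub> \<phi> (\<kappa> b \<otimes> x)" unfolding x(2) by (subst xe) (use bc x(1) in simp)
      also have "\<dots> = \<phi> (\<kappa> (inv\<^bsub>K\<^esub> b) \<otimes> l)" unfolding l(2) using bc lc by simp
      finally show "u \<in> \<phi> ` lspan B Y'.E (zpowers B z s)"
        using B.lspan_smult[OF Y'.E_subring zc lE Y'.E_const[OF i(1)]] by blast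
    qed
  qed
  then show ?thesis using phi.lspan_image[OF E'c zc] unfolding z_def by simp
qed

end

text \<open>The degree in z of the monomial with exponents e after x_i is replaced by y_i +
  z^(M^(i+1)) for i < m and x_m by z. The exponents are the digits of this number in base M, with
  \<open>e m\<close> the lowest, so they can be recovered when all are below M.\<close>

definition weight :: "nat \<Rightarrow> nat \<Rightarrow> (nat \<Rightarrow> nat) \<Rightarrow> nat" where
  "weight M m e = e m + (\<Sum>i<m. e i * M ^ Suc i)"

context banach_algebra
begin

lemma weight_inj:
  assumes "e \<in> expos (Suc m)" "e' \<in> expos (Suc m)" "\<And>i. i < Suc m \<Longrightarrow> e i < M" "\<And>i. i < Suc m \<Longrightarrow> e' i < M"
    and "weight M m e = weight M m e'"
  shows "e = e'"
proof
  fix i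
  define a where "a = (\<lambda>e j. if j = 0 then e m else e (j - 1 :: nat) :: nat)"
  have w: "(\<Sum>j<Suc m. a e j * M ^ j) = weight M m e" for e
    unfolding weight_def sum.lessThan_Suc_shift by (simp add: a_def)
  have lt: "a e j < M" if "\<And>i. i < Suc m \<Longrightarrow> e i < M" "j < Suc m" for e j using that unfolding a_def by auto
  have eq: "a e j = a e' j" if "j < Suc m" for j
    using digits_unique[of "Suc m" "a e" M "a e'" j] lt assms(3,4,5) that unfolding w by blast
  show "e i = e' i"
  proof (cases "i < m")
    case True then show ?thesis using eq[of "Suc i"] by (simp add: a_def)
  next
    case False
    show ?thesis
    proof (cases "i = m")
      case True then show ?thesis using eq[of 0] by (simp add: a_def)
    next
      case False
      then have "Suc m \<le> i" using \<open>\<not> i < m\<close> by simp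
      then show ?thesis using assms(1,2) unfolding expos_def by simp
    qed
  qed
qed

end

context variables
begin

text \<open>The inductive definition of \<open>Pol\<close> allows a monomial to be added several
  times. Collecting like terms is what gives a meaning to the largest coefficient of a
  polynomial.\<close>

lemma Pol_repr:
  assumes "p \<in> Pol y m"
  shows "\<exists>F b. finite F \<and> F \<subseteq> expos m \<and> (\<forall>e\<in>F. b e \<in> V) \<and> p = (\<Oplus>e\<in>F. \<kappa> (b e) \<otimes> mnm y m e)"
  using assms
proof (induction rule: Pol.induct)
  case zero
  show ?case by (intro exI[of _ "{}"]) simp
next
  case (step p c e)
  then obtain F b where F: "finite F" "F \<subseteq> expos m" "\<And>e. e \<in> F \<Longrightarrow> b e \<in> V"
    "p = (\<Oplus>e\<in>F. \<kappa> (b e) \<otimes> mnm y m e)" by blast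
  define b' where "b' = b(e := if e \<in> F then c \<oplus>\<^bsub>K\<^esub> b e else c)"
  have b'V: "b' f \<in> V" if "f \<in> insert e F" for f
    using that F(3) step.hyps(2) V_add unfolding b'_def by auto
  have tc: "\<kappa> (b f) \<otimes> mnm y m f \<in> carrier B" if "f \<in> F" for f using F(3)[OF that] V_carrier mc by simp
  let ?R = "\<Oplus>f\<in>F - {e}. \<kappa> (b f) \<otimes> mnm y m f"
  have Rc: "?R \<in> carrier B" using tc by (intro B.finsum_closed) auto
  have cc: "\<kappa> c \<in> carrier B" using step.hyps(2) V_carrier by simp
  have e1: "(\<Oplus>f\<in>insert e F. \<kappa> (b' f) \<otimes> mnm y m f) = \<kappa> (b' e) \<otimes> mnm y m e \<oplus> ?R"
  proof -
    have "(\<Oplus>f\<in>insert e (F - {e}). \<kappa> (b' f) \<otimes> mnm y m f) =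
      \<kappa> (b' e) \<otimes> mnm y m e \<oplus> (\<Oplus>f\<in>F - {e}. \<kappa> (b' f) \<otimes> mnm y m f)"
      using F(1) b'V V_carrier mc by (intro B.finsum_insert) auto
    also have "(\<Oplus>f\<in>F - {e}. \<kappa> (b' f) \<otimes> mnm y m f) = ?R"
      using tc by (intro B.finsum_cong') (auto simp: b'_def)
    finally show ?thesis by simp
  qed
  have "\<kappa> c \<otimes> mnm y m e \<oplus> p = \<kappa> (b' e) \<otimes> mnm y m e \<oplus> ?R"
  proof (cases "e \<in> F")
    case True
    have be: "\<kappa> (b e) \<in> carrier B" using F(3)[OF True] V_carrier by simp
    have "(\<Oplus>f\<in>insert e (F - {e}). \<kappa> (b f) \<otimes> mnm y m f) = \<kappa> (b e) \<otimes> mnm y m e \<oplus> ?R"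
      using F(1) tc True by (intro B.finsum_insert) auto
    then have "p = \<kappa> (b e) \<otimes> mnm y m e \<oplus> ?R" unfolding F(4) using True by (simp add: insert_absorb)
    moreover have "\<kappa> (b' e) = \<kappa> c \<oplus> \<kappa> (b e)" unfolding b'_def using True F(3) step.hyps(2) V_carrier by simp
    moreover have "k \<otimes> x \<oplus> (l \<otimes> x \<oplus> r) = (k \<oplus> l) \<otimes> x \<oplus> r"
      if "k \<in> carrier B" "l \<in> carrier B" "x \<in> carrier B" "r \<in> carrier B" for k l x r using that by algebra
    ultimately show ?thesis using cc be mc Rc by simp
  next
    case False
    then show ?thesis using F(4) by (simp add: b'_def)
  qed
  then show ?case unfolding e1[symmetric] using F(1,2) b'V step.hyps(3)
    by (intro exI[of _ "insert e F"] exI[of _ b']) auto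
qed

end

section \<open>The substitution that makes monomials monic in the last variable\<close>

context variables
begin

context
  fixes x :: "nat \<Rightarrow> 'a" and z :: 'a and M :: nat
  assumes z: "z \<in> carrier B" and M: "0 < M"
    and x: "i < m \<Longrightarrow> x i = y i \<oplus> z [^] (M ^ Suc i)" and xm: "x m = z"
begin

text \<open>Polynomials in z of degree below s over the ring of the new variables y. The old
  variables are x, and z is the last of them.\<close>

abbreviation low :: "nat \<Rightarrow> 'a set" where "low s \<equiv> lspan B (Pol y m) (zpowers B z s)"

definition monic :: "nat \<Rightarrow> 'a \<Rightarrow> bool" where "monic w a \<longleftrightarrow> (\<exists>l\<in>low w. a = z [^] w \<oplus> l)"

lemma low_carrier: "l \<in> low s \<Longrightarrow> l \<in> carrier B"
  using B.lspan_carrier[OF _ B.zpowers_carrier[OF z], of "Pol y m"] Pol_carrier by blast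

lemma monicD: "monic w a \<Longrightarrow> \<exists>l\<in>low w. a = z [^] w \<oplus> l" by (simp add: monic_def)

lemma monic_carrier: "monic w a \<Longrightarrow> a \<in> carrier B"
  unfolding monic_def using z low_carrier by auto

lemma monic_shift: "monic w a \<Longrightarrow> monic (w + j) (a \<otimes> z [^] (j::nat))"
proof -
  assume "monic w a"
  then obtain l where l: "l \<in> low w" "a = z [^] w \<oplus> l" unfolding monic_def by blast
  have "a \<otimes> z [^] j = z [^] (w + j) \<oplus> z [^] j \<otimes> l"
    unfolding l(2) using z low_carrier[OF l(1)] B.m_comm[of l "z [^] j"] by (simp add: B.l_distr B.nat_pow_mult)
  then show ?thesis unfolding monic_def using B.zpowers_shift[OF Pol_subring z l(1)] by blast
qed

text \<open>Multiplying by r contributes only terms of degree at most w, which is below w + j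
  because j is positive.\<close>

lemma monic_factor:
  assumes a: "monic w a" and r: "r \<in> Pol y m" and j: "0 < (j::nat)"
  shows "monic (w + j) (a \<otimes> (r \<oplus> z [^] j))"
proof -
  obtain l where l: "l \<in> low w" "a = z [^] w \<oplus> l" using a unfolding monic_def by blast
  obtain l' where l': "l' \<in> low (w + j)" "a \<otimes> z [^] j = z [^] (w + j) \<oplus> l'"
    using monic_shift[OF a, of j] unfolding monic_def by blast
  note cc = low_carrier[OF l(1)] low_carrier[OF l'(1)] Pol_carrier[OF r]
  have zp: "z [^] w \<in> low (w + j)" using j by (intro B.zpowers_power[OF Pol_subring z]) simp
  have lw: "l \<in> low (w + j)" using B.zpowers_mono[OF Pol_subring z, of w "w + j"] l(1) by auto
  have "r \<otimes> (z [^] w \<oplus> l) \<oplus> l' \<in> low (w + j)"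
    by (intro B.lspan_add B.lspan_smult Pol_subring B.zpowers_carrier z zp lw r l')
  moreover have "a \<otimes> (r \<oplus> z [^] j) = z [^] (w + j) \<oplus> (r \<otimes> (z [^] w \<oplus> l) \<oplus> l')"
  proof -
    have "a \<otimes> (r \<oplus> z [^] j) = a \<otimes> z [^] j \<oplus> r \<otimes> a"
      using monic_carrier[OF a] cc z by (simp add: B.r_distr B.m_comm B.a_comm)
    then show ?thesis unfolding l'(2) using l(2) cc z by (simp add: B.a_ac)
  qed
  ultimately show ?thesis unfolding monic_def by blast
qed

lemma monic_factor_power:
  assumes a: "monic w a" and r: "r \<in> Pol y m" and j: "0 < (j::nat)"
  shows "monic (w + n * j) (a \<otimes> (r \<oplus> z [^] j) [^] (n::nat))"
proof (induction n)
  case 0 then show ?case using a monic_carrier[OF a] by simp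
next
  case (Suc n)
  have "a \<otimes> (r \<oplus> z [^] j) [^] Suc n = a \<otimes> (r \<oplus> z [^] j) [^] n \<otimes> (r \<oplus> z [^] j)"
    using monic_carrier[OF a] Pol_carrier[OF r] z by (simp add: B.m_assoc)
  then show ?case using monic_factor[OF Suc r j] by (simp add: add_ac)
qed

lemma monic_mnm: "monic (weight M m e) (mnm x (Suc m) e)"
proof -
  have "j \<le> m \<Longrightarrow> monic (\<Sum>i<j. e i * M ^ Suc i) (mnm x j e)" for j
  proof (induction j)
    case 0
    have "\<one> = z [^] (0::nat) \<oplus> \<zero>" by simp
    then show ?case unfolding monic_def by auto
  next
    case (Suc j)
    then show ?case using monic_factor_power[of _ _ "y j" "M ^ Suc j" "e j"] Pol_var M x[of j] by simp
  qed
  then show ?thesis using monic_shift[of "\<Sum>i<m. e i * M ^ Suc i" "mnm x m e" "e m"] xm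
    unfolding weight_def by (simp add: add.commute)
qed

lemma mnm_low: "weight M m e < s \<Longrightarrow> mnm x (Suc m) e \<in> low s"
proof -
  assume s: "weight M m e < s"
  obtain l where l: "l \<in> low (weight M m e)" "mnm x (Suc m) e = z [^] weight M m e \<oplus> l"
    using monic_mnm unfolding monic_def by blast
  have "z [^] weight M m e \<in> low s" by (rule B.zpowers_power[OF Pol_subring z s])
  moreover have "l \<in> low s" using B.zpowers_mono[OF Pol_subring z, of "weight M m e" s] l(1) s by auto
  ultimately show ?thesis unfolding l(2) by (intro B.lspan_add Pol_subring B.zpowers_carrier z)
qed

end

text \<open>Without variables the polynomials are constants, so splitting by g^n approximates x by a
  constant up to |g|^n. These constants form a Cauchy sequence, and K is complete.\<close>

lemma D_zero_variables:
  assumes "m = 0" "x \<in> D"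
  shows "x \<in> \<kappa> ` carrier K"
proof -
  have 2: "ring_hom_ring K B \<kappa>" by (rule ring_hom_ringI2[OF K.ring_axioms B.ring_axioms homh])
  have P: "Pol y m \<subseteq> \<kappa> ` carrier K"
    by (rule Pol_least[OF ring_hom_ring.img_is_subring[OF 2 K.carrier_is_subring]])
      (use V_carrier assms(1) in auto)
  obtain g where g: "g \<in> carrier K" "g \<noteq> 0\<^sub>K" "v g < 1" by (rule small_scalar)
  have xc: "x \<in> carrier B" using D_carrier assms(2) .
  have "\<exists>a\<in>carrier K. nm (x \<ominus> \<kappa> a) \<le> v g ^ n" for n
  proof -
    have gn: "g [^]\<^bsub>K\<^esub> n \<in> carrier K" "g [^]\<^bsub>K\<^esub> n \<noteq> 0\<^sub>K"
      using g v_pos[OF g(1,2)] v_zero[of "g [^]\<^bsub>K\<^esub> n"] by (auto simp: v_pow)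
    obtain p t where pt: "p \<in> Pol y m" "t \<in> D" "x = p \<oplus> \<kappa> (g [^]\<^bsub>K\<^esub> n) \<otimes> t" using D_split[OF assms(2) gn] .
    obtain a where a: "a \<in> carrier K" "p = \<kappa> a" using P pt(1) by blast
    have tc: "t \<in> carrier B" "\<kappa> a \<in> carrier B" "\<kappa> (g [^]\<^bsub>K\<^esub> n) \<in> carrier B"
      using D_carrier[OF pt(2)] a(1) gn(1) by auto
    have "(u \<oplus> w \<otimes> s) \<ominus> u = w \<otimes> s" if "u \<in> carrier B" "w \<in> carrier B" "s \<in> carrier B" for u w s
      using that by algebra
    then have "x \<ominus> \<kappa> a = \<kappa> (g [^]\<^bsub>K\<^esub> n) \<otimes> t" unfolding pt(3) a(2) using tc by blast
    then have "nm (x \<ominus> \<kappa> a) = v g ^ n * nm t" using nm_smult[OF gn(1) tc(1)] v_pow[OF g(1)] by simp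
    also have "\<dots> \<le> v g ^ n * 1" using D_nm[OF pt(2)] v_nonneg[OF g(1)] by (intro mult_left_mono) auto
    finally show ?thesis using a(1) by auto
  qed
  then obtain a where a: "\<And>n. a n \<in> carrier K" "\<And>n. nm (x \<ominus> \<kappa> (a n)) \<le> v g ^ n" by metis
  have kc: "\<kappa> (a n) \<in> carrier B" for n using a(1) by simp
  have kd: "nm (\<kappa> b \<ominus> \<kappa> c) = v (b \<ominus>\<^sub>K c)" if "b \<in> carrier K" "c \<in> carrier K" for b c
    using nm_kappa[of "b \<ominus>\<^sub>K c"] that by (simp add: K.minus_eq B.minus_eq)
  have "\<forall>\<epsilon>>0. \<exists>N. \<forall>i\<ge>N. \<forall>j\<ge>N. v (a i \<ominus>\<^sub>K a j) < \<epsilon>"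
  proof (intro allI impI)
    fix e :: real assume "e > 0"
    then obtain N where N: "v g ^ N < e" using real_arch_pow_inv g(3) by blast
    have "v (a i \<ominus>\<^sub>K a j) < e" if "i \<ge> N" "j \<ge> N" for i j
    proof -
      have "p \<ominus> q = (w \<ominus> q) \<ominus> (w \<ominus> p)" if "p \<in> carrier B" "q \<in> carrier B" "w \<in> carrier B" for p q w
        using that by algebra
      then have e: "\<kappa> (a i) \<ominus> \<kappa> (a j) = (x \<ominus> \<kappa> (a j)) \<ominus> (x \<ominus> \<kappa> (a i))" using kc xc by blast
      have "v (a i \<ominus>\<^sub>K a j) \<le> max (nm (x \<ominus> \<kappa> (a j))) (nm (x \<ominus> \<kappa> (a i)))"
        unfolding kd[OF a(1) a(1), symmetric] e using kc xc by (intro nm_diff) auto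
      moreover have "v g ^ i \<le> v g ^ N" "v g ^ j \<le> v g ^ N"
        using that v_nonneg[OF g(1)] g(3) by (auto intro!: power_decreasing)
      ultimately show ?thesis using a(2)[of i] a(2)[of j] N by linarith
    qed
    then show "\<exists>N. \<forall>i\<ge>N. \<forall>j\<ge>N. v (a i \<ominus>\<^sub>K a j) < e" by blast
  qed
  then obtain l where l: "l \<in> carrier K" "(\<lambda>i. v (a i \<ominus>\<^sub>K l)) \<longlonglongrightarrow> 0"
    using cv a(1) unfolding complete_value_def by blast
  have lc: "\<kappa> l \<in> carrier B" using l by simp
  have bd: "nm (x \<ominus> \<kappa> l) \<le> v g ^ n + v (a n \<ominus>\<^sub>K l)" for n
  proof -
    have "x' \<ominus> q = (x' \<ominus> p) \<oplus> (p \<ominus> q)" if "p \<in> carrier B" "q \<in> carrier B" "x' \<in> carrier B" for p q x'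
      using that by algebra
    then have "x \<ominus> \<kappa> l = (x \<ominus> \<kappa> (a n)) \<oplus> (\<kappa> (a n) \<ominus> \<kappa> l)" using kc xc lc by blast
    then have "nm (x \<ominus> \<kappa> l) \<le> max (nm (x \<ominus> \<kappa> (a n))) (v (a n \<ominus>\<^sub>K l))"
      using nm_add[of "x \<ominus> \<kappa> (a n)" "\<kappa> (a n) \<ominus> \<kappa> l"] kc xc lc kd[OF a(1) l(1)] by simp
    moreover have "0 \<le> v (a n \<ominus>\<^sub>K l)" "0 \<le> v g ^ n" using v_nonneg a(1) l(1) g(1) by simp_all
    ultimately show ?thesis using a(2)[of n] by linarith
  qed
  have "(\<lambda>n. v g ^ n + v (a n \<ominus>\<^sub>K l)) \<longlonglongrightarrow> 0 + 0"
    using v_nonneg[OF g(1)] g(3) by (intro tendsto_add l(2) LIMSEQ_power_zero) simp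
  then have "nm (x \<ominus> \<kappa> l) \<le> 0" using bd by (intro LIMSEQ_le_const) auto
  then have "x \<ominus> \<kappa> l = \<zero>" using nm_nonneg[of "x \<ominus> \<kappa> l"] nm_zero[of "x \<ominus> \<kappa> l"] xc lc by simp
  then show ?thesis using xc lc l(1) by auto
qed

end

section \<open>Finiteness of residue fields\<close>

context banach_point
begin

text \<open>The inverse \<open>x\<close> of \<open>z = y\<^sub>m\<close> is approximated by a polynomial \<open>p\<close>; the substitution
  \<open>y'\<^sub>i = y\<^sub>i - z\<^bsup>M^(i+1)\<^esup>\<close> makes \<open>zp - 1\<close>, divided by its largest coefficient, monic in \<open>z\<close> up to
  small terms.\<close>

lemma distinguished_relation:
  assumes vY: "variables B K \<kappa> v nm y (Suc m)"
    and inv: "\<And>l. l \<in> \<phi> ` variables.E B K \<kappa> v nm y (Suc m) \<Longrightarrow> l \<noteq> \<zero>\<^bsub>L\<^esub> \<Longrightarrow>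
      inv\<^bsub>L\<^esub> l \<in> \<phi> ` variables.E B K \<kappa> v nm y (Suc m)"
  shows "\<exists>y' c l d s. variables B K \<kappa> v nm y' m \<and> (\<forall>i<m. y' i \<in> Pol y (Suc m)) \<and>
    (\<forall>i<m. \<exists>t. y i \<in> lspan B (Pol y' m) (zpowers B (y m) t)) \<and>
    c \<in> carrier K \<and> c \<noteq> 0\<^sub>K \<and> v c < 1 \<and> l \<in> lspan B (Pol y' m) (zpowers B (y m) s) \<and>
    d \<in> variables.D B K \<kappa> v nm y (Suc m) \<and> \<phi> (y m [^] (s::nat)) = \<phi> (l \<oplus> \<kappa> c \<otimes> d)"
proof -
  interpret Y: variables B K \<kappa> v nm y "Suc m" by (rule vY)
  define z where "z = y m"
  have z: "z \<in> carrier B" "nm z \<le> 1" "z \<in> Pol y (Suc m)" unfolding z_def using Y.y[of m] Y.Pol_var by auto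
  obtain g where g: "g \<in> carrier K" "g \<noteq> 0\<^sub>K" "v g < 1" by (rule small_scalar)
  have Y0: "\<zero> \<in> Y.D" by (rule subringE(2)[OF Y.D_subring])
  show ?thesis
  proof (cases "\<phi> z = \<zero>\<^bsub>L\<^esub>")
    \<comment> \<open>If z maps to zero, then s = 1 with l and d both zero is a relation; g merely
      fills the place of c.\<close>
    case True
    have vY': "variables B K \<kappa> v nm y m" by unfold_locales (use Y.y in auto)
    interpret Y': variables B K \<kappa> v nm y m by (rule vY')
    have "y i \<in> lspan B (Pol y m) (zpowers B z 1)" if "i < m" for i
      using that Y'.Pol_var Y'.y by (auto intro!: exI[of _ "y i"])
    moreover have "\<zero> \<in> lspan B (Pol y m) (zpowers B z 1)"
      by (rule B.lspan_zero[OF Y'.Pol_subring B.zpowers_carrier[OF z(1)]])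
    moreover have "\<phi> (z [^] (1::nat)) = \<phi> (\<zero> \<oplus> \<kappa> g \<otimes> \<zero>)" using True z(1) g(1) by simp
    moreover have "\<forall>i<m. y i \<in> Pol y (Suc m)" using Y.Pol_var by simp
    ultimately show ?thesis using vY' g Y0 unfolding z_def by blast
  next
    case False
    have "\<phi> z \<in> \<phi> ` Y.E" using z(3) Y.Pol_D Y.D_E by blast
    then obtain x where x: "x \<in> Y.E" "\<phi> x = inv\<^bsub>L\<^esub> \<phi> z" using inv[OF _ False] by (metis imageE)
    obtain c where c: "c \<in> carrier K" "c \<noteq> 0\<^sub>K" "\<kappa> c \<otimes> x \<in> Y.D" and xc: "x \<in> carrier B"
      using x(1) unfolding Y.E_def by blast
    \<comment> \<open>The approximation is taken up to c g instead of c. The largest coefficient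
      \<open>mx\<close> below is at least |c|, so after division by it the error is bounded by |g| <
      1.\<close>
    have cg: "c \<cdot> g \<in> carrier K" "c \<cdot> g \<noteq> 0\<^sub>K" using c g K.integral by auto
    obtain p t where pt: "p \<in> Pol y (Suc m)" "t \<in> Y.D" "\<kappa> c \<otimes> x = p \<oplus> \<kappa> (c \<cdot> g) \<otimes> t"
      using Y.D_split[OF c(3) cg] .
    have ptc: "p \<in> carrier B" "t \<in> carrier B" "\<kappa> c \<in> carrier B" "\<kappa> (c \<cdot> g) \<in> carrier B"
      using Y.Pol_carrier[OF pt(1)] Y.D_carrier[OF pt(2)] c cg by auto
    obtain F b where F: "finite F" "F \<subseteq> expos (Suc m)" "\<And>e. e \<in> F \<Longrightarrow> b e \<in> V"
      "p = (\<Oplus>e\<in>F. \<kappa> (b e) \<otimes> mnm y (Suc m) e)" using Y.Pol_repr[OF pt(1)] by blast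
    \<comment> \<open>The effect on exponents of multiplication by z.\<close>
    define sh where "sh e = e(m := Suc (e m))" for e :: "nat \<Rightarrow> nat"
    have sh_inj: "inj_on sh F"
    proof (rule inj_onI)
      fix e e' assume "sh e = sh e'"
      then have "(sh e)(m := sh e m - 1) = (sh e')(m := sh e' m - 1)" by simp
      then show "e = e'" unfolding sh_def by simp
    qed
    have sh_mnm: "mnm y (Suc m) (sh e) = z \<otimes> mnm y (Suc m) e" for e
    proof -
      have "mnm y m (sh e) = mnm y m e" by (rule mnm_cong) (simp add: sh_def)
      moreover have "mnm y m e \<in> carrier B" using Y.y by (intro mnm_carrier) simp
      ultimately show ?thesis using z(1) by (simp add: sh_def z_def B.m_ac)
    qed
    note mnm.simps(2)[simp del] zpowers.simps(2)[simp del] lspan.simps(2)[simp del] power_Suc[simp del]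
    let ?o = "\<lambda>_. 0 :: nat"
    have o: "?o \<notin> sh ` F"
    proof
      assume "?o \<in> sh ` F"
      then obtain e where "?o = sh e" by blast
      from fun_cong[OF this, of m] show False by (simp add: sh_def)
    qed
    \<comment> \<open>The exponents of z p - c. No exponent of z p is zero, so the constant
      coefficient is exactly -c; this bounds the largest coefficient below by |c|.\<close>
    define G where "G = insert ?o (sh ` F)"
    define \<beta> where "\<beta> e = (if e = ?o then \<ominus>\<^bsub>K\<^esub> c else b (e(m := e m - 1)))" for e
    have Gf: "finite G" unfolding G_def using F(1) by simp
    have GE: "G \<subseteq> expos (Suc m)" unfolding G_def sh_def using F(2) by (auto simp: expos_def)
    have \<beta>sh: "\<beta> (sh e) = b e" if "e \<in> F" for e
    proof -
      have "sh e \<noteq> ?o" using o that by (metis imageI)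
      then show ?thesis unfolding \<beta>_def by (simp add: sh_def)
    qed
    have \<beta>c: "\<beta> e \<in> carrier K" if "e \<in> G" for e
      using that \<beta>sh F(3) V_carrier c(1) unfolding G_def by (auto simp: \<beta>_def[of ?o])
    have term_c: "\<kappa> (\<beta> e) \<otimes> mnm y (Suc m) e \<in> carrier B" if "e \<in> G" for e
      using \<beta>c[OF that] Y.mc by (metis B.m_closed hom_closed)
    have sumG: "(\<Oplus>e\<in>G. \<kappa> (\<beta> e) \<otimes> mnm y (Suc m) e) = \<ominus> \<kappa> c \<oplus> z \<otimes> p"
    proof -
      have "(\<Oplus>e\<in>G. \<kappa> (\<beta> e) \<otimes> mnm y (Suc m) e) =
          \<kappa> (\<beta> ?o) \<otimes> mnm y (Suc m) ?o \<oplus> (\<Oplus>e\<in>sh ` F. \<kappa> (\<beta> e) \<otimes> mnm y (Suc m) e)"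
        unfolding G_def using o F(1) term_c by (intro B.finsum_insert) (auto simp: G_def)
      also have "\<kappa> (\<beta> ?o) \<otimes> mnm y (Suc m) ?o = \<ominus> \<kappa> c"
        using mnm_zero[of "Suc m" y] Y.y c(1) by (simp add: \<beta>_def)
      also have "(\<Oplus>e\<in>sh ` F. \<kappa> (\<beta> e) \<otimes> mnm y (Suc m) e) = (\<Oplus>e\<in>F. \<kappa> (\<beta> (sh e)) \<otimes> mnm y (Suc m) (sh e))"
        using sh_inj term_c by (intro B.finsum_reindex) (auto simp: G_def)
      also have "\<dots> = (\<Oplus>e\<in>F. z \<otimes> (\<kappa> (b e) \<otimes> mnm y (Suc m) e))"
      proof (rule B.finsum_cong')
        fix e assume e: "e \<in> F"
        have "\<kappa> (b e) \<in> carrier B" "mnm y (Suc m) e \<in> carrier B" using F(3)[OF e] V_carrier Y.mc by auto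
        then show "\<kappa> (\<beta> (sh e)) \<otimes> mnm y (Suc m) (sh e) = z \<otimes> (\<kappa> (b e) \<otimes> mnm y (Suc m) e)"
          unfolding \<beta>sh[OF e] sh_mnm using z(1) by (simp only: B.m_lcomm)
      qed (use F(3) V_carrier Y.mc z(1) in auto)
      also have "\<dots> = z \<otimes> p" unfolding F(4)
        using F(1,3) V_carrier Y.mc z(1) by (intro B.finsum_rdistr[symmetric]) auto
      finally show ?thesis .
    qed
    \<comment> \<open>Larger than every exponent occurring in G, so that distinct members of G have
      distinct weights.\<close>
    define M where "M = Suc (\<Sum>e\<in>G. \<Sum>i<Suc m. e i)"
    have Mb: "e i < M" if "e \<in> G" "i < Suc m" for e i
    proof -
      have "e i \<le> (\<Sum>i<Suc m. e i)" using that(2) by (intro member_le_sum) auto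
      also have "\<dots> \<le> (\<Sum>e\<in>G. \<Sum>i<Suc m. e i)" using that(1) Gf by (intro member_le_sum) auto
      finally show ?thesis unfolding M_def by simp
    qed
    define mx where "mx = Max ((\<lambda>e. v (\<beta> e)) ` G)"
    have mx_ge: "v (\<beta> e) \<le> mx" if "e \<in> G" for e unfolding mx_def using that Gf by simp
    have oG: "?o \<in> G" unfolding G_def by simp
    have "v (\<ominus>\<^bsub>K\<^esub> c) = v c" using nm_kappa[of "\<ominus>\<^bsub>K\<^esub> c"] nm_kappa[OF c(1)] nm_minus[of "\<kappa> c"] c(1) by simp
    then have cmx: "v c \<le> mx" using mx_ge[OF oG] by (simp add: \<beta>_def)
    \<comment> \<open>The exponents with coefficient of maximal size. The one of largest weight,
      after division by its coefficient, yields the leading power of z; the rest of \<open>U\<close>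
      yields lower powers only, and outside \<open>U\<close> all coefficients have absolute value
      below 1.\<close>
    define U where "U = {e \<in> G. v (\<beta> e) = mx}"
    have U: "finite U" "U \<subseteq> G" unfolding U_def using Gf by auto
    have "mx \<in> (\<lambda>e. v (\<beta> e)) ` G" unfolding mx_def using Gf oG by (intro Max_in) auto
    then have "U \<noteq> {}" unfolding U_def by blast
    then have "Max (weight M m ` U) \<in> weight M m ` U" using U(1) by (intro Max_in) auto
    then obtain \<nu> where \<nu>: "\<nu> \<in> U" "weight M m \<nu> = Max (weight M m ` U)" by auto
    have \<nu>G: "\<nu> \<in> G" "v (\<beta> \<nu>) = mx" using \<nu>(1) unfolding U_def by auto
    define s where "s = weight M m \<nu>"
    have wlt: "weight M m e < s" if "e \<in> U - {\<nu>}" for e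
    proof -
      have "weight M m e \<le> s" unfolding s_def \<nu>(2) using that U(1) by simp
      moreover have "weight M m e \<noteq> s"
        using weight_inj[of e m \<nu> M] that U(2) GE Mb \<nu>G(1) unfolding s_def by blast
      ultimately show ?thesis by simp
    qed
    have \<beta>\<nu>: "\<beta> \<nu> \<in> carrier K" "\<beta> \<nu> \<noteq> 0\<^sub>K"
      using \<beta>c[OF \<nu>G(1)] \<nu>G(2) cmx v_pos[OF c(1,2)] v_zero[of "\<beta> \<nu>"] by auto
    define i\<beta> where "i\<beta> = inv\<^bsub>K\<^esub> (\<beta> \<nu>)"
    have i\<beta>: "i\<beta> \<in> carrier K" "i\<beta> \<cdot> \<beta> \<nu> = 1\<^sub>K" "v i\<beta> = 1 / mx" "\<kappa> i\<beta> \<in> carrier B"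
      using K_inv[OF \<beta>\<nu>] v_inv[OF \<beta>\<nu>] \<nu>G(2) \<beta>\<nu>(1) unfolding i\<beta>_def by (auto simp: K.m_comm)
    have mx0: "0 < mx" using cmx v_pos[OF c(1,2)] by simp
    define \<gamma> where "\<gamma> e = i\<beta> \<cdot> \<beta> e" for e
    have \<gamma>c: "\<gamma> e \<in> carrier K" if "e \<in> G" for e unfolding \<gamma>_def using i\<beta>(1) \<beta>c[OF that] by simp
    have v\<gamma>: "v (\<gamma> e) = v (\<beta> e) / mx" if "e \<in> G" for e
      unfolding \<gamma>_def using v_mult[OF i\<beta>(1) \<beta>c[OF that]] i\<beta>(3) by simp
    have \<gamma>V: "\<gamma> e \<in> V" if "e \<in> G" for e
      unfolding V_def using \<gamma>c[OF that] v\<gamma>[OF that] mx_ge[OF that] mx0 by simp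
    have \<gamma>lt: "v (\<gamma> e) < 1" if "e \<in> G - U" for e
      using v\<gamma>[of e] mx_ge[of e] mx0 that unfolding U_def by auto
    \<comment> \<open>These finitely many scalars have absolute value below 1. A largest one, c0,
      divides every scalar of at most its size with quotient in V. Including g covers the
      approximation error and keeps c0 nonzero.\<close>
    let ?\<Gamma> = "insert g (\<gamma> ` (G - U))"
    have \<Gamma>f: "finite (v ` ?\<Gamma>)" "v ` ?\<Gamma> \<noteq> {}" using Gf by auto
    obtain c0 where c0': "Max (v ` ?\<Gamma>) = v c0" "c0 \<in> ?\<Gamma>" using Max_in[OF \<Gamma>f] by (rule imageE)
    note c0 = c0'(2) c0'(1)[symmetric]
    have c0max: "v a \<le> v c0" if "a \<in> ?\<Gamma>" for a unfolding c0(2) using that \<Gamma>f by (intro Max_ge) auto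
    have c0K: "c0 \<in> carrier K" "v c0 < 1" using c0(1) g \<gamma>c \<gamma>lt by auto
    have c0n: "c0 \<noteq> 0\<^sub>K" using c0max[of g] v_pos[OF g(1,2)] v_zero[OF c0K(1)] by auto
    have quot: "\<exists>q\<in>V. a = c0 \<cdot> q" if a: "a \<in> carrier K" "v a \<le> v c0" for a
    proof
      have i: "inv\<^bsub>K\<^esub> c0 \<in> carrier K" "c0 \<cdot> inv\<^bsub>K\<^esub> c0 = 1\<^sub>K" using K_inv[OF c0K(1) c0n] by auto
      show "a = c0 \<cdot> (inv\<^bsub>K\<^esub> c0 \<cdot> a)" using i c0K(1) a(1) by (simp add: K.m_assoc[symmetric])
      show "inv\<^bsub>K\<^esub> c0 \<cdot> a \<in> V"
        unfolding V_def using i a v_inv[OF c0K(1) c0n] v_pos[OF c0K(1) c0n] by (simp add: v_mult)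
    qed
    define y' where "y' i = y i \<ominus> z [^] (M ^ Suc i)" for i
    have M0: "0 < M" unfolding M_def by simp
    have zP: "z [^] (n::nat) \<in> Pol y (Suc m)" for n
      using z(3) subringE(3,6)[OF Y.Pol_subring] by (induction n) auto
    have y'P: "y' i \<in> Pol y (Suc m)" if "i < m" for i
      unfolding y'_def B.minus_eq using Y.Pol_var[of i] that zP subringE(5,7)[OF Y.Pol_subring] by simp
    have vY': "variables B K \<kappa> v nm y' m"
      by unfold_locales (use y'P Y.Pol_carrier Y.Pol_nm in auto)
    interpret Y': variables B K \<kappa> v nm y' m by (rule vY')
    have yy': "y i = y' i \<oplus> z [^] (M ^ Suc i)" if "i < m" for i
    proof -
      have "a = (a \<ominus> w) \<oplus> w" if "a \<in> carrier B" "w \<in> carrier B" for a w using that by algebra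
      then show ?thesis unfolding y'_def using Y.y(1)[of i] that z(1) by simp
    qed
    note ctx = z(1) M0 yy' z_def[symmetric]
    let ?low = "\<lambda>t. lspan B (Pol y' m) (zpowers B z t)"
    have lowc: "l \<in> carrier B" if "l \<in> ?low t" for l t
      using B.lspan_carrier[OF _ B.zpowers_carrier[OF z(1)], of "Pol y' m"] Y'.Pol_carrier that by blast
    note ladd = B.lspan_add[OF Y'.Pol_subring B.zpowers_carrier[OF z(1)]]
      and lsm = B.lspan_smult[OF Y'.Pol_subring B.zpowers_carrier[OF z(1)]]
      and lzero = B.lspan_zero[OF Y'.Pol_subring B.zpowers_carrier[OF z(1)]]
    have yz: "y i \<in> ?low (Suc (M ^ Suc i))" if "i < m" for i
    proof -
      have "y' i \<otimes> z [^] (0::nat) \<in> ?low (Suc (M ^ Suc i))"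
        by (intro lsm B.zpowers_power[OF Y'.Pol_subring z(1)] Y'.Pol_var that) simp
      moreover have "z [^] (M ^ Suc i) \<in> ?low (Suc (M ^ Suc i))"
        by (intro B.zpowers_power[OF Y'.Pol_subring z(1)]) simp
      ultimately show ?thesis using ladd yy'[OF that] Y'.y(1)[OF that] by simp
    qed
    let ?t = "\<lambda>e. \<kappa> (\<gamma> e) \<otimes> mnm y (Suc m) e"
    have tc: "?t e \<in> carrier B" if "e \<in> G" for e
      using \<gamma>c[OF that] Y.mc by (metis B.m_closed hom_closed)
    have s1: "(\<Oplus>e\<in>G. ?t e) = \<kappa> i\<beta> \<otimes> (\<ominus> \<kappa> c \<oplus> z \<otimes> p)"
    proof -
      have "\<kappa> i\<beta> \<otimes> (\<Oplus>e\<in>G. \<kappa> (\<beta> e) \<otimes> mnm y (Suc m) e) = (\<Oplus>e\<in>G. \<kappa> i\<beta> \<otimes> (\<kappa> (\<beta> e) \<otimes> mnm y (Suc m) e))"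
        using Gf i\<beta>(4) term_c by (intro B.finsum_rdistr) auto
      also have "\<dots> = (\<Oplus>e\<in>G. ?t e)"
      proof (rule B.finsum_cong')
        fix e assume e: "e \<in> G"
        have "\<kappa> (\<beta> e) \<in> carrier B" "\<kappa> (\<gamma> e) = \<kappa> i\<beta> \<otimes> \<kappa> (\<beta> e)" "mnm y (Suc m) e \<in> carrier B"
          using \<beta>c[OF e] i\<beta>(1) Y.mc unfolding \<gamma>_def by auto
        then show "\<kappa> i\<beta> \<otimes> (\<kappa> (\<beta> e) \<otimes> mnm y (Suc m) e) = ?t e" using i\<beta>(4) by (simp only: B.m_assoc)
      qed (use tc in auto)
      finally show ?thesis unfolding sumG by simp
    qed
    have sU: "(\<Oplus>e\<in>U - {\<nu>}. ?t e) \<in> ?low s"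
    proof (rule B.finsum_in)
      fix e assume e: "e \<in> U - {\<nu>}"
      have "\<kappa> (\<gamma> e) \<in> Pol y' m" using Y'.Pol_const[OF \<gamma>V] e U(2) by blast
      then show "?t e \<in> ?low s" using lsm[OF Y'.mnm_low[OF ctx wlt[OF e]]] by blast
    qed (use U(1) lowc ladd lzero in auto)
    have sR: "(\<Oplus>e\<in>G - U. ?t e) \<in> {\<kappa> c0 \<otimes> d | d. d \<in> Y.D}"
    proof (rule B.finsum_in)
      fix e assume e: "e \<in> G - U"
      obtain q where q: "q \<in> V" "\<gamma> e = c0 \<cdot> q" using quot[of "\<gamma> e"] \<gamma>c[of e] c0max[of "\<gamma> e"] e by auto
      have "mnm y (Suc m) e \<in> Pol y (Suc m)"
      proof -
        have "\<kappa> 1\<^sub>K \<otimes> mnm y (Suc m) e \<oplus> \<zero> \<in> Pol y (Suc m)"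
          using e GE by (intro Pol.step[OF Pol.zero V_one]) auto
        then show ?thesis using Y.mc by simp
      qed
      then have "\<kappa> q \<otimes> mnm y (Suc m) e \<in> Y.D" using Y.D_smult[OF q(1)] Y.Pol_D by blast
      moreover have "?t e = \<kappa> c0 \<otimes> (\<kappa> q \<otimes> mnm y (Suc m) e)"
        unfolding q(2) using V_carrier[OF q(1)] c0K(1) Y.mc by (simp add: B.m_assoc)
      ultimately show "?t e \<in> {\<kappa> c0 \<otimes> d | d. d \<in> Y.D}" by blast
    next
      have k0: "\<kappa> c0 \<in> carrier B" using c0K(1) by simp
      then show "{\<kappa> c0 \<otimes> d | d. d \<in> Y.D} \<subseteq> carrier B" using Y.D_carrier by auto
      have "\<zero> = \<kappa> c0 \<otimes> \<zero>" using k0 by simp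
      then show "\<zero> \<in> {\<kappa> c0 \<otimes> d | d. d \<in> Y.D}" using Y0 by blast
      fix a a' assume "a \<in> {\<kappa> c0 \<otimes> d | d. d \<in> Y.D}" "a' \<in> {\<kappa> c0 \<otimes> d | d. d \<in> Y.D}"
      then obtain d d' where d: "d \<in> Y.D" "d' \<in> Y.D" "a = \<kappa> c0 \<otimes> d" "a' = \<kappa> c0 \<otimes> d'" by blast
      have "a \<oplus> a' = \<kappa> c0 \<otimes> (d \<oplus> d')" unfolding d(3,4) using k0 d(1,2) Y.D_carrier by (simp add: B.r_distr)
      then show "a \<oplus> a' \<in> {\<kappa> c0 \<otimes> d | d. d \<in> Y.D}" using Y.D_add[OF d(1,2)] by blast
    qed (use Gf in auto)
    obtain d1 where d1: "d1 \<in> Y.D" "(\<Oplus>e\<in>G - U. ?t e) = \<kappa> c0 \<otimes> d1" using sR by blast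
    have mon: "Y'.monic z s (mnm y (Suc m) \<nu>)" unfolding s_def by (rule Y'.monic_mnm[OF ctx])
    have "\<exists>l0\<in>?low s. mnm y (Suc m) \<nu> = z [^] s \<oplus> l0"
      by (rule Y'.monicD[where x=y and M=M]) (rule z(1) M0 yy' z_def[symmetric] mon | assumption)+
    then obtain l0 where l0: "l0 \<in> ?low s" "mnm y (Suc m) \<nu> = z [^] s \<oplus> l0" by blast
    define l1 where "l1 = (\<Oplus>e\<in>U - {\<nu>}. ?t e)"
    have sG: "(\<Oplus>e\<in>G. ?t e) = (z [^] s \<oplus> l0) \<oplus> l1 \<oplus> \<kappa> c0 \<otimes> d1"
    proof -
      have "G = U \<union> (G - U)" using U(2) by blast
      then have "(\<Oplus>e\<in>G. ?t e) = (\<Oplus>e\<in>U. ?t e) \<oplus> (\<Oplus>e\<in>G - U. ?t e)"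
        using B.finsum_Un_disjoint[of U "G - U" ?t] U Gf tc by auto
      moreover have "(\<Oplus>e\<in>insert \<nu> (U - {\<nu>}). ?t e) = ?t \<nu> \<oplus> l1"
        unfolding l1_def using U tc \<nu>G(1) by (intro B.finsum_insert) auto
      moreover have "insert \<nu> (U - {\<nu>}) = U" using \<nu>(1) by blast
      moreover have "\<gamma> \<nu> = 1\<^sub>K" unfolding \<gamma>_def by (rule i\<beta>(2))
      ultimately show ?thesis using Y.mc[of \<nu>] by (simp add: l0(2) d1(2))
    qed
    have q2: "\<exists>q\<in>V. i\<beta> \<cdot> (c \<cdot> g) = c0 \<cdot> q"
    proof (rule quot)
      have "v (i\<beta> \<cdot> (c \<cdot> g)) = v c / mx * v g" using i\<beta>(1,3) c(1) g(1) cg(1) by (simp add: v_mult)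
      also have "\<dots> \<le> 1 * v g" using cmx mx0 v_nonneg[OF g(1)] by (intro mult_right_mono) auto
      finally show "v (i\<beta> \<cdot> (c \<cdot> g)) \<le> v c0" using c0max[of g] by simp
    qed (use i\<beta>(1) cg(1) in simp)
    then obtain q where q: "q \<in> V" "i\<beta> \<cdot> (c \<cdot> g) = c0 \<cdot> q" by blast
    define d2 where "d2 = \<kappa> q \<otimes> (z \<otimes> t)"
    have d2: "d2 \<in> Y.D" unfolding d2_def using Y.D_smult[OF q(1)] Y.D_Pol_mult[OF z(3) pt(2)] by blast
    have k0: "\<kappa> c0 \<in> carrier B" "\<kappa> q \<in> carrier B" using c0K(1) V_carrier[OF q(1)] by auto
    have kq: "\<kappa> i\<beta> \<otimes> \<kappa> (c \<cdot> g) = \<kappa> c0 \<otimes> \<kappa> q"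
      using hom_mult[of i\<beta> "c \<cdot> g"] hom_mult[of c0 q] i\<beta>(1) cg(1) c0K(1) V_carrier[OF q(1)] q(2) by simp
    have l1: "l1 \<in> ?low s" unfolding l1_def by (rule sU)
    note cs = lowc[OF l0(1)] lowc[OF l1] Y.D_carrier[OF d1(1)] Y.D_carrier[OF d2] k0 ptc i\<beta>(4) z(1) xc
    \<comment> \<open>Inserting p = c x - c g t separates a multiple of z x - 1, which vanishes in
      L, from the approximation error, a multiple of c0.\<close>
    have key: "\<kappa> i\<beta> \<otimes> (\<ominus> \<kappa> c \<oplus> z \<otimes> p) = \<kappa> i\<beta> \<otimes> \<kappa> c \<otimes> (z \<otimes> x \<ominus> \<one>) \<ominus> \<kappa> c0 \<otimes> d2"
    proof -
      define w where "w = \<kappa> (c \<cdot> g)"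
      have wc: "w \<in> carrier B" using ptc(4) unfolding w_def .
      have e1: "p = \<kappa> c \<otimes> x \<ominus> w \<otimes> t" unfolding pt(3) w_def[symmetric] using wc ptc(1,2) by algebra
      have e2: "\<kappa> c0 \<otimes> d2 = \<kappa> i\<beta> \<otimes> w \<otimes> (z \<otimes> t)"
        unfolding d2_def w_def kq using k0 z(1) ptc(2) by (simp add: B.m_assoc)
      show ?thesis unfolding e2 e1 using wc ptc(2,3) i\<beta>(4) z(1) xc by algebra
    qed
    have "\<phi> (z \<otimes> x \<ominus> \<one>) = \<zero>\<^bsub>L\<^esub>"
      using x(2) False z(1) xc phi.hom_closed[OF z(1)] by (simp add: B.minus_eq L.r_neg L.field_Units)
    then have p1: "\<phi> (\<kappa> i\<beta> \<otimes> \<kappa> c \<otimes> (z \<otimes> x \<ominus> \<one>)) = \<zero>\<^bsub>L\<^esub>"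
      using phi.hom_mult[of "\<kappa> i\<beta> \<otimes> \<kappa> c" "z \<otimes> x \<ominus> \<one>"] phi.hom_closed[of "\<kappa> i\<beta> \<otimes> \<kappa> c"] cs
      by (metis B.m_closed B.minus_closed B.one_closed L.r_null)
    define zz where "zz = z [^] s"
    have zzc: "zz \<in> carrier B" unfolding zz_def using z(1) by simp
    have "zz = \<kappa> i\<beta> \<otimes> \<kappa> c \<otimes> (z \<otimes> x \<ominus> \<one>) \<oplus> (\<ominus> (l0 \<oplus> l1) \<oplus> \<kappa> c0 \<otimes> (\<ominus> (d1 \<oplus> d2)))"
    proof -
      have "(zz \<oplus> l0) \<oplus> l1 \<oplus> \<kappa> c0 \<otimes> d1 = \<kappa> i\<beta> \<otimes> \<kappa> c \<otimes> (z \<otimes> x \<ominus> \<one>) \<ominus> \<kappa> c0 \<otimes> d2"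
        using s1 sG key unfolding zz_def by simp
      moreover have "r = e \<oplus> (\<ominus> (a \<oplus> b) \<oplus> k \<otimes> (\<ominus> (d \<oplus> d')))"
        if "(r \<oplus> a) \<oplus> b \<oplus> k \<otimes> d = e \<ominus> k \<otimes> d'"
          "r \<in> carrier B" "a \<in> carrier B" "b \<in> carrier B" "k \<in> carrier B" "d \<in> carrier B"
          "e \<in> carrier B" "d' \<in> carrier B" for r a b k d e d'
      proof -
        have "r = ((r \<oplus> a) \<oplus> b \<oplus> k \<otimes> d) \<ominus> (a \<oplus> b \<oplus> k \<otimes> d)" using that(2-) by algebra
        then show ?thesis unfolding that(1) using that(3-) by algebra
      qed
      ultimately show ?thesis using cs zzc by blast
    qed
    then have "\<phi> zz = \<phi> (\<kappa> i\<beta> \<otimes> \<kappa> c \<otimes> (z \<otimes> x \<ominus> \<one>)) \<oplus>\<^bsub>L\<^esub> \<phi> (\<ominus> (l0 \<oplus> l1) \<oplus> \<kappa> c0 \<otimes> (\<ominus> (d1 \<oplus> d2)))"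
      using phi.hom_add[of "\<kappa> i\<beta> \<otimes> \<kappa> c \<otimes> (z \<otimes> x \<ominus> \<one>)" "\<ominus> (l0 \<oplus> l1) \<oplus> \<kappa> c0 \<otimes> (\<ominus> (d1 \<oplus> d2))"] cs
      by (metis B.a_closed B.a_inv_closed B.m_closed B.minus_closed B.one_closed)
    then have fin: "\<phi> (z [^] s) = \<phi> (\<ominus> (l0 \<oplus> l1) \<oplus> \<kappa> c0 \<otimes> (\<ominus> (d1 \<oplus> d2)))"
      unfolding p1 zz_def using phi.hom_closed[of "\<ominus> (l0 \<oplus> l1) \<oplus> \<kappa> c0 \<otimes> (\<ominus> (d1 \<oplus> d2))"] cs by simp
    have "\<ominus> (l0 \<oplus> l1) \<in> ?low s"
      by (rule B.lspan_minus[OF Y'.Pol_subring B.zpowers_carrier[OF z(1)] ladd[OF l0(1) l1]])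
    moreover have "\<ominus> (d1 \<oplus> d2) \<in> Y.D" by (rule subringE(5)[OF Y.D_subring Y.D_add[OF d1(1) d2]])
    ultimately show ?thesis using vY' y'P yz c0K c0n fin unfolding z_def by blast
  qed
qed

text \<open>The image of \<open>Y.E\<close> is a finite module over the image of
  \<open>Y'.E\<close>, so the latter is a field as well by \<open>nakayama_inverse\<close>, the
  induction hypothesis applies to it, and finiteness is transitive. Closure under inverses, rather
  than surjectivity onto L, is the property that survives the loss of a variable.\<close>

lemma finite_of_field:
  "variables B K \<kappa> v nm y m \<Longrightarrow>
    (\<And>l. l \<in> \<phi> ` variables.E B K \<kappa> v nm y m \<Longrightarrow> l \<noteq> \<zero>\<^bsub>L\<^esub> \<Longrightarrow> inv\<^bsub>L\<^esub> l \<in> \<phi> ` variables.E B K \<kappa> v nm y m) \<Longrightarrow>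
    \<exists>bs. set bs \<subseteq> carrier L \<and> \<phi> ` variables.E B K \<kappa> v nm y m \<subseteq> lspan L k bs"
proof (induction m arbitrary: y)
  case 0
  interpret Y: variables B K \<kappa> v nm y 0 by (rule 0(1))
  have ks: "subring k L" by (rule subfieldE(1)[OF k_subfield])
  have "\<phi> ` Y.E \<subseteq> lspan L k [\<one>\<^bsub>L\<^esub>]"
  proof
    fix u assume "u \<in> \<phi> ` Y.E"
    then obtain x b where x: "x \<in> carrier B" "u = \<phi> x" "b \<in> carrier K" "b \<noteq> 0\<^sub>K" "\<kappa> b \<otimes> x \<in> Y.D"
      unfolding Y.E_def by blast
    obtain a where a: "a \<in> carrier K" "\<kappa> b \<otimes> x = \<kappa> a" using Y.D_zero_variables[OF refl x(5)] by blast
    have i: "inv\<^bsub>K\<^esub> b \<in> carrier K" "b \<cdot> inv\<^bsub>K\<^esub> b = 1\<^sub>K" using K_inv[OF x(3,4)] by auto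
    have bc: "\<kappa> b \<in> carrier B" "\<kappa> (inv\<^bsub>K\<^esub> b) \<in> carrier B" "\<kappa> b \<otimes> \<kappa> (inv\<^bsub>K\<^esub> b) = \<one>"
      using x(3) i hom_mult[of b "inv\<^bsub>K\<^esub> b"] by auto
    have "x = (\<kappa> b \<otimes> \<kappa> (inv\<^bsub>K\<^esub> b)) \<otimes> x" using bc(3) x(1) by simp
    also have "\<dots> = \<kappa> (inv\<^bsub>K\<^esub> b) \<otimes> (\<kappa> b \<otimes> x)" using bc(1,2) x(1) by algebra
    also have "\<dots> = \<kappa> (inv\<^bsub>K\<^esub> b \<cdot> a)" unfolding a(2) using i(1) a(1) by simp
    finally have "u \<in> k" unfolding x(2) k_def using i(1) a(1) by blast
    moreover from this have "u \<in> carrier L" using subringE(1)[OF ks] by blast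
    ultimately show "u \<in> lspan L k [\<one>\<^bsub>L\<^esub>]" by (intro lspan_ConsI[where a=u and w="\<zero>\<^bsub>L\<^esub>"]) simp_all
  qed
  then show ?case by (intro exI[of _ "[\<one>\<^bsub>L\<^esub>]"]) simp
next
  case (Suc m)
  interpret Y: variables B K \<kappa> v nm y "Suc m" by (rule Suc.prems(1))
  obtain y' c l d s where vY': "variables B K \<kappa> v nm y' m"
    and r: "\<And>i. i < m \<Longrightarrow> y' i \<in> Pol y (Suc m)"
    "\<And>i. i < m \<Longrightarrow> \<exists>t. y i \<in> lspan B (Pol y' m) (zpowers B (y m) t)"
    "c \<in> carrier K" "c \<noteq> 0\<^sub>K" "v c < 1" "l \<in> lspan B (Pol y' m) (zpowers B (y m) s)"
    "d \<in> Y.D" "\<phi> (y m [^] (s::nat)) = \<phi> (l \<oplus> \<kappa> c \<otimes> d)"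
    using distinguished_relation[OF Suc.prems] by blast
  interpret Y': variables B K \<kappa> v nm y' m by (rule vY')
  let ?ws = "map \<phi> (zpowers B (y m) s)"
  have eq: "\<phi> ` Y.E = lspan L (\<phi> ` Y'.E) ?ws"
    by (rule finite_over_subalgebra[OF Suc.prems(1) vY' r])
  have hr: "ring_hom_ring B L \<phi>" by (rule ring_hom_ringI2[OF B.ring_axioms L.ring_axioms phi.homh])
  have A: "subring (\<phi> ` Y'.E) L" "subring (\<phi> ` Y.E) L"
    by (rule ring_hom_ring.img_is_subring[OF hr Y'.E_subring] ring_hom_ring.img_is_subring[OF hr Y.E_subring])+
  have ws: "set ?ws \<subseteq> carrier L" using B.zpowers_carrier[of "y m" s] Y.y(1)[of m] by auto
  have one: "\<one>\<^bsub>L\<^esub> \<in> lspan L (\<phi> ` Y'.E) ?ws" unfolding eq[symmetric] by (rule subringE(3)[OF A(2)])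
  have wsE: "w \<in> \<phi> ` Y.E" if "w \<in> set ?ws" for w unfolding eq by (rule L.lspan_member[OF A(1) ws that])
  have AE: "\<phi> ` Y'.E \<subseteq> \<phi> ` Y.E"
  proof
    fix e assume e: "e \<in> \<phi> ` Y'.E"
    then have "e \<otimes>\<^bsub>L\<^esub> \<one>\<^bsub>L\<^esub> \<in> \<phi> ` Y.E" unfolding eq by (rule L.lspan_smult[OF A(1) ws one])
    then show "e \<in> \<phi> ` Y.E" using e subringE(1)[OF A(1)] by auto
  qed
  have "inv\<^bsub>L\<^esub> e \<in> \<phi> ` Y'.E" if e: "e \<in> \<phi> ` Y'.E" "e \<noteq> \<zero>\<^bsub>L\<^esub>" for e
  proof (rule L.nakayama_inverse[OF A(1) e ws one])
    fix w assume "w \<in> set ?ws"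
    then show "inv\<^bsub>L\<^esub> e \<otimes>\<^bsub>L\<^esub> w \<in> lspan L (\<phi> ` Y'.E) ?ws"
      unfolding eq[symmetric] using wsE Suc.prems(2)[OF _ e(2)] AE e(1) subringE(6)[OF A(2)] by blast
  qed
  then obtain bs where bs: "set bs \<subseteq> carrier L" "\<phi> ` Y'.E \<subseteq> lspan L k bs" using Suc.IH[OF vY'] by blast
  let ?cs = "concat (map (\<lambda>w. map (\<lambda>b. b \<otimes>\<^bsub>L\<^esub> w) bs) ?ws)"
  have "\<phi> ` Y.E \<subseteq> lspan L k ?cs"
    unfolding eq by (rule L.lspan_tower[OF subfieldE(1)[OF k_subfield] ws bs])
  moreover have "set ?cs \<subseteq> carrier L" using ws bs(1) by auto
  ultimately show ?case by blast
qed

text \<open>Under \<open>dense\<close> the ring E is all of B, so its image is the field L and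
  \<open>finite_of_field\<close> applies.\<close>

theorem residue_field_finite:
  assumes vY: "variables B K \<kappa> v nm y m"
    and dense: "\<And>x. x \<in> carrier B \<Longrightarrow> x \<in> variables.E B K \<kappa> v nm y m"
  shows "\<exists>bs. set bs \<subseteq> carrier L \<and> lspan L k bs = carrier L"
proof -
  interpret Y: variables B K \<kappa> v nm y m by (rule vY)
  have "Y.E = carrier B" using dense subringE(1)[OF Y.E_subring] by blast
  then have E: "\<phi> ` Y.E = carrier L" using surj by simp
  obtain bs where bs: "set bs \<subseteq> carrier L" "\<phi> ` Y.E \<subseteq> lspan L k bs"
    using finite_of_field[OF vY] unfolding E by (metis L.field_Units L.Units_inv_closed DiffI empty_iff insert_iff)
  moreover have "lspan L k bs \<subseteq> carrier L"
    by (rule L.lspan_carrier[OF subringE(1)[OF subfieldE(1)[OF k_subfield]] bs(1)])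
  ultimately show ?thesis unfolding E by blast
qed

end

section \<open>Tate algebras\<close>

lemma finite_submultisets: "finite {\<mu>. \<mu> \<subseteq># \<nu>}"
proof (induction \<nu>)
  case empty then show ?case by simp
next
  case (add x \<nu>)
  have "{\<mu>. \<mu> \<subseteq># add_mset x \<nu>} \<subseteq> {\<mu>. \<mu> \<subseteq># \<nu>} \<union> add_mset x ` {\<mu>. \<mu> \<subseteq># \<nu>}"
  proof
    fix \<mu> assume m: "\<mu> \<in> {\<mu>. \<mu> \<subseteq># add_mset x \<nu>}"
    show "\<mu> \<in> {\<mu>. \<mu> \<subseteq># \<nu>} \<union> add_mset x ` {\<mu>. \<mu> \<subseteq># \<nu>}"
    proof (cases "x \<in># \<mu>")
      case True
      then obtain \<mu>' where "\<mu> = add_mset x \<mu>'" by (metis mset_add)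
      then show ?thesis using m by auto
    next
      case False
      have "count \<mu> a \<le> count \<nu> a" for a
        using m False mset_subset_eq_count[of \<mu> "add_mset x \<nu>" a]
        by (cases "a = x") (simp_all add: count_eq_zero_iff[THEN iffD2])
      then have "\<mu> \<subseteq># \<nu>" by (rule mset_subset_eqI)
      then show ?thesis by blast
    qed
  qed
  then show ?case using add by (meson finite_UnI finite_imageI finite_subset)
qed

lemma (in abelian_monoid) finsum_Sigma:
  assumes "finite A" "\<And>x. x \<in> A \<Longrightarrow> finite (B x)" "\<And>x y. x \<in> A \<Longrightarrow> y \<in> B x \<Longrightarrow> f x y \<in> carrier G"
  shows "(\<Oplus>x\<in>A. \<Oplus>y\<in>B x. f x y) = (\<Oplus>p\<in>Sigma A B. f (fst p) (snd p))"
  using assms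
proof (induction A)
  case empty then show ?case by simp
next
  case (insert a A)
  have fin: "finite (Sigma A B)" using insert by (intro finite_SigmaI) auto
  have S: "Sigma (insert a A) B = Pair a ` B a \<union> Sigma A B" by auto
  have d: "Pair a ` B a \<inter> Sigma A B = {}" using insert(2) by auto
  have "(\<Oplus>p\<in>Sigma (insert a A) B. f (fst p) (snd p)) =
      (\<Oplus>p\<in>Pair a ` B a. f (fst p) (snd p)) \<oplus> (\<Oplus>p\<in>Sigma A B. f (fst p) (snd p))"
    unfolding S using insert d fin by (intro finsum_Un_disjoint) auto
  also have "(\<Oplus>p\<in>Pair a ` B a. f (fst p) (snd p)) = (\<Oplus>y\<in>B a. f a y)"
    using insert.prems by (subst finsum_reindex) (auto simp: inj_on_def)
  also have "(\<Oplus>p\<in>Sigma A B. f (fst p) (snd p)) = (\<Oplus>x\<in>A. \<Oplus>y\<in>B x. f x y)"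
    using insert by simp
  finally show ?case using insert by (subst finsum_insert) auto
qed

lemma (in abelian_monoid) finsum_single:
  assumes "finite A" "i \<in> A" "f i \<in> carrier G" "\<And>j. j \<in> A \<Longrightarrow> j \<noteq> i \<Longrightarrow> f j = \<zero>"
  shows "(\<Oplus>j\<in>A. f j) = f i"
proof -
  have "A = insert i (A - {i})" using assms(2) by blast
  then have "(\<Oplus>j\<in>A. f j) = (\<Oplus>j\<in>insert i (A - {i}). f j)" by simp
  also have "\<dots> = f i \<oplus> (\<Oplus>j\<in>A - {i}. f j)" using assms by (intro finsum_insert) auto
  also have "(\<Oplus>j\<in>A - {i}. f j) = \<zero>" using assms(4) by (intro add.finprod_one_eqI) auto
  finally show ?thesis using assms(3) by simp
qed

section \<open>Formal and restricted power series, and the Gauss norm\<close>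

locale nonarch_field = field K for K :: "('k, 'm) ring_scheme" (structure) +
  fixes v :: "'k \<Rightarrow> real"
  assumes av: "absolute_value K v" and na: "nonarchimedean K v"
    and nt: "nontrivial_value K v" and cv: "complete_value K v"
begin

lemma v_nonneg: "c \<in> carrier K \<Longrightarrow> 0 \<le> v c"
  and v_zero_iff: "c \<in> carrier K \<Longrightarrow> v c = 0 \<longleftrightarrow> c = \<zero>"
  and v_mult: "c \<in> carrier K \<Longrightarrow> d \<in> carrier K \<Longrightarrow> v (c \<otimes> d) = v c * v d"
  and v_add: "c \<in> carrier K \<Longrightarrow> d \<in> carrier K \<Longrightarrow> v (c \<oplus> d) \<le> max (v c) (v d)"
  using av na unfolding absolute_value_def nonarchimedean_def by blast+

lemma v_zero: "v \<zero> = 0" using v_zero_iff[of \<zero>] by simp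

lemma v_one: "v \<one> = 1"
  using v_mult[of "\<one>" "\<one>"] v_zero_iff[of "\<one>"] by simp

lemma v_minus: "c \<in> carrier K \<Longrightarrow> v (\<ominus> c) = v c"
proof -
  assume c: "c \<in> carrier K"
  have "v (\<ominus> \<one>) * v (\<ominus> \<one>) = 1" using v_mult[of "\<ominus> \<one>" "\<ominus> \<one>"] v_one by (simp add: l_minus r_minus)
  then have "(v (\<ominus> \<one>))\<^sup>2 = 1" by (simp add: power2_eq_square)
  then have "v (\<ominus> \<one>) = 1" using v_nonneg[of "\<ominus> \<one>"] by (auto simp: power2_eq_1_iff)
  moreover have "\<ominus> c = \<ominus> \<one> \<otimes> c" using c by (simp add: l_minus)
  ultimately show ?thesis using v_mult[of "\<ominus> \<one>" c] c by simp
qed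

lemma v_diff: "c \<in> carrier K \<Longrightarrow> d \<in> carrier K \<Longrightarrow> v (c \<ominus> d) \<le> max (v c) (v d)"
  using v_add[of c "\<ominus> d"] v_minus by (simp add: minus_eq)

lemma v_finsum_le:
  assumes "finite A" "0 \<le> M" "\<And>x. x \<in> A \<Longrightarrow> f x \<in> carrier K \<and> v (f x) \<le> M"
  shows "v (\<Oplus>x\<in>A. f x) \<le> M"
  using assms(1,3)
proof (induction A)
  case empty then show ?case using assms(2) v_zero by simp
next
  case (insert a A)
  have "(\<Oplus>x\<in>insert a A. f x) = f a \<oplus> (\<Oplus>x\<in>A. f x)" using insert by (intro finsum_insert) auto
  moreover have "v (f a \<oplus> (\<Oplus>x\<in>A. f x)) \<le> max (v (f a)) (v (\<Oplus>x\<in>A. f x))"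
    using insert by (intro v_add finsum_closed) auto
  ultimately show ?case using insert by fastforce
qed

lemma v_finsum_less:
  assumes "finite A" "0 < M" "\<And>x. x \<in> A \<Longrightarrow> f x \<in> carrier K \<and> v (f x) < M"
  shows "v (\<Oplus>x\<in>A. f x) < M"
proof -
  let ?B = "insert 0 ((\<lambda>x. v (f x)) ` A)"
  have "v (\<Oplus>x\<in>A. f x) \<le> Max ?B"
    by (rule v_finsum_le) (use assms in \<open>auto intro!: Max_ge\<close>)
  also have "\<dots> < M" using assms by (subst Max_less_iff) auto
  finally show ?thesis .
qed

text \<open>All formal power series in countably many variables. The Tate algebras are subrings of
  this one ring, so their operations do not depend on n and \<open>RS n\<close> is literally a
  subset of \<open>RS (Suc n)\<close>.\<close>

definition PS :: "'k series ring" where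
  "PS = \<lparr>carrier = {a. \<forall>\<nu>. a \<nu> \<in> carrier K},
      mult = (\<lambda>a b \<nu>. \<Oplus>\<mu>\<in>{\<mu>. \<mu> \<subseteq># \<nu>}. a \<mu> \<otimes> b (\<nu> - \<mu>)),
      one = const_series K \<one>,
      zero = const_series K \<zero>,
      add = (\<lambda>a b \<nu>. a \<nu> \<oplus> b \<nu>)\<rparr>"

abbreviation PS_times (infixl "\<star>" 70) where "a \<star> b \<equiv> a \<otimes>\<^bsub>PS\<^esub> b"

abbreviation PS_plus (infixl "\<boxplus>" 65) where "a \<boxplus> b \<equiv> a \<oplus>\<^bsub>PS\<^esub> b"

abbreviation cst :: "'k \<Rightarrow> 'k series" where "cst \<equiv> const_series K"

lemma tate_PS: "tate_algebra K v n = PS \<lparr>carrier := restricted_series K v n\<rparr>"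
  unfolding tate_algebra_def PS_def by simp

lemma PS_mult: "(a \<star> b) \<nu> = (\<Oplus>\<mu>\<in>{\<mu>. \<mu> \<subseteq># \<nu>}. a \<mu> \<otimes> b (\<nu> - \<mu>))"
  and PS_add: "(a \<boxplus> b) \<nu> = a \<nu> \<oplus> b \<nu>"
  and PS_one: "\<one>\<^bsub>PS\<^esub> = cst \<one>"
  and PS_zero: "\<zero>\<^bsub>PS\<^esub> \<nu> = \<zero>"
  and PS_carrier: "a \<in> carrier PS \<longleftrightarrow> (\<forall>\<nu>. a \<nu> \<in> carrier K)"
  by (simp_all add: PS_def const_series_def)

lemma PS_mult_closed: "a \<in> carrier PS \<Longrightarrow> b \<in> carrier PS \<Longrightarrow> a \<star> b \<in> carrier PS"
  by (auto simp: PS_carrier PS_mult intro!: finsum_closed)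

lemma PS_mult_comm:
  assumes a: "a \<in> carrier PS" and b: "b \<in> carrier PS"
  shows "a \<star> b = b \<star> a"
proof
  fix \<nu> :: "nat multiset"
  have ac: "a \<mu> \<in> carrier K" "b \<mu> \<in> carrier K" for \<mu> using a b by (simp_all add: PS_carrier)
  have im: "(\<lambda>\<mu>. \<nu> - \<mu>) ` {\<mu>. \<mu> \<subseteq># \<nu>} = {\<mu>. \<mu> \<subseteq># \<nu>}"
  proof
    show "{\<mu>. \<mu> \<subseteq># \<nu>} \<subseteq> (\<lambda>\<mu>. \<nu> - \<mu>) ` {\<mu>. \<mu> \<subseteq># \<nu>}"
    proof
      fix \<mu> assume "\<mu> \<in> {\<mu>. \<mu> \<subseteq># \<nu>}"
      then have "\<mu> = \<nu> - (\<nu> - \<mu>)" by (simp add: double_diff[symmetric] multiset_eq_iff subseteq_mset_def)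
      then show "\<mu> \<in> (\<lambda>\<mu>. \<nu> - \<mu>) ` {\<mu>. \<mu> \<subseteq># \<nu>}" by (metis diff_subset_eq_self imageI mem_Collect_eq)
    qed
  qed (auto simp: diff_subset_eq_self)
  have inj: "inj_on (\<lambda>\<mu>. \<nu> - \<mu>) {\<mu>. \<mu> \<subseteq># \<nu>}"
  proof (rule inj_onI)
    fix x y assume "x \<in> {\<mu>. \<mu> \<subseteq># \<nu>}" "y \<in> {\<mu>. \<mu> \<subseteq># \<nu>}" "\<nu> - x = \<nu> - y"
    then show "x = y" by (metis mem_Collect_eq subset_mset.add_diff_inverse add_right_cancel)
  qed
  have "(b \<star> a) \<nu> = (\<Oplus>\<mu>\<in>(\<lambda>\<mu>. \<nu> - \<mu>) ` {\<mu>. \<mu> \<subseteq># \<nu>}. b \<mu> \<otimes> a (\<nu> - \<mu>))"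
    unfolding PS_mult im ..
  also have "\<dots> = (\<Oplus>\<mu>\<in>{\<mu>. \<mu> \<subseteq># \<nu>}. b (\<nu> - \<mu>) \<otimes> a (\<nu> - (\<nu> - \<mu>)))"
    using ac inj by (intro finsum_reindex) auto
  also have "\<dots> = (a \<star> b) \<nu>"
    unfolding PS_mult
  proof (rule finsum_cong')
    fix \<mu> assume "\<mu> \<in> {\<mu>. \<mu> \<subseteq># \<nu>}"
    then have "\<nu> - (\<nu> - \<mu>) = \<mu>" by (simp add: multiset_eq_iff subseteq_mset_def)
    then show "b (\<nu> - \<mu>) \<otimes> a (\<nu> - (\<nu> - \<mu>)) = a \<mu> \<otimes> b (\<nu> - \<mu>)" using ac by (simp add: m_comm)
  qed (use ac in auto)
  finally show "(a \<star> b) \<nu> = (b \<star> a) \<nu>" ..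
qed

lemma PS_mult_assoc:
  assumes a: "a \<in> carrier PS" and b: "b \<in> carrier PS" and c: "c \<in> carrier PS"
  shows "(a \<star> b) \<star> c = a \<star> (b \<star> c)"
proof
  fix \<nu> :: "nat multiset"
  have ac: "a \<mu> \<in> carrier K" "b \<mu> \<in> carrier K" "c \<mu> \<in> carrier K" for \<mu> using a b c by (simp_all add: PS_carrier)
  let ?S = "\<lambda>\<nu>. {\<mu>. \<mu> \<subseteq># \<nu>}"
  note fs = finite_submultisets
  have "((a \<star> b) \<star> c) \<nu> = (\<Oplus>\<mu>\<in>?S \<nu>. \<Oplus>\<rho>\<in>?S \<mu>. a \<rho> \<otimes> b (\<mu> - \<rho>) \<otimes> c (\<nu> - \<mu>))"
    unfolding PS_mult
  proof (rule finsum_cong'[OF refl])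
    fix \<mu>
    show "(\<Oplus>\<rho>\<in>?S \<mu>. a \<rho> \<otimes> b (\<mu> - \<rho>)) \<otimes> c (\<nu> - \<mu>) = (\<Oplus>\<rho>\<in>?S \<mu>. a \<rho> \<otimes> b (\<mu> - \<rho>) \<otimes> c (\<nu> - \<mu>))"
      using ac by (intro finsum_ldistr[OF fs]) auto
  qed (use ac in \<open>auto intro!: finsum_closed\<close>)
  also have "\<dots> = (\<Oplus>p\<in>Sigma (?S \<nu>) ?S. a (snd p) \<otimes> b (fst p - snd p) \<otimes> c (\<nu> - fst p))"
    using ac fs by (intro finsum_Sigma) auto
  \<comment> \<open>A pair of \<mu> below \<nu> and \<rho> below \<mu> is reindexed by \<rho> and
    the difference \<mu> - \<rho>.\<close>
  also have "Sigma (?S \<nu>) ?S = (\<lambda>p. (fst p + snd p, fst p)) ` Sigma (?S \<nu>) (\<lambda>\<rho>. ?S (\<nu> - \<rho>))"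
  proof
    show "Sigma (?S \<nu>) ?S \<subseteq> (\<lambda>p. (fst p + snd p, fst p)) ` Sigma (?S \<nu>) (\<lambda>\<rho>. ?S (\<nu> - \<rho>))"
    proof
      fix p assume "p \<in> Sigma (?S \<nu>) ?S"
      then obtain \<mu> \<rho> where p: "p = (\<mu>, \<rho>)" "\<mu> \<subseteq># \<nu>" "\<rho> \<subseteq># \<mu>" by auto
      then have "(\<rho>, \<mu> - \<rho>) \<in> Sigma (?S \<nu>) (\<lambda>\<rho>. ?S (\<nu> - \<rho>))"
        by (auto simp: subseteq_mset_def intro: order_trans) (meson diff_le_mono)
      moreover have "\<rho> + (\<mu> - \<rho>) = \<mu>" using p(3) by (simp add: subset_mset.add_diff_inverse)
      ultimately show "p \<in> (\<lambda>p. (fst p + snd p, fst p)) ` Sigma (?S \<nu>) (\<lambda>\<rho>. ?S (\<nu> - \<rho>))"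
        unfolding p(1) by (intro image_eqI[of _ _ "(\<rho>, \<mu> - \<rho>)"]) simp_all
    qed
    show "(\<lambda>p. (fst p + snd p, fst p)) ` Sigma (?S \<nu>) (\<lambda>\<rho>. ?S (\<nu> - \<rho>)) \<subseteq> Sigma (?S \<nu>) ?S"
    proof
      fix p assume "p \<in> (\<lambda>p. (fst p + snd p, fst p)) ` Sigma (?S \<nu>) (\<lambda>\<rho>. ?S (\<nu> - \<rho>))"
      then obtain \<rho> \<tau> where p: "p = (\<rho> + \<tau>, \<rho>)" "\<rho> \<subseteq># \<nu>" "\<tau> \<subseteq># \<nu> - \<rho>" by auto
      then have "\<rho> + \<tau> \<subseteq># \<nu>" by (metis subset_mset.add_diff_inverse subset_mset.add_left_mono)
      then show "p \<in> Sigma (?S \<nu>) ?S" unfolding p(1) by simp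
    qed
  qed
  also have "(\<Oplus>p\<in>\<dots>. a (snd p) \<otimes> b (fst p - snd p) \<otimes> c (\<nu> - fst p)) =
      (\<Oplus>p\<in>Sigma (?S \<nu>) (\<lambda>\<rho>. ?S (\<nu> - \<rho>)). a (fst p) \<otimes> b (snd p) \<otimes> c (\<nu> - (fst p + snd p)))"
    using ac by (subst finsum_reindex) (auto simp: inj_on_def)
  also have "\<dots> = (\<Oplus>p\<in>Sigma (?S \<nu>) (\<lambda>\<rho>. ?S (\<nu> - \<rho>)). a (fst p) \<otimes> (b (snd p) \<otimes> c (\<nu> - fst p - snd p)))"
    using ac by (intro finsum_cong') (auto simp: m_assoc)
  also have "\<dots> = (\<Oplus>\<rho>\<in>?S \<nu>. \<Oplus>\<tau>\<in>?S (\<nu> - \<rho>). a \<rho> \<otimes> (b \<tau> \<otimes> c (\<nu> - \<rho> - \<tau>)))"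
    using ac fs by (intro finsum_Sigma[symmetric]) auto
  also have "\<dots> = (a \<star> (b \<star> c)) \<nu>"
    unfolding PS_mult
  proof (rule finsum_cong'[OF refl])
    fix \<rho>
    show "(\<Oplus>\<tau>\<in>?S (\<nu> - \<rho>). a \<rho> \<otimes> (b \<tau> \<otimes> c (\<nu> - \<rho> - \<tau>))) =
        a \<rho> \<otimes> (\<Oplus>\<tau>\<in>?S (\<nu> - \<rho>). b \<tau> \<otimes> c (\<nu> - \<rho> - \<tau>))"
      using ac by (intro finsum_rdistr[OF fs, symmetric]) auto
  qed (use ac in \<open>auto intro!: finsum_closed\<close>)
  finally show "((a \<star> b) \<star> c) \<nu> = (a \<star> (b \<star> c)) \<nu>" .
qed

definition monom :: "nat multiset \<Rightarrow> 'k series" where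
  "monom \<rho> = (\<lambda>\<nu>. if \<nu> = \<rho> then \<one> else \<zero>)"

lemma monom_carrier: "monom \<rho> \<in> carrier PS" by (simp add: monom_def PS_carrier)

lemma monom_mult:
  assumes b: "b \<in> carrier PS"
  shows "(monom \<rho> \<star> b) \<nu> = (if \<rho> \<subseteq># \<nu> then b (\<nu> - \<rho>) else \<zero>)"
proof (cases "\<rho> \<subseteq># \<nu>")
  case True
  then show ?thesis unfolding PS_mult using b finite_submultisets
    by (subst finsum_single[of _ \<rho>]) (auto simp: monom_def PS_carrier)
next
  case False
  have "(monom \<rho> \<star> b) \<nu> = \<zero>" unfolding PS_mult
  proof (rule add.finprod_one_eqI)
    fix \<mu> assume "\<mu> \<in> {\<mu>. \<mu> \<subseteq># \<nu>}"
    then have "\<mu> \<noteq> \<rho>" using False by auto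
    then show "monom \<rho> \<mu> \<otimes> b (\<nu> - \<mu>) = \<zero>" using b by (simp add: monom_def PS_carrier)
  qed
  then show ?thesis using False by simp
qed

lemma const_mult:
  assumes b: "b \<in> carrier PS" and c: "c \<in> carrier K"
  shows "(cst c \<star> b) \<nu> = c \<otimes> b \<nu>"
  unfolding PS_mult using b c finite_submultisets
  by (subst finsum_single[of _ "{#}"]) (auto simp: const_series_def PS_carrier)

lemma PS_one_monom: "\<one>\<^bsub>PS\<^esub> = monom {#}" by (simp add: PS_one const_series_def monom_def)

lemma PS_cring: "cring PS"
proof (rule cringI)
  show "abelian_group PS"
  proof (rule abelian_groupI)
    fix x assume x: "x \<in> carrier PS"
    then show "\<exists>y\<in>carrier PS. y \<boxplus> x = \<zero>\<^bsub>PS\<^esub>"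
      by (intro bexI[of _ "\<lambda>\<nu>. \<ominus> x \<nu>"] ext) (auto simp: PS_carrier PS_add PS_zero l_neg)
  qed (auto simp: PS_carrier PS_add PS_zero a_ac intro!: ext)
  show "comm_monoid PS"
  proof (rule comm_monoidI)
    fix x assume x: "x \<in> carrier PS"
    show "\<one>\<^bsub>PS\<^esub> \<star> x = x" unfolding PS_one_monom using monom_mult[OF x, of "{#}"] by auto
  qed (simp_all only: PS_mult_closed PS_mult_assoc PS_one_monom monom_carrier, rule PS_mult_comm)
next
  fix x y z assume "x \<in> carrier PS" "y \<in> carrier PS" "z \<in> carrier PS"
  then have c: "x \<mu> \<in> carrier K" "y \<mu> \<in> carrier K" "z \<mu> \<in> carrier K" for \<mu> by (simp_all add: PS_carrier)
  show "(x \<boxplus> y) \<star> z = x \<star> z \<boxplus> y \<star> z"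
  proof
    fix \<nu>
    have "((x \<boxplus> y) \<star> z) \<nu> = (\<Oplus>\<mu>\<in>{\<mu>. \<mu> \<subseteq># \<nu>}. x \<mu> \<otimes> z (\<nu> - \<mu>) \<oplus> y \<mu> \<otimes> z (\<nu> - \<mu>))"
      unfolding PS_mult PS_add using c by (intro finsum_cong') (auto simp: l_distr)
    also have "\<dots> = (x \<star> z \<boxplus> y \<star> z) \<nu>"
      unfolding PS_mult PS_add using c by (intro finsum_addf) auto
    finally show "((x \<boxplus> y) \<star> z) \<nu> = (x \<star> z \<boxplus> y \<star> z) \<nu>" .
  qed
qed

lemma PS_minus: "a \<in> carrier PS \<Longrightarrow> (\<ominus>\<^bsub>PS\<^esub> a) \<nu> = \<ominus> a \<nu>"
proof -
  interpret PS: cring PS by (rule PS_cring)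
  assume a: "a \<in> carrier PS"
  have "(\<ominus>\<^bsub>PS\<^esub> a \<boxplus> a) \<nu> = \<zero>" using PS.l_neg[OF a] PS_zero by simp
  then have "(\<ominus>\<^bsub>PS\<^esub> a) \<nu> \<oplus> a \<nu> = \<zero>" by (simp add: PS_add)
  moreover have "(\<ominus>\<^bsub>PS\<^esub> a) \<nu> \<in> carrier K" "a \<nu> \<in> carrier K" using a PS.a_inv_closed[OF a] by (simp_all add: PS_carrier)
  ultimately show ?thesis by (simp add: sum_zero_eq_neg)
qed

abbreviation RS :: "nat \<Rightarrow> 'k series set" where "RS n \<equiv> restricted_series K v n"

lemma RS_D:
  assumes "a \<in> RS n"
  shows "a \<nu> \<in> carrier K" "\<not> set_mset \<nu> \<subseteq> {..<n} \<Longrightarrow> a \<nu> = \<zero>" "\<epsilon> > 0 \<Longrightarrow> finite {\<nu>. \<epsilon> \<le> v (a \<nu>)}"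
  using assms unfolding restricted_series_def by auto

lemma RS_PS: "RS n \<subseteq> carrier PS" by (auto simp: PS_carrier RS_D)

lemma RS_mono: "n \<le> m \<Longrightarrow> RS n \<subseteq> RS m"
  unfolding restricted_series_def by (auto simp: subset_iff) (meson leD le_less_trans not_le order_less_le_trans)

definition gauss :: "'k series \<Rightarrow> real" where "gauss a = (SUP \<nu>. v (a \<nu>))"

lemma gauss_bdd: assumes "a \<in> RS n" shows "bdd_above (range (\<lambda>\<nu>. v (a \<nu>)))"
proof -
  have "finite {\<nu>. 1 \<le> v (a \<nu>)}" using RS_D(3)[OF assms, of 1] by simp
  then have "bdd_above ((\<lambda>\<nu>. v (a \<nu>)) ` {\<nu>. 1 \<le> v (a \<nu>)})" by simp
  then obtain M where "\<And>\<nu>. 1 \<le> v (a \<nu>) \<Longrightarrow> v (a \<nu>) \<le> M" unfolding bdd_above_def by blast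
  then have "v (a \<nu>) \<le> max 1 M" for \<nu> by (cases "1 \<le> v (a \<nu>)") (simp_all add: le_max_iff_disj)
  then show ?thesis by (intro bdd_aboveI[of _ "max 1 M"]) blast
qed

lemma gauss_ge: "a \<in> RS n \<Longrightarrow> v (a \<nu>) \<le> gauss a"
  unfolding gauss_def by (rule cSUP_upper[OF _ gauss_bdd]) auto

lemma gauss_le: "(\<And>\<nu>. v (a \<nu>) \<le> M) \<Longrightarrow> gauss a \<le> M"
  unfolding gauss_def by (rule cSUP_least) auto

lemma gauss_nonneg: "a \<in> RS n \<Longrightarrow> 0 \<le> gauss a"
  using gauss_ge[of a n "{#}"] v_nonneg[OF RS_D(1)[of a n "{#}"]] by simp

text \<open>A coefficient of the product of size at least \<epsilon> needs a pair of coefficients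
  that are both at least \<epsilon> / M, where M bounds both Gauss norms; there are only finitely
  many such pairs.\<close>

lemma RS_mult: assumes a: "a \<in> RS n" and b: "b \<in> RS n" shows "a \<star> b \<in> RS n"
  unfolding restricted_series_def
proof (intro CollectI conjI allI impI)
  note ac = RS_D(1)[OF a] RS_D(1)[OF b]
  show "(a \<star> b) \<nu> \<in> carrier K" for \<nu> using PS_mult_closed a b RS_PS by (auto simp: PS_carrier subset_iff)
  fix \<nu> assume n: "\<not> set_mset \<nu> \<subseteq> {..<n}"
  show "(a \<star> b) \<nu> = \<zero>"
    unfolding PS_mult
  proof (rule add.finprod_one_eqI)
    fix \<mu> assume "\<mu> \<in> {\<mu>. \<mu> \<subseteq># \<nu>}"
    then have "\<nu> = \<mu> + (\<nu> - \<mu>)" by simp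
    then have "\<not> set_mset \<mu> \<subseteq> {..<n} \<or> \<not> set_mset (\<nu> - \<mu>) \<subseteq> {..<n}" using n by (metis set_mset_union Un_subset_iff)
    then show "a \<mu> \<otimes> b (\<nu> - \<mu>) = \<zero>" using RS_D(2)[OF a, of \<mu>] RS_D(2)[OF b, of "\<nu> - \<mu>"] ac by (elim disjE) simp_all
  qed
next
  note ac = RS_D(1)[OF a] RS_D(1)[OF b]
  fix \<epsilon> :: real assume e: "\<epsilon> > 0"
  define M where "M = 1 + gauss a + gauss b"
  have M: "M > 0" "gauss a \<le> M" "gauss b \<le> M" using gauss_nonneg[OF a] gauss_nonneg[OF b] by (simp_all add: M_def)
  have eM: "\<epsilon> / M > 0" using e M by simp
  let ?A = "{\<nu>. \<epsilon> / M \<le> v (a \<nu>)}" and ?B = "{\<nu>. \<epsilon> / M \<le> v (b \<nu>)}"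
  have "{\<nu>. \<epsilon> \<le> v ((a \<star> b) \<nu>)} \<subseteq> (\<lambda>(\<mu>, \<rho>). \<mu> + \<rho>) ` (?A \<times> ?B)"
  proof (rule subsetI, rule ccontr)
    fix \<nu> assume "\<nu> \<in> {\<nu>. \<epsilon> \<le> v ((a \<star> b) \<nu>)}" and n: "\<nu> \<notin> (\<lambda>(\<mu>, \<rho>). \<mu> + \<rho>) ` (?A \<times> ?B)"
    have "v (a \<mu> \<otimes> b (\<nu> - \<mu>)) < \<epsilon>" if "\<mu> \<in> {\<mu>. \<mu> \<subseteq># \<nu>}" for \<mu>
    proof -
      have "\<nu> = \<mu> + (\<nu> - \<mu>)" using that by simp
      then have "\<mu> \<notin> ?A \<or> \<nu> - \<mu> \<notin> ?B" using n by (metis (mono_tags, lifting) SigmaI image_eqI old.prod.case)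
      then consider "v (a \<mu>) < \<epsilon> / M" | "v (b (\<nu> - \<mu>)) < \<epsilon> / M" by fastforce
      then show ?thesis
      proof cases
        case 1
        have "v (a \<mu>) * v (b (\<nu> - \<mu>)) \<le> v (a \<mu>) * M"
          using gauss_ge[OF b, of "\<nu> - \<mu>"] M(3) v_nonneg ac by (intro mult_left_mono) auto
        also have "\<dots> < \<epsilon>" using 1 M(1) by (simp add: pos_less_divide_eq)
        finally show ?thesis using v_mult ac by simp
      next
        case 2
        have "v (a \<mu>) * v (b (\<nu> - \<mu>)) \<le> M * v (b (\<nu> - \<mu>))"
          using gauss_ge[OF a, of \<mu>] M(2) v_nonneg ac by (intro mult_right_mono) auto
        also have "\<dots> < \<epsilon>" using 2 M(1) by (simp add: pos_less_divide_eq mult.commute)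
        finally show ?thesis using v_mult ac by simp
      qed
    qed
    then have "v ((a \<star> b) \<nu>) < \<epsilon>"
      unfolding PS_mult using finite_submultisets e ac by (intro v_finsum_less) auto
    then show False using \<open>\<nu> \<in> {\<nu>. \<epsilon> \<le> v ((a \<star> b) \<nu>)}\<close> by simp
  qed
  moreover have "finite ((\<lambda>(\<mu>, \<rho>). \<mu> + \<rho>) ` (?A \<times> ?B))"
    using RS_D(3)[OF a eM] RS_D(3)[OF b eM] by simp
  ultimately show "finite {\<nu>. \<epsilon> \<le> v ((a \<star> b) \<nu>)}" by (rule finite_subset)
qed

lemma RS_add: assumes a: "a \<in> RS n" and b: "b \<in> RS n" shows "a \<boxplus> b \<in> RS n"
  unfolding restricted_series_def
proof (intro CollectI conjI allI impI)
  note ac = RS_D(1)[OF a] RS_D(1)[OF b]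
  show "(a \<boxplus> b) \<nu> \<in> carrier K" for \<nu> using ac by (simp add: PS_add)
  show "(a \<boxplus> b) \<nu> = \<zero>" if "\<not> set_mset \<nu> \<subseteq> {..<n}" for \<nu>
    using RS_D(2)[OF a that] RS_D(2)[OF b that] by (simp add: PS_add)
  fix \<epsilon> :: real assume e: "\<epsilon> > 0"
  have "\<epsilon> \<le> v (a \<nu>) \<or> \<epsilon> \<le> v (b \<nu>)" if "\<epsilon> \<le> v ((a \<boxplus> b) \<nu>)" for \<nu>
    using that v_add[of "a \<nu>" "b \<nu>"] ac[of \<nu>] by (simp add: PS_add le_max_iff_disj)
      (metis le_max_iff_disj order_trans)
  then have "{\<nu>. \<epsilon> \<le> v ((a \<boxplus> b) \<nu>)} \<subseteq> {\<nu>. \<epsilon> \<le> v (a \<nu>)} \<union> {\<nu>. \<epsilon> \<le> v (b \<nu>)}" by blast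
  then show "finite {\<nu>. \<epsilon> \<le> v ((a \<boxplus> b) \<nu>)}"
    using RS_D(3)[OF a e] RS_D(3)[OF b e] by (meson finite_UnI finite_subset)
qed

lemma RS_finite_support:
  assumes "\<And>\<nu>. a \<nu> \<in> carrier K" "finite {\<nu>. a \<nu> \<noteq> \<zero>}" "\<And>\<nu>. a \<nu> \<noteq> \<zero> \<Longrightarrow> set_mset \<nu> \<subseteq> {..<n}"
  shows "a \<in> RS n"
  unfolding restricted_series_def
proof (intro CollectI conjI allI impI)
  fix \<epsilon> :: real assume "\<epsilon> > 0"
  then have "{\<nu>. \<epsilon> \<le> v (a \<nu>)} \<subseteq> {\<nu>. a \<nu> \<noteq> \<zero>}" using v_zero by auto
  then show "finite {\<nu>. \<epsilon> \<le> v (a \<nu>)}" using assms(2) by (rule finite_subset)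
qed (use assms in auto)

lemma RS_monom: "set_mset \<rho> \<subseteq> {..<n} \<Longrightarrow> monom \<rho> \<in> RS n"
  by (rule RS_finite_support) (auto simp: monom_def split: if_splits)

lemma RS_const: "c \<in> carrier K \<Longrightarrow> cst c \<in> RS n"
  by (rule RS_finite_support) (auto simp: const_series_def split: if_splits)

lemma RS_subring: "subring (RS n) PS"
proof (rule ring.subringI)
  show "ring PS" using PS_cring by (rule cring.axioms(1))
  show "\<one>\<^bsub>PS\<^esub> \<in> RS n" unfolding PS_one_monom by (rule RS_monom) simp
  fix h assume h: "h \<in> RS n"
  have "(\<ominus>\<^bsub>PS\<^esub> h) \<nu> = \<ominus> h \<nu>" for \<nu> using PS_minus h RS_PS by blast
  then have "\<ominus>\<^bsub>PS\<^esub> h = (\<lambda>\<nu>. \<ominus> h \<nu>)" by (rule ext)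
  then show "\<ominus>\<^bsub>PS\<^esub> h \<in> RS n" using h unfolding restricted_series_def by (auto simp: v_minus)
qed (use RS_PS RS_mult RS_add in auto)

abbreviation TA :: "nat \<Rightarrow> 'k series ring" where "TA n \<equiv> tate_algebra K v n"

lemma TA_simps: "carrier (TA n) = RS n" "(\<otimes>\<^bsub>TA n\<^esub>) = (\<otimes>\<^bsub>PS\<^esub>)" "(\<oplus>\<^bsub>TA n\<^esub>) = (\<oplus>\<^bsub>PS\<^esub>)"
    "\<one>\<^bsub>TA n\<^esub> = \<one>\<^bsub>PS\<^esub>" "\<zero>\<^bsub>TA n\<^esub> = \<zero>\<^bsub>PS\<^esub>"
  by (simp_all add: tate_PS)

lemma TA_cring: "cring (TA n)"
proof -
  interpret PS: cring PS by (rule PS_cring)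
  have "subcring (RS n) PS" by (rule PS.subcringI'[OF RS_subring])
  then show ?thesis unfolding tate_PS using PS.subcring_iff RS_PS by blast
qed

lemma TA_minus: "a \<in> RS n \<Longrightarrow> (\<ominus>\<^bsub>TA n\<^esub> a) \<nu> = \<ominus> a \<nu>"
proof -
  assume a: "a \<in> RS n"
  interpret T: cring "TA n" by (rule TA_cring)
  have "(\<ominus>\<^bsub>TA n\<^esub> a \<oplus>\<^bsub>TA n\<^esub> a) \<nu> = \<zero>" using T.l_neg a by (simp add: TA_simps PS_zero)
  then have "(\<ominus>\<^bsub>TA n\<^esub> a) \<nu> \<oplus> a \<nu> = \<zero>" by (simp add: TA_simps PS_add)
  moreover have "(\<ominus>\<^bsub>TA n\<^esub> a) \<nu> \<in> carrier K" "a \<nu> \<in> carrier K"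
    using a T.a_inv_closed[of a] RS_D(1) by (auto simp: TA_simps)
  ultimately show ?thesis by (simp add: sum_zero_eq_neg)
qed

lemma TA_diff: "a \<in> RS n \<Longrightarrow> b \<in> RS n \<Longrightarrow> (a \<ominus>\<^bsub>TA n\<^esub> b) \<nu> = a \<nu> \<ominus> b \<nu>"
  by (simp add: a_minus_def TA_minus TA_simps PS_add)

lemma gauss_mult: assumes a: "a \<in> RS n" and b: "b \<in> RS n" shows "gauss (a \<star> b) \<le> gauss a * gauss b"
proof (rule gauss_le)
  fix \<nu>
  show "v ((a \<star> b) \<nu>) \<le> gauss a * gauss b"
    unfolding PS_mult
  proof (rule v_finsum_le[OF finite_submultisets])
    fix \<mu>
    show "a \<mu> \<otimes> b (\<nu> - \<mu>) \<in> carrier K \<and> v (a \<mu> \<otimes> b (\<nu> - \<mu>)) \<le> gauss a * gauss b"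
      using RS_D(1)[OF a] RS_D(1)[OF b] v_nonneg gauss_ge[OF a] gauss_ge[OF b] gauss_nonneg[OF a]
      by (auto simp: v_mult intro!: mult_mono)
  qed (use gauss_nonneg a b in auto)
qed

lemma gauss_add: assumes a: "a \<in> RS n" and b: "b \<in> RS n" shows "gauss (a \<boxplus> b) \<le> max (gauss a) (gauss b)"
proof (rule gauss_le)
  fix \<nu>
  have "v (a \<nu> \<oplus> b \<nu>) \<le> max (v (a \<nu>)) (v (b \<nu>))" using RS_D(1)[OF a] RS_D(1)[OF b] by (intro v_add)
  then show "v ((a \<boxplus> b) \<nu>) \<le> max (gauss a) (gauss b)"
    unfolding PS_add using gauss_ge[OF a, of \<nu>] gauss_ge[OF b, of \<nu>] by linarith
qed

lemma gauss_const_mult: assumes c: "c \<in> carrier K" and a: "a \<in> RS n"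
  shows "gauss (cst c \<star> a) = v c * gauss a"
proof (cases "v c = 0")
  case True
  have "v ((cst c \<star> a) \<nu>) = 0" for \<nu>
    using const_mult[OF subsetD[OF RS_PS a] c, of \<nu>] c RS_D(1)[OF a] True by (auto simp: v_mult)
  then show ?thesis using True by (simp add: gauss_def)
next
  case False
  then have vc: "v c > 0" using v_nonneg[OF c] by simp
  have e: "v ((cst c \<star> a) \<nu>) = v c * v (a \<nu>)" for \<nu>
    using const_mult[OF subsetD[OF RS_PS a] c, of \<nu>] c RS_D(1)[OF a] by (auto simp: v_mult)
  show ?thesis
  proof (rule antisym)
    show "gauss (cst c \<star> a) \<le> v c * gauss a"
      by (rule gauss_le) (use e gauss_ge[OF a] vc in simp)
    have "gauss a \<le> gauss (cst c \<star> a) / v c"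
      by (rule gauss_le) (use e gauss_ge[OF RS_mult[OF RS_const[OF c] a]] vc in \<open>simp add: pos_le_divide_eq mult.commute\<close>)
    then show "v c * gauss a \<le> gauss (cst c \<star> a)" using vc by (simp add: pos_le_divide_eq mult.commute)
  qed
qed

text \<open>The limit is formed coefficientwise in K. As the Gauss norm controls all coefficients at
  once, the convergence is uniform in the exponents, and a uniform limit of restricted series is
  restricted.\<close>

lemma gauss_complete:
  assumes s: "\<And>i. s i \<in> RS n" and C: "\<And>\<epsilon>. \<epsilon> > 0 \<Longrightarrow> \<exists>N. \<forall>i\<ge>N. \<forall>j\<ge>N. gauss (s i \<ominus>\<^bsub>TA n\<^esub> s j) < \<epsilon>"
  shows "\<exists>l\<in>RS n. (\<lambda>i. gauss (s i \<ominus>\<^bsub>TA n\<^esub> l)) \<longlonglongrightarrow> 0"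
proof -
  interpret T: cring "TA n" by (rule TA_cring)
  have sc: "s i \<nu> \<in> carrier K" for i \<nu> using RS_D(1)[OF s] .
  have dRS: "a \<ominus>\<^bsub>TA n\<^esub> b \<in> RS n" if "a \<in> RS n" "b \<in> RS n" for a b
    using T.minus_closed[of a b] that by (simp add: TA_simps)
  have co: "v (s i \<nu> \<ominus> s j \<nu>) \<le> gauss (s i \<ominus>\<^bsub>TA n\<^esub> s j)" for i j \<nu>
    using gauss_ge[OF dRS[OF s s], of i j \<nu>] by (simp add: TA_diff[OF s s])
  have "\<exists>l\<in>carrier K. (\<lambda>i. v (s i \<nu> \<ominus> l)) \<longlonglongrightarrow> 0" for \<nu>
  proof -
    have "\<forall>\<epsilon>>0. \<exists>N. \<forall>i\<ge>N. \<forall>j\<ge>N. v (s i \<nu> \<ominus> s j \<nu>) < \<epsilon>"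
      using C co by (meson le_less_trans)
    then show ?thesis using cv[unfolded complete_value_def, THEN spec, of "\<lambda>i. s i \<nu>"] sc by blast
  qed
  then obtain l where l: "\<And>\<nu>. l \<nu> \<in> carrier K" "\<And>\<nu>. (\<lambda>i. v (s i \<nu> \<ominus> l \<nu>)) \<longlonglongrightarrow> 0" by metis
  have close: "\<exists>N. \<forall>i\<ge>N. \<forall>\<nu>. v (s i \<nu> \<ominus> l \<nu>) \<le> \<epsilon>" if e: "\<epsilon> > 0" for \<epsilon>
  proof -
    obtain N where N: "\<And>i j. i \<ge> N \<Longrightarrow> j \<ge> N \<Longrightarrow> gauss (s i \<ominus>\<^bsub>TA n\<^esub> s j) < \<epsilon>" using C[OF e] by blast
    have "v (s i \<nu> \<ominus> l \<nu>) \<le> \<epsilon>" if i: "i \<ge> N" for i \<nu>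
    proof -
      have "\<forall>\<^sub>F j in sequentially. v (s j \<nu> \<ominus> l \<nu>) < \<epsilon>" using order_tendstoD(2)[OF l(2) e] .
      then obtain N' where N': "\<And>j. j \<ge> N' \<Longrightarrow> v (s j \<nu> \<ominus> l \<nu>) < \<epsilon>" unfolding eventually_sequentially by blast
      let ?j = "max N N'"
      have "a \<ominus> c = (a \<ominus> b) \<oplus> (b \<ominus> c)" if "a \<in> carrier K" "b \<in> carrier K" "c \<in> carrier K" for a b c
        using that by algebra
      then have "s i \<nu> \<ominus> l \<nu> = (s i \<nu> \<ominus> s ?j \<nu>) \<oplus> (s ?j \<nu> \<ominus> l \<nu>)" using sc l(1) by blast
      then have "v (s i \<nu> \<ominus> l \<nu>) \<le> max (v (s i \<nu> \<ominus> s ?j \<nu>)) (v (s ?j \<nu> \<ominus> l \<nu>))"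
        using v_add[of "s i \<nu> \<ominus> s ?j \<nu>" "s ?j \<nu> \<ominus> l \<nu>"] sc l(1) by simp
      moreover have "v (s i \<nu> \<ominus> s ?j \<nu>) < \<epsilon>" using co[of i \<nu> ?j] N[of i ?j] i by simp
      ultimately show ?thesis using N'[of ?j] by simp
    qed
    then show ?thesis by blast
  qed
  have lRS: "l \<in> RS n"
    unfolding restricted_series_def
  proof (intro CollectI conjI allI impI)
    show "l \<nu> \<in> carrier K" for \<nu> by (rule l(1))
    show "l \<nu> = \<zero>" if "\<not> set_mset \<nu> \<subseteq> {..<n}" for \<nu>
    proof -
      have "v (s i \<nu> \<ominus> l \<nu>) = v (l \<nu>)" for i
        using RS_D(2)[OF s that, of i] l(1) v_minus by (simp add: minus_eq)
      then have "(\<lambda>i::nat. v (l \<nu>)) \<longlonglongrightarrow> 0" using l(2)[of \<nu>] by simp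
      then have "v (l \<nu>) = 0" by (simp add: LIMSEQ_const_iff)
      then show ?thesis using v_zero_iff l(1) by simp
    qed
    fix \<epsilon> :: real assume e: "\<epsilon> > 0"
    then obtain N where N: "\<And>\<nu>. v (s N \<nu> \<ominus> l \<nu>) \<le> \<epsilon> / 2" using close[of "\<epsilon> / 2"] by auto
    have "\<epsilon> \<le> v (s N \<nu>)" if "\<epsilon> \<le> v (l \<nu>)" for \<nu>
    proof -
      have "c = a \<ominus> (a \<ominus> c)" if "a \<in> carrier K" "c \<in> carrier K" for a c using that by algebra
      then have "l \<nu> = s N \<nu> \<ominus> (s N \<nu> \<ominus> l \<nu>)" using sc l(1) by blast
      then have "v (l \<nu>) \<le> max (v (s N \<nu>)) (v (s N \<nu> \<ominus> l \<nu>))" using v_diff[of "s N \<nu>" "s N \<nu> \<ominus> l \<nu>"] sc l(1) by simp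
      then show ?thesis using that N[of \<nu>] e by linarith
    qed
    then have "{\<nu>. \<epsilon> \<le> v (l \<nu>)} \<subseteq> {\<nu>. \<epsilon> \<le> v (s N \<nu>)}" by blast
    then show "finite {\<nu>. \<epsilon> \<le> v (l \<nu>)}" using RS_D(3)[OF s e] finite_subset by blast
  qed
  have "(\<lambda>i. gauss (s i \<ominus>\<^bsub>TA n\<^esub> l)) \<longlonglongrightarrow> 0"
  proof (rule LIMSEQ_I)
    fix r :: real assume "r > 0"
    then obtain N where N: "\<And>i \<nu>. i \<ge> N \<Longrightarrow> v (s i \<nu> \<ominus> l \<nu>) \<le> r / 2" using close[of "r / 2"] by auto
    have "norm (gauss (s i \<ominus>\<^bsub>TA n\<^esub> l) - 0) < r" if "i \<ge> N" for i
    proof -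
      have "gauss (s i \<ominus>\<^bsub>TA n\<^esub> l) \<le> r / 2" by (rule gauss_le) (use N[OF that] TA_diff[OF s lRS] in simp)
      then show ?thesis using gauss_nonneg[OF dRS[OF s lRS], of i] \<open>r > 0\<close> by simp
    qed
    then show "\<exists>no. \<forall>i\<ge>no. norm (gauss (s i \<ominus>\<^bsub>TA n\<^esub> l) - 0) < r" by blast
  qed
  then show ?thesis using lRS by blast
qed

end

section \<open>Absolute values on residue fields: uniqueness and existence\<close>

context banach_point
begin

lemma phi_kappa_inj:
  assumes "c \<in> carrier K" "d \<in> carrier K" "\<phi> (\<kappa> c) = \<phi> (\<kappa> d)" shows "c = d"
proof (rule ccontr)
  assume "c \<noteq> d"
  then have e: "c \<ominus>\<^sub>K d \<in> carrier K" "c \<ominus>\<^sub>K d \<noteq> 0\<^sub>K" using assms by auto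
  have "\<phi> (\<kappa> (c \<ominus>\<^sub>K d)) = \<zero>\<^bsub>L\<^esub>"
    using assms by (simp add: K.minus_eq L.r_neg)
  moreover have "\<phi> (\<kappa> (c \<ominus>\<^sub>K d)) \<otimes>\<^bsub>L\<^esub> \<phi> (\<kappa> (inv\<^bsub>K\<^esub> (c \<ominus>\<^sub>K d))) = \<phi> (\<kappa> ((c \<ominus>\<^sub>K d) \<cdot> inv\<^bsub>K\<^esub> (c \<ominus>\<^sub>K d)))"
    using e(1) K_inv[OF e] by (metis hom_closed hom_mult phi.hom_mult)
  ultimately have "\<zero>\<^bsub>L\<^esub> = \<one>\<^bsub>L\<^esub>" using K_inv[OF e] by simp
  then show False by simp
qed

text \<open>The absolute value of K carried over to its copy \<open>k\<close> in L; the choice is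
  unambiguous by \<open>phi_kappa_inj\<close>.\<close>

definition vk :: "'l \<Rightarrow> real" where "vk a = v (SOME c. c \<in> carrier K \<and> \<phi> (\<kappa> c) = a)"

lemma vk: assumes "c \<in> carrier K" shows "vk (\<phi> (\<kappa> c)) = v c"
proof -
  have "(SOME d. d \<in> carrier K \<and> \<phi> (\<kappa> d) = \<phi> (\<kappa> c)) = c"
    using assms phi_kappa_inj by (intro some_equality) auto
  then show ?thesis unfolding vk_def by simp
qed

lemma valued_subfield_k: "valued_subfield L k vk"
proof (intro valued_subfield.intro L.field_axioms valued_subfield_axioms.intro k_subfield)
  fix a assume a: "a \<in> k"
  then obtain c where c: "c \<in> carrier K" "a = \<phi> (\<kappa> c)" using kE by blast
  show "0 \<le> vk a" unfolding c(2) vk[OF c(1)] by (rule v_nonneg[OF c(1)])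
  show "vk a = 0 \<longleftrightarrow> a = \<zero>\<^bsub>L\<^esub>"
    unfolding c(2) vk[OF c(1)] v_zero[OF c(1)] using phi_kappa_inj[OF c(1) K.zero_closed] by auto
  fix b assume "b \<in> k"
  then obtain d where d: "d \<in> carrier K" "b = \<phi> (\<kappa> d)" using kE by blast
  have "a \<otimes>\<^bsub>L\<^esub> b = \<phi> (\<kappa> (c \<cdot> d))" using c d by simp
  then show "vk (a \<otimes>\<^bsub>L\<^esub> b) = vk a * vk b" using vk[of "c \<cdot> d"] vk c d v_mult by simp
next
  fix s :: "nat \<Rightarrow> 'l" assume s: "\<And>i. s i \<in> k" and C: "value_Cauchy L vk s"
  have "\<forall>i. \<exists>c. c \<in> carrier K \<and> s i = \<phi> (\<kappa> c)" using s kE by blast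
  then obtain c where c: "\<And>i. c i \<in> carrier K" "\<And>i. s i = \<phi> (\<kappa> (c i))" by metis
  have df: "\<phi> (\<kappa> a) \<ominus>\<^bsub>L\<^esub> \<phi> (\<kappa> b) = \<phi> (\<kappa> (a \<ominus>\<^sub>K b))" if "a \<in> carrier K" "b \<in> carrier K" for a b
    using that by (simp add: K.minus_eq L.minus_eq)
  have "vk (s i \<ominus>\<^bsub>L\<^esub> s j) = v (c i \<ominus>\<^sub>K c j)" for i j unfolding c(2) df[OF c(1) c(1)] by (rule vk) (use c(1) in simp)
  then have "\<forall>\<epsilon>>0. \<exists>N. \<forall>i\<ge>N. \<forall>j\<ge>N. v (c i \<ominus>\<^sub>K c j) < \<epsilon>" using C unfolding value_Cauchy_def by simp
  then obtain l where l: "l \<in> carrier K" "(\<lambda>i. v (c i \<ominus>\<^sub>K l)) \<longlonglongrightarrow> 0"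
    using cv c(1) unfolding complete_value_def by blast
  have "vk (s i \<ominus>\<^bsub>L\<^esub> \<phi> (\<kappa> l)) = v (c i \<ominus>\<^sub>K l)" for i unfolding c(2) df[OF c(1) l(1)] by (rule vk) (use c(1) l(1) in simp)
  then show "\<exists>l\<in>k. (\<lambda>i. vk (s i \<ominus>\<^bsub>L\<^esub> l)) \<longlonglongrightarrow> 0"
    using l unfolding k_def by (intro bexI[of _ "\<phi> (\<kappa> l)"]) auto
qed

lemma extension_knorm:
  assumes "absolute_value L w" "\<And>c. c \<in> carrier K \<Longrightarrow> w (\<phi> (\<kappa> c)) = v c"
  shows "valued_subfield.knorm L k vk w"
  unfolding valued_subfield.knorm_def[OF valued_subfield_k]
proof (intro conjI ballI impI)
  fix a x assume "a \<in> k" "x \<in> carrier L"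
  moreover from this obtain c where c: "c \<in> carrier K" "a = \<phi> (\<kappa> c)" using kE by blast
  ultimately show "w (a \<otimes>\<^bsub>L\<^esub> x) = vk a * w x"
    using assms vk by (simp add: absolute_value_def)
qed (use assms(1) in \<open>auto simp: absolute_value_def\<close>)

theorem extension_unique:
  assumes bs: "set bs \<subseteq> carrier L" "lspan L k bs = carrier L"
    and w: "absolute_value L w" "\<And>c. c \<in> carrier K \<Longrightarrow> w (\<phi> (\<kappa> c)) = v c"
    and w': "absolute_value L w'" "\<And>c. c \<in> carrier K \<Longrightarrow> w' (\<phi> (\<kappa> c)) = v c"
    and x: "x \<in> carrier L"
  shows "w x = w' x"
proof -
  note kn = extension_knorm[OF w] extension_knorm[OF w']
  have m: "u (a \<otimes>\<^bsub>L\<^esub> b) = u a * u b"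
    if "absolute_value L u" "a \<in> carrier L" "b \<in> carrier L" for u a b
    using that by (simp add: absolute_value_def)
  show ?thesis
    using valued_subfield.mult_norm_unique[OF valued_subfield_k bs kn(1) m[OF w(1)] kn(2) m[OF w'(1)] x]
      valued_subfield.mult_norm_unique[OF valued_subfield_k bs kn(2) m[OF w'(1)] kn(1) m[OF w(1)] x] by simp
qed

definition quotient_norm :: "'l \<Rightarrow> real" where
  "quotient_norm l = Inf (nm ` {x \<in> carrier B. \<phi> x = l})"

lemma quotient_norm_lower: "x \<in> carrier B \<Longrightarrow> quotient_norm (\<phi> x) \<le> nm x"
  unfolding quotient_norm_def by (intro cInf_lower bdd_belowI[of _ 0]) (auto simp: nm_nonneg)

lemma quotient_norm_greatest:
  assumes "l \<in> carrier L" "\<And>x. x \<in> carrier B \<Longrightarrow> \<phi> x = l \<Longrightarrow> b \<le> nm x"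
  shows "b \<le> quotient_norm l"
proof -
  obtain x where "x \<in> carrier B" "\<phi> x = l" using surj assms(1) by (metis imageE)
  then show ?thesis unfolding quotient_norm_def using assms(2) by (intro cInf_greatest) auto
qed

lemma quotient_norm_approx:
  assumes "l \<in> carrier L" "e > 0"
  obtains x where "x \<in> carrier B" "\<phi> x = l" "nm x < quotient_norm l + e"
proof -
  have "\<not> (\<forall>x. x \<in> carrier B \<longrightarrow> \<phi> x = l \<longrightarrow> quotient_norm l + e \<le> nm x)"
    using quotient_norm_greatest[OF assms(1), of "quotient_norm l + e"] assms(2) by auto
  then show ?thesis using that by force
qed

text \<open>The value at 1 is exactly 1: a preimage x of 1 with norm below 1 would make 1 - x a unit
  inside the kernel. Exact homogeneity follows from the inequality for a scalar and for its
  inverse.\<close>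

lemma quotient_norm_submult: "submult_norm L k vk quotient_norm"
proof (intro submult_norm.intro valued_subfield_k submult_norm_axioms.intro)
  have nn: "0 \<le> quotient_norm x" if "x \<in> carrier L" for x
    using quotient_norm_greatest[OF that, of 0] nm_nonneg by blast
  then show "\<And>x. x \<in> carrier L \<Longrightarrow> 0 \<le> quotient_norm x" .
  show "quotient_norm \<one>\<^bsub>L\<^esub> = 1"
  proof (rule antisym)
    show "quotient_norm \<one>\<^bsub>L\<^esub> \<le> 1" using quotient_norm_lower[of \<one>] nm_one by simp
    show "1 \<le> quotient_norm \<one>\<^bsub>L\<^esub>"
    proof (rule quotient_norm_greatest; (rule ccontr)?)
      fix x assume x: "x \<in> carrier B" "\<phi> x = \<one>\<^bsub>L\<^esub>" "\<not> 1 \<le> nm x"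
      then obtain w where w: "w \<in> carrier B" "(\<one> \<ominus> x) \<otimes> w = \<one>" using one_minus_unit[of x] by auto
      have z: "\<phi> (\<one> \<ominus> x) = \<zero>\<^bsub>L\<^esub>" using x by (simp add: B.minus_eq L.r_neg)
      have "\<phi> ((\<one> \<ominus> x) \<otimes> w) = \<phi> (\<one> \<ominus> x) \<otimes>\<^bsub>L\<^esub> \<phi> w" by (rule phi.hom_mult) (use x(1) w(1) in auto)
      also have "\<dots> = \<zero>\<^bsub>L\<^esub>" unfolding z using w(1) by simp
      finally show False using w(2) by simp
    qed simp
  qed
  fix x y assume xy: "x \<in> carrier L" "y \<in> carrier L"
  show "quotient_norm (x \<oplus>\<^bsub>L\<^esub> y) \<le> max (quotient_norm x) (quotient_norm y)"
  proof (rule field_le_epsilon)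
    fix e :: real assume e: "e > 0"
    obtain a where a: "a \<in> carrier B" "\<phi> a = x" "nm a < quotient_norm x + e" by (rule quotient_norm_approx[OF xy(1) e])
    obtain b where b: "b \<in> carrier B" "\<phi> b = y" "nm b < quotient_norm y + e" by (rule quotient_norm_approx[OF xy(2) e])
    have "quotient_norm (x \<oplus>\<^bsub>L\<^esub> y) \<le> nm (a \<oplus> b)" using quotient_norm_lower[of "a \<oplus> b"] a b by simp
    also have "\<dots> \<le> max (nm a) (nm b)" using nm_add a b by simp
    finally show "quotient_norm (x \<oplus>\<^bsub>L\<^esub> y) \<le> max (quotient_norm x) (quotient_norm y) + e" using a(3) b(3) by linarith
  qed
  show "quotient_norm (x \<otimes>\<^bsub>L\<^esub> y) \<le> quotient_norm x * quotient_norm y"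
  proof (rule le_mult_epsilon)
    fix e :: real assume e: "e > 0"
    obtain a where a: "a \<in> carrier B" "\<phi> a = x" "nm a < quotient_norm x + e" by (rule quotient_norm_approx[OF xy(1) e])
    obtain b where b: "b \<in> carrier B" "\<phi> b = y" "nm b < quotient_norm y + e" by (rule quotient_norm_approx[OF xy(2) e])
    have "quotient_norm (x \<otimes>\<^bsub>L\<^esub> y) \<le> nm (a \<otimes> b)" using quotient_norm_lower[of "a \<otimes> b"] a b by simp
    also have "\<dots> \<le> nm a * nm b" using nm_mult a b by simp
    also have "\<dots> \<le> (quotient_norm x + e) * (quotient_norm y + e)"
      using a b nm_nonneg nn xy e by (intro mult_mono) (auto intro: less_imp_le add_nonneg_nonneg)
    finally show "quotient_norm (x \<otimes>\<^bsub>L\<^esub> y) \<le> (quotient_norm x + e) * (quotient_norm y + e)" .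
  qed
next
  fix a x assume a: "a \<in> k" and x: "x \<in> carrier L"
  obtain c where c: "c \<in> carrier K" "a = \<phi> (\<kappa> c)" using kE[OF a] by blast
  have nn: "0 \<le> quotient_norm x" if "x \<in> carrier L" for x
    using quotient_norm_greatest[OF that, of 0] nm_nonneg by blast
  have le: "quotient_norm (\<phi> (\<kappa> d) \<otimes>\<^bsub>L\<^esub> x) \<le> v d * quotient_norm x" if d: "d \<in> carrier K" "d \<noteq> 0\<^sub>K" and x: "x \<in> carrier L" for d x
  proof -
    have "quotient_norm (\<phi> (\<kappa> d) \<otimes>\<^bsub>L\<^esub> x) / v d \<le> quotient_norm x"
    proof (rule quotient_norm_greatest[OF x])
      fix b assume b: "b \<in> carrier B" "\<phi> b = x"
      have "quotient_norm (\<phi> (\<kappa> d) \<otimes>\<^bsub>L\<^esub> x) \<le> nm (\<kappa> d \<otimes> b)" using quotient_norm_lower[of "\<kappa> d \<otimes> b"] b d by simp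
      then show "quotient_norm (\<phi> (\<kappa> d) \<otimes>\<^bsub>L\<^esub> x) / v d \<le> nm b"
        using nm_smult[OF d(1) b(1)] v_pos[OF d] by (simp add: pos_divide_le_eq mult.commute)
    qed
    then show ?thesis using v_pos[OF d] by (simp add: pos_divide_le_eq mult.commute)
  qed
  show "quotient_norm (a \<otimes>\<^bsub>L\<^esub> x) = vk a * quotient_norm x"
  proof (cases "c = 0\<^sub>K")
    case True
    have "quotient_norm \<zero>\<^bsub>L\<^esub> \<le> 0" using quotient_norm_lower[of \<zero>] nm_zero[of \<zero>] by simp
    then have "quotient_norm \<zero>\<^bsub>L\<^esub> = 0" using nn[of "\<zero>\<^bsub>L\<^esub>"] by simp
    moreover have "a \<otimes>\<^bsub>L\<^esub> x = \<zero>\<^bsub>L\<^esub>" using c(2) True x by simp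
    moreover have "vk a = 0" unfolding c(2) vk[OF c(1)] using True v_zero[of "0\<^sub>K"] by simp
    ultimately show ?thesis by simp
  next
    case False
    note i = K_inv[OF c(1) False]
    have ac: "a \<in> carrier L" using c by simp
    have "\<phi> (\<kappa> (inv\<^bsub>K\<^esub> c \<cdot> c)) = \<one>\<^bsub>L\<^esub>" using i K.m_comm[of "inv\<^bsub>K\<^esub> c" c] c(1) by simp
    then have "\<phi> (\<kappa> (inv\<^bsub>K\<^esub> c)) \<otimes>\<^bsub>L\<^esub> a = \<one>\<^bsub>L\<^esub>" using i c by simp
    then have "\<phi> (\<kappa> (inv\<^bsub>K\<^esub> c)) \<otimes>\<^bsub>L\<^esub> (a \<otimes>\<^bsub>L\<^esub> x) = x" using i ac x by (simp add: L.m_assoc[symmetric])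
    then have "quotient_norm x \<le> v (inv\<^bsub>K\<^esub> c) * quotient_norm (a \<otimes>\<^bsub>L\<^esub> x)"
      using le[of "inv\<^bsub>K\<^esub> c" "a \<otimes>\<^bsub>L\<^esub> x"] i ac x by simp
    then have "v c * quotient_norm x \<le> quotient_norm (a \<otimes>\<^bsub>L\<^esub> x)"
      using v_inv[OF c(1) False] v_pos[OF c(1) False] by (simp add: pos_le_divide_eq mult.commute)
    then show ?thesis using le[OF c(1) False x] c(2) vk[OF c(1)] by simp
  qed
qed

text \<open>The spectral norm of the quotient norm, which is multiplicative by
  \<open>sp_mult\<close> because L is finite over \<open>k\<close>. That it stays below the norm of
  B is later the bound of points by the Gauss norm.\<close>

theorem extension_exists:
  assumes bs: "set bs \<subseteq> carrier L" "lspan L k bs = carrier L"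
  shows "\<exists>w. absolute_value L w \<and> (\<forall>c\<in>carrier K. w (\<phi> (\<kappa> c)) = v c) \<and> (\<forall>x\<in>carrier B. w (\<phi> x) \<le> nm x)"
proof -
  interpret S: submult_norm L k vk quotient_norm by (rule quotient_norm_submult)
  have m: "S.sp (g \<otimes>\<^bsub>L\<^esub> f) = S.sp g * S.sp f" if "g \<in> carrier L" "f \<in> carrier L" for g f
    by (rule S.sp_mult[OF bs that])
  have kn: "S.knorm S.sp" by (rule submult_norm.p_knorm[OF S.sp_submult])
  have "absolute_value L S.sp"
    unfolding absolute_value_def using m S.knormD[OF kn] S.knorm_zero[OF kn] by auto
  moreover have "S.sp (\<phi> (\<kappa> c)) = v c" if "c \<in> carrier K" for c
  proof -
    have "\<phi> (\<kappa> c) \<in> k" using that unfolding k_def by blast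
    then show ?thesis using submult_norm.p_k[OF S.sp_submult] vk[OF that] by simp
  qed
  moreover have "S.sp (\<phi> x) \<le> nm x" if "x \<in> carrier B" for x
    using S.sp_le[of "\<phi> x"] quotient_norm_lower[OF that] that by (meson order_trans phi.hom_closed)
  ultimately show ?thesis by blast
qed

end

section \<open>Tate algebras as Banach algebras generated by their variables\<close>

context nonarch_field
begin

lemma const_hom: "cst \<in> ring_hom K (TA n)"
proof (rule ring_hom_memI)
  fix c d assume c: "c \<in> carrier K" "d \<in> carrier K"
  show "cst c \<in> carrier (TA n)" using RS_const[OF c(1)] by (simp add: TA_simps)
  show "cst (c \<otimes> d) = cst c \<otimes>\<^bsub>TA n\<^esub> cst d"
  proof
    fix \<nu>
    have "cst d \<in> carrier PS" using c by (simp add: PS_carrier const_series_def)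
    then show "cst (c \<otimes> d) \<nu> = (cst c \<otimes>\<^bsub>TA n\<^esub> cst d) \<nu>"
      using c by (simp add: TA_simps const_mult) (simp add: const_series_def)
  qed
  show "cst (c \<oplus> d) = cst c \<oplus>\<^bsub>TA n\<^esub> cst d"
    by (rule ext) (simp add: TA_simps PS_add const_series_def)
qed (simp add: TA_simps PS_one)

lemma gauss_zero_iff: assumes "a \<in> RS n" shows "gauss a = 0 \<longleftrightarrow> a = \<zero>\<^bsub>PS\<^esub>"
proof
  assume g: "gauss a = 0"
  show "a = \<zero>\<^bsub>PS\<^esub>"
  proof
    fix \<nu>
    have "v (a \<nu>) = 0" using gauss_ge[OF assms, of \<nu>] g v_nonneg[OF RS_D(1)[OF assms, of \<nu>]] by simp
    then show "a \<nu> = \<zero>\<^bsub>PS\<^esub> \<nu>" using v_zero_iff RS_D(1)[OF assms] by (simp add: PS_zero)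
  qed
next
  assume "a = \<zero>\<^bsub>PS\<^esub>"
  then show "gauss a = 0" by (simp add: gauss_def PS_zero v_zero)
qed

lemma gauss_monom: "gauss (monom \<rho>) = 1"
proof (rule antisym)
  have r: "monom \<rho> \<in> RS (Suc (\<Sum>x\<in>set_mset \<rho>. x))"
  proof (rule RS_monom, rule subsetI)
    fix x assume "x \<in># \<rho>"
    then have "x \<le> (\<Sum>x\<in>set_mset \<rho>. x)" by (intro member_le_sum) auto
    then show "x \<in> {..<Suc (\<Sum>x\<in>set_mset \<rho>. x)}" by simp
  qed
  show "1 \<le> gauss (monom \<rho>)" using gauss_ge[OF r, of \<rho>] by (simp add: monom_def v_one)
  show "gauss (monom \<rho>) \<le> 1" by (rule gauss_le) (simp add: monom_def v_one v_zero)
qed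

lemma tate_banach: "banach_algebra (TA n) K cst v gauss"
proof -
  interpret T: cring "TA n" by (rule TA_cring)
  interpret H: ring_hom_cring K "TA n" cst
    by unfold_locales (rule const_hom)
  show ?thesis
  proof unfold_locales
    fix s assume s: "\<And>i::nat. s i \<in> carrier (TA n)" and C: "value_Cauchy (TA n) gauss s"
    then show "\<exists>l\<in>carrier (TA n). (\<lambda>i. gauss (s i \<ominus>\<^bsub>TA n\<^esub> l)) \<longlonglongrightarrow> 0"
      using gauss_complete[of s n] unfolding value_Cauchy_def TA_simps by blast
  qed (use av na nt cv in \<open>simp_all add: TA_simps gauss_nonneg gauss_zero_iff gauss_add gauss_mult
      gauss_const_mult PS_one_monom gauss_monom\<close>)
qed

definition X :: "nat \<Rightarrow> 'k series" where "X i = monom {#i#}"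

lemma X_RS: "i < n \<Longrightarrow> X i \<in> RS n" unfolding X_def by (rule RS_monom) simp

lemma tate_variables: "variables (TA n) K cst v gauss X n"
proof (intro variables.intro tate_banach variables_axioms.intro)
  fix i assume "i < n"
  then show "X i \<in> carrier (TA n)" using X_RS by (simp only: TA_simps)
  show "gauss (X i) \<le> 1" unfolding X_def gauss_monom by (rule order_refl)
qed

text \<open>The unit ball of the Gauss norm supports the coinductive step defining \<open>D\<close>:
  the coefficients of size at least |c| are finitely many and form a polynomial, and the rest is
  divisible by c within the unit ball. A general series is scaled into the unit ball.\<close>

lemma tate_dense: assumes x: "x \<in> carrier (TA n)" shows "x \<in> variables.E (TA n) K cst v gauss X n"
proof -
  interpret variables "TA n" K cst v gauss X n by (rule tate_variables)
  have monom_Pol: "set_mset \<rho> \<subseteq> {..<n} \<Longrightarrow> monom \<rho> \<in> Pol X n" for \<rho>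
  proof (induction \<rho>)
    case empty then show ?case using subringE(3)[OF Pol_subring] by (simp add: TA_simps PS_one_monom)
  next
    case (add i \<rho>)
    have "X i \<otimes>\<^bsub>TA n\<^esub> monom \<rho> = monom (add_mset i \<rho>)"
    proof
      fix \<nu>
      show "(X i \<otimes>\<^bsub>TA n\<^esub> monom \<rho>) \<nu> = monom (add_mset i \<rho>) \<nu>"
        unfolding X_def TA_simps monom_mult[OF monom_carrier] by (auto simp: monom_def)
    qed
    then show ?case using Pol_mult[OF Pol_var[of i] add.IH] add.prems by simp
  qed
  have trunc: "(\<lambda>\<nu>. if \<nu> \<in> F then t \<nu> else \<zero>\<^bsub>K\<^esub>) \<in> Pol X n"
    if "finite F" "\<And>\<nu>. \<nu> \<in> F \<Longrightarrow> t \<nu> \<in> V \<and> set_mset \<nu> \<subseteq> {..<n}" for F t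
    using that
  proof (induction F)
    case empty
    have "(\<lambda>\<nu>. \<zero>\<^bsub>K\<^esub>) = \<zero>\<^bsub>TA n\<^esub>" by (rule ext) (simp add: TA_simps PS_zero)
    then show ?case using Pol.zero by simp
  next
    case (insert \<rho> F)
    have \<rho>: "t \<rho> \<in> V" "t \<rho> \<in> carrier K" "set_mset \<rho> \<subseteq> {..<n}" using insert.prems V_carrier by auto
    have e: "(\<lambda>\<nu>. if \<nu> \<in> insert \<rho> F then t \<nu> else \<zero>\<^bsub>K\<^esub>) =
        cst (t \<rho>) \<otimes>\<^bsub>TA n\<^esub> monom \<rho> \<oplus>\<^bsub>TA n\<^esub> (\<lambda>\<nu>. if \<nu> \<in> F then t \<nu> else \<zero>\<^bsub>K\<^esub>)"
    proof
      fix \<nu>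
      have "\<nu> \<in> F \<Longrightarrow> t \<nu> \<in> carrier K" using insert.prems V_carrier by auto
      then show "(if \<nu> \<in> insert \<rho> F then t \<nu> else \<zero>\<^bsub>K\<^esub>) =
        (cst (t \<rho>) \<otimes>\<^bsub>TA n\<^esub> monom \<rho> \<oplus>\<^bsub>TA n\<^esub> (\<lambda>\<nu>. if \<nu> \<in> F then t \<nu> else \<zero>\<^bsub>K\<^esub>)) \<nu>"
        unfolding TA_simps PS_add const_mult[OF monom_carrier \<rho>(2)]
        using insert.hyps(2) \<rho>(2) by (auto simp: monom_def)
    qed
    show ?case unfolding e
      using Pol_add[OF Pol_mult[OF Pol_const[OF \<rho>(1)] monom_Pol[OF \<rho>(3)]]] insert by simp
  qed
  let ?T = "{t \<in> carrier (TA n). gauss t \<le> 1}"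
  have "?T \<subseteq> D"
  proof (rule D_coinduct)
    fix c t assume c: "c \<in> carrier K" "c \<noteq> \<zero>\<^bsub>K\<^esub>" and "t \<in> ?T"
    then have t: "t \<in> RS n" "gauss t \<le> 1" by (simp_all add: TA_simps)
    note i = K_inv[OF c]
    have vc: "v c > 0" by (rule v_pos[OF c])
    define F where "F = {\<nu>. v c \<le> v (t \<nu>)}"
    define p where "p = (\<lambda>\<nu>. if \<nu> \<in> F then t \<nu> else \<zero>\<^bsub>K\<^esub>)"
    have pP: "p \<in> Pol X n"
      unfolding p_def
    proof (rule trunc)
      show "finite F" unfolding F_def by (rule RS_D(3)[OF t(1) vc])
      fix \<nu> assume "\<nu> \<in> F"
      then have "t \<nu> \<noteq> \<zero>\<^bsub>K\<^esub>" unfolding F_def using vc v_zero[of "\<zero>\<^bsub>K\<^esub>"] by auto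
      then show "t \<nu> \<in> V \<and> set_mset \<nu> \<subseteq> {..<n}"
        using RS_D(1,2)[OF t(1)] gauss_ge[OF t(1), of \<nu>] t(2) unfolding V_def by fastforce
    qed
    have pRS: "p \<in> RS n" using Pol_carrier[OF pP] by (simp add: TA_simps)
    define d where "d = t \<ominus>\<^bsub>TA n\<^esub> p"
    have dRS: "d \<in> RS n" unfolding d_def using B.minus_closed[of t p] t pRS by (simp add: TA_simps)
    have gd: "gauss d \<le> v c"
    proof (rule gauss_le)
      fix \<nu>
      have "d \<nu> = t \<nu> \<ominus>\<^bsub>K\<^esub> p \<nu>" unfolding d_def by (rule TA_diff[OF t(1) pRS])
      then have "d \<nu> = (if \<nu> \<in> F then \<zero>\<^bsub>K\<^esub> else t \<nu>)"
        using RS_D(1)[OF t(1), of \<nu>] by (simp add: p_def minus_eq r_neg)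
      then show "v (d \<nu>) \<le> v c" using vc v_zero[of "\<zero>\<^bsub>K\<^esub>"] unfolding F_def by auto
    qed
    define t' where "t' = cst (inv\<^bsub>K\<^esub> c) \<otimes>\<^bsub>TA n\<^esub> d"
    have t'T: "t' \<in> ?T"
    proof -
      have "gauss t' = v (inv\<^bsub>K\<^esub> c) * gauss d" unfolding t'_def TA_simps using gauss_const_mult dRS i by simp
      also have "\<dots> \<le> 1" unfolding v_inv[OF c] using gd vc by simp
      finally show ?thesis unfolding t'_def using RS_mult[OF RS_const dRS] i by (simp add: TA_simps)
    qed
    have "t = p \<oplus>\<^bsub>TA n\<^esub> cst c \<otimes>\<^bsub>TA n\<^esub> t'"
    proof -
      have cc: "cst c \<in> carrier (TA n)" "cst (inv\<^bsub>K\<^esub> c) \<in> carrier (TA n)"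
        using c i RS_const by (auto simp: TA_simps)
      have dc: "d \<in> carrier (TA n)" "p \<in> carrier (TA n)" "t \<in> carrier (TA n)" using dRS pRS t by (simp_all add: TA_simps)
      have "cst c \<otimes>\<^bsub>TA n\<^esub> t' = cst (c \<otimes>\<^bsub>K\<^esub> inv\<^bsub>K\<^esub> c) \<otimes>\<^bsub>TA n\<^esub> d"
        unfolding t'_def using cc dc c i hom_mult[of c "inv\<^bsub>K\<^esub> c"] by (simp add: B.m_assoc)
      also have "\<dots> = d" using i dc hom_one by simp
      finally have "cst c \<otimes>\<^bsub>TA n\<^esub> t' = d" .
      moreover have "a = b \<oplus>\<^bsub>TA n\<^esub> (a \<ominus>\<^bsub>TA n\<^esub> b)" if "a \<in> carrier (TA n)" "b \<in> carrier (TA n)" for a b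
        using that by (simp add: B.minus_eq B.a_lcomm[of b] B.r_neg)
      ultimately show ?thesis unfolding d_def using dc by simp
    qed
    then show "\<exists>p\<in>Pol X n. \<exists>t'\<in>?T. t = p \<oplus>\<^bsub>TA n\<^esub> cst c \<otimes>\<^bsub>TA n\<^esub> t'" using pP t'T by blast
  qed simp
  moreover obtain c where c: "c \<in> carrier K" "c \<noteq> \<zero>\<^bsub>K\<^esub>" "v c * gauss x \<le> 1"
  proof -
    obtain g where g: "g \<in> carrier K" "g \<noteq> \<zero>\<^bsub>K\<^esub>" "v g < 1" by (rule small_scalar)
    have gx: "0 \<le> gauss x" using gauss_nonneg x by (simp add: TA_simps)
    obtain r where r: "v g ^ r < 1 / (gauss x + 1)" using real_arch_pow_inv[OF _ g(3), of "1 / (gauss x + 1)"] gx by auto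
    have "v g ^ r * gauss x \<le> 1 / (gauss x + 1) * gauss x" using r gx by (intro mult_right_mono) auto
    also have "\<dots> \<le> 1" using gx by simp
    finally have "v (g [^]\<^bsub>K\<^esub> r) * gauss x \<le> 1" using g(1) by (simp add: v_pow)
    moreover have "g [^]\<^bsub>K\<^esub> r \<noteq> \<zero>\<^bsub>K\<^esub>" using v_pos[OF g(1,2)] v_zero[of "g [^]\<^bsub>K\<^esub> r"] g(1) by (auto simp: v_pow)
    ultimately show ?thesis using that g(1) by blast
  qed
  moreover have "cst c \<otimes>\<^bsub>TA n\<^esub> x \<in> ?T"
    using nm_smult[OF c(1) x] c(1,3) x by simp
  ultimately show ?thesis unfolding E_def using x by blast
qed

text \<open>The coefficient of the j-th power of \<open>X n\<close>, as a series in the variables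
  below n.\<close>

definition slice :: "nat \<Rightarrow> nat \<Rightarrow> 'k series \<Rightarrow> 'k series" where
  "slice n j H = (\<lambda>\<nu>. if set_mset \<nu> \<subseteq> {..<n} then H (\<nu> + replicate_mset j n) else \<zero>)"

lemma slice_RS: assumes H: "H \<in> RS m" shows "slice n j H \<in> RS n"
  unfolding restricted_series_def
proof (intro CollectI conjI allI impI)
  show "slice n j H \<nu> \<in> carrier K" for \<nu> using RS_D(1)[OF H] by (simp add: slice_def)
  show "slice n j H \<nu> = \<zero>" if "\<not> set_mset \<nu> \<subseteq> {..<n}" for \<nu> using that by (simp add: slice_def)
  fix \<epsilon> :: real assume e: "\<epsilon> > 0"
  have "{\<nu>. \<epsilon> \<le> v (slice n j H \<nu>)} \<subseteq> (\<lambda>\<nu>. \<nu> + replicate_mset j n) -` {\<nu>. \<epsilon> \<le> v (H \<nu>)}"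
    using e by (auto simp: slice_def v_zero split: if_splits)
  moreover have "finite ((\<lambda>\<nu>. \<nu> + replicate_mset j n) -` {\<nu>. \<epsilon> \<le> v (H \<nu>)})"
    by (rule finite_vimageI[OF RS_D(3)[OF H e]]) (simp add: inj_def)
  ultimately show "finite {\<nu>. \<epsilon> \<le> v (slice n j H \<nu>)}" by (rule finite_subset)
qed

lemma slice_tendsto_zero:
  assumes H: "H \<in> RS m" and e: "\<epsilon> > 0"
  shows "\<exists>j0. \<forall>j\<ge>j0. gauss (slice n j H) \<le> \<epsilon>"
proof -
  let ?A = "{\<nu>. \<epsilon> \<le> v (H \<nu>)}"
  \<comment> \<open>Exceeds the exponent of \<open>X n\<close> in each of the finitely many
    monomials whose coefficient has size at least \<epsilon>.\<close>
  define j0 where "j0 = Suc (\<Sum>\<nu>\<in>?A. count \<nu> n)"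
  have "gauss (slice n j H) \<le> \<epsilon>" if j: "j \<ge> j0" for j
  proof (rule gauss_le)
    fix \<nu>
    have "\<nu> + replicate_mset j n \<notin> ?A"
    proof
      assume "\<nu> + replicate_mset j n \<in> ?A"
      then have "count (\<nu> + replicate_mset j n) n \<le> (\<Sum>\<nu>\<in>?A. count \<nu> n)"
        using RS_D(3)[OF H e] by (intro member_le_sum) auto
      then show False using j unfolding j0_def by simp
    qed
    then show "v (slice n j H \<nu>) \<le> \<epsilon>" using e by (simp add: slice_def v_zero)
  qed
  then show ?thesis by blast
qed

lemma slice_add: "slice n j (G \<boxplus> H) = slice n j G \<boxplus> slice n j H"
  by (rule ext) (simp add: slice_def PS_add)

lemma slice_zero: "slice n j \<zero>\<^bsub>PS\<^esub> = \<zero>\<^bsub>PS\<^esub>"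
  by (rule ext) (simp add: slice_def PS_zero)

lemma TA_finsum: "finite A \<Longrightarrow> (\<And>x. x \<in> A \<Longrightarrow> f x \<in> RS n) \<Longrightarrow> finsum (TA n) f A \<nu> = (\<Oplus>x\<in>A. f x \<nu>)"
proof (induction A rule: finite_induct)
  case empty
  interpret T: cring "TA n" by (rule TA_cring)
  show ?case by (simp add: TA_simps PS_zero)
next
  case (insert a A)
  interpret T: cring "TA n" by (rule TA_cring)
  have "finsum (TA n) f (insert a A) = f a \<oplus>\<^bsub>TA n\<^esub> finsum (TA n) f A"
    using insert by (intro T.finsum_insert) (auto simp: TA_simps)
  moreover have "(\<Oplus>x\<in>insert a A. f x \<nu>) = f a \<nu> \<oplus> (\<Oplus>x\<in>A. f x \<nu>)"
    using insert RS_D(1) by (intro finsum_insert) auto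
  ultimately show ?case using insert by (simp add: TA_simps PS_add)
qed

text \<open>The Cauchy product in the variable \<open>X n\<close>. As n does not occur in \<nu>, a
  submultiset of \<nu> together with j copies of n splits uniquely into a submultiset of \<nu> and i
  \<le> j copies of n.\<close>

lemma slice_mult:
  assumes G: "G \<in> RS m" and H: "H \<in> RS m'"
  shows "slice n j (G \<star> H) = (\<Oplus>\<^bsub>TA n\<^esub>i\<in>{..j}. slice n i G \<star> slice n (j - i) H)"
proof
  fix \<nu> :: "nat multiset"
  note gc = RS_D(1)[OF G] RS_D(1)[OF H]
  let ?S = "\<lambda>\<nu>. {\<mu>. \<mu> \<subseteq># \<nu>}" and ?r = "\<lambda>i. replicate_mset i n"
  have prodRS: "slice n i G \<star> slice n (j - i) H \<in> RS n" for i using RS_mult slice_RS G H by blast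
  have R: "(\<Oplus>\<^bsub>TA n\<^esub>i\<in>{..j}. slice n i G \<star> slice n (j - i) H) \<nu> =
      (\<Oplus>i\<in>{..j}. (slice n i G \<star> slice n (j - i) H) \<nu>)"
    by (rule TA_finsum) (use prodRS in auto)
  show "slice n j (G \<star> H) \<nu> = (\<Oplus>\<^bsub>TA n\<^esub>i\<in>{..j}. slice n i G \<star> slice n (j - i) H) \<nu>"
  proof (cases "set_mset \<nu> \<subseteq> {..<n}")
    case False
    then have "(slice n i G \<star> slice n (j - i) H) \<nu> = \<zero>" for i using RS_D(2)[OF prodRS] by blast
    then show ?thesis unfolding R using False by (simp add: slice_def)
  next
    case True
    have nn: "count \<nu> n = 0" using True by (auto simp: count_eq_zero_iff)
    have im: "?S (\<nu> + ?r j) = (\<lambda>p. snd p + ?r (fst p)) ` (Sigma {..j} (\<lambda>_. ?S \<nu>))"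
    proof
      show "(\<lambda>p. snd p + ?r (fst p)) ` (Sigma {..j} (\<lambda>_. ?S \<nu>)) \<subseteq> ?S (\<nu> + ?r j)"
        by (auto simp: subseteq_mset_def intro!: add_mono)
      show "?S (\<nu> + ?r j) \<subseteq> (\<lambda>p. snd p + ?r (fst p)) ` (Sigma {..j} (\<lambda>_. ?S \<nu>))"
      proof
        fix \<mu> assume "\<mu> \<in> ?S (\<nu> + ?r j)"
        then have m: "count \<mu> x \<le> count \<nu> x + (if x = n then j else 0)" for x
          using mset_subset_eq_count[of \<mu> "\<nu> + ?r j" x] by (auto split: if_splits)
        define i where "i = count \<mu> n"
        define \<mu>' where "\<mu>' = \<mu> - ?r i"
        have "i \<le> j" unfolding i_def using m[of n] nn by simp
        moreover have "\<mu>' \<subseteq># \<nu>"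
          unfolding subseteq_mset_def
        proof
          fix x show "count \<mu>' x \<le> count \<nu> x" using m[of x] unfolding \<mu>'_def i_def by auto
        qed
        moreover have "\<mu> = \<mu>' + ?r i" unfolding \<mu>'_def i_def by (rule multiset_eqI) simp
        ultimately show "\<mu> \<in> (\<lambda>p. snd p + ?r (fst p)) ` (Sigma {..j} (\<lambda>_. ?S \<nu>))"
          by (intro image_eqI[of _ _ "(i, \<mu>')"]) simp_all
      qed
    qed
    have c0: "count \<mu> n = 0" if "\<mu> \<subseteq># \<nu>" for \<mu> using mset_subset_eq_count[OF that, of n] nn by simp
    have inj: "inj_on (\<lambda>p. snd p + ?r (fst p)) (Sigma {..j} (\<lambda>_. ?S \<nu>))"
    proof (rule inj_onI)
      fix p q assume p: "p \<in> Sigma {..j} (\<lambda>_. ?S \<nu>)" and q: "q \<in> Sigma {..j} (\<lambda>_. ?S \<nu>)"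
        and e: "snd p + ?r (fst p) = snd q + ?r (fst q)"
      have "count (snd p + ?r (fst p)) n = count (snd q + ?r (fst q)) n" using e by simp
      then have "fst p = fst q" using c0[of "snd p"] c0[of "snd q"] p q by auto
      then show "p = q" using e by (simp add: prod_eq_iff)
    qed
    have "slice n j (G \<star> H) \<nu> = (\<Oplus>\<mu>\<in>?S (\<nu> + ?r j). G \<mu> \<otimes> H (\<nu> + ?r j - \<mu>))"
      using True by (simp add: slice_def PS_mult)
    also have "\<dots> = (\<Oplus>p\<in>Sigma {..j} (\<lambda>_. ?S \<nu>). G (snd p + ?r (fst p)) \<otimes> H (\<nu> + ?r j - (snd p + ?r (fst p))))"
      unfolding im using gc inj by (intro finsum_reindex) auto
    also have "\<dots> = (\<Oplus>p\<in>Sigma {..j} (\<lambda>_. ?S \<nu>). slice n (fst p) G (snd p) \<otimes> slice n (j - fst p) H (\<nu> - snd p))"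
    proof (rule finsum_cong'[OF refl])
      fix p assume p: "p \<in> Sigma {..j} (\<lambda>_. ?S \<nu>)"
      then have pj: "fst p \<le> j" "snd p \<subseteq># \<nu>" by auto
      have s1: "set_mset (snd p) \<subseteq> {..<n}" using set_mset_mono[OF pj(2)] True by blast
      have s2: "set_mset (\<nu> - snd p) \<subseteq> {..<n}" using True by (meson in_diffD subset_iff)
      have "\<nu> + ?r j - (snd p + ?r (fst p)) = (\<nu> - snd p) + ?r (j - fst p)"
      proof (rule multiset_eqI)
        fix x show "count (\<nu> + ?r j - (snd p + ?r (fst p))) x = count (\<nu> - snd p + ?r (j - fst p)) x"
          using mset_subset_eq_count[OF pj(2), of x] pj(1) by (simp add: add.commute)
      qed
      then show "G (snd p + ?r (fst p)) \<otimes> H (\<nu> + ?r j - (snd p + ?r (fst p))) =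
          slice n (fst p) G (snd p) \<otimes> slice n (j - fst p) H (\<nu> - snd p)"
        using s1 s2 by (simp add: slice_def)
    qed (use RS_D(1)[OF slice_RS[OF G]] RS_D(1)[OF slice_RS[OF H]] in auto)
    also have "\<dots> = (\<Oplus>i\<in>{..j}. \<Oplus>\<mu>\<in>?S \<nu>. slice n i G \<mu> \<otimes> slice n (j - i) H (\<nu> - \<mu>))"
      using finite_submultisets RS_D(1)[OF slice_RS[OF G]] RS_D(1)[OF slice_RS[OF H]]
      by (intro finsum_Sigma[symmetric]) auto
    also have "\<dots> = (\<Oplus>i\<in>{..j}. (slice n i G \<star> slice n (j - i) H) \<nu>)" unfolding PS_mult ..
    finally show ?thesis unfolding R .
  qed
qed

lemma slice_low:
  assumes g: "g \<in> RS n" shows "slice n j g = (if j = 0 then g else \<zero>\<^bsub>PS\<^esub>)"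
proof (cases j)
  case 0
  then show ?thesis using RS_D(2)[OF g] by (auto simp: slice_def)
next
  case (Suc i)
  have "g (\<nu> + replicate_mset j n) = \<zero>" for \<nu> using Suc by (intro RS_D(2)[OF g]) auto
  then show ?thesis using Suc by (auto simp: slice_def PS_zero intro!: ext)
qed

lemma slice_low_mult:
  assumes g: "g \<in> RS n" and H: "H \<in> RS m"
  shows "slice n j (g \<star> H) = g \<star> slice n j H"
proof -
  interpret T: cring "TA n" by (rule TA_cring)
  have z: "\<zero>\<^bsub>PS\<^esub> \<star> x = \<zero>\<^bsub>PS\<^esub>" if "x \<in> RS n" for x using T.l_null[of x] that by (simp add: TA_simps)
  have "(\<Oplus>\<^bsub>TA n\<^esub>i\<in>{..j}. slice n i g \<star> slice n (j - i) H) = slice n 0 g \<star> slice n (j - 0) H"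
    using RS_mult[OF g slice_RS[OF H]] z slice_RS[OF H]
    by (intro T.finsum_single) (auto simp: slice_low[OF g] TA_simps)
  then show ?thesis unfolding slice_mult[OF g H] by (simp add: slice_low[OF g])
qed

lemma slice_X_mult:
  assumes H: "H \<in> RS m"
  shows "slice n 0 (X n \<star> H) = \<zero>\<^bsub>PS\<^esub>" "slice n (Suc j) (X n \<star> H) = slice n j H"
proof -
  have e: "(X n \<star> H) \<nu> = (if n \<in># \<nu> then H (\<nu> - {#n#}) else \<zero>)" for \<nu>
    unfolding X_def using monom_mult[of H "{#n#}" \<nu>] subsetD[OF RS_PS H] by simp
  show "slice n 0 (X n \<star> H) = \<zero>\<^bsub>PS\<^esub>"
    by (rule ext) (auto simp: slice_def e PS_zero)
  show "slice n (Suc j) (X n \<star> H) = slice n j H"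
    by (rule ext) (simp add: slice_def e)
qed

end

section \<open>Points of affinoid spaces\<close>

lemma (in cring) idealI_comm:
  assumes I: "I \<subseteq> carrier R" "\<zero> \<in> I" "\<And>a b. a \<in> I \<Longrightarrow> b \<in> I \<Longrightarrow> a \<oplus> b \<in> I"
    and mult: "\<And>r a. r \<in> carrier R \<Longrightarrow> a \<in> I \<Longrightarrow> r \<otimes> a \<in> I"
  shows "ideal I R"
proof (rule idealI[OF ring_axioms])
  show "subgroup I (add_monoid R)"
  proof (rule add.subgroupI)
    fix a assume a: "a \<in> I"
    then have "a \<in> carrier R" using I(1) by blast
    then have "\<ominus> a = (\<ominus> \<one>) \<otimes> a" by (simp add: l_minus)
    then show "\<ominus> a \<in> I" using mult[OF _ a] by simp
  qed (use I in auto)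
  fix a x assume a: "a \<in> I" and x: "x \<in> carrier R"
  show "x \<otimes> a \<in> I" by (rule mult[OF x a])
  have "a \<in> carrier R" using a I(1) by blast
  then have "a \<otimes> x = x \<otimes> a" using x by (simp add: m_comm)
  then show "a \<otimes> x \<in> I" using mult[OF x a] by simp
qed

lemma (in cring) maximal_ideal_exists:
  assumes I: "ideal I R" "\<one> \<notin> I"
  shows "\<exists>N. maximalideal N R \<and> I \<subseteq> N"
proof -
  let ?A = "{J. ideal J R \<and> I \<subseteq> J \<and> \<one> \<notin> J}"
  have "\<exists>M\<in>?A. \<forall>J\<in>?A. M \<subseteq> J \<longrightarrow> J = M"
  proof (rule subset_Zorn_nonempty)
    show "?A \<noteq> {}" using I by blast
    fix \<C> assume ne: "\<C> \<noteq> {}" and ch: "subset.chain ?A \<C>"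
    have C: "ideal J R" "I \<subseteq> J" "\<one> \<notin> J" if "J \<in> \<C>" for J
      using ch that unfolding subset.chain_def by blast+
    obtain J0 where J0: "J0 \<in> \<C>" using ne by blast
    have "ideal (\<Union>\<C>) R"
    proof (rule idealI_comm)
      show "\<Union>\<C> \<subseteq> carrier R" using ideal.Icarr[OF C(1)] by blast
      show "\<zero> \<in> \<Union>\<C>" using J0 additive_subgroup.zero_closed[OF ideal.axioms(1)[OF C(1)[OF J0]]] by blast
      show "a \<oplus> b \<in> \<Union>\<C>" if ab: "a \<in> \<Union>\<C>" "b \<in> \<Union>\<C>" for a b
      proof -
        obtain J J' where J: "J \<in> \<C>" "a \<in> J" "J' \<in> \<C>" "b \<in> J'" using ab by blast
        have "J \<subseteq> J' \<or> J' \<subseteq> J" using ch J unfolding subset.chain_def by blast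
        then obtain M where M: "M \<in> \<C>" "a \<in> M" "b \<in> M"
          using J that[of J'] that[of J] subsetD[of J J' a] subsetD[of J' J b] by metis
        show ?thesis using additive_subgroup.a_closed[OF ideal.axioms(1)[OF C(1)[OF M(1)]] M(2,3)] M(1) by blast
      qed
      show "r \<otimes> a \<in> \<Union>\<C>" if "r \<in> carrier R" "a \<in> \<Union>\<C>" for r a
        using that ideal.I_l_closed[OF C(1)] by blast
    qed
    moreover have "I \<subseteq> \<Union>\<C>" using C(2)[OF J0] J0 by blast
    ultimately show "\<Union>\<C> \<in> ?A" using C(3) by simp
  qed
  then obtain M where M: "ideal M R" "I \<subseteq> M" "\<one> \<notin> M"
    and max: "\<And>J. ideal J R \<Longrightarrow> I \<subseteq> J \<Longrightarrow> \<one> \<notin> J \<Longrightarrow> M \<subseteq> J \<Longrightarrow> J = M" by auto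
  have "maximalideal M R"
  proof (rule maximalidealI[OF M(1)])
    show "carrier R \<noteq> M" using M(3) by blast
    fix J assume J: "ideal J R" "M \<subseteq> J" "J \<subseteq> carrier R"
    show "J = M \<or> J = carrier R"
      using max[OF J(1) _ _ J(2)] M(2) J(2) ideal.one_imp_carrier[OF J(1)] by blast
  qed
  then show ?thesis using M(2) by blast
qed

lemma (in cring) maximal_criterion:
  assumes N: "ideal N R" "\<one> \<notin> N"
    and inverse: "\<And>f. f \<in> carrier R \<Longrightarrow> f \<notin> N \<Longrightarrow> \<exists>g\<in>carrier R. \<exists>e\<in>N. f \<otimes> g = \<one> \<oplus> e"
  shows "maximalideal N R"
proof (rule maximalidealI[OF N(1)])
  show "carrier R \<noteq> N" using N(2) by blast
  fix J assume J: "ideal J R" "N \<subseteq> J" "J \<subseteq> carrier R"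
  interpret J: ideal J R by (rule J(1))
  show "J = N \<or> J = carrier R"
  proof (cases "J = N")
    case False
    then obtain f where f: "f \<in> J" "f \<notin> N" using J(2) by blast
    then obtain g e where g: "g \<in> carrier R" "e \<in> N" "f \<otimes> g = \<one> \<oplus> e" using inverse J(3) by blast
    have e: "e \<in> J" "e \<in> carrier R" using g(2) J by blast+
    have "\<one> = f \<otimes> g \<oplus> \<ominus> e" unfolding g(3) using e(2) by (simp add: a_assoc r_neg)
    moreover have "f \<otimes> g \<in> J" by (rule J.I_r_closed[OF f(1) g(1)])
    moreover have "\<ominus> e \<in> J" by (rule J.a_inv_closed[OF e(1)])
    ultimately have "\<one> \<in> J" by (metis J.a_closed)
    then show ?thesis using J.one_imp_carrier by blast
  qed simp
qed

lemma (in abelian_group) eq_add_diff: "a \<in> carrier G \<Longrightarrow> b \<in> carrier G \<Longrightarrow> a = b \<oplus> (a \<ominus> b)"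
  by (simp add: minus_eq a_lcomm r_neg)

lemma FactRing_zero: "\<zero>\<^bsub>R Quot N\<^esub> = N"
  by (simp add: FactRing_def)

lemma FactRing_carrier: "carrier (R Quot N) = (\<lambda>f. N +>\<^bsub>R\<^esub> f) ` carrier R"
  unfolding FactRing_def A_RCOSETS_def' by auto

text \<open>By the triangle inequality \<mu> is constant on the cosets of its kernel, so any chosen
  representative computes the value.\<close>

lemma (in cring) quotient_absolute_value:
  fixes \<mu> :: "'a \<Rightarrow> real"
  assumes N: "ideal N R" and ker: "\<And>f. f \<in> carrier R \<Longrightarrow> f \<in> N \<longleftrightarrow> \<mu> f = 0"
    and nonneg: "\<And>f. f \<in> carrier R \<Longrightarrow> 0 \<le> \<mu> f"
    and mult: "\<And>f g. f \<in> carrier R \<Longrightarrow> g \<in> carrier R \<Longrightarrow> \<mu> (f \<otimes> g) = \<mu> f * \<mu> g"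
    and add: "\<And>f g. f \<in> carrier R \<Longrightarrow> g \<in> carrier R \<Longrightarrow> \<mu> (f \<oplus> g) \<le> \<mu> f + \<mu> g"
  shows "\<exists>w. absolute_value (R Quot N) w \<and> (\<forall>f\<in>carrier R. w (N +> f) = \<mu> f)"
proof (intro exI conjI ballI)
  interpret N: ideal N R by (rule N)
  interpret H: ring_hom_cring R "R Quot N" "(+>) N" by (rule N.rcos_ring_hom_cring[OF cring_axioms])
  let ?w = "\<lambda>l. \<mu> (SOME f. f \<in> l)"
  show w: "?w (N +> f) = \<mu> f" if f: "f \<in> carrier R" for f
  proof -
    have "f \<in> N +> f" using f by (rule N.a_rcos_self)
    then have "(SOME g. g \<in> N +> f) \<in> N +> f" by (rule someI)
    then obtain e where e: "e \<in> N" "(SOME g. g \<in> N +> f) = e \<oplus> f" unfolding a_r_coset_def' by blast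
    have ec: "e \<in> carrier R" by (rule N.Icarr[OF e(1)])
    have "\<ominus> e \<in> N" by (rule N.a_inv_closed[OF e(1)])
    then have z: "\<mu> e = 0" "\<mu> (\<ominus> e) = 0" using e(1) ec ker by auto
    have "\<ominus> e \<oplus> (e \<oplus> f) = f" using ec f by (simp add: r_neg1)
    then have "\<mu> f \<le> \<mu> (e \<oplus> f)" using add[of "\<ominus> e" "e \<oplus> f"] ec f z by simp
    moreover have "\<mu> (e \<oplus> f) \<le> \<mu> f" using add[OF ec f] z by simp
    ultimately show ?thesis unfolding e(2) by simp
  qed
  have C: "\<exists>f\<in>carrier R. l = N +> f" if "l \<in> carrier (R Quot N)" for l
    using that unfolding FactRing_carrier by blast
  show "absolute_value (R Quot N) ?w"
    unfolding absolute_value_def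
  proof (intro conjI ballI)
    fix l assume "l \<in> carrier (R Quot N)"
    then obtain f where f: "f \<in> carrier R" "l = N +> f" using C by blast
    show "0 \<le> ?w l" unfolding f(2) w[OF f(1)] by (rule nonneg[OF f(1)])
    have "N +> f = N \<longleftrightarrow> f \<in> N" using a_rcos_zero[OF N] N.rcos_const_imp_mem[OF f(1)] by blast
    then show "?w l = 0 \<longleftrightarrow> l = \<zero>\<^bsub>R Quot N\<^esub>"
      unfolding FactRing_zero f(2) w[OF f(1)] using ker[OF f(1)] by metis
    fix l' assume "l' \<in> carrier (R Quot N)"
    then obtain g where g: "g \<in> carrier R" "l' = N +> g" using C by blast
    have m: "l \<otimes>\<^bsub>R Quot N\<^esub> l' = N +> (f \<otimes> g)" unfolding f(2) g(2) by (rule H.hom_mult[OF f(1) g(1), symmetric])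
    have a: "l \<oplus>\<^bsub>R Quot N\<^esub> l' = N +> (f \<oplus> g)" unfolding f(2) g(2) by (rule H.hom_add[OF f(1) g(1), symmetric])
    show "?w (l \<otimes>\<^bsub>R Quot N\<^esub> l') = ?w l * ?w l'"
      unfolding m w[OF m_closed[OF f(1) g(1)]] unfolding f(2) g(2) w[OF f(1)] w[OF g(1)] by (rule mult[OF f(1) g(1)])
    show "?w (l \<oplus>\<^bsub>R Quot N\<^esub> l') \<le> ?w l + ?w l'"
      unfolding a w[OF a_closed[OF f(1) g(1)]] unfolding f(2) g(2) w[OF f(1)] w[OF g(1)] by (rule add[OF f(1) g(1)])
  qed
qed

section \<open>Points as multiplicative seminorms\<close>

context nonarch_field
begin

text \<open>The last clause says that the kernel is maximal, phrased as invertibility modulo the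
  kernel so that no quotient ring is involved. The ideal of an affinoid algebra does not enter: its
  points are the points that vanish on it.\<close>

definition point :: "nat \<Rightarrow> ('k series \<Rightarrow> real) \<Rightarrow> bool" where
  "point n \<mu> \<longleftrightarrow> (\<forall>f\<in>RS n. 0 \<le> \<mu> f) \<and> (\<forall>f\<in>RS n. \<forall>g\<in>RS n. \<mu> (f \<star> g) = \<mu> f * \<mu> g) \<and>
    (\<forall>f\<in>RS n. \<forall>g\<in>RS n. \<mu> (f \<boxplus> g) \<le> \<mu> f + \<mu> g) \<and>
    (\<forall>c\<in>carrier K. \<mu> (cst c) = v c) \<and>
    (\<forall>f\<in>RS n. \<mu> f \<noteq> 0 \<longrightarrow> (\<exists>g\<in>RS n. \<exists>e\<in>RS n. \<mu> e = 0 \<and> f \<star> g = \<one>\<^bsub>PS\<^esub> \<boxplus> e))"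

abbreviation kernel :: "nat \<Rightarrow> ('k series \<Rightarrow> real) \<Rightarrow> 'k series set" where
  "kernel n \<mu> \<equiv> {f \<in> RS n. \<mu> f = 0}"

lemma pointD:
  assumes "point n \<mu>"
  shows "f \<in> RS n \<Longrightarrow> 0 \<le> \<mu> f" "f \<in> RS n \<Longrightarrow> g \<in> RS n \<Longrightarrow> \<mu> (f \<star> g) = \<mu> f * \<mu> g"
    "f \<in> RS n \<Longrightarrow> g \<in> RS n \<Longrightarrow> \<mu> (f \<boxplus> g) \<le> \<mu> f + \<mu> g"
    "c \<in> carrier K \<Longrightarrow> \<mu> (cst c) = v c"
    "f \<in> RS n \<Longrightarrow> \<mu> f \<noteq> 0 \<Longrightarrow> \<exists>g\<in>RS n. \<exists>e\<in>RS n. \<mu> e = 0 \<and> f \<star> g = \<one>\<^bsub>PS\<^esub> \<boxplus> e"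
  using assms unfolding point_def by blast+

lemma PS_zero_const: "\<zero>\<^bsub>PS\<^esub> = cst \<zero>" by (rule ext) (simp add: PS_zero const_series_def)

lemma point_zero_one:
  assumes "point n \<mu>" shows "\<mu> \<zero>\<^bsub>PS\<^esub> = 0" "\<mu> \<one>\<^bsub>PS\<^esub> = 1"
  using pointD(4)[OF assms, of \<zero>] pointD(4)[OF assms, of \<one>] unfolding PS_zero_const PS_one by (simp_all add: v_zero v_one)

lemma RS_zero_one: "\<zero>\<^bsub>PS\<^esub> \<in> RS n" "\<one>\<^bsub>PS\<^esub> \<in> RS n"
  using RS_const[of \<zero>] RS_const[of \<one>] unfolding PS_zero_const PS_one by simp_all

lemma point_add_zero:
  assumes p: "point n \<mu>" and f: "f \<in> RS n" and e: "e \<in> RS n" "\<mu> e = 0"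
  shows "\<mu> (f \<boxplus> e) = \<mu> f"
proof -
  interpret PS: cring PS by (rule PS_cring)
  let ?c = "cst (\<ominus> \<one>)"
  have c: "?c \<in> RS n" "\<mu> (?c \<star> e) = 0" using RS_const[of "\<ominus> \<one>" n] pointD(2)[OF p _ e(1)] e(2) by auto
  have "(?c \<star> e) \<nu> = \<ominus> e \<nu>" for \<nu>
    using const_mult[of e "\<ominus> \<one>" \<nu>] e(1) RS_PS RS_D(1)[OF e(1), of \<nu>] by (simp add: l_minus subset_iff)
  then have "(f \<boxplus> e) \<boxplus> (?c \<star> e) = f"
    using RS_D(1)[OF f] RS_D(1)[OF e(1)] by (intro ext) (simp add: PS_add a_assoc r_neg)
  moreover have "f \<boxplus> e \<in> RS n" "?c \<star> e \<in> RS n" using f e c RS_add RS_mult by auto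
  ultimately have "\<mu> f \<le> \<mu> (f \<boxplus> e)" using pointD(3)[OF p, of "f \<boxplus> e" "?c \<star> e"] c(2) by simp
  moreover have "\<mu> (f \<boxplus> e) \<le> \<mu> f" using pointD(3)[OF p f e(1)] e(2) by simp
  ultimately show ?thesis by simp
qed

lemma v_minus_one: "v (\<ominus> \<one>) = 1" using v_minus[of \<one>] v_one by simp

lemma point_sum_zero:
  assumes p: "point n \<mu>" and f: "f \<in> RS n" and g: "g \<in> RS n" and z: "\<mu> (f \<boxplus> g) = 0"
  shows "\<mu> f = \<mu> g"
proof -
  interpret PS: cring PS by (rule PS_cring)
  let ?c = "cst (\<ominus> \<one>)"
  have c: "?c \<in> RS n" "\<mu> (?c \<star> g) = \<mu> g"
    using RS_const[of "\<ominus> \<one>" n] pointD(2)[OF p _ g, of ?c] pointD(4)[OF p, of "\<ominus> \<one>"] v_minus_one by auto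
  have "(?c \<star> g) \<nu> = \<ominus> g \<nu>" for \<nu>
    using const_mult[of g "\<ominus> \<one>" \<nu>] g RS_PS RS_D(1)[OF g, of \<nu>] by (simp add: l_minus subset_iff)
  then have "(?c \<star> g) \<boxplus> (f \<boxplus> g) = f"
    using RS_D(1)[OF f] RS_D(1)[OF g] by (intro ext) (simp add: PS_add a_comm[of "f _" "g _"] r_neg1)
  moreover have "\<mu> ((?c \<star> g) \<boxplus> (f \<boxplus> g)) = \<mu> (?c \<star> g)"
    by (rule point_add_zero[OF p RS_mult[OF c(1) g] RS_add[OF f g] z])
  ultimately show ?thesis using c(2) by simp
qed

lemma kernel_ideal:
  assumes p: "point n \<mu>" shows "ideal (kernel n \<mu>) (TA n)"
proof (rule cring.idealI_comm[OF TA_cring], goal_cases)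
  case (3 a b)
  then show ?case using point_add_zero[OF p, of a b] RS_add[of a n b] by (simp add: TA_simps)
qed (auto simp: TA_simps point_zero_one[OF p] RS_zero_one RS_mult pointD(2)[OF p])

lemma kernel_maximal:
  assumes p: "point n \<mu>" shows "maximalideal (kernel n \<mu>) (TA n)"
  by (rule cring.maximal_criterion[OF TA_cring kernel_ideal[OF p]])
    (use pointD(5)[OF p] point_zero_one[OF p] in \<open>fastforce simp: TA_simps\<close>)+

lemma quotient_banach_point:
  assumes N: "maximalideal N (TA n)"
  shows "banach_point (TA n) K cst v gauss (TA n Quot N) (\<lambda>f. N +>\<^bsub>TA n\<^esub> f)"
proof (intro banach_point.intro tate_banach banach_point_axioms.intro)
  interpret N: maximalideal N "TA n" by (rule N)
  show "field (TA n Quot N)" by (rule N.quotient_is_field[OF TA_cring])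
  show "ring_hom_cring (TA n) (TA n Quot N) ((+>\<^bsub>TA n\<^esub>) N)" by (rule N.rcos_ring_hom_cring[OF TA_cring])
  show "(+>\<^bsub>TA n\<^esub>) N ` carrier (TA n) = carrier (TA n Quot N)" by (rule FactRing_carrier[symmetric])
qed

lemma residue_value_exists:
  assumes "banach_point (TA n) K cst v gauss L \<phi>"
  shows "\<exists>w. absolute_value L w \<and> (\<forall>c\<in>carrier K. w (\<phi> (cst c)) = v c) \<and> (\<forall>f\<in>RS n. w (\<phi> f) \<le> gauss f)"
proof -
  interpret P: banach_point "TA n" K cst v gauss L \<phi> by (rule assms)
  obtain bs where "set bs \<subseteq> carrier L" "lspan L P.k bs = carrier L"
    using P.residue_field_finite[OF tate_variables tate_dense] by blast
  then show ?thesis using P.extension_exists unfolding TA_simps by blast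
qed

lemma residue_value_unique:
  assumes "banach_point (TA n) K cst v gauss L \<phi>"
    and w: "absolute_value L w" "\<And>c. c \<in> carrier K \<Longrightarrow> w (\<phi> (cst c)) = v c"
    and w': "absolute_value L w'" "\<And>c. c \<in> carrier K \<Longrightarrow> w' (\<phi> (cst c)) = v c"
    and x: "x \<in> carrier L"
  shows "w x = w' x"
proof -
  interpret P: banach_point "TA n" K cst v gauss L \<phi> by (rule assms(1))
  obtain bs where "set bs \<subseteq> carrier L" "lspan L P.k bs = carrier L"
    using P.residue_field_finite[OF tate_variables tate_dense] by blast
  then show ?thesis using P.extension_unique[of bs w w' x] w w' x by blast
qed

lemma point_residue_value:
  assumes "banach_point (TA n) K cst v gauss L \<phi>"
    and w: "absolute_value L w" "\<And>c. c \<in> carrier K \<Longrightarrow> w (\<phi> (cst c)) = v c"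
  shows "point n (\<lambda>f. w (\<phi> f))"
proof -
  interpret P: banach_point "TA n" K cst v gauss L \<phi> by (rule assms(1))
  have c: "\<phi> f \<in> carrier L" "f \<in> carrier (TA n)" if "f \<in> RS n" for f using that P.phi.hom_closed unfolding TA_simps by auto
  have m: "\<phi> (f \<star> g) = \<phi> f \<otimes>\<^bsub>L\<^esub> \<phi> g" if "f \<in> RS n" "g \<in> RS n" for f g
    using P.phi.hom_mult[OF c(2)[OF that(1)] c(2)[OF that(2)]] unfolding TA_simps .
  have a: "\<phi> (f \<boxplus> g) = \<phi> f \<oplus>\<^bsub>L\<^esub> \<phi> g" if "f \<in> RS n" "g \<in> RS n" for f g
    using P.phi.hom_add[OF c(2)[OF that(1)] c(2)[OF that(2)]] unfolding TA_simps .
  have inverse: "\<exists>g\<in>RS n. \<exists>e\<in>RS n. w (\<phi> e) = 0 \<and> f \<star> g = \<one>\<^bsub>PS\<^esub> \<boxplus> e"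
    if f: "f \<in> RS n" "w (\<phi> f) \<noteq> 0" for f
  proof -
    have "\<phi> f \<noteq> \<zero>\<^bsub>L\<^esub>" using f(2) w(1) unfolding absolute_value_def by auto
    then have u: "\<phi> f \<in> Units L" using c[OF f(1)] by (simp add: P.L.field_Units)
    then have "inv\<^bsub>L\<^esub> \<phi> f \<in> carrier L" by simp
    then obtain g where g: "g \<in> carrier (TA n)" "inv\<^bsub>L\<^esub> \<phi> f = \<phi> g" using P.surj by (metis imageE)
    let ?e = "f \<otimes>\<^bsub>TA n\<^esub> g \<ominus>\<^bsub>TA n\<^esub> \<one>\<^bsub>TA n\<^esub>"
    have ec: "?e \<in> carrier (TA n)" using c(2)[OF f(1)] g(1) by simp
    have "\<phi> (f \<otimes>\<^bsub>TA n\<^esub> g) = \<one>\<^bsub>L\<^esub>" using P.phi.hom_mult[OF c(2)[OF f(1)] g(1)] u g(2)[symmetric] by simp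
    then have "\<phi> ?e = \<zero>\<^bsub>L\<^esub>"
      using c(2)[OF f(1)] g(1) by (simp only: P.B.minus_eq P.phi.hom_add P.phi.hom_a_inv P.B.m_closed P.B.one_closed P.B.a_inv_closed
        P.phi.hom_one P.L.r_neg P.L.one_closed)
    then have "w (\<phi> ?e) = 0" using w(1) unfolding absolute_value_def by auto
    moreover have "f \<otimes>\<^bsub>TA n\<^esub> g = \<one>\<^bsub>TA n\<^esub> \<oplus>\<^bsub>TA n\<^esub> ?e"
      by (rule P.B.eq_add_diff[OF P.B.m_closed[OF c(2)[OF f(1)] g(1)] P.B.one_closed])
    ultimately show ?thesis using g(1) ec unfolding TA_simps by blast
  qed
  show ?thesis unfolding point_def using c w(2) w(1)[unfolded absolute_value_def] inverse
    by (simp add: m a)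
qed

text \<open>The residue field carries an absolute value extending v that is bounded by the Gauss
  norm; its pullback to the Tate algebra is the point.\<close>

lemma point_of_maximal:
  assumes N: "maximalideal N (TA n)"
  shows "\<exists>\<mu>. point n \<mu> \<and> kernel n \<mu> = N \<and> (\<forall>f\<in>RS n. \<mu> f \<le> gauss f)"
proof -
  interpret N: maximalideal N "TA n" by (rule N)
  note bp = quotient_banach_point[OF N]
  obtain w where w: "absolute_value (TA n Quot N) w" "\<And>c. c \<in> carrier K \<Longrightarrow> w (N +>\<^bsub>TA n\<^esub> cst c) = v c"
    "\<And>f. f \<in> RS n \<Longrightarrow> w (N +>\<^bsub>TA n\<^esub> f) \<le> gauss f"
    using residue_value_exists[OF bp] by blast
  have "w (N +>\<^bsub>TA n\<^esub> f) = 0 \<longleftrightarrow> f \<in> N" if f: "f \<in> RS n" for f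
  proof -
    have "N +>\<^bsub>TA n\<^esub> f \<in> carrier (TA n Quot N)" using f unfolding FactRing_carrier TA_simps by blast
    then have "w (N +>\<^bsub>TA n\<^esub> f) = 0 \<longleftrightarrow> N +>\<^bsub>TA n\<^esub> f = N"
      using w(1) unfolding absolute_value_def FactRing_zero by blast
    also have "\<dots> \<longleftrightarrow> f \<in> N"
      using N.a_rcos_zero[OF N.is_ideal, of f] N.rcos_const_imp_mem[of f] f unfolding TA_simps by blast
    finally show ?thesis .
  qed
  then have "kernel n (\<lambda>f. w (N +>\<^bsub>TA n\<^esub> f)) = N" using N.Icarr unfolding TA_simps by auto
  then show ?thesis using point_residue_value[OF bp w(1,2)] w(3) by blast
qed

text \<open>The kernel of \<mu> is maximal, so inclusion already forces equality: an element outside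
  it is invertible modulo it and cannot be a zero of \<mu>'. Both seminorms then define absolute
  values on the same residue field, and the extension of v is unique.\<close>

lemma point_unique:
  assumes p: "point n \<mu>" and q: "point n \<mu>'" and le: "kernel n \<mu> \<subseteq> kernel n \<mu>'" and f: "f \<in> RS n"
  shows "\<mu> f = \<mu>' f"
proof -
  interpret T: cring "TA n" by (rule TA_cring)
  have sub: "kernel n \<mu>' \<subseteq> kernel n \<mu>"
  proof
    fix h assume h: "h \<in> kernel n \<mu>'"
    show "h \<in> kernel n \<mu>"
    proof (rule ccontr)
      assume "h \<notin> kernel n \<mu>"
      then obtain g e where g: "g \<in> RS n" "e \<in> RS n" "\<mu> e = 0" "h \<star> g = \<one>\<^bsub>PS\<^esub> \<boxplus> e"
        using pointD(5)[OF p, of h] h by auto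
      have "\<mu>' e = 0" using g(2,3) le by blast
      then have "\<mu>' (h \<star> g) = 1"
        unfolding g(4) using point_add_zero[OF q RS_zero_one(2) g(2)] point_zero_one[OF q] by simp
      then show False using pointD(2)[OF q, of h g] h g(1) by simp
    qed
  qed
  let ?N = "kernel n \<mu>"
  note N = kernel_maximal[OF p]
  have w: "\<exists>w. absolute_value (TA n Quot ?N) w \<and> (\<forall>f\<in>carrier (TA n). w (?N +>\<^bsub>TA n\<^esub> f) = \<mu>'' f)"
    if r: "point n \<mu>''" "kernel n \<mu>'' = ?N" for \<mu>''
    by (rule T.quotient_absolute_value[OF kernel_ideal[OF p]])
      (use r(2) pointD(1-3)[OF r(1)] in \<open>auto simp: TA_simps\<close>)
  obtain w where w1: "absolute_value (TA n Quot ?N) w" "\<And>f. f \<in> RS n \<Longrightarrow> w (?N +>\<^bsub>TA n\<^esub> f) = \<mu> f"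
    using w[OF p refl] unfolding TA_simps by blast
  obtain w' where w2: "absolute_value (TA n Quot ?N) w'" "\<And>f. f \<in> RS n \<Longrightarrow> w' (?N +>\<^bsub>TA n\<^esub> f) = \<mu>' f"
    using w[OF q subset_antisym[OF sub le]] unfolding TA_simps by blast
  have fc: "?N +>\<^bsub>TA n\<^esub> f \<in> carrier (TA n Quot ?N)" using f unfolding FactRing_carrier TA_simps by blast
  have "w (?N +>\<^bsub>TA n\<^esub> f) = w' (?N +>\<^bsub>TA n\<^esub> f)"
  proof (rule residue_value_unique[OF quotient_banach_point[OF N] w1(1) _ w2(1) _ fc])
    fix c assume c: "c \<in> carrier K"
    show "w (?N +>\<^bsub>TA n\<^esub> cst c) = v c" unfolding w1(2)[OF RS_const[OF c]] by (rule pointD(4)[OF p c])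
    show "w' (?N +>\<^bsub>TA n\<^esub> cst c) = v c" unfolding w2(2)[OF RS_const[OF c]] by (rule pointD(4)[OF q c])
  qed
  then show ?thesis using w1(2)[OF f] w2(2)[OF f] by simp
qed

text \<open>The bound is not part of the definition of a point; it is inherited from the point
  constructed out of the same kernel.\<close>

lemma point_le_gauss:
  assumes p: "point n \<mu>" and f: "f \<in> RS n" shows "\<mu> f \<le> gauss f"
proof -
  obtain \<mu>' where "point n \<mu>'" "kernel n \<mu>' = kernel n \<mu>" "\<And>f. f \<in> RS n \<Longrightarrow> \<mu>' f \<le> gauss f"
    using point_of_maximal[OF kernel_maximal[OF p]] by blast
  then show ?thesis using point_unique[OF p _ _ f, of \<mu>'] f by simp
qed

end

lemma (in ring) ideal_finsum:
  assumes I: "ideal I R" and f: "finite A" "\<And>x. x \<in> A \<Longrightarrow> f x \<in> I"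
  shows "finsum R f A \<in> I"
  using f
proof (induction A rule: finite_induct)
  case empty
  then show ?case using additive_subgroup.zero_closed[OF ideal.axioms(1)[OF I]] by simp
next
  case (insert x A)
  have "f \<in> A \<rightarrow> carrier R" "f x \<in> carrier R" using insert.prems ideal.Icarr[OF I] by auto
  then have "finsum R f (insert x A) = f x \<oplus> finsum R f A" using insert.hyps by simp
  then show ?case using additive_subgroup.a_closed[OF ideal.axioms(1)[OF I]] insert by simp
qed

section \<open>Adjoining a variable for one inequality\<close>

context nonarch_field
begin

lemma RS_Suc: "f \<in> RS n \<Longrightarrow> f \<in> RS (Suc n)"
  using RS_mono[of n "Suc n"] by auto

lemma RS_subring_TA: "subring (RS n) (TA (Suc n))"
proof -
  interpret T: cring "TA (Suc n)" by (rule TA_cring)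
  interpret T': cring "TA n" by (rule TA_cring)
  show ?thesis
  proof (rule T.subringI)
    fix f assume f: "f \<in> RS n"
    have "(\<ominus>\<^bsub>TA (Suc n)\<^esub> f) = (\<ominus>\<^bsub>TA n\<^esub> f)" by (rule ext) (simp add: TA_minus[OF f] TA_minus[OF RS_Suc[OF f]])
    then show "\<ominus>\<^bsub>TA (Suc n)\<^esub> f \<in> RS n" using T'.a_inv_closed[of f] f unfolding TA_simps by simp
  qed (auto simp: TA_simps RS_zero_one RS_mult RS_add RS_Suc)
qed

text \<open>The residue field of a point of the larger ball is finite over \<open>K\<close>, hence integral over the
  image of the smaller Tate algebra, which is therefore a field.\<close>

lemma point_restrict:
  assumes p: "point (Suc n) \<mu>" shows "point n \<mu>"
proof -
  let ?N = "kernel (Suc n) \<mu>" let ?L = "TA (Suc n) Quot ?N" let ?\<phi> = "\<lambda>f. ?N +>\<^bsub>TA (Suc n)\<^esub> f"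
  interpret P: banach_point "TA (Suc n)" K cst v gauss ?L ?\<phi>
    by (rule quotient_banach_point[OF kernel_maximal[OF p]])
  interpret N: ideal ?N "TA (Suc n)" by (rule kernel_ideal[OF p])
  obtain bs where bs: "set bs \<subseteq> carrier ?L" "lspan ?L P.k bs = carrier ?L"
    using P.residue_field_finite[OF tate_variables tate_dense] by blast
  let ?A = "?\<phi> ` RS n"
  have A: "subring ?A ?L" 
    by (rule ring_hom_ring.img_is_subring[OF ring_hom_ringI2[OF P.B.ring_axioms P.L.ring_axioms P.phi.homh] RS_subring_TA])
  have kA: "P.k \<subseteq> ?A" unfolding P.k_def using RS_const by blast
  have span: "carrier ?L \<subseteq> lspan ?L ?A bs" using P.L.lspan_mono[OF kA, of bs] unfolding bs(2) .
  have c: "f \<in> carrier (TA (Suc n))" if "f \<in> RS n" for f using RS_Suc[OF that] unfolding TA_simps .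
  have ker: "?\<phi> f = \<zero>\<^bsub>?L\<^esub> \<longleftrightarrow> \<mu> f = 0" if f: "f \<in> RS n" for f
    using P.B.a_rcos_zero[OF N.is_ideal, of f] N.rcos_const_imp_mem[OF c[OF f]] RS_Suc[OF f] unfolding FactRing_zero by blast
  have inverse: "\<exists>g\<in>RS n. \<exists>e\<in>RS n. \<mu> e = 0 \<and> f \<star> g = \<one>\<^bsub>PS\<^esub> \<boxplus> e"
    if f: "f \<in> RS n" "\<mu> f \<noteq> 0" for f
  proof -
    have ne: "?\<phi> f \<noteq> \<zero>\<^bsub>?L\<^esub>" using ker[OF f(1)] f(2) by blast
    have fL: "?\<phi> f \<in> carrier ?L" by (rule P.phi.hom_closed[OF c[OF f(1)]])
    have u: "?\<phi> f \<in> Units ?L" using fL ne P.L.field_Units by blast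
    have iL: "inv\<^bsub>?L\<^esub> ?\<phi> f \<in> carrier ?L" by (rule P.L.Units_inv_closed[OF u])
    have "inv\<^bsub>?L\<^esub> ?\<phi> f \<in> ?A"
    proof (rule P.L.nakayama_inverse[OF A _ ne bs(1)])
      show "?\<phi> f \<in> ?A" using f(1) by blast
      show "\<one>\<^bsub>?L\<^esub> \<in> lspan ?L ?A bs" using span P.L.one_closed by blast
      fix x assume "x \<in> set bs"
      then show "inv\<^bsub>?L\<^esub> ?\<phi> f \<otimes>\<^bsub>?L\<^esub> x \<in> lspan ?L ?A bs" using span P.L.m_closed[OF iL] bs(1) by blast
    qed
    then obtain g where g: "g \<in> RS n" "inv\<^bsub>?L\<^esub> ?\<phi> f = ?\<phi> g" by blast
    interpret T: cring "TA n" by (rule TA_cring)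
    let ?e = "f \<otimes>\<^bsub>TA n\<^esub> g \<ominus>\<^bsub>TA n\<^esub> \<one>\<^bsub>TA n\<^esub>"
    have fg: "f \<in> carrier (TA n)" "g \<in> carrier (TA n)" using f(1) g(1) unfolding TA_simps .
    have e: "?e \<in> carrier (TA n)" by (intro T.minus_closed T.m_closed fg T.one_closed)
    then have eR: "?e \<in> RS n" unfolding TA_simps .
    have eq: "f \<otimes>\<^bsub>TA n\<^esub> g = \<one>\<^bsub>TA n\<^esub> \<oplus>\<^bsub>TA n\<^esub> ?e" by (rule T.eq_add_diff[OF T.m_closed[OF fg] T.one_closed])
    have eq': "f \<otimes>\<^bsub>TA (Suc n)\<^esub> g = \<one>\<^bsub>TA (Suc n)\<^esub> \<oplus>\<^bsub>TA (Suc n)\<^esub> ?e" using eq unfolding TA_simps .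
    have "\<one>\<^bsub>?L\<^esub> = ?\<phi> f \<otimes>\<^bsub>?L\<^esub> ?\<phi> g" using P.L.Units_r_inv[OF u] g(2) by simp
    also have "\<dots> = ?\<phi> (f \<otimes>\<^bsub>TA (Suc n)\<^esub> g)" by (rule P.phi.hom_mult[OF c[OF f(1)] c[OF g(1)], symmetric])
    also have "\<dots> = \<one>\<^bsub>?L\<^esub> \<oplus>\<^bsub>?L\<^esub> ?\<phi> ?e" unfolding eq'
      using P.phi.hom_add[OF P.B.one_closed c[OF eR]] P.phi.hom_one by metis
    finally have "?\<phi> ?e = \<zero>\<^bsub>?L\<^esub>"
      using P.L.add.l_cancel_one'[OF P.L.one_closed P.phi.hom_closed[OF c[OF eR]]] by blast
    then have "\<mu> ?e = 0" using ker[OF eR] by blast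
    then show ?thesis using g(1) eR eq unfolding TA_simps by blast
  qed
  show ?thesis unfolding point_def using inverse pointD[OF p] RS_Suc by simp
qed

text \<open>The extension of I to one more variable, described by coefficients of powers of
  \<open>X n\<close> instead of generators, so that relations modulo it can be read off coefficient
  by coefficient.\<close>

definition slices_in :: "nat \<Rightarrow> 'k series set \<Rightarrow> 'k series set" where
  "slices_in n I = {G \<in> RS (Suc n). \<forall>j. slice n j G \<in> I}"

text \<open>\<open>TA (Suc n)\<close> modulo this ideal is the algebra of the Laurent domain \<open>|b| \<le> |a|\<close> in the
  affinoid space of \<open>TA n\<close> modulo \<open>I\<close>, the new variable being \<open>-b/a\<close>.\<close>

definition ext_ideal :: "nat \<Rightarrow> 'k series set \<Rightarrow> 'k series \<Rightarrow> 'k series \<Rightarrow> 'k series set" where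
  "ext_ideal n I a b = {((a \<star> X n) \<boxplus> b) \<star> h \<boxplus> G | h G. h \<in> RS (Suc n) \<and> G \<in> slices_in n I}"

lemma slices_in_closed:
  assumes I: "ideal I (TA n)"
  shows "slices_in n I \<subseteq> RS (Suc n)" "\<zero>\<^bsub>PS\<^esub> \<in> slices_in n I"
    "G \<in> slices_in n I \<Longrightarrow> H \<in> slices_in n I \<Longrightarrow> G \<boxplus> H \<in> slices_in n I"
    "r \<in> RS (Suc n) \<Longrightarrow> G \<in> slices_in n I \<Longrightarrow> r \<star> G \<in> slices_in n I"
proof -
  interpret I: ideal I "TA n" by (rule I)
  have z: "\<zero>\<^bsub>PS\<^esub> \<in> I" 
    using additive_subgroup.zero_closed[OF ideal.axioms(1)[OF I]] unfolding TA_simps .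
  show "slices_in n I \<subseteq> RS (Suc n)" unfolding slices_in_def by blast
  show "\<zero>\<^bsub>PS\<^esub> \<in> slices_in n I" unfolding slices_in_def using z RS_zero_one(1) by (simp add: slice_zero TA_simps)
  show "G \<boxplus> H \<in> slices_in n I" if "G \<in> slices_in n I" "H \<in> slices_in n I"
    
    using that additive_subgroup.a_closed[OF ideal.axioms(1)[OF I]] RS_add
    unfolding slices_in_def by (simp add: slice_add TA_simps)
  show "r \<star> G \<in> slices_in n I" if r: "r \<in> RS (Suc n)" and G: "G \<in> slices_in n I"
  proof -
    have GR: "G \<in> RS (Suc n)" using G unfolding slices_in_def by blast
    have "slice n j (r \<star> G) \<in> I" for j
      unfolding slice_mult[OF r GR]
    proof (rule I.ideal_finsum[OF I])
      fix i
      have "slice n (j - i) G \<in> I" using G unfolding slices_in_def by blast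
      then show "slice n i r \<star> slice n (j - i) G \<in> I"
        using I.I_l_closed[of _ "slice n i r"] slice_RS[OF r] unfolding TA_simps by blast
    qed simp
    then show ?thesis unfolding slices_in_def using RS_mult[OF r GR] by blast
  qed
qed

lemma ext_generator_RS: "a \<in> RS n \<Longrightarrow> b \<in> RS n \<Longrightarrow> (a \<star> X n) \<boxplus> b \<in> RS (Suc n)"
  by (intro RS_add RS_mult RS_Suc X_RS) auto

lemma PS_ring_identities:
  assumes "t \<in> carrier PS" "h \<in> carrier PS" "G \<in> carrier PS" "h' \<in> carrier PS" "G' \<in> carrier PS"
  shows "(t \<star> h \<boxplus> G) \<boxplus> (t \<star> h' \<boxplus> G') = t \<star> (h \<boxplus> h') \<boxplus> (G \<boxplus> G')"
    "h' \<star> (t \<star> h \<boxplus> G) = t \<star> (h' \<star> h) \<boxplus> h' \<star> G"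
    "((t \<star> G) \<boxplus> G') \<star> h = t \<star> (G \<star> h) \<boxplus> G' \<star> h"
proof -
  interpret PS: cring PS by (rule PS_cring)
  show "(t \<star> h \<boxplus> G) \<boxplus> (t \<star> h' \<boxplus> G') = t \<star> (h \<boxplus> h') \<boxplus> (G \<boxplus> G')"
    using assms by (simp add: PS.r_distr PS.a_ac)
  show "h' \<star> (t \<star> h \<boxplus> G) = t \<star> (h' \<star> h) \<boxplus> h' \<star> G"
    using assms by (simp add: PS.r_distr PS.m_lcomm)
  show "((t \<star> G) \<boxplus> G') \<star> h = t \<star> (G \<star> h) \<boxplus> G' \<star> h"
    using assms by (simp add: PS.l_distr PS.m_assoc)
qed

lemma ext_idealI:
  "h \<in> RS (Suc n) \<Longrightarrow> G \<in> slices_in n I \<Longrightarrow> ((a \<star> X n) \<boxplus> b) \<star> h \<boxplus> G \<in> ext_ideal n I a b"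
  unfolding ext_ideal_def by blast

lemma ext_ideal_mem:
  assumes I: "ideal I (TA n)" and a: "a \<in> RS n" and b: "b \<in> RS n"
  shows "(a \<star> X n) \<boxplus> b \<in> ext_ideal n I a b" "I \<subseteq> ext_ideal n I a b"
proof -
  interpret PS: cring PS by (rule PS_cring)
  interpret I: ideal I "TA n" by (rule I)
  have z: "\<zero>\<^bsub>PS\<^esub> \<in> I" 
    using additive_subgroup.zero_closed[OF ideal.axioms(1)[OF I]] unfolding TA_simps .
  let ?t = "(a \<star> X n) \<boxplus> b"
  have t: "?t \<in> carrier PS" using ext_generator_RS[OF a b] RS_PS by blast
  have "?t \<star> \<one>\<^bsub>PS\<^esub> \<boxplus> \<zero>\<^bsub>PS\<^esub> = ?t" using t by simp
  then show "?t \<in> ext_ideal n I a b"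
    using ext_idealI[OF RS_zero_one(2) slices_in_closed(2)[OF I]] by metis
  show "I \<subseteq> ext_ideal n I a b"
  proof
    fix g assume g: "g \<in> I"
    have gR: "g \<in> RS n" using I.Icarr[OF g] unfolding TA_simps .
    then have gc: "g \<in> carrier PS" using RS_PS by blast
    have "g \<in> slices_in n I" unfolding slices_in_def using RS_Suc[OF gR] g z
      by (simp add: slice_low[OF gR] TA_simps)
    moreover have "?t \<star> \<zero>\<^bsub>PS\<^esub> \<boxplus> g = g" using t gc by simp
    ultimately show "g \<in> ext_ideal n I a b" using ext_idealI[OF RS_zero_one(1)] by metis
  qed
qed

lemma ext_ideal_ideal:
  assumes I: "ideal I (TA n)" and a: "a \<in> RS n" and b: "b \<in> RS n"
  shows "ideal (ext_ideal n I a b) (TA (Suc n))"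
proof -
  note S = slices_in_closed[OF I]
  let ?t = "(a \<star> X n) \<boxplus> b"
  note t = ext_generator_RS[OF a b]
  have PSc: "f \<in> carrier PS" if "f \<in> RS (Suc n)" for f using that RS_PS by blast
  show ?thesis
  proof (rule cring.idealI_comm[OF TA_cring], unfold TA_simps)
    show "ext_ideal n I a b \<subseteq> RS (Suc n)"
      unfolding ext_ideal_def using RS_add RS_mult[OF t] S(1) by blast
    show "\<zero>\<^bsub>PS\<^esub> \<in> ext_ideal n I a b"
      using ext_ideal_mem(2)[OF I a b] additive_subgroup.zero_closed[OF ideal.axioms(1)[OF I]] unfolding TA_simps by blast
    fix f assume "f \<in> ext_ideal n I a b"
    then obtain h G where f: "f = ?t \<star> h \<boxplus> G" "h \<in> RS (Suc n)" "G \<in> slices_in n I" unfolding ext_ideal_def by blast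
    have G: "G \<in> RS (Suc n)" using f(3) S(1) by blast
    show "r \<star> f \<in> ext_ideal n I a b" if r: "r \<in> RS (Suc n)" for r
      unfolding f(1) PS_ring_identities(2)[OF PSc[OF t] PSc[OF f(2)] PSc[OF G] PSc[OF r] PSc[OF G]]
      by (rule ext_idealI[OF RS_mult[OF r f(2)] S(4)[OF r f(3)]])
    fix g assume "g \<in> ext_ideal n I a b"
    then obtain h' G' where g: "g = ?t \<star> h' \<boxplus> G'" "h' \<in> RS (Suc n)" "G' \<in> slices_in n I" unfolding ext_ideal_def by blast
    have G': "G' \<in> RS (Suc n)" using g(3) S(1) by blast
    show "f \<boxplus> g \<in> ext_ideal n I a b"
      unfolding f(1) g(1) PS_ring_identities(1)[OF PSc[OF t] PSc[OF f(2)] PSc[OF G] PSc[OF g(2)] PSc[OF G']]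
      by (rule ext_idealI[OF RS_add[OF f(2) g(2)] S(3)[OF f(3) g(3)]])
  qed
qed

text \<open>Comparing coefficients of the powers of X in 1 = (a X + b) h + G gives b h_0 = 1 and a
  h_j + b h_(j+1) = 0 modulo I, hence |b| |h_0| = 1 and |b| |h_(j+1)| = |a| |h_j|. One h serves all
  points, which is the origin of uniformity.\<close>

lemma ext_unit:
  assumes I: "ideal I (TA n)" and a: "a \<in> RS n" and b: "b \<in> RS n" and one: "\<one>\<^bsub>PS\<^esub> \<in> ext_ideal n I a b"
  shows "\<exists>h\<in>RS (Suc n). \<forall>\<mu>. point n \<mu> \<and> (\<forall>f\<in>I. \<mu> f = 0) \<longrightarrow> (\<forall>j. \<mu> (slice n j h) * \<mu> b ^ Suc j = \<mu> a ^ j)"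
proof -
  obtain h G where h: "h \<in> RS (Suc n)" and G: "G \<in> slices_in n I"
    and eq: "\<one>\<^bsub>PS\<^esub> = ((a \<star> X n) \<boxplus> b) \<star> h \<boxplus> G" using one unfolding ext_ideal_def by blast
  have PSc: "f \<in> carrier PS" if "f \<in> RS (Suc n)" for f using that RS_PS by blast
  have Xn: "X n \<in> RS (Suc n)" by (rule X_RS) simp
  have GR: "G \<in> RS (Suc n)" using G unfolding slices_in_def by blast
  have eq': "\<one>\<^bsub>PS\<^esub> = (a \<star> (X n \<star> h) \<boxplus> b \<star> h) \<boxplus> G"
    unfolding eq by (subst PS_ring_identities(3)) (use PSc RS_Suc a b h Xn GR in auto)
  have sl: "slice n j \<one>\<^bsub>PS\<^esub> = (a \<star> slice n j (X n \<star> h) \<boxplus> b \<star> slice n j h) \<boxplus> slice n j G" for j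
    by (subst eq') (simp only: slice_add slice_low_mult[OF a RS_mult[OF Xn h]] slice_low_mult[OF b h])
  have hR: "slice n j h \<in> RS n" for j by (rule slice_RS[OF h])
  have Gj: "slice n j G \<in> RS n" "slice n j G \<in> I" for j using slice_RS[OF GR] G unfolding slices_in_def by blast+
  interpret PS: cring PS by (rule PS_cring)
  have RSc: "f \<in> carrier PS" if "f \<in> RS n" for f using that RS_PS by blast
  have s0: "\<one>\<^bsub>PS\<^esub> = b \<star> slice n 0 h \<boxplus> slice n 0 G"
    using sl[of 0] RSc[OF a] RSc[OF b] RSc[OF hR[of 0]]
    by (simp add: slice_low[OF RS_zero_one(2)] slice_X_mult(1)[OF h])
  have s1: "\<zero>\<^bsub>PS\<^esub> = (a \<star> slice n j h \<boxplus> b \<star> slice n (Suc j) h) \<boxplus> slice n (Suc j) G" for j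
    using sl[of "Suc j"] by (simp add: slice_low[OF RS_zero_one(2)] slice_X_mult(2)[OF h])
  have "\<mu> (slice n j h) * \<mu> b ^ Suc j = \<mu> a ^ j" if p: "point n \<mu>" and z: "\<forall>f\<in>I. \<mu> f = 0" for \<mu> j
  proof (induction j)
    case 0
    have "\<mu> (b \<star> slice n 0 h \<boxplus> slice n 0 G) = \<mu> (b \<star> slice n 0 h)"
      by (rule point_add_zero[OF p RS_mult[OF b hR] Gj(1)]) (use z Gj(2) in blast)
    then have "\<mu> b * \<mu> (slice n 0 h) = 1"
      using s0 point_zero_one[OF p] pointD(2)[OF p b hR, of 0] by simp
    then show ?case by (simp add: mult.commute)
  next
    case (Suc j)
    have "\<mu> ((a \<star> slice n j h \<boxplus> b \<star> slice n (Suc j) h) \<boxplus> slice n (Suc j) G)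
        = \<mu> (a \<star> slice n j h \<boxplus> b \<star> slice n (Suc j) h)"
      by (rule point_add_zero[OF p RS_add[OF RS_mult[OF a hR] RS_mult[OF b hR]] Gj(1)]) (use z Gj(2) in blast)
    then have "\<mu> (a \<star> slice n j h \<boxplus> b \<star> slice n (Suc j) h) = 0"
      unfolding s1[symmetric] point_zero_one(1)[OF p] by simp
    then have "\<mu> a * \<mu> (slice n j h) = \<mu> b * \<mu> (slice n (Suc j) h)"
      using point_sum_zero[OF p RS_mult[OF a hR] RS_mult[OF b hR]] pointD(2)[OF p a hR] pointD(2)[OF p b hR] by metis
    then have "\<mu> (slice n (Suc j) h) * \<mu> b ^ Suc (Suc j) = \<mu> a * (\<mu> (slice n j h) * \<mu> b ^ Suc j)"
      by (simp add: algebra_simps)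
    then show ?case unfolding Suc by simp
  qed
  then show ?thesis using h by blast
qed

text \<open>At such a point |b| = |a| |X|, and |X| \<le> 1 because every point is bounded by the
  Gauss norm.\<close>

lemma ext_restrict:
  assumes I: "ideal I (TA n)" and a: "a \<in> RS n" and b: "b \<in> RS n"
    and p: "point (Suc n) \<mu>" "\<And>f. f \<in> ext_ideal n I a b \<Longrightarrow> \<mu> f = 0"
  shows "point n \<mu>" "\<And>f. f \<in> I \<Longrightarrow> \<mu> f = 0" "\<mu> b \<le> \<mu> a"
proof -
  show "point n \<mu>" by (rule point_restrict[OF p(1)])
  show "\<mu> f = 0" if "f \<in> I" for f using that p(2) ext_ideal_mem(2)[OF I a b] by blast
  have Xn: "X n \<in> RS (Suc n)" by (rule X_RS) simp
  have "\<mu> ((a \<star> X n) \<boxplus> b) = 0" by (rule p(2)[OF ext_ideal_mem(1)[OF I a b]])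
  then have "\<mu> b = \<mu> a * \<mu> (X n)"
    using point_sum_zero[OF p(1) RS_mult[OF RS_Suc[OF a] Xn] RS_Suc[OF b]] pointD(2)[OF p(1) RS_Suc[OF a] Xn] by simp
  moreover have "\<mu> (X n) \<le> 1" using point_le_gauss[OF p(1) Xn] unfolding X_def gauss_monom .
  ultimately show "\<mu> b \<le> \<mu> a" using pointD(1)[OF p(1) RS_Suc[OF a]] by (simp add: mult_left_le)
qed

text \<open>I is first enlarged to the kernel of \<mu>. If 1 lay in the extended ideal,
  \<open>ext_unit\<close> and |b| \<le> |a| would give |h_j| |b| \<ge> 1 for all j, although the h_j
  tend to zero. A maximal ideal above the extended ideal yields a point whose restriction vanishes
  on the kernel of \<mu> and hence equals \<mu>.\<close>

lemma point_lift:
  assumes I: "ideal I (TA n)" and a: "a \<in> RS n" and b: "b \<in> RS n"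
    and p: "point n \<mu>" "\<And>f. f \<in> I \<Longrightarrow> \<mu> f = 0" and le: "\<mu> b \<le> \<mu> a"
  shows "\<exists>\<mu>'. point (Suc n) \<mu>' \<and> (\<forall>f\<in>ext_ideal n I a b. \<mu>' f = 0) \<and> (\<forall>f\<in>RS n. \<mu>' f = \<mu> f)"
proof -
  let ?I = "kernel n \<mu>"
  note k = kernel_ideal[OF p(1)]
  have "\<one>\<^bsub>PS\<^esub> \<notin> ext_ideal n ?I a b"
  proof
    assume "\<one>\<^bsub>PS\<^esub> \<in> ext_ideal n ?I a b"
    then obtain h where h: "h \<in> RS (Suc n)" "\<And>j. \<mu> (slice n j h) * \<mu> b ^ Suc j = \<mu> a ^ j"
      using ext_unit[OF k a b] p(1) by auto
    have b0: "0 \<le> \<mu> b" by (rule pointD(1)[OF p(1) b])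
    moreover have "\<mu> b \<noteq> 0" using h(2)[of 0] by auto
    ultimately have bp: "\<mu> b > 0" by simp
    have low: "1 \<le> \<mu> (slice n j h) * \<mu> b" for j
    proof -
      have "\<mu> b ^ j \<le> \<mu> a ^ j" by (rule power_mono[OF le b0])
      then have "\<mu> b ^ j * 1 \<le> \<mu> b ^ j * (\<mu> (slice n j h) * \<mu> b)" using h(2)[of j] by (simp add: mult_ac)
      then show ?thesis using bp by (simp only: mult_le_cancel_left_pos zero_less_power)
    qed
    obtain j where "gauss (slice n j h) \<le> 1 / (2 * \<mu> b)" using slice_tendsto_zero[OF h(1), of "1 / (2 * \<mu> b)" n] bp by auto
    then have "\<mu> (slice n j h) \<le> 1 / (2 * \<mu> b)" using point_le_gauss[OF p(1) slice_RS[OF h(1)], of j] by linarith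
    then have "\<mu> (slice n j h) * \<mu> b \<le> 1 / 2" using bp by (simp add: field_simps)
    then show False using low[of j] by simp
  qed
  then obtain N where N: "maximalideal N (TA (Suc n))" "ext_ideal n ?I a b \<subseteq> N"
    using cring.maximal_ideal_exists[OF TA_cring ext_ideal_ideal[OF k a b]] unfolding TA_simps by blast
  obtain \<mu>' where q: "point (Suc n) \<mu>'" "kernel (Suc n) \<mu>' = N" using point_of_maximal[OF N(1)] by blast
  have z: "\<mu>' f = 0" if "f \<in> ext_ideal n ?I a b" for f using that N(2) q(2) by blast
  have "kernel n \<mu> \<subseteq> kernel n \<mu>'" using ext_restrict(2)[OF k a b q(1) z] by blast
  then have eq: "\<mu> f = \<mu>' f" if "f \<in> RS n" for f using point_unique[OF p(1) ext_restrict(1)[OF k a b q(1) z] _ that] by blast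
  have "I \<subseteq> ?I" using p(2) ideal.Icarr[OF I] unfolding TA_simps by blast
  then have "ext_ideal n I a b \<subseteq> ext_ideal n ?I a b" unfolding ext_ideal_def slices_in_def by blast
  then show ?thesis using q(1) z eq by fastforce
qed

text \<open>Induction on the list of conditions, with n and I varying. A condition |d| \<le> |c| is
  absorbed into \<open>ext_ideal\<close>: by \<open>ext_restrict\<close> and
  \<open>point_lift\<close> the points of the larger algebra restrict exactly onto the points
  satisfying it. Without conditions, the hypothesis says that |b| \<le> |a| holds nowhere, so the
  extended ideal contains 1.\<close>

lemma uniform_bound:
  assumes "ideal I (TA n)" and "\<And>c d. (c, d) \<in> set cs \<Longrightarrow> c \<in> RS n \<and> d \<in> RS n" and "a \<in> RS n" and "b \<in> RS n"
    and "\<And>\<mu>. point n \<mu> \<Longrightarrow> \<forall>f\<in>I. \<mu> f = 0 \<Longrightarrow> \<forall>(c, d)\<in>set cs. \<mu> d \<le> \<mu> c \<Longrightarrow> \<mu> a < \<mu> b"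
  shows "\<exists>\<rho>>0. \<rho> < 1 \<and> (\<forall>\<mu>. point n \<mu> \<and> (\<forall>f\<in>I. \<mu> f = 0) \<and> (\<forall>(c, d)\<in>set cs. \<mu> d \<le> \<mu> c) \<longrightarrow> \<mu> a \<le> \<rho> * \<mu> b)"
  using assms
proof (induction cs arbitrary: n I)
  case Nil
  note I = Nil(1) and a = Nil(3) and b = Nil(4)
  have "\<one>\<^bsub>PS\<^esub> \<in> ext_ideal n I a b"
  proof (rule ccontr)
    assume "\<one>\<^bsub>PS\<^esub> \<notin> ext_ideal n I a b"
    then obtain N where N: "maximalideal N (TA (Suc n))" "ext_ideal n I a b \<subseteq> N"
      using cring.maximal_ideal_exists[OF TA_cring ext_ideal_ideal[OF I a b]] unfolding TA_simps by blast
    obtain \<mu> where q: "point (Suc n) \<mu>" "kernel (Suc n) \<mu> = N" using point_of_maximal[OF N(1)] by blast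
    have z: "\<mu> f = 0" if "f \<in> ext_ideal n I a b" for f using that N(2) q(2) by blast
    show False using Nil(5)[of \<mu>] ext_restrict[OF I a b q(1) z] by auto
  qed
  then obtain h where h: "h \<in> RS (Suc n)"
    "\<And>\<mu> j. point n \<mu> \<Longrightarrow> \<forall>f\<in>I. \<mu> f = 0 \<Longrightarrow> \<mu> (slice n j h) * \<mu> b ^ Suc j = \<mu> a ^ j"
    using ext_unit[OF I a b] by blast
  have g: "0 \<le> gauss b" by (rule gauss_nonneg[OF b])
  obtain j0 where j0: "\<And>j. j \<ge> j0 \<Longrightarrow> gauss (slice n j h) \<le> 1 / (2 * (gauss b + 1))"
    using slice_tendsto_zero[OF h(1), of "1 / (2 * (gauss b + 1))" n] g by auto
  \<comment> \<open>At this index |h_j| |b| \<le> 1/2 for all points, so \<open>ext_unit\<close>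
    gives |a|^j \<le> |b|^j / 2, and the j-th root of 1/2 is the uniform constant. The successor
    keeps the index positive.\<close>
  let ?j = "Suc j0" let ?\<rho> = "root ?j (1 / 2)"
  have r: "?\<rho> ^ ?j = 1 / 2" by (rule real_root_pow_pos2) auto
  have "\<mu> a \<le> ?\<rho> * \<mu> b" if p: "point n \<mu>" "\<forall>f\<in>I. \<mu> f = 0" for \<mu>
  proof -
    have nb: "0 \<le> \<mu> b" "\<mu> b \<le> gauss b" using pointD(1)[OF p(1) b] point_le_gauss[OF p(1) b] by auto
    have "\<mu> (slice n ?j h) \<le> 1 / (2 * (gauss b + 1))"
      using point_le_gauss[OF p(1) slice_RS[OF h(1)], of ?j] j0[of ?j] by simp
    then have "\<mu> (slice n ?j h) * \<mu> b \<le> 1 / (2 * (gauss b + 1)) * (gauss b + 1)"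
      using nb g pointD(1)[OF p(1) slice_RS[OF h(1)], of ?j] by (intro mult_mono) auto
    also have "\<dots> = 1 / 2" using g by simp
    finally have "\<mu> b ^ ?j * (\<mu> (slice n ?j h) * \<mu> b) \<le> \<mu> b ^ ?j * (1 / 2)" using nb by (intro mult_left_mono) auto
    then have "\<mu> a ^ ?j \<le> (?\<rho> * \<mu> b) ^ ?j"
      unfolding power_mult_distrib r using h(2)[OF p, of ?j] by (simp add: mult_ac)
    then show ?thesis by (rule power_le_imp_le_base) (use nb in simp)
  qed
  then show ?case by (intro exI[of _ ?\<rho>]) auto
next
  case (Cons cd cs)
  obtain c d where cd: "cd = (c, d)" by (cases cd)
  note I = Cons.prems(1)
  have c: "c \<in> RS n" and d: "d \<in> RS n" using Cons.prems(2)[of c d] cd by auto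
  let ?J = "ext_ideal n I c d"
  have "\<exists>\<rho>>0. \<rho> < 1 \<and> (\<forall>\<mu>. point (Suc n) \<mu> \<and> (\<forall>f\<in>?J. \<mu> f = 0) \<and> (\<forall>(c, d)\<in>set cs. \<mu> d \<le> \<mu> c) \<longrightarrow> \<mu> a \<le> \<rho> * \<mu> b)"
  proof (rule Cons.IH[OF ext_ideal_ideal[OF I c d]])
    show "c \<in> RS (Suc n) \<and> d \<in> RS (Suc n)" if "(c, d) \<in> set cs" for c d
      using Cons.prems(2)[of c d] that RS_Suc by auto
    show "a \<in> RS (Suc n)" "b \<in> RS (Suc n)" using Cons.prems(3,4) RS_Suc by auto
    fix \<mu> assume q: "point (Suc n) \<mu>" "\<forall>f\<in>?J. \<mu> f = 0" "\<forall>(c, d)\<in>set cs. \<mu> d \<le> \<mu> c"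
    note e = ext_restrict[OF I c d q(1) q(2)[rule_format]]
    show "\<mu> a < \<mu> b" by (rule Cons.prems(5)) (use e q(3) cd in auto)
  qed
  then obtain \<rho> where \<rho>: "\<rho> > 0" "\<rho> < 1" and bound: "\<And>\<mu>. point (Suc n) \<mu> \<Longrightarrow> \<forall>f\<in>?J. \<mu> f = 0 \<Longrightarrow>
      \<forall>(c, d)\<in>set cs. \<mu> d \<le> \<mu> c \<Longrightarrow> \<mu> a \<le> \<rho> * \<mu> b" by metis
  have "\<mu> a \<le> \<rho> * \<mu> b"
    if p: "point n \<mu>" "\<forall>f\<in>I. \<mu> f = 0" "\<forall>(c, d)\<in>set (cd # cs). \<mu> d \<le> \<mu> c" for \<mu>
  proof -
    have "\<mu> d \<le> \<mu> c" using p(3) cd by simp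
    then obtain \<mu>' where q: "point (Suc n) \<mu>'" "\<forall>f\<in>?J. \<mu>' f = 0" "\<And>f. f \<in> RS n \<Longrightarrow> \<mu>' f = \<mu> f"
      using point_lift[OF I c d p(1) p(2)[rule_format]] by blast
    have "\<forall>(c, d)\<in>set cs. \<mu>' d \<le> \<mu>' c"
    proof (intro ballI, clarify)
      fix c' d' assume cd': "(c', d') \<in> set cs"
      then have "c' \<in> RS n" "d' \<in> RS n" "\<mu> d' \<le> \<mu> c'" using Cons.prems(2)[of c' d'] p(3) by auto
      then show "\<mu>' d' \<le> \<mu>' c'" using q(3) by simp
    qed
    from bound[OF q(1,2) this] show ?thesis using q(3)[OF Cons.prems(3)] q(3)[OF Cons.prems(4)] by simp
  qed
  then show ?case using \<rho> by blast
qed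

end

section \<open>The affinoid space of a Tate algebra modulo an ideal\<close>

locale affinoid_space = nonarch_field K v for K :: "('k, 'm) ring_scheme" (structure) and v +
  fixes n :: nat and I :: "'k series set"
  assumes I: "ideal I (TA n)"
begin

abbreviation A :: "'k series set ring" where "A \<equiv> TA n Quot I"

abbreviation pr :: "'k series \<Rightarrow> 'k series set" where "pr h \<equiv> I +>\<^bsub>TA n\<^esub> h"

abbreviation \<kappa> :: "'k \<Rightarrow> 'k series set" where "\<kappa> \<equiv> \<lambda>c. pr (cst c)"

abbreviation val :: "'k series set \<Rightarrow> 'k series set set \<Rightarrow> real" where "val \<equiv> abs_at K v A \<kappa>"

lemma A_cring: "cring A" by (rule ideal.quotient_is_cring[OF I TA_cring])

lemma pr_hom: "(\<lambda>h. pr h) \<in> ring_hom (TA n) A" by (rule ideal.rcos_ring_hom[OF I])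

lemma pr_carrier: "h \<in> RS n \<Longrightarrow> pr h \<in> carrier A" unfolding FactRing_carrier TA_simps by blast

lemma pr_surj: "f \<in> carrier A \<Longrightarrow> \<exists>h\<in>RS n. f = pr h" unfolding FactRing_carrier TA_simps by blast

lemma pr_mult: "f \<in> RS n \<Longrightarrow> g \<in> RS n \<Longrightarrow> pr (f \<star> g) = pr f \<otimes>\<^bsub>A\<^esub> pr g"
  using ring_hom_mult[OF pr_hom, of f g] unfolding TA_simps .

lemma pr_add: "f \<in> RS n \<Longrightarrow> g \<in> RS n \<Longrightarrow> pr (f \<boxplus> g) = pr f \<oplus>\<^bsub>A\<^esub> pr g"
  using ring_hom_add[OF pr_hom, of f g] unfolding TA_simps .

lemma pr_one: "pr \<one>\<^bsub>PS\<^esub> = \<one>\<^bsub>A\<^esub>"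
  using ring_hom_one[OF pr_hom] unfolding TA_simps .

lemma pr_ideal: "f \<in> I \<Longrightarrow> pr f = \<zero>\<^bsub>A\<^esub>"
  unfolding FactRing_zero by (rule ring.a_rcos_zero[OF cring.axioms(1)[OF TA_cring] I])

text \<open>The residue field at x is treated directly as a quotient of the Tate algebra, so that no
  norm on A has to be introduced.\<close>

lemma residue_banach_point:
  assumes x: "x \<in> Max_spec A"
  shows "banach_point (TA n) K cst v gauss (A Quot x) (\<lambda>h. x +>\<^bsub>A\<^esub> pr h)"
proof (intro banach_point.intro tate_banach banach_point_axioms.intro)
  interpret x: maximalideal x A using x unfolding Max_spec_def by simp
  show "field (A Quot x)" by (rule x.quotient_is_field[OF A_cring])
  have "(\<lambda>f. x +>\<^bsub>A\<^esub> f) \<circ> (\<lambda>h. pr h) \<in> ring_hom (TA n) (A Quot x)"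
    by (rule ring_hom_trans[OF pr_hom x.rcos_ring_hom])
  then have "(\<lambda>h. x +>\<^bsub>A\<^esub> pr h) \<in> ring_hom (TA n) (A Quot x)" by (simp only: comp_def)
  then show "ring_hom_cring (TA n) (A Quot x) (\<lambda>h. x +>\<^bsub>A\<^esub> pr h)"
    by (intro ring_hom_cringI ring_hom_ringI2 TA_cring x.quotient_is_cring[OF A_cring] x.quotient_is_ring
      cring.axioms(1)[OF TA_cring])
  show "(\<lambda>h. x +>\<^bsub>A\<^esub> pr h) ` carrier (TA n) = carrier (A Quot x)"
    unfolding FactRing_carrier image_image ..
qed

text \<open>This justifies the definite description \<open>residue_abs\<close>: existence is
  \<open>residue_value_exists\<close>, uniqueness on the carrier is
  \<open>residue_value_unique\<close>, and outside the carrier extensionality decides.\<close>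

lemma residue_abs_properties:
  assumes x: "x \<in> Max_spec A"
  shows "absolute_value (A Quot x) (residue_abs K v A \<kappa> x)"
    and "c \<in> carrier K \<Longrightarrow> residue_abs K v A \<kappa> x (x +>\<^bsub>A\<^esub> \<kappa> c) = v c"
proof -
  note bp = residue_banach_point[OF x]
  let ?L = "A Quot x"
  interpret L: field ?L
    by (rule maximalideal.quotient_is_field[OF _ A_cring]) (use x in \<open>simp add: Max_spec_def\<close>)
  let ?P = "\<lambda>w. w \<in> extensional (carrier ?L) \<and> absolute_value ?L w \<and> (\<forall>c\<in>carrier K. w (x +>\<^bsub>A\<^esub> \<kappa> c) = v c)"
  obtain w where w: "absolute_value ?L w" "\<And>c. c \<in> carrier K \<Longrightarrow> w (x +>\<^bsub>A\<^esub> \<kappa> c) = v c"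
    using residue_value_exists[OF bp] by blast
  have kc: "x +>\<^bsub>A\<^esub> \<kappa> c \<in> carrier ?L" if "c \<in> carrier K" for c
    unfolding FactRing_carrier[of A x] using pr_carrier[OF RS_const[OF that]] by blast
  have "?P (restrict w (carrier ?L))"
    using w kc unfolding absolute_value_def by simp
  moreover have "w' = w''" if P: "?P w'" "?P w''" for w' w''
  proof (rule extensionalityI[of _ "carrier ?L"])
    show "w' y = w'' y" if "y \<in> carrier ?L" for y
      by (rule residue_value_unique[OF bp _ _ _ _ that]) (use P in blast)+
  qed (use P in blast)+
  ultimately have "\<exists>!w. ?P w" by blast
  then have "?P (residue_abs K v A \<kappa> x)" unfolding residue_abs_def by (rule theI')
  then show "absolute_value ?L (residue_abs K v A \<kappa> x)"
    "c \<in> carrier K \<Longrightarrow> residue_abs K v A \<kappa> x (x +>\<^bsub>A\<^esub> \<kappa> c) = v c" by blast+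
qed

lemma point_at:
  assumes x: "x \<in> Max_spec A" shows "point n (\<lambda>h. val (pr h) x)"
  unfolding abs_at_def
  by (rule point_residue_value[OF residue_banach_point[OF x] residue_abs_properties[OF x]])

lemma val_zero_iff:
  assumes x: "x \<in> Max_spec A" and f: "f \<in> carrier A"
  shows "val f x = 0 \<longleftrightarrow> f \<in> x"
proof -
  have xi: "ideal x A" using x maximalideal.axioms(1) unfolding Max_spec_def by blast
  have "x +>\<^bsub>A\<^esub> f \<in> carrier (A Quot x)" unfolding FactRing_carrier[of A x] using f by blast
  then have "val f x = 0 \<longleftrightarrow> x +>\<^bsub>A\<^esub> f = x"
    using residue_abs_properties(1)[OF x] unfolding absolute_value_def abs_at_def FactRing_zero by blast
  also have "\<dots> \<longleftrightarrow> f \<in> x"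
    using ring.a_rcos_zero[OF cring.axioms(1)[OF A_cring] xi, of f] ideal.rcos_const_imp_mem[OF xi f] by blast
  finally show ?thesis .
qed

lemma val_ideal: "x \<in> Max_spec A \<Longrightarrow> f \<in> I \<Longrightarrow> val (pr f) x = 0"
  using val_zero_iff[of x "pr f"] pr_ideal[of f] ring.ring_simprules(2)[OF cring.axioms(1)[OF A_cring]]
    additive_subgroup.zero_closed[OF ideal.axioms(1)[OF maximalideal.axioms(1)]]
  unfolding Max_spec_def by (metis mem_Collect_eq)

text \<open>The maximal ideal is the image of the kernel of \<mu>. As \<mu> vanishes on I, only
  elements of the kernel map into this image, which is the fact \<open>mem\<close>; the values then
  agree by \<open>point_unique\<close>.\<close>

lemma point_realized:
  assumes p: "point n \<mu>" and z: "\<And>f. f \<in> I \<Longrightarrow> \<mu> f = 0"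
  shows "\<exists>x\<in>Max_spec A. \<forall>h\<in>RS n. val (pr h) x = \<mu> h"
proof -
  let ?x = "(\<lambda>h. pr h) ` kernel n \<mu>"
  have mem: "\<mu> f = 0" if f: "f \<in> RS n" "pr f \<in> ?x" for f
  proof -
    obtain e where e: "e \<in> RS n" "\<mu> e = 0" "pr f = pr e" using f(2) by auto
    have "f \<in> pr e"
      unfolding e(3)[symmetric]
      by (rule abelian_subgroup.a_rcos_self[OF abelian_subgroupI3[OF ideal.axioms(1)[OF I] ring.is_abelian_group[OF cring.axioms(1)[OF TA_cring]]]])
        (use f(1) in \<open>simp add: TA_simps\<close>)
    then have "f \<in> (\<Union>i\<in>I. {i \<boxplus> e})" unfolding a_r_coset_def' TA_simps .
    then obtain i where i: "i \<in> I" "f = i \<boxplus> e" by (elim UN_E singletonE)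
    have "i \<in> RS n" using ideal.Icarr[OF I i(1)] unfolding TA_simps .
    then show ?thesis unfolding i(2) using point_add_zero[OF p _ e(1,2)] z[OF i(1)] by simp
  qed
  have id: "ideal ?x A"
  proof (rule cring.idealI_comm[OF A_cring])
    show "?x \<subseteq> carrier A" using pr_carrier by blast
    have "pr \<zero>\<^bsub>PS\<^esub> = \<zero>\<^bsub>A\<^esub>"
      using additive_subgroup.zero_closed[OF ideal.axioms(1)[OF I]] unfolding TA_simps by (rule pr_ideal)
    moreover have "pr \<zero>\<^bsub>PS\<^esub> \<in> ?x" by (rule imageI) (use RS_zero_one(1) point_zero_one(1)[OF p] in simp)
    ultimately show "\<zero>\<^bsub>A\<^esub> \<in> ?x" by (rule subst)
    fix a assume "a \<in> ?x"
    then obtain f where f: "f \<in> RS n" "\<mu> f = 0" "a = pr f" by auto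
    show "a \<oplus>\<^bsub>A\<^esub> b \<in> ?x" if b: "b \<in> ?x" for b
    proof -
      obtain g where g: "g \<in> RS n" "\<mu> g = 0" "b = pr g" using b by auto
      have "f \<boxplus> g \<in> kernel n \<mu>" using point_add_zero[OF p f(1) g(1,2)] f(2) RS_add[OF f(1) g(1)] by simp
      then show ?thesis unfolding f(3) g(3) pr_add[OF f(1) g(1), symmetric] by (rule imageI)
    qed
    show "r \<otimes>\<^bsub>A\<^esub> a \<in> ?x" if r: "r \<in> carrier A" for r
    proof -
      obtain g where g: "g \<in> RS n" "r = pr g" using pr_surj[OF r] by blast
      have "g \<star> f \<in> kernel n \<mu>" using pointD(2)[OF p g(1) f(1)] f(2) RS_mult[OF g(1) f(1)] by simp
      then show ?thesis unfolding f(3) g(2) pr_mult[OF g(1) f(1), symmetric] by (rule imageI)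
    qed
  qed
  have "maximalideal ?x A"
  proof (rule cring.maximal_criterion[OF A_cring id])
    show "\<one>\<^bsub>A\<^esub> \<notin> ?x" using mem[OF RS_zero_one(2)] point_zero_one(2)[OF p] unfolding pr_one by auto
    fix f assume "f \<in> carrier A" and n: "f \<notin> ?x"
    then obtain h where h: "h \<in> RS n" "f = pr h" using pr_surj by blast
    have "\<mu> h \<noteq> 0" using n h by blast
    then obtain g e where g: "g \<in> RS n" "e \<in> RS n" "\<mu> e = 0" "h \<star> g = \<one>\<^bsub>PS\<^esub> \<boxplus> e" using pointD(5)[OF p h(1)] by blast
    have "f \<otimes>\<^bsub>A\<^esub> pr g = \<one>\<^bsub>A\<^esub> \<oplus>\<^bsub>A\<^esub> pr e"
      unfolding h(2) pr_mult[OF h(1) g(1), symmetric] g(4) pr_add[OF RS_zero_one(2) g(2)] pr_one ..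
    moreover have "pr e \<in> ?x" using g(2,3) by blast
    ultimately show "\<exists>g\<in>carrier A. \<exists>e\<in>?x. f \<otimes>\<^bsub>A\<^esub> g = \<one>\<^bsub>A\<^esub> \<oplus>\<^bsub>A\<^esub> e" using pr_carrier[OF g(1)] by blast
  qed
  then have x: "?x \<in> Max_spec A" unfolding Max_spec_def by simp
  have "kernel n \<mu> \<subseteq> kernel n (\<lambda>h. val (pr h) ?x)"
  proof
    fix h assume h: "h \<in> kernel n \<mu>"
    then have "pr h \<in> ?x" by (rule imageI)
    then show "h \<in> kernel n (\<lambda>h. val (pr h) ?x)" using h val_zero_iff[OF x pr_carrier[of h]] by simp
  qed
  then have "val (pr h) ?x = \<mu> h" if "h \<in> RS n" for h
    using point_unique[OF p point_at[OF x] _ that] by simp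
  then show ?thesis using x by blast
qed

lemma point_power:
  assumes h: "h \<in> RS n" shows "\<exists>g\<in>RS n. \<forall>\<mu>. point n \<mu> \<longrightarrow> \<mu> g = \<mu> h ^ m"
proof (induction m)
  case 0
  show ?case by (intro bexI[of _ "\<one>\<^bsub>PS\<^esub>"]) (simp_all add: RS_zero_one point_zero_one)
next
  case (Suc m)
  then obtain g where "g \<in> RS n" "\<And>\<mu>. point n \<mu> \<Longrightarrow> \<mu> g = \<mu> h ^ m" by blast
  then show ?case using RS_mult[OF h] pointD(2)[OF _ h] by (intro bexI[of _ "h \<star> g"]) simp_all
qed

lemma val_nonneg: "f \<in> carrier A \<Longrightarrow> x \<in> Max_spec A \<Longrightarrow> 0 \<le> val f x"
  using pr_surj[of f] pointD(1)[OF point_at[of x]] by blast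

interpretation D: laurent_data "Max_spec A" "carrier A" val "sqrt_value_group K v" .

text \<open>The failure of a condition, with both sides raised to the power \<open>m\<close> that brings the bound
  into the value group of \<open>K\<close>, is an inequality between values of elements of the algebra.\<close>

lemma condition_pair:
  assumes "(\<sigma>, f, \<alpha>) \<in> D.conds"
  shows "\<exists>a b m. a \<in> RS n \<and> b \<in> RS n \<and> 0 < m \<and>
    (\<forall>x\<in>Max_spec A. val (pr a) x = (if \<sigma> = 1 then val f x else \<alpha>) ^ m \<and>
      val (pr b) x = (if \<sigma> = 1 then \<alpha> else val f x) ^ m)"
proof -
  have f: "f \<in> carrier A" and S: "\<alpha> \<in> sqrt_value_group K v" using assms unfolding D.conds_def by auto
  obtain z m where z: "z \<in> carrier K" "m \<ge> 1" "\<alpha> ^ m = v z" using S unfolding sqrt_value_group_def by auto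
  obtain h where h: "h \<in> RS n" "f = pr h" using pr_surj[OF f] by blast
  obtain g where g: "g \<in> RS n" "\<And>\<mu>. point n \<mu> \<Longrightarrow> \<mu> g = \<mu> h ^ m" using point_power[OF h(1)] by blast
  let ?c = "cst z"
  have "val (pr g) x = val f x ^ m" "val (pr ?c) x = \<alpha> ^ m" if x: "x \<in> Max_spec A" for x
    using g(2)[OF point_at[OF x]] pointD(4)[OF point_at[OF x] z(1)] h(2) z(3) by simp_all
  then show ?thesis
    using g(1) RS_const[OF z(1), of n] z(2)
    by (intro exI[of _ "if \<sigma> = 1 then g else ?c"] exI[of _ "if \<sigma> = 1 then ?c else g"] exI[of _ m]) simp
qed

lemma not_sat_iff:
  assumes c: "(\<sigma>, f, \<alpha>) \<in> D.conds" and x: "x \<in> Max_spec A" and m: "0 < (m::nat)"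
  shows "\<not> D.sat (\<sigma>, f, \<alpha>) x \<longleftrightarrow>
    (if \<sigma> = 1 then \<alpha> else val f x) ^ m \<le> (if \<sigma> = 1 then val f x else \<alpha>) ^ m"
proof -
  have s: "\<sigma> = 1 \<or> \<sigma> = -1" and f: "f \<in> carrier A" and "0 < \<alpha>"
    using c unfolding D.conds_def unfolding sqrt_value_group_def by auto
  then show ?thesis using val_nonneg[OF f x] m by (elim disjE) (simp_all add: power_mono_iff not_less)
qed

text \<open>For z with |z| > 1 all powers of |z| with rational exponent belong to the set, since
  their suitable integral powers are values of powers of z; and the rational multiples of log |z|
  are dense.\<close>

lemma S_dense:
  assumes a: "0 \<le> a" "a < b" shows "\<exists>s\<in>sqrt_value_group K v. a < s \<and> s < b"
proof -
  obtain z where z: "z \<in> carrier K" "1 < v z"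
  proof -
    obtain z where z: "z \<in> carrier K" "z \<noteq> \<zero>" "v z \<noteq> 1" using nt unfolding nontrivial_value_def by blast
    have i: "inv z \<in> carrier K" "z \<otimes> inv z = \<one>" using z by (auto simp: field_Units)
    then have "v z * v (inv z) = 1" using v_mult[OF z(1) i(1)] v_one by simp
    moreover have "0 < v z" using v_nonneg[OF z(1)] v_zero_iff[OF z(1)] z(2) by linarith
    moreover have "1 < v (inv z)" if "v z < 1"
    proof (rule ccontr)
      assume "\<not> 1 < v (inv z)"
      then have "v z * v (inv z) \<le> v z * 1" using \<open>0 < v z\<close> by (intro mult_left_mono) auto
      then show False using \<open>v z * v (inv z) = 1\<close> that by simp
    qed
    ultimately have "1 < v z \<or> 1 < v (inv z)" using z(3) by linarith
    then show thesis using \<open>\<And>z. z \<in> carrier K \<Longrightarrow> 1 < v z \<Longrightarrow> thesis\<close> z(1) i(1) by blast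
  qed
  have pow: "\<exists>w\<in>carrier K. v w = v u ^ k" if u: "u \<in> carrier K" for u and k :: nat
  proof (induction k)
    case 0 show ?case using v_one by (intro bexI[of _ \<one>]) simp_all
  next
    case (Suc k)
    then obtain w where "w \<in> carrier K" "v w = v u ^ k" by blast
    then show ?case using v_mult[OF u] u by (intro bexI[of _ "u \<otimes> w"]) simp_all
  qed
  have zz: "z \<noteq> \<zero>" using z(2) v_zero by auto
  have i: "inv z \<in> carrier K" "z \<otimes> inv z = \<one>" using z(1) zz by (auto simp: field_Units)
  have vi: "v (inv z) = inverse (v z)" using v_mult[OF z(1) i(1)] i(2) v_one z(2) by (metis inverse_unique)
  let ?l = "ln (v z)"
  have l: "0 < ?l" using z(2) by simp
  \<comment> \<open>A positive lower bound still below b, so that its logarithm makes sense even if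
    a = 0.\<close>
  let ?a = "max a (b / 2)"
  have ab: "0 < ?a" "?a < b" "a \<le> ?a" using a by (auto simp: max_def)
  then have "ln ?a / ?l < ln b / ?l" using l by (simp add: divide_strict_right_mono)
  then obtain r where r: "r \<in> \<rat>" "ln ?a / ?l < r" "r < ln b / ?l" using Rats_dense_in_real by blast
  from r(1) obtain p q where pq: "q > 0" "r = of_int p / of_int q" by (rule Rats_cases')
  let ?s = "exp (r * ?l)"
  have "ln ?a < r * ?l" "r * ?l < ln b" using r l by (simp_all add: field_simps)
  then have s: "?a < ?s" "?s < b" using ab by (metis exp_less_mono exp_ln order.strict_trans)+
  have "?s ^ nat q = exp (of_int p * ?l)" using pq by (simp flip: exp_of_nat_mult)
  also have "\<exists>w\<in>carrier K. v w = exp (of_int p * ?l)"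
  proof (cases "0 \<le> p")
    case True
    have "exp (of_int p * ?l) = v z ^ nat p" using True z(2) by (simp add: exp_of_nat_mult flip: of_nat_nat)
    then show ?thesis using pow[OF z(1)] by metis
  next
    case False
    have "exp (of_int p * ?l) = inverse (exp (of_nat (nat (-p)) * ?l))" using False by (simp flip: exp_minus)
    also have "\<dots> = v (inv z) ^ nat (-p)" using z(2) vi by (simp add: exp_of_nat_mult power_inverse)
    finally show ?thesis using pow[OF i(1)] by metis
  qed
  then obtain w where "w \<in> carrier K" "v w = exp (of_int p * ?l)" by blast
  then have "?s \<in> sqrt_value_group K v"
    unfolding sqrt_value_group_def using pq(1) \<open>?s ^ nat q = exp (of_int p * ?l)\<close>
    by (auto intro!: bexI[of _ w] exI[of _ "nat q"])
  then show ?thesis using s ab(3) by (intro bexI[of _ ?s]) auto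
qed

text \<open>Failure of a condition becomes an inequality between values of elements of the Tate
  algebra, and emptiness becomes the strict inequality |a0| < |b0| required by
  \<open>uniform_bound\<close>. The constant \<rho> refers to m-th powers, so its m-th root r bounds
  |f| away from \<alpha>, and density of the bounds supplies \<alpha>' in the gap.\<close>

lemma relaxed_condition:
  assumes Cs: "finite Cs" "Cs \<subseteq> D.conds" and c: "(\<sigma>, f, \<alpha>) \<in> D.conds"
    and empty: "{x \<in> D.ncdom Cs. \<not> D.sat (\<sigma>, f, \<alpha>) x} = {}"
  shows "\<exists>\<alpha>'\<in>sqrt_value_group K v. \<sigma> * \<alpha>' < \<sigma> * \<alpha> \<and> {x \<in> D.ncdom Cs. \<not> D.sat (\<sigma>, f, \<alpha>') x} = {}"
proof -
  have s: "\<sigma> = 1 \<or> \<sigma> = -1" and f: "f \<in> carrier A" and \<alpha>: "0 < \<alpha>"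
    using c unfolding D.conds_def unfolding sqrt_value_group_def by auto
  let ?P = "\<lambda>d p. fst p \<in> RS n \<and> snd p \<in> RS n \<and>
    (\<forall>x\<in>Max_spec A. \<not> D.sat d x \<longleftrightarrow> val (pr (snd p)) x \<le> val (pr (fst p)) x)"
  have "\<exists>p. ?P d p" if "d \<in> Cs" for d
  proof -
    obtain \<tau> g \<beta> where d: "d = (\<tau>, g, \<beta>)" by (metis prod_cases3)
    then have dc: "(\<tau>, g, \<beta>) \<in> D.conds" using that Cs(2) by blast
    obtain a b m where "a \<in> RS n" "b \<in> RS n" "0 < m" "\<And>x. x \<in> Max_spec A \<Longrightarrow> val (pr a) x = (if \<tau> = 1 then val g x else \<beta>) ^ m"
      "\<And>x. x \<in> Max_spec A \<Longrightarrow> val (pr b) x = (if \<tau> = 1 then \<beta> else val g x) ^ m"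
      using condition_pair[OF dc] by blast
    then show ?thesis unfolding d using not_sat_iff[OF dc] by (intro exI[of _ "(a, b)"]) simp
  qed
  then have "\<forall>d\<in>Cs. \<exists>p. ?P d p" by blast
  from bchoice[OF this] obtain p where p: "\<forall>d\<in>Cs. ?P d (p d)" ..
  have ab: "fst (p d) \<in> RS n \<and> snd (p d) \<in> RS n"
    "x \<in> Max_spec A \<Longrightarrow> \<not> D.sat d x \<longleftrightarrow> val (pr (snd (p d))) x \<le> val (pr (fst (p d))) x" if "d \<in> Cs" for d x
    using bspec[OF p that] by blast+
  obtain ds where ds: "set ds = Cs" using finite_list[OF Cs(1)] by blast
  let ?cs = "map p ds"
  have ncdom: "x \<in> D.ncdom Cs \<longleftrightarrow> (\<forall>(c, d)\<in>set ?cs. val (pr d) x \<le> val (pr c) x)" if "x \<in> Max_spec A" for x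
    unfolding D.ncdom_def using that ab(2) ds by auto
  obtain a0 b0 m where 0: "a0 \<in> RS n" "b0 \<in> RS n" "0 < m"
    "\<And>x. x \<in> Max_spec A \<Longrightarrow> val (pr a0) x = (if \<sigma> = 1 then val f x else \<alpha>) ^ m"
    "\<And>x. x \<in> Max_spec A \<Longrightarrow> val (pr b0) x = (if \<sigma> = 1 then \<alpha> else val f x) ^ m"
    using condition_pair[OF c] by blast
  have "\<exists>\<rho>>0. \<rho> < 1 \<and> (\<forall>\<mu>. point n \<mu> \<and> (\<forall>f\<in>I. \<mu> f = 0) \<and> (\<forall>(c, d)\<in>set ?cs. \<mu> d \<le> \<mu> c) \<longrightarrow> \<mu> a0 \<le> \<rho> * \<mu> b0)"
  proof (rule uniform_bound[OF I _ 0(1,2)])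
    show "c \<in> RS n \<and> d \<in> RS n" if cd: "(c, d) \<in> set ?cs" for c d
    proof -
      have "(c, d) \<in> p ` Cs" using cd ds by simp
      then obtain e where "e \<in> Cs" "p e = (c, d)" by (elim imageE) simp
      then show ?thesis using ab(1)[of e] by simp
    qed
    fix \<mu> assume q: "point n \<mu>" "\<forall>f\<in>I. \<mu> f = 0" "\<forall>(c, d)\<in>set ?cs. \<mu> d \<le> \<mu> c"
    obtain x where x: "x \<in> Max_spec A" "\<And>h. h \<in> RS n \<Longrightarrow> val (pr h) x = \<mu> h" using point_realized[OF q(1)] q(2) by blast
    have "\<forall>(c, d)\<in>set ?cs. val (pr d) x \<le> val (pr c) x"
      unfolding set_map ds ball_simps split_beta
    proof
      fix e assume e: "e \<in> Cs"
      have "\<mu> (snd (p e)) \<le> \<mu> (fst (p e))" using q(3) e unfolding set_map ds ball_simps split_beta by (rule bspec)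
      then show "val (pr (snd (p e))) x \<le> val (pr (fst (p e))) x" using x(2) ab(1)[OF e] by simp
    qed
    then have "x \<in> D.ncdom Cs" using ncdom[OF x(1)] by simp
    then have "D.sat (\<sigma>, f, \<alpha>) x" using empty by blast
    then show "\<mu> a0 < \<mu> b0" using not_sat_iff[OF c x(1) 0(3)] 0(4,5)[OF x(1)] x(2)[OF 0(1)] x(2)[OF 0(2)] by simp
  qed
  then obtain \<rho> where \<rho>: "0 < \<rho>" "\<rho> < 1" and bd: "\<And>\<mu>. point n \<mu> \<Longrightarrow> \<forall>f\<in>I. \<mu> f = 0 \<Longrightarrow>
      \<forall>(c, d)\<in>set ?cs. \<mu> d \<le> \<mu> c \<Longrightarrow> \<mu> a0 \<le> \<rho> * \<mu> b0" by metis
  let ?r = "root m \<rho>"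
  have r: "0 < ?r" "?r < 1" "?r ^ m = \<rho>" using \<rho> 0(3) by simp_all
  have le: "(if \<sigma> = 1 then val f x else \<alpha>) \<le> ?r * (if \<sigma> = 1 then \<alpha> else val f x)" if x: "x \<in> D.ncdom Cs" for x
  proof -
    have xM: "x \<in> Max_spec A" using x unfolding D.ncdom_def by blast
    have "val (pr a0) x \<le> \<rho> * val (pr b0) x"
      by (rule bd[OF point_at[OF xM]]) (use val_ideal[OF xM] ncdom[OF xM] x in auto)
    then have "(if \<sigma> = 1 then val f x else \<alpha>) ^ m \<le> (?r * (if \<sigma> = 1 then \<alpha> else val f x)) ^ m"
      unfolding power_mult_distrib r(3) 0(4)[OF xM] 0(5)[OF xM] .
    moreover have "0 \<le> ?r * (if \<sigma> = 1 then \<alpha> else val f x)" using r \<alpha> val_nonneg[OF f xM] by simp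
    moreover have "0 \<le> (if \<sigma> = 1 then val f x else \<alpha>)" using \<alpha> val_nonneg[OF f xM] by simp
    ultimately show ?thesis using power_mono_iff[OF _ _ 0(3)] by blast
  qed
  show ?thesis
  proof (cases "\<sigma> = 1")
    case True
    obtain \<alpha>' where "\<alpha>' \<in> sqrt_value_group K v" "?r * \<alpha> < \<alpha>'" "\<alpha>' < \<alpha>"
      using S_dense[of "?r * \<alpha>" \<alpha>] r \<alpha> by auto
    then show ?thesis using le True by (intro bexI[of _ \<alpha>']) fastforce+
  next
    case False
    then have m: "\<sigma> = -1" using s by simp
    have "\<alpha> < \<alpha> / ?r" using r \<alpha> by (simp add: field_simps)
    then obtain \<alpha>' where a: "\<alpha>' \<in> sqrt_value_group K v" "\<alpha> < \<alpha>'" "\<alpha>' < \<alpha> / ?r"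
      using S_dense[of \<alpha> "\<alpha> / ?r"] \<alpha> by auto
    have "D.sat (\<sigma>, f, \<alpha>') x" if "x \<in> D.ncdom Cs" for x
    proof -
      have "\<alpha> / ?r \<le> val f x" using le[OF that] m r by (simp add: field_simps)
      then show ?thesis using a(3) m by simp
    qed
    then show ?thesis using a m by (intro bexI[of _ \<alpha>']) auto
  qed
qed

lemma laurent_space: "laurent_space (Max_spec A) (carrier A) val (sqrt_value_group K v)"
proof
  show "0 \<le> val f x" if "f \<in> carrier A" "x \<in> Max_spec A" for f x by (rule val_nonneg[OF that])
  show "\<exists>M. \<forall>x\<in>Max_spec A. val f x \<le> M" if "f \<in> carrier A" for f
    using pr_surj[OF that] point_le_gauss[OF point_at] by blast
  show "0 < s" if "s \<in> sqrt_value_group K v" for s using that unfolding sqrt_value_group_def by simp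
  show "\<exists>s\<in>sqrt_value_group K v. a < s \<and> s < b" if "0 \<le> a" "a < b" for a b by (rule S_dense[OF that])
  show "\<exists>f\<in>carrier A. val f x < val f y" if x: "x \<in> Max_spec A" and y: "y \<in> Max_spec A" and "x \<noteq> y" for x y
  proof -
    interpret x: maximalideal x A using x unfolding Max_spec_def by simp
    interpret y: maximalideal y A using y unfolding Max_spec_def by simp
    have "\<not> x \<subseteq> y"
      using x.I_maximal[OF y.is_ideal] y.I_notcarr y.a_subset \<open>x \<noteq> y\<close> by blast
    then obtain f where f: "f \<in> x" "f \<notin> y" by blast
    have fA: "f \<in> carrier A" by (rule x.Icarr[OF f(1)])
    have "val f x = 0" "val f y \<noteq> 0" using val_zero_iff[OF x fA] val_zero_iff[OF y fA] f by auto
    then show ?thesis using val_nonneg[OF fA y] fA by (intro bexI[of _ f]) auto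
  qed
  show "\<exists>\<alpha>'\<in>sqrt_value_group K v. \<sigma> * \<alpha>' < \<sigma> * \<alpha> \<and> {x \<in> D.ncdom Cs. \<not> D.sat (\<sigma>, f, \<alpha>') x} = {}"
    if "finite Cs" "Cs \<subseteq> D.conds" "(\<sigma>, f, \<alpha>) \<in> D.conds" "{x \<in> D.ncdom Cs. \<not> D.sat (\<sigma>, f, \<alpha>) x} = {}" for Cs \<sigma> f \<alpha>
    by (rule relaxed_condition[OF that])
qed

end

text \<open>The completion is realized once, by filters on the spectrum, while its properties are
  shown for every completion on any type; in this form its uniqueness is not invoked.\<close>

theorem mainTheorem3:
  fixes K :: "('k, 'm) ring_scheme" and v :: "'k \<Rightarrow> real"
    and A :: "'k series set ring" and \<kappa> :: "'k \<Rightarrow> 'k series set"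
  assumes "field K" and "absolute_value K v" and "nonarchimedean K v"
    and "nontrivial_value K v" and "complete_value K v"
    and "affinoid_algebra K v A \<kappa>"
  shows "uniform_structure (Max_spec A) (laurent_uniformity K v A \<kappa>) \<and>
    uniform_Hausdorff (Max_spec A) (laurent_uniformity K v A \<kappa>) \<and>
    uniform_totally_bounded (Max_spec A) (laurent_uniformity K v A \<kappa>) \<and>
    (\<exists>(Y :: 'k series set set filter set) \<D> \<iota>.
       is_completion (Max_spec A) (laurent_uniformity K v A \<kappa>) Y \<D> \<iota>) \<and>
    (\<forall>(Y :: 'y set) \<D> \<iota>.
       is_completion (Max_spec A) (laurent_uniformity K v A \<kappa>) Y \<D> \<iota> \<longrightarrow>
         topspace (uniform_topology Y \<D>) = Y \<and>
         compact_space (uniform_topology Y \<D>) \<and>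
         Hausdorff_space (uniform_topology Y \<D>) \<and>
         embedding_map (canonical_topology K v A \<kappa>) (uniform_topology Y \<D>) \<iota> \<and>
         topspace (canonical_topology K v A \<kappa>) = Max_spec A \<and>
         uniform_topology Y \<D> closure_of (\<iota> ` Max_spec A) = Y)"
proof -
  obtain n I where I: "ideal I (tate_algebra K v n)" and A: "A = tate_algebra K v n Quot I"
    and \<kappa>: "\<kappa> = (\<lambda>c. I +>\<^bsub>tate_algebra K v n\<^esub> const_series K c)"
    using assms(6) unfolding affinoid_algebra_def by blast
  interpret X: affinoid_space K v n I
    by (intro affinoid_space.intro nonarch_field.intro nonarch_field_axioms.intro affinoid_space_axioms.intro assms(1-5) I)
  interpret S: laurent_space "Max_spec A" "carrier A" "abs_at K v A \<kappa>" "sqrt_value_group K v"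
    unfolding A \<kappa> by (rule X.laurent_space)
  have LD: "S.LD = open_laurent_domains K v A \<kappa>" unfolding S.LD_def open_laurent_domains_def ..
  have LU: "S.LU = laurent_uniformity K v A \<kappa>" unfolding S.LU_def laurent_uniformity_def LD ..
  have top: "canonical_topology K v A \<kappa> = uniform_topology (Max_spec A) S.LU"
    by (simp add: topology_eq openin_canonical_topology S.openin_laurent LD)
  have completed: "topspace (uniform_topology Y \<D>) = Y \<and> compact_space (uniform_topology Y \<D>) \<and>
      Hausdorff_space (uniform_topology Y \<D>) \<and>
      embedding_map (canonical_topology K v A \<kappa>) (uniform_topology Y \<D>) \<iota> \<and>
      topspace (canonical_topology K v A \<kappa>) = Max_spec A \<and>
      uniform_topology Y \<D> closure_of (\<iota> ` Max_spec A) = Y"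
    if "is_completion (Max_spec A) S.LU Y \<D> \<iota>" for Y :: "'y set" and \<D> \<iota>
  proof -
    interpret C: completed "Max_spec A" S.LU Y \<D> \<iota>
      by (intro completed.intro completed_axioms.intro S.U.cover_uniform_axioms that)
    show ?thesis unfolding top using C.completion_properties[OF S.laurent_totally_bounded] S.U.topspace_uniform by simp
  qed
  show ?thesis
    unfolding LU[symmetric]
    using S.laurent_uniform S.laurent_Hausdorff S.laurent_totally_bounded
      S.U.completion_exists[OF S.laurent_Hausdorff] completed by blast
qed

end
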